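(* Consider the $GI^X/M/1$ queue with negative customers and disasters described in the context, in steady state, with $\delta>0$ and $g_b\neq 0$. The characteristic equation $$A^*(\delta+(\mu+\eta)(1-z))\sum_{i=1}^{b} g_i z^{b-i}-z^b=0$$ has exactly $b$ roots inside the unit circle $|z|=1$; denote them by $r_1,\dots,r_b$. Let the constants $c_1,\dots,c_b$ be obtained by solving the system of $b$ linear equations in $b$ unknowns $$\sum_{j=1}^{b} c_j r_j^{\,n-b}=0\quad (1\le n\le b-1),\qquad \sum_{i=1}^{b}\frac{c_i}{1-r_i}=\lambda .$$ Then the steady-state distributions of the number of positive customers in the system at pre-arrival epochs, $(p_n^-)_{n\ge 0}$, and at arbitrary epochs, $(p_n)_{n\ge 0}$, are given by $$p_n^-=\frac{1}{\lambda}\sum_{i=1}^{b} c_i r_i^{\,n},\qquad n\ge 0,$$ $$p_n=\sum_{j=1}^{b} c_j\left\{\frac{G(r_j^{-1})-1}{\delta+(\mu+\eta)(1-r_j)}\right\} r_j^{\,n},\qquad n\ge 1,$$ $$p_0=1-\sum_{n=1}^{\infty}p_n=1-\sum_{j=1}^{b}\frac{c_j r_j}{1-r_j}\left\{\frac{G(r_j^{-1})-1}{\delta+(\mu+\eta)(1-r_j)}\right\}.$$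
   Context: The model. Positive customers arrive in batches at an infinite-buffer single-server queue. The arriving batch size is a random variable $X$ with $P(X=i)=g_i$, $1\le i\le b$, where $b$ is the (finite) maximum batch size; its probability generating function is $G(z)=\sum_{i=1}^{b} g_i z^i$. The inter-arrival times between batches are independent and identically distributed continuous random variables with probability density function $a(t)$, Laplace-Stieltjes transform $A^*(s)=\int_0^\infty e^{-st}a(t)\,dt$, and mean $\lambda^{-1}=a=-A^{*(1)}(0)$, where $A^{*(1)}(0)$ is the derivative of $A^*(s)$ at $s=0$; $\lambda$ is the arrival rate of the batches. Customers are served individually by the single server, with exponentially distributed service times of parameter $\mu$. Negative customers arrive according to a Poisson process of rate $\eta$; each removes only the positive customer undergoing service. Disasters occur according to an independent Poisson process of rate $\delta$; each removes all positive customers present in the system. Negative customers and disasters have no effect when the system is empty. The arrival process, the service process and the negative arrivals are independent of each other. Steady-state quantities. Let $N(t)$ be the number of positive customers in the system at time $t$ and $U(t)$ the remaining inter-arrival time of the next batch. Define $q_n(u,t)$ by $q_n(u,t)\,du=P[N(t)=n,\ u<U(t)\le u+du]$ for $n\ge 0$, $u\ge 0$, and in steady state let $p_n(u)=\lim_{t\to\infty}q_n(u,t)$. The arbitrary-epoch probability of $n$ positive customers is $p_n=\int_0^\infty p_n(u)\,du$, with the normalizing condition $\sum_{n\ge 0}p_n=1$. The pre-arrival probability $p_n^-$ is the steady-state probability that there are $n$ positive customers in the system just before the arrival of a batch; it is given by $p_n^-=p_n(0)/\sum_{k\ge 0}p_k(0)=p_n(0)/\lambda$. *)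

theory Defs
  imports "HOL-Probability.Probability" "HOL-Complex_Analysis.Complex_Analysis"
begin

text \<open>The random inputs of the queue. \<open>num0\<close> is the number of positive customers at time 0 and
  \<open>res0\<close> the time until the first batch arrives; \<open>gap k\<close> separates batch \<open>k\<close> from batch
  \<open>k + 1\<close>, and \<open>batch k\<close> is the size of batch \<open>k\<close>. \<open>svc k\<close> is the time required by the
  \<open>k\<close>-th service to be started. \<open>neg k\<close> and \<open>dis k\<close> are the times between successive
  negative customers and successive disasters.\<close>

record 'a queue_input =
  num0 :: "'a \<Rightarrow> nat"
  res0 :: "'a \<Rightarrow> real"
  gap :: "nat \<Rightarrow> 'a \<Rightarrow> real"
  batch :: "nat \<Rightarrow> 'a \<Rightarrow> nat"
  svc :: "nat \<Rightarrow> 'a \<Rightarrow> real"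
  neg :: "nat \<Rightarrow> 'a \<Rightarrow> real"
  dis :: "nat \<Rightarrow> 'a \<Rightarrow> real"

definition arrival_epoch :: "'a queue_input \<Rightarrow> nat \<Rightarrow> 'a \<Rightarrow> real" where
  "arrival_epoch Q k \<omega> = res0 Q \<omega> + (\<Sum>i<k. gap Q i \<omega>)"

definition partial_sums :: "(nat \<Rightarrow> 'a \<Rightarrow> real) \<Rightarrow> 'a \<Rightarrow> real set" where
  "partial_sums E \<omega> = range (\<lambda>k. \<Sum>i\<le>k. E i \<omega>)"

definition external_epochs :: "'a queue_input \<Rightarrow> 'a \<Rightarrow> real set" where
  "external_epochs Q \<omega> =
     range (\<lambda>k. arrival_epoch Q k \<omega>) \<union> partial_sums (neg Q) \<omega> \<union> partial_sums (dis Q) \<omega>"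

text \<open>The state of the server is \<open>(n, m, v)\<close>: there are \<open>n\<close> customers, and \<open>v\<close> is what
  remains of service number \<open>m\<close>, the one in progress if \<open>n > 0\<close> and the next to start if
  \<open>n = 0\<close>. A service that is interrupted by a removal is abandoned, and the next customer
  starts a fresh one. \<open>serve S d\<close> lets time \<open>d\<close> pass without external events.\<close>

type_synonym server_state = "nat \<times> nat \<times> real"

fun serve :: "(nat \<Rightarrow> real) \<Rightarrow> real \<Rightarrow> server_state \<Rightarrow> server_state" where
  "serve S d (0, m, v) = (0, m, v)"
| "serve S d (Suc n, m, v) =
     (if d < v then (Suc n, m, v - d) else serve S (d - v) (n, Suc m, S (Suc m)))"

fun remove_one :: "(nat \<Rightarrow> real) \<Rightarrow> server_state \<Rightarrow> server_state" where
  "remove_one S (0, m, v) = (0, m, v)"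
| "remove_one S (Suc n, m, v) = (n, Suc m, S (Suc m))"

fun remove_all :: "(nat \<Rightarrow> real) \<Rightarrow> server_state \<Rightarrow> server_state" where
  "remove_all S (0, m, v) = (0, m, v)"
| "remove_all S (Suc n, m, v) = (0, Suc m, S (Suc m))"

fun add_batch :: "nat \<Rightarrow> server_state \<Rightarrow> server_state" where
  "add_batch x (n, m, v) = (n + x, m, v)"

text \<open>Distinct external events almost surely happen at distinct times, so the order of the
  tests does not matter.\<close>

definition external_event ::
    "'a queue_input \<Rightarrow> 'a \<Rightarrow> real \<Rightarrow> server_state \<Rightarrow> server_state" where
  "external_event Q \<omega> s st =
     (if s \<in> partial_sums (dis Q) \<omega> then remove_all (\<lambda>k. svc Q k \<omega>) st
      else if s \<in> partial_sums (neg Q) \<omega> then remove_one (\<lambda>k. svc Q k \<omega>) st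
      else add_batch (batch Q (LEAST k. arrival_epoch Q k \<omega> = s) \<omega>) st)"

text \<open>\<open>evolve Q \<omega> t s st es\<close> is the state at time \<open>t\<close>, starting from state \<open>st\<close> at time
  \<open>s\<close>, when the external events in between happen at the times in the sorted list \<open>es\<close>.\<close>

fun evolve :: "'a queue_input \<Rightarrow> 'a \<Rightarrow> real \<Rightarrow> real \<Rightarrow> server_state \<Rightarrow> real list \<Rightarrow> server_state" where
  "evolve Q \<omega> t s st [] = serve (\<lambda>k. svc Q k \<omega>) (t - s) st"
| "evolve Q \<omega> t s st (e # es) =
     evolve Q \<omega> t e (external_event Q \<omega> e (serve (\<lambda>k. svc Q k \<omega>) (e - s) st)) es"

text \<open>\<open>num_customers Q t\<close> is the random variable $N(t)$ and \<open>remaining_time Q t\<close> is $U(t)$. Almost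
  surely only finitely many external events happen up to time \<open>t\<close>.\<close>

definition num_customers :: "'a queue_input \<Rightarrow> real \<Rightarrow> 'a \<Rightarrow> nat" where
  "num_customers Q t \<omega> =
     fst (evolve Q \<omega> t 0 (num0 Q \<omega>, 0, svc Q 0 \<omega>)
            (sorted_list_of_set (external_epochs Q \<omega> \<inter> {0<..t})))"

definition remaining_time :: "'a queue_input \<Rightarrow> real \<Rightarrow> 'a \<Rightarrow> real" where
  "remaining_time Q t \<omega> = arrival_epoch Q (LEAST k. t < arrival_epoch Q k \<omega>) \<omega> - t"

text \<open>All inputs are coded into one type so that their joint independence can be stated with
  \<open>indep_vars\<close>. The two components of the initial state may depend on each other.\<close>

datatype input_index = Initial | Gap nat | Batch nat | Svc nat | Neg nat | Dis nat

fun input_var :: "'a queue_input \<Rightarrow> input_index \<Rightarrow> 'a \<Rightarrow> nat \<times> real" where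
  "input_var Q Initial \<omega> = (num0 Q \<omega>, res0 Q \<omega>)"
| "input_var Q (Gap k) \<omega> = (0, gap Q k \<omega>)"
| "input_var Q (Batch k) \<omega> = (batch Q k \<omega>, 0)"
| "input_var Q (Svc k) \<omega> = (0, svc Q k \<omega>)"
| "input_var Q (Neg k) \<omega> = (0, neg Q k \<omega>)"
| "input_var Q (Dis k) \<omega> = (0, dis Q k \<omega>)"

locale negative_disaster_queue = prob_space M for M :: "'a measure" +
  fixes Q :: "'a queue_input" and a :: "real \<Rightarrow> real" and b :: nat and g :: "nat \<Rightarrow> real"
    and \<mu> \<eta> \<delta> :: real
  assumes indep: "indep_vars (\<lambda>_. count_space UNIV \<Otimes>\<^sub>M borel) (input_var Q) UNIV"
    and res0_pos: "AE \<omega> in M. 0 < res0 Q \<omega>"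
    and a_nonneg: "\<And>t. 0 \<le> a t"
    and a_support: "\<And>t. t < 0 \<Longrightarrow> a t = 0"
    and gap_density: "\<And>k. distributed M lborel (gap Q k) (\<lambda>t. ennreal (a t))"
    and a_mean: "integrable lborel (\<lambda>t. t * a t)"
    and b_pos: "1 \<le> b"
    and batch_size: "\<And>k i. 1 \<le> i \<Longrightarrow> i \<le> b \<Longrightarrow> prob {\<omega> \<in> space M. batch Q k \<omega> = i} = g i"
    and g_sum: "(\<Sum>i=1..b. g i) = 1"
    and \<mu>_pos: "0 < \<mu>" and \<eta>_pos: "0 < \<eta>" and \<delta>_pos: "0 < \<delta>"
    and svc_exp: "\<And>k. distributed M lborel (svc Q k) (\<lambda>t. ennreal (exponential_density \<mu> t))"
    and neg_exp: "\<And>k. distributed M lborel (neg Q k) (\<lambda>t. ennreal (exponential_density \<eta> t))"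
    and dis_exp: "\<And>k. distributed M lborel (dis Q k) (\<lambda>t. ennreal (exponential_density \<delta> t))"

definition arrival_rate :: "(real \<Rightarrow> real) \<Rightarrow> real" where
  "arrival_rate a = 1 / (LINT t|lborel. t * a t)"

text \<open>Rendering of $q_n(u,t)\,du = P[N(t)=n,\ u<U(t)\le u+du]$. A limit of difference quotients
  is used because the pointwise values matter below, in particular the one at \<open>u = 0\<close>, and a
  density in the measure-theoretic sense would leave them undetermined.\<close>

definition residual_density ::
    "'a measure \<Rightarrow> 'a queue_input \<Rightarrow> (nat \<Rightarrow> real \<Rightarrow> real \<Rightarrow> real) \<Rightarrow> bool" where
  "residual_density M Q q \<longleftrightarrow>
     (\<forall>n. \<forall>u\<ge>0. \<forall>t>0.
        ((\<lambda>h. measure M {\<omega> \<in> space M. num_customers Q t \<omega> = n \<and>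
                 u < remaining_time Q t \<omega> \<and> remaining_time Q t \<omega> \<le> u + h} / h)
           \<longlongrightarrow> q n u t) (at_right 0))"

text \<open>In the following, \<open>p n u\<close> stands for $p_n(u)$.\<close>

definition arbitrary_prob :: "(nat \<Rightarrow> real \<Rightarrow> real) \<Rightarrow> nat \<Rightarrow> real" where
  "arbitrary_prob p n = (LINT u:{0..}|lborel. p n u)"

definition prearrival_prob :: "(nat \<Rightarrow> real \<Rightarrow> real) \<Rightarrow> nat \<Rightarrow> real" where
  "prearrival_prob p n = p n 0 / (\<Sum>k. p k 0)"

definition steady_state ::
    "'a measure \<Rightarrow> 'a queue_input \<Rightarrow> (nat \<Rightarrow> real \<Rightarrow> real) \<Rightarrow> bool" where
  "steady_state M Q p \<longleftrightarrow>
     (\<exists>q. residual_density M Q q \<and> (\<forall>n. \<forall>u\<ge>0. ((\<lambda>t. q n u t) \<longlongrightarrow> p n u) at_top)) \<and>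
     (\<lambda>n. arbitrary_prob p n) sums 1"

definition lst :: "(real \<Rightarrow> real) \<Rightarrow> complex \<Rightarrow> complex" where
  "lst a s = (LINT t:{0..}|lborel. exp (- s * of_real t) * of_real (a t))"

definition batch_pgf :: "nat \<Rightarrow> (nat \<Rightarrow> real) \<Rightarrow> complex \<Rightarrow> complex" where
  "batch_pgf b g z = (\<Sum>i=1..b. of_real (g i) * z ^ i)"

definition char_fun ::
    "(real \<Rightarrow> real) \<Rightarrow> nat \<Rightarrow> (nat \<Rightarrow> real) \<Rightarrow> real \<Rightarrow> real \<Rightarrow> real \<Rightarrow> complex \<Rightarrow> complex" where
  "char_fun a b g \<mu> \<eta> \<delta> z =
     lst a (of_real \<delta> + of_real (\<mu> + \<eta>) * (1 - z)) * (\<Sum>i=1..b. of_real (g i) * z ^ (b - i)) - z ^ b"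

text \<open>Roots are counted with multiplicity.\<close>

definition roots_in_disc :: "(complex \<Rightarrow> complex) \<Rightarrow> complex set" where
  "roots_in_disc f = {z. norm z < 1 \<and> f z = 0}"

definition lists_roots_in_disc :: "(complex \<Rightarrow> complex) \<Rightarrow> nat \<Rightarrow> (nat \<Rightarrow> complex) \<Rightarrow> bool" where
  "lists_roots_in_disc f b r \<longleftrightarrow>
     (\<forall>j\<in>{1..b}. r j \<in> roots_in_disc f) \<and>
     (\<forall>z\<in>roots_in_disc f. int (card {j\<in>{1..b}. r j = z}) = zorder f z)"

text \<open>The exponents \<open>n - b\<close> are negative. The system is solvable only if the \<open>r j\<close> are
  distinct.\<close>

definition solves_system :: "nat \<Rightarrow> real \<Rightarrow> (nat \<Rightarrow> complex) \<Rightarrow> (nat \<Rightarrow> complex) \<Rightarrow> bool" where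
  "solves_system b lam r c \<longleftrightarrow>
     (\<forall>n\<in>{1..b-1}. (\<Sum>j=1..b. c j * r j powi (int n - int b)) = 0) \<and>
     (\<Sum>i=1..b. c i / (1 - r i)) = of_real lam"

definition root_coeff ::
    "nat \<Rightarrow> (nat \<Rightarrow> real) \<Rightarrow> real \<Rightarrow> real \<Rightarrow> real \<Rightarrow> complex \<Rightarrow> complex" where
  "root_coeff b g \<mu> \<eta> \<delta> z =
     (batch_pgf b g (inverse z) - 1) / (of_real \<delta> + of_real (\<mu> + \<eta>) * (1 - z))"

end

(* Conditionally on the arrival epochs and batch sizes, memorylessness makes the number of customers
   a Markov chain: between arrivals, customers leave at rate mu + eta and all leave at rate delta.
   The density p_n(0) is identified with the long-run rate of arrivals that find n customers: the
   difference quotients in the definition of q_n(0,t) are, up to o(1), the increments of the expected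
   number of such arrivals. Laplace transforms in t, a renewal-type recursion for them, and Fatou's
   lemma as the transform parameter tends to 0 give inequalities for the limits. Both sides have the
   same total mass (tightness comes from the disasters, which contract the tails by the factor
   A*(delta)), so they are equalities: (p_n(0)) is invariant for the embedded chain and p_n is the
   mean time spent in n per unit of time.

   Tails of the difference between p_n(0) and the sum of the c_j r_j^n vanish for 1 - b <= n <= 0 by
   the linear system and satisfy a recursion with total weight A*(delta) < 1, hence vanish. The
   number of roots is Rouche's theorem on the unit circle, where again |A*| <= A*(delta) < 1; the
   generating function of the removal probabilities converges on a slightly larger disc, as
   delta > 0. *)

theory Submission
  imports Defs
begin

section \<open>Sample paths\<close>

text \<open>Each \<open>p n u\<close> is only a pointwise limit, with no uniformity in t or u, so
  the usual balance equations, obtained by differentiating in u, are out of reach. Two averaged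
  consequences of the hypothesis survive. Right derivatives that converge to x force linear growth
  of slope x, so the value at u = 0 is a long-run rate; and Fatou's lemma bounds the integral of
  \<open>p n u\<close> over u by occupation probabilities. Computations with nonnegative kernels are
  done in \<open>ennreal\<close>, where sums and integrals may be exchanged freely. The recursion
  for \<open>p n 0\<close> holds only for n >= 1, because disasters feed state 0 from every state.
  The total mass replaces the missing equation at 0, and this is the origin of the condition on the
  sum of c_i / (1 - r_i). For the same reason the difference to the geometric sums is not known to
  vanish at 0, while its tail does, which is why the contraction argument concerns tails. On paths,
  the point to watch is the idle server: its service clock is frozen, neither aging nor competing,
  so the idle state has its own version of each argument about clocks.\<close>

definition psums :: "real \<Rightarrow> (nat \<Rightarrow> real) \<Rightarrow> real set" where
  "psums s E = range (\<lambda>k. s + (\<Sum>i\<le>k. E i))"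

text \<open>The event map of the model with the random inputs replaced by separate arguments: sets
  of epochs for disasters and negative customers, and a batch size for each arrival epoch. Cutting a
  path at an event changes these arguments one at a time.\<close>

definition jump :: "(nat \<Rightarrow> real) \<Rightarrow> real set \<Rightarrow> real set \<Rightarrow> (real \<Rightarrow> nat) \<Rightarrow> real \<Rightarrow> server_state \<Rightarrow> server_state" where
  "jump S D N bt e st =
     (if e \<in> D then remove_all S st else if e \<in> N then remove_one S st else add_batch (bt e) st)"

fun evo :: "(nat \<Rightarrow> real) \<Rightarrow> real set \<Rightarrow> real set \<Rightarrow> (real \<Rightarrow> nat) \<Rightarrow> real \<Rightarrow> real \<Rightarrow> server_state \<Rightarrow>
    real list \<Rightarrow> server_state" where
  "evo S D N bt t s st [] = serve S (t - s) st"
| "evo S D N bt t s st (e # es) = evo S D N bt t e (jump S D N bt e (serve S (e - s) st)) es"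

lemma evolve_eq_evo:
  "evolve Q \<omega> t s st es = evo (\<lambda>k. svc Q k \<omega>) (partial_sums (dis Q) \<omega>) (partial_sums (neg Q) \<omega>)
     (\<lambda>s. batch Q (LEAST k. arrival_epoch Q k \<omega> = s) \<omega>) t s st es"
  by (induction es arbitrary: s st) (auto simp: external_event_def jump_def)

lemma serve_add:
  assumes "0 \<le> d1" "0 \<le> d2"
  shows "serve S d2 (serve S d1 (n, m, v)) = serve S (d1 + d2) (n, m, v)"
  using assms
proof (induction n arbitrary: m v d1)
  case (Suc n)
  show ?case
  proof (cases "d1 < v")
    case True
    then show ?thesis by (auto simp: diff_diff_eq algebra_simps)
  next
    case False
    then show ?thesis using Suc.IH[of "d1 - v" "Suc m" "S (Suc m)"] Suc.prems
      by (cases "0 \<le> v") (auto simp: algebra_simps)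
  qed
qed simp


text \<open>Renumbering of services. After a removal the state carries service number 1; with the
  service sequence shifted by one, the rest of the path can be read as a fresh start from number
  0.\<close>

fun idx_up :: "server_state \<Rightarrow> server_state" where "idx_up (n, m, v) = (n, Suc m, v)"

lemma fst_idx_up [simp]: "fst (idx_up st) = fst st" by (cases st) auto

lemma serve_idx_up: "serve S d (idx_up (n, m, v)) = idx_up (serve (\<lambda>k. S (Suc k)) d (n, m, v))"
  by (induction n arbitrary: m v d) auto

lemma jump_idx_up: "jump S D N bt e (idx_up st) = idx_up (jump (\<lambda>k. S (Suc k)) D N bt e st)"
  by (cases st; cases "fst st") (auto simp: jump_def)

lemma evo_idx_up: "evo S D N bt t s (idx_up st) es = idx_up (evo (\<lambda>k. S (Suc k)) D N bt t s st es)"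
proof (induction es arbitrary: s st)
  case Nil
  then show ?case by (cases st) (auto simp: serve_idx_up simp del: idx_up.simps)
next
  case (Cons e es)
  then show ?case
    by (cases st) (auto simp: serve_idx_up jump_idx_up simp del: idx_up.simps)
qed

text \<open>Entry 0 of the service sequence is read only through the initial state, since every
  service started later has a positive index. Hence a service that is partly done can be stored at
  index 0 without affecting the rest.\<close>

lemma serve_cong_tail:
  "(\<And>k. S (Suc k) = S' (Suc k)) \<Longrightarrow> serve S d (n, m, v) = serve S' d (n, m, v)"
  by (induction n arbitrary: m v d) auto

lemma evo_cong:
  assumes "\<And>k. S (Suc k) = S' (Suc k)"
    and "\<And>e. e \<in> set es \<Longrightarrow> (e \<in> D \<longleftrightarrow> e \<in> D') \<and> (e \<in> N \<longleftrightarrow> e \<in> N')"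
  shows "evo S D N bt t s st es = evo S' D' N' bt t s st es"
  using assms(2)
proof (induction es arbitrary: s st)
  case Nil
  show ?case using serve_cong_tail[of S S'] assms(1) by (cases st) auto
next
  case (Cons e es)
  have j: "jump S D N bt e st' = jump S' D' N' bt e st'" for st'
    using Cons.prems[of e] assms(1) by (cases st'; cases "fst st'") (auto simp: jump_def)
  show ?case using serve_cong_tail[of S S'] assms(1) Cons by (cases st) (auto simp: j)
qed

lemma evo_advance:
  assumes "0 \<le> d" "s + d \<le> t" "\<And>e. e \<in> set es \<Longrightarrow> s + d \<le> e"
  shows "evo S D N bt t s st es = evo S D N bt t (s + d) (serve S d st) es"
proof (cases es)
  case Nil
  then show ?thesis using assms serve_add[of d "t - (s + d)" S] by (cases st) auto
next
  case (Cons e es)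
  then show ?thesis using assms(3)[of e] serve_add[of d "e - (s + d)" S] assms(1)
    by (cases st) auto
qed

text \<open>A path started at time \<open>s\<close> with \<open>n\<close> customers, whose arrivals
  are a fixed set \<open>R\<close> and whose clocks are the arguments \<open>S\<close>,
  \<open>N\<close>, \<open>D\<close>. Only epochs after \<open>s\<close> count, so a batch arriving
  exactly at \<open>s\<close> is understood to be included in \<open>n\<close>.\<close>

definition cust :: "real set \<Rightarrow> (real \<Rightarrow> nat) \<Rightarrow> real \<Rightarrow> real \<Rightarrow> nat \<Rightarrow>
    (nat \<Rightarrow> real) \<Rightarrow> (nat \<Rightarrow> real) \<Rightarrow> (nat \<Rightarrow> real) \<Rightarrow> nat" where
  "cust R bt t s n S N D = fst (evo S (psums s D) (psums s N) bt t s (n, 0, S 0)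
     (sorted_list_of_set ((R \<union> psums s N \<union> psums s D) \<inter> {s<..t})))"

lemma num_customers_eq_cust:
  "num_customers Q t \<omega> = cust (range (\<lambda>k. arrival_epoch Q k \<omega>))
     (\<lambda>s. batch Q (LEAST k. arrival_epoch Q k \<omega> = s) \<omega>) t 0 (num0 Q \<omega>)
     (\<lambda>k. svc Q k \<omega>) (\<lambda>k. neg Q k \<omega>) (\<lambda>k. dis Q k \<omega>)"
  by (simp add: num_customers_def cust_def evolve_eq_evo external_epochs_def psums_def partial_sums_def)

text \<open>The second conjunct keeps the epochs up to any time finite. Without it
  \<open>sorted_list_of_set\<close> would fall back to the empty list.\<close>

definition regular :: "(nat \<Rightarrow> real) \<Rightarrow> bool" where
  "regular E \<longleftrightarrow> (\<forall>k. 0 < E k) \<and> (\<forall>t. \<exists>k. t < (\<Sum>i\<le>k. E i))"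

text \<open>Aging of a clock sequence by \<open>x\<close>: only the running clock is shortened, and
  the epochs stay where they are once the origin is moved by \<open>x\<close>.\<close>

definition elapse :: "real \<Rightarrow> (nat \<Rightarrow> real) \<Rightarrow> nat \<Rightarrow> real" where
  "elapse x E = E(0 := E 0 - x)"

lemma psums_elapse: "psums (s + x) (elapse x E) = psums s E"
proof -
  have "s + x + (\<Sum>i\<le>k. elapse x E i) = s + (\<Sum>i\<le>k. E i)" for k
    by (induction k) (auto simp: elapse_def)
  then show ?thesis unfolding psums_def by (simp add: add.assoc)
qed

lemma psums_unfold: "psums s E = insert (s + E 0) (psums (s + E 0) (\<lambda>k. E (Suc k)))"
proof -
  have "s + (\<Sum>i\<le>Suc k. E i) = s + E 0 + (\<Sum>i\<le>k. E (Suc i))" for k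
    by (subst sum.atMost_Suc_shift) simp
  then have *: "(\<lambda>k. s + (\<Sum>i\<le>Suc k. E i)) = (\<lambda>k. s + E 0 + (\<Sum>i\<le>k. E (Suc i)))" by auto
  have "range f = insert (f 0) (range (\<lambda>k. f (Suc k)))" for f :: "nat \<Rightarrow> real"
  proof -
    have "UNIV = insert 0 (range Suc)" using not0_implies_Suc by auto
    then show ?thesis by (metis image_image image_insert)
  qed
  from this[of "\<lambda>k. s + (\<Sum>i\<le>k. E i)"] show ?thesis unfolding psums_def * by simp
qed

lemma psums_tail: "s + E 0 < e \<Longrightarrow> e \<in> psums (s + E 0) (\<lambda>k. E (Suc k)) \<longleftrightarrow> e \<in> psums s E"
  by (subst (2) psums_unfold) auto

lemma psums_ge:
  assumes "\<And>k. 0 < E k" "e \<in> psums s E" shows "s + E 0 \<le> e"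
proof -
  obtain k where e: "e = s + (\<Sum>i\<le>k. E i)" using assms(2) by (auto simp: psums_def)
  have "E 0 \<le> (\<Sum>i\<le>k. E i)" by (rule member_le_sum) (auto simp: assms(1) less_imp_le)
  then show ?thesis using e by simp
qed

lemma finite_psums:
  assumes "regular E" shows "finite (psums s E \<inter> {..t})"
proof -
  obtain k where k: "t - s < (\<Sum>i\<le>k. E i)" using assms by (auto simp: regular_def)
  have "psums s E \<inter> {..t} \<subseteq> (\<lambda>k. s + (\<Sum>i\<le>k. E i)) ` {..k}"
  proof
    fix e assume "e \<in> psums s E \<inter> {..t}"
    then obtain j where j: "e = s + (\<Sum>i\<le>j. E i)" "e \<le> t" by (auto simp: psums_def)
    have "\<not> k \<le> j"
    proof
      assume "k \<le> j"
      then have "(\<Sum>i\<le>k. E i) \<le> (\<Sum>i\<le>j. E i)"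
        using assms by (intro sum_mono2) (auto simp: regular_def less_imp_le)
      then show False using j k by simp
    qed
    then show "e \<in> (\<lambda>k. s + (\<Sum>i\<le>k. E i)) ` {..k}" using j by auto
  qed
  then show ?thesis by (rule finite_subset) simp
qed

section \<open>Decomposition of a path at its first event\<close>

lemma sorted_list_of_set_first:
  fixes E :: "real set"
  assumes "finite E" "e \<in> E" "\<And>x. x \<in> E \<Longrightarrow> e \<le> x"
  shows "sorted_list_of_set E = e # sorted_list_of_set (E - {e})"
proof -
  have "Min E = e" using assms by (intro Min_eqI) auto
  then show ?thesis using sorted_list_of_set_nonempty[of E] assms by auto
qed

text \<open>The end of a service is not an external epoch, so the list of epochs is unchanged; the
  origin moves and the two external clocks age by \<open>S 0\<close>. Positivity of
  \<open>S 1\<close> prevents the next service from ending at the same instant.\<close>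

lemma cust_service:
  assumes N: "regular N" and D: "regular D" and R: "finite (R \<inter> {s<..t})"
    and x: "0 < S 0" "0 < S 1" "S 0 < N 0" "S 0 < D 0" "s + S 0 \<le> t" "R \<inter> {s<..s + S 0} = {}"
  shows "cust R bt t s (Suc n) S N D =
    cust R bt t (s + S 0) n (\<lambda>k. S (Suc k)) (elapse (S 0) N) (elapse (S 0) D)"
proof -
  let ?E = "(R \<union> psums s N \<union> psums s D) \<inter> {s<..t}"
  have *: "e > s + S 0" if "e \<in> ?E" for e
    using that psums_ge[of N e s] psums_ge[of D e s] N D x by (fastforce simp: regular_def)
  have E: "?E = (R \<union> psums s N \<union> psums s D) \<inter> {s + S 0<..t}" using * x(1) by force
  have fin: "finite ?E"
    using finite_psums[OF N, of s t] finite_psums[OF D, of s t] R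
    by (auto simp: Int_Un_distrib2 intro: finite_subset[rotated])
  have "evo S (psums s D) (psums s N) bt t s (Suc n, 0, S 0) (sorted_list_of_set ?E) =
     evo S (psums s D) (psums s N) bt t (s + S 0) (serve S (S 0) (Suc n, 0, S 0)) (sorted_list_of_set ?E)"
    using * x fin by (intro evo_advance) (auto intro: less_imp_le)
  also have "serve S (S 0) (Suc n, 0, S 0) = idx_up (n, 0, S 1)"
    using x by (cases n) auto
  finally show ?thesis
    unfolding cust_def psums_elapse E[symmetric] evo_idx_up fst_idx_up by simp
qed

text \<open>The part common to the three external events: nothing happens before
  \<open>s + x\<close>, so the server works for time \<open>x\<close> and then jumps. With no
  customer present the service clock is frozen, whence the distinction on
  \<open>n = 0\<close>.\<close>

lemma cust_event:
  assumes N: "regular N" and D: "regular D" and R: "finite (R \<inter> {s<..t})"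
    and x: "0 < x" "n > 0 \<Longrightarrow> x < S 0" "x \<le> N 0" "x \<le> D 0" "s + x \<le> t" "R \<inter> {s<..<s + x} = {}"
    and e: "s + x \<in> R \<union> psums s N \<union> psums s D"
  shows "cust R bt t s n S N D =
    fst (evo S (psums s D) (psums s N) bt t (s + x)
      (jump S (psums s D) (psums s N) bt (s + x) (n, 0, if n = 0 then S 0 else S 0 - x))
      (sorted_list_of_set ((R \<union> psums s N \<union> psums s D) \<inter> {s + x<..t})))"
proof -
  let ?E = "(R \<union> psums s N \<union> psums s D) \<inter> {s<..t}"
  have *: "e \<ge> s + x" if "e \<in> ?E" for e
    using that psums_ge[of N e s] psums_ge[of D e s] N D x by (fastforce simp: regular_def)
  have E: "?E - {s + x} = (R \<union> psums s N \<union> psums s D) \<inter> {s + x<..t}"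
    using * x(1) by force
  have fin: "finite ?E"
    using finite_psums[OF N, of s t] finite_psums[OF D, of s t] R
    by (auto simp: Int_Un_distrib2 intro: finite_subset[rotated])
  have s: "sorted_list_of_set ?E = (s + x) # sorted_list_of_set (?E - {s + x})"
    using * fin x e by (intro sorted_list_of_set_first) auto
  have "serve S x (n, 0, S 0) = (n, 0, if n = 0 then S 0 else S 0 - x)"
    using x by (cases n) auto
  then show ?thesis unfolding cust_def s E by simp
qed

text \<open>If somebody is in service, that service is abandoned and the shifted sequence takes
  over; if nobody is, the pending service keeps its place. The disaster clock restarts, while the
  clock of the negative customers only ages.\<close>

lemma cust_disaster:
  assumes N: "regular N" and D: "regular D" and R: "finite (R \<inter> {s<..t})"
    and x: "n > 0 \<Longrightarrow> D 0 < S 0" "D 0 < N 0" "s + D 0 \<le> t" "R \<inter> {s<..s + D 0} = {}"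
  shows "cust R bt t s n S N D =
    cust R bt t (s + D 0) 0 (if n = 0 then S else (\<lambda>k. S (Suc k))) (elapse (D 0) N) (\<lambda>k. D (Suc k))"
proof -
  have D0: "0 < D 0" using D by (auto simp: regular_def)
  have mem: "s + D 0 \<in> psums s D" by (subst psums_unfold) simp
  have E: "(R \<union> psums s N \<union> psums s D) \<inter> {s + D 0<..t} =
     (R \<union> psums s N \<union> psums (s + D 0) (\<lambda>k. D (Suc k))) \<inter> {s + D 0<..t}"
    by (auto simp: psums_tail)
  have fin: "finite ((R \<union> psums s N \<union> psums s D) \<inter> {s + D 0<..t})"
    by (rule finite_subset[of _ "R \<inter> {s<..t} \<union> psums s N \<inter> {..t} \<union> psums s D \<inter> {..t}"])
      (use finite_psums[OF N] finite_psums[OF D] R D0 in auto)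
  have "cust R bt t s n S N D =
    fst (evo S (psums s D) (psums s N) bt t (s + D 0)
      (jump S (psums s D) (psums s N) bt (s + D 0) (n, 0, if n = 0 then S 0 else S 0 - D 0))
      (sorted_list_of_set ((R \<union> psums s N \<union> psums s D) \<inter> {s + D 0<..t})))"
    using x D0 mem by (intro cust_event N D R) auto
  also have "jump S (psums s D) (psums s N) bt (s + D 0) (n, 0, if n = 0 then S 0 else S 0 - D 0) =
     (if n = 0 then (0, 0, S 0) else idx_up (0, 0, S 1))"
    using mem by (cases n) (auto simp: jump_def)
  also have "evo S (psums s D) (psums s N) bt t (s + D 0) \<dots>
      (sorted_list_of_set ((R \<union> psums s N \<union> psums s D) \<inter> {s + D 0<..t})) =
     evo S (psums (s + D 0) (\<lambda>k. D (Suc k))) (psums s N) bt t (s + D 0)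
      (if n = 0 then (0, 0, S 0) else idx_up (0, 0, S 1))
      (sorted_list_of_set ((R \<union> psums s N \<union> psums s D) \<inter> {s + D 0<..t}))"
    using fin by (intro evo_cong) (auto simp: psums_tail)
  finally show ?thesis
    unfolding cust_def psums_elapse E by (auto simp: evo_idx_up simp del: idx_up.simps)
qed

lemma cust_negative:
  assumes N: "regular N" and D: "regular D" and R: "finite (R \<inter> {s<..t})"
    and x: "n > 0 \<Longrightarrow> N 0 < S 0" "N 0 < D 0" "s + N 0 \<le> t" "R \<inter> {s<..s + N 0} = {}"
  shows "cust R bt t s n S N D =
    cust R bt t (s + N 0) (n - 1) (if n = 0 then S else (\<lambda>k. S (Suc k))) (\<lambda>k. N (Suc k)) (elapse (N 0) D)"
proof -
  have N0: "0 < N 0" using N by (auto simp: regular_def)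
  have mem: "s + N 0 \<in> psums s N" by (subst psums_unfold) simp
  have nmem: "s + N 0 \<notin> psums s D" using psums_ge[of D "s + N 0" s] D x by (auto simp: regular_def)
  have E: "(R \<union> psums s N \<union> psums s D) \<inter> {s + N 0<..t} =
     (R \<union> psums (s + N 0) (\<lambda>k. N (Suc k)) \<union> psums s D) \<inter> {s + N 0<..t}"
    by (auto simp: psums_tail)
  have fin: "finite ((R \<union> psums s N \<union> psums s D) \<inter> {s + N 0<..t})"
    by (rule finite_subset[of _ "R \<inter> {s<..t} \<union> psums s N \<inter> {..t} \<union> psums s D \<inter> {..t}"])
      (use finite_psums[OF N] finite_psums[OF D] R N0 in auto)
  have "cust R bt t s n S N D =
    fst (evo S (psums s D) (psums s N) bt t (s + N 0)
      (jump S (psums s D) (psums s N) bt (s + N 0) (n, 0, if n = 0 then S 0 else S 0 - N 0))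
      (sorted_list_of_set ((R \<union> psums s N \<union> psums s D) \<inter> {s + N 0<..t})))"
    using x N0 mem by (intro cust_event N D R) auto
  also have "jump S (psums s D) (psums s N) bt (s + N 0) (n, 0, if n = 0 then S 0 else S 0 - N 0) =
     (if n = 0 then (0, 0, S 0) else idx_up (n - 1, 0, S 1))"
    using mem nmem by (cases n) (auto simp: jump_def)
  also have "evo S (psums s D) (psums s N) bt t (s + N 0) \<dots>
      (sorted_list_of_set ((R \<union> psums s N \<union> psums s D) \<inter> {s + N 0<..t})) =
     evo S (psums s D) (psums (s + N 0) (\<lambda>k. N (Suc k))) bt t (s + N 0)
      (if n = 0 then (0, 0, S 0) else idx_up (n - 1, 0, S 1))
      (sorted_list_of_set ((R \<union> psums s N \<union> psums s D) \<inter> {s + N 0<..t}))"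
    using fin by (intro evo_cong) (auto simp: psums_tail)
  finally show ?thesis
    unfolding cust_def psums_elapse E by (auto simp: evo_idx_up simp del: idx_up.simps)
qed

text \<open>An arrival interrupts nothing, so all running clocks merely age. A batch that finds the
  system empty meets a service clock that has been frozen and still has its full length.\<close>

lemma cust_arrival:
  assumes N: "regular N" and D: "regular D" and R: "finite (R \<inter> {s<..t})"
    and x: "0 < x" "n > 0 \<Longrightarrow> x < S 0" "x < N 0" "x < D 0" "s + x \<le> t" "R \<inter> {s<..<s + x} = {}" "s + x \<in> R"
  shows "cust R bt t s n S N D =
    cust R bt t (s + x) (n + bt (s + x)) (if n = 0 then S else elapse x S) (elapse x N) (elapse x D)"
proof -
  have nmem: "s + x \<notin> psums s D" "s + x \<notin> psums s N"
    using psums_ge[of D "s + x" s] psums_ge[of N "s + x" s] D N x by (auto simp: regular_def)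
  have "cust R bt t s n S N D =
    fst (evo S (psums s D) (psums s N) bt t (s + x)
      (jump S (psums s D) (psums s N) bt (s + x) (n, 0, if n = 0 then S 0 else S 0 - x))
      (sorted_list_of_set ((R \<union> psums s N \<union> psums s D) \<inter> {s + x<..t})))"
    using x by (intro cust_event N D R) auto
  also have "jump S (psums s D) (psums s N) bt (s + x) (n, 0, if n = 0 then S 0 else S 0 - x) =
     (n + bt (s + x), 0, (if n = 0 then S else elapse x S) 0)"
    using nmem by (auto simp: jump_def elapse_def)
  also have "evo S (psums s D) (psums s N) bt t (s + x) \<dots>
      (sorted_list_of_set ((R \<union> psums s N \<union> psums s D) \<inter> {s + x<..t})) =
     evo (if n = 0 then S else elapse x S) (psums s D) (psums s N) bt t (s + x)
      (n + bt (s + x), 0, (if n = 0 then S else elapse x S) 0)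
      (sorted_list_of_set ((R \<union> psums s N \<union> psums s D) \<inter> {s + x<..t}))"
    by (intro evo_cong) (auto simp: elapse_def)
  finally show ?thesis
    unfolding cust_def psums_elapse .
qed

lemma cust_no_event:
  assumes N: "regular N" and D: "regular D" and "s \<le> t"
    and x: "n > 0 \<Longrightarrow> t - s < S 0" "t - s < N 0" "t - s < D 0" "R \<inter> {s<..t} = {}"
  shows "cust R bt t s n S N D = n"
proof -
  have "(R \<union> psums s N \<union> psums s D) \<inter> {s<..t} = {}"
    using psums_ge[of N _ s] psums_ge[of D _ s] N D x by (fastforce simp: regular_def)
  then show ?thesis using x by (cases n) (auto simp: cust_def)
qed

section \<open>Measurability of the number of customers\<close>

abbreviation state_space :: "server_state measure" where
  "state_space \<equiv> count_space UNIV \<Otimes>\<^sub>M count_space UNIV \<Otimes>\<^sub>M borel"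

lemma measurable_serve:
  assumes S[measurable]: "\<And>k. (\<lambda>\<omega>. S \<omega> k) \<in> borel_measurable M"
    and d[measurable]: "d \<in> borel_measurable M" and st[measurable]: "st \<in> measurable M state_space"
  shows "(\<lambda>\<omega>. serve (S \<omega>) (d \<omega>) (st \<omega>)) \<in> measurable M state_space"
proof -
  have *: "(\<lambda>\<omega>. serve (S \<omega>) (d \<omega>) (n, m \<omega>, v \<omega>)) \<in> measurable M state_space"
    if [measurable]: "d \<in> borel_measurable M" "m \<in> measurable M (count_space UNIV)" "v \<in> borel_measurable M"
    for n d m v
    using that
  proof (induction n arbitrary: d m v)
    case (Suc n)
    note [measurable] = Suc.prems
    have [measurable]: "(\<lambda>\<omega>. S \<omega> (Suc (m \<omega>))) \<in> borel_measurable M"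
      by (rule measurable_compose_countable[OF S]) measurable
    have [measurable]: "(\<lambda>\<omega>. serve (S \<omega>) (d \<omega> - v \<omega>) (n, Suc (m \<omega>), S \<omega> (Suc (m \<omega>)))) \<in> measurable M state_space"
      by (rule Suc.IH) measurable
    show ?case unfolding serve.simps by measurable
  qed simp
  \<comment> \<open>The induction was over a constant number of customers; a random number is
    handled through its countably many values.\<close>
  have "(\<lambda>\<omega>. serve (S \<omega>) (d \<omega>) (fst (st \<omega>), fst (snd (st \<omega>)), snd (snd (st \<omega>)))) \<in> measurable M state_space"
    by (rule measurable_compose_countable[where g="\<lambda>\<omega>. fst (st \<omega>)"], rule *) measurable
  then show ?thesis by simp
qed


lemma remove_one_alt: "remove_one S st =
    (if fst st = 0 then st else (fst st - 1, Suc (fst (snd st)), S (Suc (fst (snd st)))))"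
  by (cases st; cases "fst st") auto

lemma remove_all_alt: "remove_all S st =
    (if fst st = 0 then st else (0, Suc (fst (snd st)), S (Suc (fst (snd st)))))"
  by (cases st; cases "fst st") auto

lemma add_batch_alt: "add_batch x st = (fst st + x, snd st)"
  by (cases st) auto

lemma measurable_jump:
  assumes S[measurable]: "\<And>k. (\<lambda>\<omega>. S \<omega> k) \<in> borel_measurable M"
    and [measurable]: "Measurable.pred M (\<lambda>\<omega>. e \<omega> \<in> D \<omega>)" "Measurable.pred M (\<lambda>\<omega>. e \<omega> \<in> N \<omega>)"
    and [measurable]: "(\<lambda>\<omega>. bt \<omega> (e \<omega>)) \<in> measurable M (count_space UNIV)"
    and st[measurable]: "st \<in> measurable M state_space"
  shows "(\<lambda>\<omega>. jump (S \<omega>) (D \<omega>) (N \<omega>) (bt \<omega>) (e \<omega>) (st \<omega>)) \<in> measurable M state_space"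
proof -
  have [measurable]: "(\<lambda>\<omega>. S \<omega> (Suc (fst (snd (st \<omega>))))) \<in> borel_measurable M"
    by (rule measurable_compose_countable[OF S]) measurable
  show ?thesis unfolding jump_def remove_all_alt remove_one_alt add_batch_alt by measurable
qed

lemma measurable_evo:
  assumes S[measurable]: "\<And>k. (\<lambda>\<omega>. S \<omega> k) \<in> borel_measurable M"
    and D: "\<And>i. Measurable.pred M (\<lambda>\<omega>. ep i \<omega> \<in> D \<omega>)" and N: "\<And>i. Measurable.pred M (\<lambda>\<omega>. ep i \<omega> \<in> N \<omega>)"
    and bt: "\<And>i. (\<lambda>\<omega>. bt \<omega> (ep i \<omega>)) \<in> measurable M (count_space UNIV)"
    and ep[measurable]: "\<And>i. ep i \<in> borel_measurable M"
    and t[measurable]: "t \<in> borel_measurable M"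
    and "s \<in> borel_measurable M" "st \<in> measurable M state_space"
  shows "(\<lambda>\<omega>. evo (S \<omega>) (D \<omega>) (N \<omega>) (bt \<omega>) (t \<omega>) (s \<omega>) (st \<omega>) (map (\<lambda>i. ep i \<omega>) js)) \<in> measurable M state_space"
  using assms(7,8)
proof (induction js arbitrary: s st)
  case Nil
  note [measurable] = Nil.prems
  show ?case unfolding list.map evo.simps by (intro measurable_serve) measurable
next
  case (Cons i js)
  note [measurable] = Cons.prems
  show ?case unfolding list.map evo.simps
    by (intro Cons.IH measurable_jump measurable_serve D N bt) measurable
qed

text \<open>The obstacle is that the sorted list of epochs is itself random. Epochs carry labels
  from a countable type, so there are only countably many candidate lists \<open>js\<close> of
  labels; on the event \<open>P js\<close> the path is obtained from the fixed list
  \<open>js\<close>, where measurability is a plain induction.\<close>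

lemma measurable_cust:
  fixes A S N D :: "'b \<Rightarrow> nat \<Rightarrow> real" and B :: "'b \<Rightarrow> nat \<Rightarrow> nat"
  assumes A[measurable]: "\<And>k. (\<lambda>\<omega>. A \<omega> k) \<in> borel_measurable M"
    and B[measurable]: "\<And>k. (\<lambda>\<omega>. B \<omega> k) \<in> measurable M (count_space UNIV)"
    and S[measurable]: "\<And>k. (\<lambda>\<omega>. S \<omega> k) \<in> borel_measurable M"
    and N[measurable]: "\<And>k. (\<lambda>\<omega>. N \<omega> k) \<in> borel_measurable M"
    and D[measurable]: "\<And>k. (\<lambda>\<omega>. D \<omega> k) \<in> borel_measurable M"
    and n[measurable]: "n \<in> measurable M (count_space UNIV)"
    and t[measurable]: "t \<in> borel_measurable M" and s[measurable]: "s \<in> borel_measurable M"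
  shows "(\<lambda>\<omega>. cust (range (A \<omega>)) (\<lambda>e. B \<omega> (LEAST k. A \<omega> k = e)) (t \<omega>) (s \<omega>) (n \<omega>) (S \<omega>) (N \<omega>) (D \<omega>))
     \<in> measurable M (count_space UNIV)"
proof -
  define ep where "ep i \<omega> = (case i of (Inl k) \<Rightarrow> A \<omega> k | Inr (Inl k) \<Rightarrow> s \<omega> + (\<Sum>i\<le>k. N \<omega> i)
     | Inr (Inr k) \<Rightarrow> s \<omega> + (\<Sum>i\<le>k. D \<omega> i))" for i \<omega>
  have ep[measurable]: "ep i \<in> borel_measurable M" for i
  proof (cases i)
    case (Inr j)
    then show ?thesis unfolding ep_def by (cases j) simp_all
  next
    case (Inl k)
    then have "ep i = (\<lambda>\<omega>. A \<omega> k)" by (auto simp: ep_def fun_eq_iff)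
    then show ?thesis by simp
  qed
  have rng: "range (A \<omega>) \<union> psums (s \<omega>) (N \<omega>) \<union> psums (s \<omega>) (D \<omega>) = range (\<lambda>i. ep i \<omega>)" for \<omega>
    by (auto simp: set_eq_iff image_iff psums_def split_sum_ex ep_def)
  have D'[measurable]: "Measurable.pred M (\<lambda>\<omega>. ep i \<omega> \<in> psums (s \<omega>) (D \<omega>))" for i
    unfolding psums_def image_iff by measurable
  have N'[measurable]: "Measurable.pred M (\<lambda>\<omega>. ep i \<omega> \<in> psums (s \<omega>) (N \<omega>))" for i
    unfolding psums_def image_iff by measurable
  have bt[measurable]: "(\<lambda>\<omega>. B \<omega> (LEAST k. A \<omega> k = ep i \<omega>)) \<in> measurable M (count_space UNIV)" for i
    by (rule measurable_compose_countable[OF B]) measurable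
  define F where "F js \<omega> = fst (evo (S \<omega>) (psums (s \<omega>) (D \<omega>)) (psums (s \<omega>) (N \<omega>)) (\<lambda>e. B \<omega> (LEAST k. A \<omega> k = e))
     (t \<omega>) (s \<omega>) (n \<omega>, 0, S \<omega> 0) (map (\<lambda>i. ep i \<omega>) js))" for js \<omega>
  have F[measurable]: "F js \<in> measurable M (count_space UNIV)" for js
    unfolding F_def
    by (rule measurable_compose[OF measurable_evo measurable_fst]) measurable
  \<comment> \<open>\<open>P js\<close> says that \<open>js\<close> labels the epochs in the
    observed interval, in increasing order and completely. It is spelled out with countable
    quantifiers to be visibly measurable.\<close>
  define P where "P js \<omega> \<longleftrightarrow> (\<forall>i j. i < j \<longrightarrow> j < length js \<longrightarrow> ep (js ! i) \<omega> < ep (js ! j) \<omega>) \<and>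
     (\<forall>i. i < length js \<longrightarrow> s \<omega> < ep (js ! i) \<omega> \<and> ep (js ! i) \<omega> \<le> t \<omega>) \<and>
     (\<forall>i. s \<omega> < ep i \<omega> \<and> ep i \<omega> \<le> t \<omega> \<longrightarrow> (\<exists>j. j < length js \<and> ep (js ! j) \<omega> = ep i \<omega>))" for js \<omega>
  have [measurable]: "Measurable.pred M (P js)" for js
    unfolding P_def by measurable
  have P_iff: "P js \<omega> \<longleftrightarrow> sorted_wrt (<) (map (\<lambda>i. ep i \<omega>) js) \<and>
     set (map (\<lambda>i. ep i \<omega>) js) = range (\<lambda>i. ep i \<omega>) \<inter> {s \<omega><..t \<omega>}" for js \<omega>
  proof -
    have "P js \<omega> \<longleftrightarrow> sorted_wrt (<) (map (\<lambda>i. ep i \<omega>) js) \<and> (\<forall>i\<in>set js. s \<omega> < ep i \<omega> \<and> ep i \<omega> \<le> t \<omega>) \<and>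
     (\<forall>i. s \<omega> < ep i \<omega> \<and> ep i \<omega> \<le> t \<omega> \<longrightarrow> (\<exists>j\<in>set js. ep j \<omega> = ep i \<omega>))"
      unfolding P_def sorted_wrt_iff_nth_less all_set_conv_all_nth Bex_def in_set_conv_nth by auto blast
    also have "(\<forall>i\<in>set js. s \<omega> < ep i \<omega> \<and> ep i \<omega> \<le> t \<omega>) \<and>
     (\<forall>i. s \<omega> < ep i \<omega> \<and> ep i \<omega> \<le> t \<omega> \<longrightarrow> (\<exists>j\<in>set js. ep j \<omega> = ep i \<omega>)) \<longleftrightarrow>
      set (map (\<lambda>i. ep i \<omega>) js) = range (\<lambda>i. ep i \<omega>) \<inter> {s \<omega><..t \<omega>}"
      by (auto simp: set_eq_iff image_iff) metis+
    finally show ?thesis .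
  qed
  have PE: "sorted_list_of_set (range (\<lambda>i. ep i \<omega>) \<inter> {s \<omega><..t \<omega>}) = map (\<lambda>i. ep i \<omega>) js" if "P js \<omega>" for js \<omega>
    using that unfolding P_iff by (metis sorted_list_of_set.idem_if_sorted_distinct strict_sorted_iff)
  \<comment> \<open>No list of labels fits only when infinitely many epochs occur. Then
    \<open>sorted_list_of_set\<close> is empty by default, and the path agrees with
    \<open>F []\<close>.\<close>
  have notP: "sorted_list_of_set (range (\<lambda>i. ep i \<omega>) \<inter> {s \<omega><..t \<omega>}) = []" if "\<And>js. \<not> P js \<omega>" for \<omega>
  proof (rule ccontr)
    let ?E = "range (\<lambda>i. ep i \<omega>) \<inter> {s \<omega><..t \<omega>}"
    assume *: "sorted_list_of_set ?E \<noteq> []"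
    then have fin: "finite ?E" using sorted_list_of_set.fold_insort_key.infinite by blast
    have "\<forall>e\<in>set (sorted_list_of_set ?E). \<exists>i. ep i \<omega> = e" using fin by auto
    then obtain js where js: "map (\<lambda>i. ep i \<omega>) js = sorted_list_of_set ?E"
      by (metis ex_map_conv)
    have "set (map (\<lambda>i. ep i \<omega>) js) = ?E" unfolding js using fin by simp
    then have "P js \<omega>" unfolding P_iff using js by simp
    then show False using that by blast
  qed
  have "Measurable.pred M (\<lambda>\<omega>. (\<exists>js. P js \<omega> \<and> F js \<omega> = c) \<or> ((\<forall>js. \<not> P js \<omega>) \<and> F [] \<omega> = c))" for c
    by measurable
  moreover have "cust (range (A \<omega>)) (\<lambda>e. B \<omega> (LEAST k. A \<omega> k = e)) (t \<omega>) (s \<omega>) (n \<omega>) (S \<omega>) (N \<omega>) (D \<omega>) = c \<longleftrightarrow>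
     (\<exists>js. P js \<omega> \<and> F js \<omega> = c) \<or> ((\<forall>js. \<not> P js \<omega>) \<and> F [] \<omega> = c)" for c \<omega>
    using PE[of _ \<omega>] notP[of \<omega>] unfolding cust_def rng F_def by (metis list.map(1))
  ultimately show ?thesis
    by (intro measurable_count_space_eq2_countable[THEN iffD2]) (auto simp: pred_def vimage_def Int_def conj_commute)
qed

section \<open>Sequences of independent clocks and lack of memory\<close>

abbreviation iid :: "real measure \<Rightarrow> (nat \<Rightarrow> real) measure" where
  "iid M \<equiv> PiM UNIV (\<lambda>_::nat. M)"

lemma prob_space_iid: "prob_space M \<Longrightarrow> prob_space (iid M)"
  by (intro prob_space_PiM)

lemma nn_integral_iid_step:
  assumes "prob_space M" and F[measurable]: "F \<in> borel_measurable (iid M)"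
  shows "(\<integral>\<^sup>+\<omega>. F \<omega> \<partial>iid M) = (\<integral>\<^sup>+y. \<integral>\<^sup>+\<omega>. F (case_nat y \<omega>) \<partial>iid M \<partial>M)"
proof -
  interpret M: prob_space M by fact
  interpret S: prob_space "iid M" by (rule prob_space_iid) fact
  interpret sequence_space M ..
  have "(\<integral>\<^sup>+\<omega>. F \<omega> \<partial>iid M) = (\<integral>\<^sup>+\<omega>. F \<omega> \<partial>distr (M \<Otimes>\<^sub>M iid M) (iid M) (\<lambda>(s, \<omega>). case_nat s \<omega>))"
    by (simp add: PiM_iter)
  also have "\<dots> = (\<integral>\<^sup>+x. F (case_nat (fst x) (snd x)) \<partial>(M \<Otimes>\<^sub>M iid M))"
    by (subst nn_integral_distr) (auto simp: case_prod_beta')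
  also have "\<dots> = (\<integral>\<^sup>+y. \<integral>\<^sup>+\<omega>. F (case_nat y \<omega>) \<partial>iid M \<partial>M)"
    by (subst S.nn_integral_fst[symmetric]) auto
  finally show ?thesis .
qed

lemma nn_integral_iid_exp_sum:
  assumes "prob_space M" and [measurable_cong]: "sets M = sets borel"
  shows "(\<integral>\<^sup>+\<omega>. ennreal (exp (- (\<Sum>i\<le>k. \<omega> i))) \<partial>iid M) = (\<integral>\<^sup>+x. ennreal (exp (- x)) \<partial>M) ^ Suc k"
proof (induction k)
  interpret M: prob_space M by fact
  interpret S: prob_space "iid M" by (rule prob_space_iid) fact
  {
    case 0
    show ?case
      by (subst nn_integral_iid_step[OF assms(1)]) (simp_all add: S.emeasure_space_1)
  next
    case (Suc k)
    have "(\<integral>\<^sup>+\<omega>. ennreal (exp (- (\<Sum>i\<le>Suc k. \<omega> i))) \<partial>iid M) =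
      (\<integral>\<^sup>+y. \<integral>\<^sup>+\<omega>. ennreal (exp (- (\<Sum>i\<le>Suc k. case_nat y \<omega> i))) \<partial>iid M \<partial>M)"
      by (rule nn_integral_iid_step[OF assms(1)]) measurable
    also have "\<dots> = (\<integral>\<^sup>+y. \<integral>\<^sup>+\<omega>. ennreal (exp (- y)) * ennreal (exp (- (\<Sum>i\<le>k. \<omega> i))) \<partial>iid M \<partial>M)"
      by (subst sum.atMost_Suc_shift) (simp add: ennreal_mult'[symmetric] exp_add[symmetric] algebra_simps)
    also have "\<dots> = (\<integral>\<^sup>+y. ennreal (exp (- y)) * (\<integral>\<^sup>+x. ennreal (exp (- x)) \<partial>M) ^ Suc k \<partial>M)"
      by (subst nn_integral_cmult) (auto simp: Suc.IH)
    also have "\<dots> = (\<integral>\<^sup>+x. ennreal (exp (- x)) \<partial>M) ^ Suc (Suc k)"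
      by (subst nn_integral_multc) auto
    finally show ?case .
  }
qed

text \<open>Divergence of the partial sums follows from an exponential Markov bound: the probability
  that the first k + 1 terms sum to at most t is at most exp(t) c^(k + 1), where c is the mean of
  exp(- x). Positivity of the variables gives c < 1.\<close>

lemma AE_iid_regular:
  assumes "prob_space M" and s[measurable_cong]: "sets M = sets borel" and pos: "AE x in M. 0 < x"
  shows "AE \<omega> in iid M. regular \<omega>"
proof -
  interpret M: prob_space M by fact
  interpret S: prob_space "iid M" by (rule prob_space_iid) fact
  define c where "c = (\<integral>x. exp (- x) \<partial>M)"
  have int: "integrable M (\<lambda>x. exp (- x))"
    using pos by (intro M.integrable_const_bound[where B=1]) auto
  have c0: "0 \<le> c" unfolding c_def by (intro integral_nonneg_AE) auto
  have c1: "c < 1"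
  proof (rule ccontr)
    assume "\<not> c < 1"
    moreover have "(\<integral>x. 1 - exp (- x) \<partial>M) = 1 - c"
      using int by (simp add: c_def M.prob_space)
    moreover have "0 \<le> (\<integral>x. 1 - exp (- x) \<partial>M)"
      using pos by (intro integral_nonneg_AE) auto
    ultimately have "(\<integral>x. 1 - exp (- x) \<partial>M) = 0" by simp
    then have "AE x in M. 1 - exp (- x) = 0"
      using pos int by (subst (asm) integral_nonneg_eq_0_iff_AE) auto
    with pos have "AE x in M. False" by eventually_elim auto
    then show False by simp
  qed
  have cc: "(\<integral>\<^sup>+x. ennreal (exp (- x)) \<partial>M) = ennreal c"
    unfolding c_def using int by (intro nn_integral_eq_integral) auto
  have "AE \<omega> in iid M. \<exists>k. real t < (\<Sum>i\<le>k. \<omega> i)" for t :: nat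
  proof -
    let ?A = "{\<omega> \<in> space (iid M). \<forall>k. (\<Sum>i\<le>k. \<omega> i) \<le> real t}"
    have [measurable]: "?A \<in> sets (iid M)" by measurable
    have "emeasure (iid M) ?A \<le> ennreal (exp t * c ^ Suc k)" for k
    proof -
      have "emeasure (iid M) ?A = (\<integral>\<^sup>+\<omega>. indicator ?A \<omega> \<partial>iid M)" by simp
      also have "\<dots> \<le> (\<integral>\<^sup>+\<omega>. ennreal (exp t) * ennreal (exp (- (\<Sum>i\<le>k. \<omega> i))) \<partial>iid M)"
        by (intro nn_integral_mono) (auto simp: indicator_def ennreal_mult'[symmetric] exp_add[symmetric])
      also have "\<dots> = ennreal (exp t * c ^ Suc k)"
        by (subst nn_integral_cmult)
          (auto simp: nn_integral_iid_exp_sum[OF assms(1,2)] cc ennreal_mult' c0 ennreal_power[symmetric])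
      finally show ?thesis .
    qed
    then have le: "measure (iid M) ?A \<le> exp t * c ^ Suc k" for k
      using c0 by (simp add: S.emeasure_eq_measure)
    have "(\<lambda>k. exp t * c ^ Suc k) \<longlonglongrightarrow> exp t * 0"
      by (intro tendsto_mult tendsto_const filterlim_compose[OF LIMSEQ_power_zero filterlim_Suc]) (use c0 c1 in auto)
    then have "(\<lambda>k. exp t * c ^ Suc k) \<longlonglongrightarrow> 0" by simp
    then have "measure (iid M) ?A \<le> 0" by (rule LIMSEQ_le_const) (use le in blast)
    then have "emeasure (iid M) ?A = 0" by (simp add: S.emeasure_eq_measure measure_le_0_iff)
    then show ?thesis by (intro AE_I[of _ _ ?A]) (auto simp: not_less)
  qed
  then have "AE \<omega> in iid M. \<forall>t::nat. \<exists>k. real t < (\<Sum>i\<le>k. \<omega> i)" by (simp add: AE_all_countable)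
  moreover have "AE \<omega> in iid M. \<forall>k. 0 < \<omega> k"
    unfolding AE_all_countable by (intro allI AE_PiM_component assms pos) auto
  ultimately show ?thesis
  proof eventually_elim
    case (elim \<omega>)
    have "\<exists>k. t < (\<Sum>i\<le>k. \<omega> i)" for t :: real
      using elim(1) by (metis linorder_not_less order_trans real_arch_simple not_le_imp_less)
    then show ?case using elim by (auto simp: regular_def)
  qed
qed

abbreviation expo :: "real \<Rightarrow> real measure" where
  "expo l \<equiv> density lborel (\<lambda>x. ennreal (exponential_density l x))"

lemma prob_space_expo: "0 < l \<Longrightarrow> prob_space (expo l)"
  by (rule prob_space_exponential_density)

lemma AE_expo_pos: "AE x in expo l. 0 < x"
proof -
  have "AE x in lborel. x \<noteq> (0::real)" by (rule AE_lborel_singleton)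
  then show ?thesis
    by (subst AE_density) (auto elim!: eventually_mono simp: exponential_density_def)
qed

lemma nn_integral_expo_memoryless:
  assumes [measurable]: "g \<in> borel_measurable borel" and "0 \<le> x"
  shows "(\<integral>\<^sup>+y. indicator {x<..} y * g (y - x) \<partial>expo l) = ennreal (exp (- l * x)) * (\<integral>\<^sup>+y. g y \<partial>expo l)"
proof -
  have "(\<integral>\<^sup>+y. indicator {x<..} y * g (y - x) \<partial>expo l) =
    (\<integral>\<^sup>+y. ennreal (exponential_density l y) * (indicator {x<..} y * g (y - x)) \<partial>lborel)"
    by (subst nn_integral_density) auto
  also have "\<dots> = (\<integral>\<^sup>+z. ennreal (exponential_density l (x + z)) * (indicator {x<..} (x + z) * g z) \<partial>lborel)"
    by (subst nn_integral_real_affine[where t=x and c=1]) auto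
  also have "\<dots> = (\<integral>\<^sup>+z. ennreal (exp (- l * x)) * (ennreal (exponential_density l z) * g z) \<partial>lborel)"
  proof (intro nn_integral_cong_AE)
    \<comment> \<open>The point z = 0 has to be left out: the strict indicator vanishes there, while
      the exponential density does not.\<close>
    have "AE z in lborel. z \<noteq> (0::real)" by (rule AE_lborel_singleton)
    then show "AE z in lborel. ennreal (exponential_density l (x + z)) * (indicator {x<..} (x + z) * g z) =
      ennreal (exp (- l * x)) * (ennreal (exponential_density l z) * g z)"
    proof eventually_elim
      case (elim z)
      have "exponential_density l (x + z) = exp (- l * x) * exponential_density l z" if "0 < z"
        using that \<open>0 \<le> x\<close> by (auto simp: exponential_density_def exp_add[symmetric] algebra_simps)
      then have "0 < z \<Longrightarrow> ennreal (exponential_density l (x + z)) = ennreal (exp (- l * x)) * ennreal (exponential_density l z)"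
        by (simp add: ennreal_mult')
      then show ?case using elim \<open>0 \<le> x\<close>
        by (cases "0 < z") (auto simp: indicator_def mult.assoc exponential_density_def)
    qed
  qed
  also have "\<dots> = ennreal (exp (- l * x)) * (\<integral>\<^sup>+y. g y \<partial>expo l)"
    by (subst nn_integral_cmult) (auto simp: nn_integral_density)
  finally show ?thesis .
qed

lemma elapse_case_nat: "elapse x (case_nat y \<omega>) = case_nat (y - x) \<omega>"
  by (auto simp: elapse_def fun_eq_iff split: nat.split)

lemma measurable_elapse[measurable]:
  assumes [measurable_cong]: "sets M = sets borel"
  shows "(\<lambda>\<omega>. elapse x \<omega>) \<in> measurable (iid M) (iid M)"
proof (rule measurable_PiM_single')
  fix i :: nat
  show "(\<lambda>\<omega>. elapse x \<omega> i) \<in> measurable (iid M) M"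
    by (cases i) (auto simp: elapse_def)
qed (use assms in \<open>auto simp: space_PiM dest: sets_eq_imp_space_eq\<close>)

lemma measurable_iid_intro:
  assumes "\<And>i. (\<lambda>\<omega>. f \<omega> i) \<in> borel_measurable M'" "sets M = sets borel"
  shows "f \<in> measurable M' (iid M)"
proof (rule measurable_PiM_single')
  show "(\<lambda>\<omega>. f \<omega> i) \<in> measurable M' M" for i using assms measurable_cong_sets by blast
qed (use assms sets_eq_imp_space_eq[OF assms(2)] in auto)

lemma nn_integral_iid_memoryless:
  assumes l: "0 < l" and F[measurable]: "F \<in> borel_measurable (iid (expo l))" and x: "0 \<le> x"
  shows "(\<integral>\<^sup>+\<omega>. indicator {x<..} (\<omega> 0) * F (elapse x \<omega>) \<partial>iid (expo l)) =
     ennreal (exp (- l * x)) * (\<integral>\<^sup>+\<omega>. F \<omega> \<partial>iid (expo l))"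
proof -
  interpret M: prob_space "expo l" using l by (rule prob_space_expo)
  interpret S: prob_space "iid (expo l)" by (rule prob_space_iid) unfold_locales
  have [measurable]: "(\<lambda>y. \<integral>\<^sup>+\<omega>. F (case_nat y \<omega>) \<partial>iid (expo l)) \<in> borel_measurable borel"
  proof -
    have "(\<lambda>y. \<integral>\<^sup>+\<omega>. F (case_nat y \<omega>) \<partial>iid (expo l)) \<in> borel_measurable (expo l)"
      by measurable
    then show ?thesis by simp
  qed
  have "(\<integral>\<^sup>+\<omega>. indicator {x<..} (\<omega> 0) * F (elapse x \<omega>) \<partial>iid (expo l)) =
    (\<integral>\<^sup>+y. \<integral>\<^sup>+\<omega>. indicator {x<..} y * F (case_nat (y - x) \<omega>) \<partial>iid (expo l) \<partial>expo l)"
    by (subst nn_integral_iid_step) (auto intro: M.prob_space_axioms simp: elapse_case_nat)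
  also have "\<dots> = (\<integral>\<^sup>+y. indicator {x<..} y * (\<integral>\<^sup>+\<omega>. F (case_nat (y - x) \<omega>) \<partial>iid (expo l)) \<partial>expo l)"
    by (intro nn_integral_cong nn_integral_cmult) simp
  also have "\<dots> = ennreal (exp (- l * x)) * (\<integral>\<^sup>+y. \<integral>\<^sup>+\<omega>. F (case_nat y \<omega>) \<partial>iid (expo l) \<partial>expo l)"
    by (rule nn_integral_expo_memoryless) (auto simp: x)
  also have "(\<integral>\<^sup>+y. \<integral>\<^sup>+\<omega>. F (case_nat y \<omega>) \<partial>iid (expo l) \<partial>expo l) = (\<integral>\<^sup>+\<omega>. F \<omega> \<partial>iid (expo l))"
    by (subst nn_integral_iid_step[symmetric]) (auto intro: M.prob_space_axioms)
  finally show ?thesis .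
qed

section \<open>Three independent clock sequences and the race between them\<close>

abbreviation clocks :: "real \<Rightarrow> real \<Rightarrow> real \<Rightarrow> ((nat \<Rightarrow> real) \<times> (nat \<Rightarrow> real) \<times> (nat \<Rightarrow> real)) measure" where
  "clocks l1 l2 l3 \<equiv> iid (expo l1) \<Otimes>\<^sub>M iid (expo l2) \<Otimes>\<^sub>M iid (expo l3)"

lemma prob_space_pair:
  assumes "prob_space M" "prob_space N" shows "prob_space (M \<Otimes>\<^sub>M N)"
proof -
  interpret M: prob_space M by fact
  interpret N: prob_space N by fact
  interpret pair_prob_space M N ..
  show ?thesis by unfold_locales
qed

lemma prob_space_iid_expo: "0 < l \<Longrightarrow> prob_space (iid (expo l))"
  by (intro prob_space_iid prob_space_expo)

lemma prob_space_clocks: "0 < l1 \<Longrightarrow> 0 < l2 \<Longrightarrow> 0 < l3 \<Longrightarrow> prob_space (clocks l1 l2 l3)"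
  by (intro prob_space_pair prob_space_iid_expo)

lemma nn_integral_clocks:
  assumes "0 < l1" "0 < l2" "0 < l3" and [measurable]: "f \<in> borel_measurable (clocks l1 l2 l3)"
  shows "(\<integral>\<^sup>+w. f w \<partial>clocks l1 l2 l3) =
    (\<integral>\<^sup>+X. \<integral>\<^sup>+Y. \<integral>\<^sup>+Z. f (X, Y, Z) \<partial>iid (expo l3) \<partial>iid (expo l2) \<partial>iid (expo l1))"
proof -
  interpret B: prob_space "iid (expo l2)" using assms by (intro prob_space_iid_expo)
  interpret C: prob_space "iid (expo l3)" using assms by (intro prob_space_iid_expo)
  interpret BC: prob_space "iid (expo l2) \<Otimes>\<^sub>M iid (expo l3)" using assms by (intro prob_space_iid_expo prob_space_pair)
  have "(\<integral>\<^sup>+w. f w \<partial>clocks l1 l2 l3) = (\<integral>\<^sup>+X. \<integral>\<^sup>+w. f (X, w) \<partial>(iid (expo l2) \<Otimes>\<^sub>M iid (expo l3)) \<partial>iid (expo l1))"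
    by (subst BC.nn_integral_fst[symmetric]) auto
  also have "\<dots> = (\<integral>\<^sup>+X. \<integral>\<^sup>+Y. \<integral>\<^sup>+Z. f (X, Y, Z) \<partial>iid (expo l3) \<partial>iid (expo l2) \<partial>iid (expo l1))"
    by (intro nn_integral_cong, subst C.nn_integral_fst[symmetric]) auto
  finally show ?thesis .
qed

text \<open>The race is analysed with the winner in first position. This and the following
  permutations bring each of the three clocks there.\<close>

lemma nn_integral_clocks_swap12:
  assumes "0 < l1" "0 < l2" "0 < l3" and [measurable]: "f \<in> borel_measurable (clocks l1 l2 l3)"
  shows "(\<integral>\<^sup>+w. f w \<partial>clocks l1 l2 l3) = (\<integral>\<^sup>+w. f (fst (snd w), fst w, snd (snd w)) \<partial>clocks l2 l1 l3)"
proof -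
  interpret A: prob_space "iid (expo l1)" using assms by (intro prob_space_iid_expo)
  interpret B: prob_space "iid (expo l2)" using assms by (intro prob_space_iid_expo)
  interpret C: prob_space "iid (expo l3)" using assms by (intro prob_space_iid_expo)
  interpret AB: pair_sigma_finite "iid (expo l1)" "iid (expo l2)" ..
  show ?thesis
    using AB.Fubini[of "\<lambda>(X, Y). \<integral>\<^sup>+Z. f (X, Y, Z) \<partial>iid (expo l3)"]
    by (simp add: nn_integral_clocks assms)
qed

lemma nn_integral_clocks_swap23:
  assumes "0 < l1" "0 < l2" "0 < l3" and [measurable]: "f \<in> borel_measurable (clocks l1 l2 l3)"
  shows "(\<integral>\<^sup>+w. f w \<partial>clocks l1 l2 l3) = (\<integral>\<^sup>+w. f (fst w, snd (snd w), fst (snd w)) \<partial>clocks l1 l3 l2)"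
proof -
  interpret B: prob_space "iid (expo l2)" using assms by (intro prob_space_iid_expo)
  interpret C: prob_space "iid (expo l3)" using assms by (intro prob_space_iid_expo)
  interpret BC: pair_sigma_finite "iid (expo l2)" "iid (expo l3)" ..
  have "(\<integral>\<^sup>+Y. \<integral>\<^sup>+Z. f (X, Y, Z) \<partial>iid (expo l3) \<partial>iid (expo l2)) = (\<integral>\<^sup>+Z. \<integral>\<^sup>+Y. f (X, Y, Z) \<partial>iid (expo l2) \<partial>iid (expo l3))"
    if [measurable]: "X \<in> space (iid (expo l1))" for X
    using BC.Fubini[of "\<lambda>(Y, Z). f (X, Y, Z)"] by simp
  then show ?thesis by (simp add: nn_integral_clocks assms cong: nn_integral_cong)
qed

lemma nn_integral_clocks_perm312:
  assumes "0 < l1" "0 < l2" "0 < l3" and [measurable]: "f \<in> borel_measurable (clocks l1 l2 l3)"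
  shows "(\<integral>\<^sup>+w. f w \<partial>clocks l1 l2 l3) = (\<integral>\<^sup>+w. f (fst (snd w), snd (snd w), fst w) \<partial>clocks l3 l1 l2)"
  by (subst nn_integral_clocks_swap23[OF assms], subst nn_integral_clocks_swap12) (auto simp: assms)

lemma nn_integral_clocks_perm231:
  assumes "0 < l1" "0 < l2" "0 < l3" and [measurable]: "f \<in> borel_measurable (clocks l1 l2 l3)"
  shows "(\<integral>\<^sup>+w. f w \<partial>clocks l1 l2 l3) = (\<integral>\<^sup>+w. f (snd (snd w), fst w, fst (snd w)) \<partial>clocks l2 l3 l1)"
  by (subst nn_integral_clocks_swap12[OF assms], subst nn_integral_clocks_swap23) (auto simp: assms)

lemma nn_integral_clocks_perm321:
  assumes "0 < l1" "0 < l2" "0 < l3" and [measurable]: "f \<in> borel_measurable (clocks l1 l2 l3)"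
  shows "(\<integral>\<^sup>+w. f w \<partial>clocks l1 l2 l3) = (\<integral>\<^sup>+w. f (snd (snd w), fst (snd w), fst w) \<partial>clocks l3 l2 l1)"
  by (subst nn_integral_clocks_perm231[OF assms], subst nn_integral_clocks_swap12) (auto simp: assms)

lemma measurable_elapse2[measurable]:
  "(\<lambda>w. elapse (fst w) (snd w)) \<in> measurable (borel \<Otimes>\<^sub>M iid (expo l)) (iid (expo l))"
proof (rule measurable_iid_intro)
  show "(\<lambda>w. elapse (fst w) (snd w) i) \<in> borel_measurable (borel \<Otimes>\<^sub>M iid (expo l))" for i
    by (cases i) (auto simp: elapse_def)
qed simp

lemma measurable_elapse3[measurable (raw)]:
  assumes [measurable]: "f \<in> borel_measurable M" "g \<in> measurable M (iid (expo l))"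
  shows "(\<lambda>w. elapse (f w) (g w)) \<in> measurable M (iid (expo l))"
  by (rule measurable_compose[OF _ measurable_elapse2[of l], of "\<lambda>w. (f w, g w)", simplified]) measurable

lemma measurable_tail[measurable]: "(\<lambda>\<omega> k. \<omega> (Suc k)) \<in> measurable (iid (expo l)) (iid (expo l))"
  by (rule measurable_iid_intro) auto

lemma measurable_iid_component:
  assumes "f \<in> measurable M (iid (expo l))"
  shows "(\<lambda>w. f w k) \<in> borel_measurable M"
proof -
  have "(\<lambda>\<omega>. \<omega> k) \<in> borel_measurable (iid (expo l))" by simp
  from measurable_compose[OF assms this] show ?thesis by simp
qed

lemma space_iid_expo [simp]: "space (iid (expo l)) = UNIV"
  by (auto simp: space_PiM)

lemma AE_clocks_regular:
  assumes "0 < l1" "0 < l2" "0 < l3"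
  shows "AE w in clocks l1 l2 l3. regular (fst w) \<and> regular (fst (snd w)) \<and> regular (snd (snd w))"
proof -
  interpret A: prob_space "iid (expo l1)" using assms by (intro prob_space_iid_expo)
  interpret B: prob_space "iid (expo l2)" using assms by (intro prob_space_iid_expo)
  interpret C: prob_space "iid (expo l3)" using assms by (intro prob_space_iid_expo)
  interpret BC: prob_space "iid (expo l2) \<Otimes>\<^sub>M iid (expo l3)" using assms by (intro prob_space_iid_expo prob_space_pair)
  interpret BC': pair_prob_space "iid (expo l2)" "iid (expo l3)" ..
  interpret ABC: pair_prob_space "iid (expo l1)" "iid (expo l2) \<Otimes>\<^sub>M iid (expo l3)" ..
  have r: "AE \<omega> in iid (expo l). regular \<omega>" if "0 < l" for l
    by (intro AE_iid_regular AE_expo_pos prob_space_expo that) auto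
  have [measurable]: "Measurable.pred (iid (expo l)) regular" for l
  proof -
    have *: "regular E \<longleftrightarrow> (\<forall>k. 0 < E k) \<and> (\<forall>t::nat. \<exists>k. real t < (\<Sum>i\<le>k. E i))" for E
      unfolding regular_def by (metis linorder_not_less order_trans real_arch_simple not_le_imp_less)
    show ?thesis unfolding * by measurable
  qed
  have 1: "AE w in clocks l1 l2 l3. regular (fst w)"
    by (subst ABC.AE_pair_iff[symmetric]) (use r assms in auto)
  have "AE w in iid (expo l2) \<Otimes>\<^sub>M iid (expo l3). regular (fst w)"
    by (subst BC'.AE_pair_iff[symmetric]) (use r assms in auto)
  moreover have "AE w in iid (expo l2) \<Otimes>\<^sub>M iid (expo l3). regular (snd w)"
    by (subst BC'.AE_pair_iff[symmetric]) (use r assms in auto)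
  ultimately have "AE w in iid (expo l2) \<Otimes>\<^sub>M iid (expo l3). regular (fst w) \<and> regular (snd w)"
    by eventually_elim auto
  then have 2: "AE w in clocks l1 l2 l3. regular (fst (snd w)) \<and> regular (snd (snd w))"
    by (subst ABC.AE_pair_iff[symmetric]) auto
  from 1 2 show ?thesis by eventually_elim auto
qed

lemma race_first:
  assumes l: "0 < l1" "0 < l2" "0 < l3" and K[measurable]: "K \<in> borel_measurable (borel \<Otimes>\<^sub>M clocks l1 l2 l3)"
  shows "(\<integral>\<^sup>+(X, Y, Z). of_bool (X 0 < Y 0 \<and> X 0 < Z 0 \<and> X 0 < L) *
      K (X 0, \<lambda>k. X (Suc k), elapse (X 0) Y, elapse (X 0) Z) \<partial>clocks l1 l2 l3) =
    (\<integral>\<^sup>+x. indicator {0<..<L} x * ennreal (l1 * exp (- (l1 + l2 + l3) * x)) *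
      (\<integral>\<^sup>+w. K (x, w) \<partial>clocks l1 l2 l3) \<partial>lborel)"
proof -
  interpret A0: prob_space "expo l1" using l by (intro prob_space_expo)
  interpret A: prob_space "iid (expo l1)" using assms by (intro prob_space_iid_expo)
  interpret B: prob_space "iid (expo l2)" using assms by (intro prob_space_iid_expo)
  interpret C: prob_space "iid (expo l3)" using assms by (intro prob_space_iid_expo)
  interpret ABC: prob_space "clocks l1 l2 l3" using assms by (intro prob_space_clocks)
  have inner: "(\<integral>\<^sup>+X. \<integral>\<^sup>+Y. \<integral>\<^sup>+Z. of_bool (x < Y 0 \<and> x < Z 0 \<and> x < L) *
      K (x, X, elapse x Y, elapse x Z) \<partial>iid (expo l3) \<partial>iid (expo l2) \<partial>iid (expo l1)) =
     of_bool (x < L) * ennreal (exp (- (l2 + l3) * x)) * (\<integral>\<^sup>+w. K (x, w) \<partial>clocks l1 l2 l3)"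
    if "0 < x" for x
  proof -
    have "(\<integral>\<^sup>+X. \<integral>\<^sup>+Y. \<integral>\<^sup>+Z. of_bool (x < Y 0 \<and> x < Z 0 \<and> x < L) *
      K (x, X, elapse x Y, elapse x Z) \<partial>iid (expo l3) \<partial>iid (expo l2) \<partial>iid (expo l1)) =
      (\<integral>\<^sup>+X. \<integral>\<^sup>+Y. \<integral>\<^sup>+Z. of_bool (x < L) * indicator {x<..} (Y 0) * (indicator {x<..} (Z 0) *
      K (x, X, elapse x Y, elapse x Z)) \<partial>iid (expo l3) \<partial>iid (expo l2) \<partial>iid (expo l1))"
      by (intro nn_integral_cong) (auto simp: indicator_def)
    also have "\<dots> = (\<integral>\<^sup>+X. \<integral>\<^sup>+Y. of_bool (x < L) * indicator {x<..} (Y 0) * (ennreal (exp (- l3 * x)) *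
      (\<integral>\<^sup>+Z. K (x, X, elapse x Y, Z) \<partial>iid (expo l3))) \<partial>iid (expo l2) \<partial>iid (expo l1))"
    proof (intro nn_integral_cong, goal_cases)
      case (1 X Y)
      have "(\<integral>\<^sup>+Z. indicator {x<..} (Z 0) * K (x, X, elapse x Y, elapse x Z) \<partial>iid (expo l3)) =
          ennreal (exp (- l3 * x)) * (\<integral>\<^sup>+Z. K (x, X, elapse x Y, Z) \<partial>iid (expo l3))"
        by (rule nn_integral_iid_memoryless[where F="\<lambda>Z. K (x, X, elapse x Y, Z)"]) (use \<open>0 < x\<close> l in auto)
      then show ?case by (subst nn_integral_cmult) (auto)
    qed
    also have "\<dots> = (\<integral>\<^sup>+X. of_bool (x < L) * ennreal (exp (- l3 * x)) * (\<integral>\<^sup>+Y. indicator {x<..} (Y 0) * 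
      (\<integral>\<^sup>+Z. K (x, X, elapse x Y, Z) \<partial>iid (expo l3)) \<partial>iid (expo l2)) \<partial>iid (expo l1))"
      by (intro nn_integral_cong, subst nn_integral_cmult[symmetric]) (auto simp: ac_simps)
    also have "\<dots> = (\<integral>\<^sup>+X. of_bool (x < L) * ennreal (exp (- l3 * x)) * (ennreal (exp (- l2 * x)) * (\<integral>\<^sup>+Y. 
      (\<integral>\<^sup>+Z. K (x, X, Y, Z) \<partial>iid (expo l3)) \<partial>iid (expo l2))) \<partial>iid (expo l1))"
    proof (intro nn_integral_cong, goal_cases)
      case (1 X)
      have "(\<integral>\<^sup>+Y. indicator {x<..} (Y 0) * (\<integral>\<^sup>+Z. K (x, X, elapse x Y, Z) \<partial>iid (expo l3)) \<partial>iid (expo l2)) =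
          ennreal (exp (- l2 * x)) * (\<integral>\<^sup>+Y. \<integral>\<^sup>+Z. K (x, X, Y, Z) \<partial>iid (expo l3) \<partial>iid (expo l2))"
        by (rule nn_integral_iid_memoryless[where F="\<lambda>Y. \<integral>\<^sup>+Z. K (x, X, Y, Z) \<partial>iid (expo l3)"]) (use \<open>0 < x\<close> l in auto)
      then show ?case by simp
    qed
    also have "\<dots> = of_bool (x < L) * (ennreal (exp (- l3 * x)) * ennreal (exp (- l2 * x))) * (\<integral>\<^sup>+w. K (x, w) \<partial>clocks l1 l2 l3)"
      by (simp add: nn_integral_clocks l nn_integral_cmult ac_simps)
    also have "ennreal (exp (- l3 * x)) * ennreal (exp (- l2 * x)) = ennreal (exp (- (l2 + l3) * x))"
      by (simp add: ennreal_mult'[symmetric] exp_add[symmetric] algebra_simps)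
    finally show ?thesis .
  qed
  have "(\<integral>\<^sup>+(X, Y, Z). of_bool (X 0 < Y 0 \<and> X 0 < Z 0 \<and> X 0 < L) *
      K (X 0, \<lambda>k. X (Suc k), elapse (X 0) Y, elapse (X 0) Z) \<partial>clocks l1 l2 l3) =
    (\<integral>\<^sup>+X. \<integral>\<^sup>+Y. \<integral>\<^sup>+Z. of_bool (X 0 < Y 0 \<and> X 0 < Z 0 \<and> X 0 < L) *
      K (X 0, \<lambda>k. X (Suc k), elapse (X 0) Y, elapse (X 0) Z) \<partial>iid (expo l3) \<partial>iid (expo l2) \<partial>iid (expo l1))"
    by (subst nn_integral_clocks) (auto simp: l case_prod_beta')
  also have "\<dots> = (\<integral>\<^sup>+x. \<integral>\<^sup>+X. \<integral>\<^sup>+Y. \<integral>\<^sup>+Z. of_bool (x < Y 0 \<and> x < Z 0 \<and> x < L) *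
      K (x, X, elapse x Y, elapse x Z) \<partial>iid (expo l3) \<partial>iid (expo l2) \<partial>iid (expo l1) \<partial>expo l1)"
    by (subst nn_integral_iid_step) (auto intro: A0.prob_space_axioms)
  also have "\<dots> = (\<integral>\<^sup>+x. of_bool (x < L) * ennreal (exp (- (l2 + l3) * x)) * (\<integral>\<^sup>+w. K (x, w) \<partial>clocks l1 l2 l3) \<partial>expo l1)"
    by (intro nn_integral_cong_AE eventually_mono[OF AE_expo_pos inner])
  also have "\<dots> = (\<integral>\<^sup>+x. ennreal (exponential_density l1 x) * (of_bool (x < L) * ennreal (exp (- (l2 + l3) * x)) *
      (\<integral>\<^sup>+w. K (x, w) \<partial>clocks l1 l2 l3)) \<partial>lborel)"
    by (subst nn_integral_density) auto
  also have "\<dots> = (\<integral>\<^sup>+x. indicator {0<..<L} x * ennreal (l1 * exp (- (l1 + l2 + l3) * x)) *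
      (\<integral>\<^sup>+w. K (x, w) \<partial>clocks l1 l2 l3) \<partial>lborel)"
  proof (intro nn_integral_cong_AE)
    have "AE z in lborel. z \<noteq> (0::real)" by (rule AE_lborel_singleton)
    then show "AE x in lborel. ennreal (exponential_density l1 x) * (of_bool (x < L) * ennreal (exp (- (l2 + l3) * x)) *
      (\<integral>\<^sup>+w. K (x, w) \<partial>clocks l1 l2 l3)) = indicator {0<..<L} x * ennreal (l1 * exp (- (l1 + l2 + l3) * x)) *
      (\<integral>\<^sup>+w. K (x, w) \<partial>clocks l1 l2 l3)"
    proof eventually_elim
      case (elim x)
      have "ennreal (l1 * exp (- (l1 + l2 + l3) * x)) = ennreal (l1 * exp (- x * l1)) * ennreal (exp (- (l2 + l3) * x))"
        using l by (simp add: ennreal_mult'[symmetric] mult.assoc exp_add[symmetric] algebra_simps)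
      then show ?case using elim by (auto simp: exponential_density_def indicator_def mult.assoc)
    qed
  qed
  finally show ?thesis .
qed

text \<open>Here the third sequence belongs to a frozen clock: it does not compete, does not age,
  and its rate does not enter the exponent.\<close>

lemma race_first_idle:
  assumes l: "0 < l1" "0 < l2" "0 < l3" and K[measurable]: "K \<in> borel_measurable (borel \<Otimes>\<^sub>M clocks l1 l2 l3)"
  shows "(\<integral>\<^sup>+(X, Y, Z). of_bool (X 0 < Y 0 \<and> X 0 < L) * K (X 0, \<lambda>k. X (Suc k), elapse (X 0) Y, Z) \<partial>clocks l1 l2 l3) =
    (\<integral>\<^sup>+x. indicator {0<..<L} x * ennreal (l1 * exp (- (l1 + l2) * x)) *
      (\<integral>\<^sup>+w. K (x, w) \<partial>clocks l1 l2 l3) \<partial>lborel)"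
proof -
  interpret A0: prob_space "expo l1" using l by (intro prob_space_expo)
  interpret A: prob_space "iid (expo l1)" using assms by (intro prob_space_iid_expo)
  interpret B: prob_space "iid (expo l2)" using assms by (intro prob_space_iid_expo)
  interpret C: prob_space "iid (expo l3)" using assms by (intro prob_space_iid_expo)
  interpret ABC: prob_space "clocks l1 l2 l3" using assms by (intro prob_space_clocks)
  have inner: "(\<integral>\<^sup>+X. \<integral>\<^sup>+Y. \<integral>\<^sup>+Z. of_bool (x < Y 0 \<and> x < L) *
      K (x, X, elapse x Y, Z) \<partial>iid (expo l3) \<partial>iid (expo l2) \<partial>iid (expo l1)) =
     of_bool (x < L) * ennreal (exp (- l2 * x)) * (\<integral>\<^sup>+w. K (x, w) \<partial>clocks l1 l2 l3)"
    if "0 < x" for x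
  proof -
    have "(\<integral>\<^sup>+X. \<integral>\<^sup>+Y. \<integral>\<^sup>+Z. of_bool (x < Y 0 \<and> x < L) *
      K (x, X, elapse x Y, Z) \<partial>iid (expo l3) \<partial>iid (expo l2) \<partial>iid (expo l1)) =
      (\<integral>\<^sup>+X. \<integral>\<^sup>+Y. \<integral>\<^sup>+Z. of_bool (x < L) * (indicator {x<..} (Y 0) * 
      K (x, X, elapse x Y, Z)) \<partial>iid (expo l3) \<partial>iid (expo l2) \<partial>iid (expo l1))"
      by (intro nn_integral_cong) (auto simp: indicator_def)
    also have "\<dots> = (\<integral>\<^sup>+X. of_bool (x < L) * (\<integral>\<^sup>+Y. indicator {x<..} (Y 0) * 
      (\<integral>\<^sup>+Z. K (x, X, elapse x Y, Z) \<partial>iid (expo l3)) \<partial>iid (expo l2)) \<partial>iid (expo l1))"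
      by (simp add: nn_integral_cmult)
    also have "\<dots> = (\<integral>\<^sup>+X. of_bool (x < L) * (ennreal (exp (- l2 * x)) * (\<integral>\<^sup>+Y. 
      (\<integral>\<^sup>+Z. K (x, X, Y, Z) \<partial>iid (expo l3)) \<partial>iid (expo l2))) \<partial>iid (expo l1))"
    proof (intro nn_integral_cong, goal_cases)
      case (1 X)
      have "(\<integral>\<^sup>+Y. indicator {x<..} (Y 0) * (\<integral>\<^sup>+Z. K (x, X, elapse x Y, Z) \<partial>iid (expo l3)) \<partial>iid (expo l2)) =
          ennreal (exp (- l2 * x)) * (\<integral>\<^sup>+Y. \<integral>\<^sup>+Z. K (x, X, Y, Z) \<partial>iid (expo l3) \<partial>iid (expo l2))"
        by (rule nn_integral_iid_memoryless[where F="\<lambda>Y. \<integral>\<^sup>+Z. K (x, X, Y, Z) \<partial>iid (expo l3)"]) (use \<open>0 < x\<close> l in auto)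
      then show ?case by simp
    qed
    also have "\<dots> = of_bool (x < L) * ennreal (exp (- l2 * x)) * (\<integral>\<^sup>+w. K (x, w) \<partial>clocks l1 l2 l3)"
      by (simp add: nn_integral_clocks l nn_integral_cmult ac_simps)
    finally show ?thesis .
  qed
  have "(\<integral>\<^sup>+(X, Y, Z). of_bool (X 0 < Y 0 \<and> X 0 < L) *
      K (X 0, \<lambda>k. X (Suc k), elapse (X 0) Y, Z) \<partial>clocks l1 l2 l3) =
    (\<integral>\<^sup>+X. \<integral>\<^sup>+Y. \<integral>\<^sup>+Z. of_bool (X 0 < Y 0 \<and> X 0 < L) *
      K (X 0, \<lambda>k. X (Suc k), elapse (X 0) Y, Z) \<partial>iid (expo l3) \<partial>iid (expo l2) \<partial>iid (expo l1))"
    by (subst nn_integral_clocks) (auto simp: l case_prod_beta')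
  also have "\<dots> = (\<integral>\<^sup>+x. \<integral>\<^sup>+X. \<integral>\<^sup>+Y. \<integral>\<^sup>+Z. of_bool (x < Y 0 \<and> x < L) *
      K (x, X, elapse x Y, Z) \<partial>iid (expo l3) \<partial>iid (expo l2) \<partial>iid (expo l1) \<partial>expo l1)"
    by (subst nn_integral_iid_step) (auto intro: A0.prob_space_axioms)
  also have "\<dots> = (\<integral>\<^sup>+x. of_bool (x < L) * ennreal (exp (- l2 * x)) * (\<integral>\<^sup>+w. K (x, w) \<partial>clocks l1 l2 l3) \<partial>expo l1)"
    by (intro nn_integral_cong_AE eventually_mono[OF AE_expo_pos inner])
  also have "\<dots> = (\<integral>\<^sup>+x. ennreal (exponential_density l1 x) * (of_bool (x < L) * ennreal (exp (- l2 * x)) *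
      (\<integral>\<^sup>+w. K (x, w) \<partial>clocks l1 l2 l3)) \<partial>lborel)"
    by (subst nn_integral_density) auto
  also have "\<dots> = (\<integral>\<^sup>+x. indicator {0<..<L} x * ennreal (l1 * exp (- (l1 + l2) * x)) *
      (\<integral>\<^sup>+w. K (x, w) \<partial>clocks l1 l2 l3) \<partial>lborel)"
  proof (intro nn_integral_cong_AE)
    have "AE z in lborel. z \<noteq> (0::real)" by (rule AE_lborel_singleton)
    then show "AE x in lborel. ennreal (exponential_density l1 x) * (of_bool (x < L) * ennreal (exp (- l2 * x)) *
      (\<integral>\<^sup>+w. K (x, w) \<partial>clocks l1 l2 l3)) = indicator {0<..<L} x * ennreal (l1 * exp (- (l1 + l2) * x)) *
      (\<integral>\<^sup>+w. K (x, w) \<partial>clocks l1 l2 l3)"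
    proof eventually_elim
      case (elim x)
      have "ennreal (l1 * exp (- (l1 + l2) * x)) = ennreal (l1 * exp (- x * l1)) * ennreal (exp (- l2 * x))"
        using l by (simp add: ennreal_mult'[symmetric] mult.assoc exp_add[symmetric] algebra_simps)
      then show ?case using elim by (auto simp: exponential_density_def indicator_def mult.assoc)
    qed
  qed
  finally show ?thesis .
qed

lemma race_none:
  assumes l: "0 < l1" "0 < l2" "0 < l3" and K[measurable]: "K \<in> borel_measurable (clocks l1 l2 l3)" and x: "0 \<le> x"
  shows "(\<integral>\<^sup>+(X, Y, Z). of_bool (x < X 0 \<and> x < Y 0 \<and> x < Z 0) * K (elapse x X, elapse x Y, elapse x Z) \<partial>clocks l1 l2 l3) =
    ennreal (exp (- (l1 + l2 + l3) * x)) * (\<integral>\<^sup>+w. K w \<partial>clocks l1 l2 l3)"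
proof -
  interpret A: prob_space "iid (expo l1)" using assms by (intro prob_space_iid_expo)
  interpret B: prob_space "iid (expo l2)" using assms by (intro prob_space_iid_expo)
  interpret C: prob_space "iid (expo l3)" using assms by (intro prob_space_iid_expo)
  have 3: "(\<integral>\<^sup>+Z. indicator {x<..} (Z 0) * K (X, Y, elapse x Z) \<partial>iid (expo l3)) =
      ennreal (exp (- l3 * x)) * (\<integral>\<^sup>+Z. K (X, Y, Z) \<partial>iid (expo l3))" for X Y
    by (rule nn_integral_iid_memoryless[where F="\<lambda>Z. K (X, Y, Z)"]) (use x l in auto)
  have 2: "(\<integral>\<^sup>+Y. indicator {x<..} (Y 0) * (\<integral>\<^sup>+Z. K (X, elapse x Y, Z) \<partial>iid (expo l3)) \<partial>iid (expo l2)) =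
      ennreal (exp (- l2 * x)) * (\<integral>\<^sup>+Y. \<integral>\<^sup>+Z. K (X, Y, Z) \<partial>iid (expo l3) \<partial>iid (expo l2))" for X
    by (rule nn_integral_iid_memoryless[where F="\<lambda>Y. \<integral>\<^sup>+Z. K (X, Y, Z) \<partial>iid (expo l3)"]) (use x l in auto)
  have 1: "(\<integral>\<^sup>+X. indicator {x<..} (X 0) * (\<integral>\<^sup>+Y. \<integral>\<^sup>+Z. K (elapse x X, Y, Z) \<partial>iid (expo l3) \<partial>iid (expo l2)) \<partial>iid (expo l1)) =
      ennreal (exp (- l1 * x)) * (\<integral>\<^sup>+X. \<integral>\<^sup>+Y. \<integral>\<^sup>+Z. K (X, Y, Z) \<partial>iid (expo l3) \<partial>iid (expo l2) \<partial>iid (expo l1))"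
    by (rule nn_integral_iid_memoryless[where F="\<lambda>X. \<integral>\<^sup>+Y. \<integral>\<^sup>+Z. K (X, Y, Z) \<partial>iid (expo l3) \<partial>iid (expo l2)"]) (use x l in auto)
  have "(\<integral>\<^sup>+(X, Y, Z). of_bool (x < X 0 \<and> x < Y 0 \<and> x < Z 0) * K (elapse x X, elapse x Y, elapse x Z) \<partial>clocks l1 l2 l3) =
    (\<integral>\<^sup>+X. \<integral>\<^sup>+Y. \<integral>\<^sup>+Z. indicator {x<..} (X 0) * (indicator {x<..} (Y 0) * (indicator {x<..} (Z 0) * 
       K (elapse x X, elapse x Y, elapse x Z))) \<partial>iid (expo l3) \<partial>iid (expo l2) \<partial>iid (expo l1))"
    by (subst nn_integral_clocks) (auto simp: l case_prod_beta' indicator_def intro!: nn_integral_cong)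
  also have "\<dots> = (\<integral>\<^sup>+X. indicator {x<..} (X 0) * (\<integral>\<^sup>+Y. indicator {x<..} (Y 0) * (ennreal (exp (- l3 * x)) *
      (\<integral>\<^sup>+Z. K (elapse x X, elapse x Y, Z) \<partial>iid (expo l3))) \<partial>iid (expo l2)) \<partial>iid (expo l1))"
    by (simp add: nn_integral_cmult 3)
  also have "\<dots> = ennreal (exp (- l3 * x)) * (\<integral>\<^sup>+X. indicator {x<..} (X 0) * (\<integral>\<^sup>+Y. indicator {x<..} (Y 0) *
      (\<integral>\<^sup>+Z. K (elapse x X, elapse x Y, Z) \<partial>iid (expo l3)) \<partial>iid (expo l2)) \<partial>iid (expo l1))"
    by (simp add: nn_integral_cmult mult.left_commute[of _ "ennreal (exp (- (l3 * x)))"])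
  also have "\<dots> = ennreal (exp (- l3 * x)) * (ennreal (exp (- l2 * x)) * (\<integral>\<^sup>+X. indicator {x<..} (X 0) * (\<integral>\<^sup>+Y. 
      (\<integral>\<^sup>+Z. K (elapse x X, Y, Z) \<partial>iid (expo l3)) \<partial>iid (expo l2)) \<partial>iid (expo l1)))"
    unfolding 2 by (simp add: nn_integral_cmult mult.left_commute[of _ "ennreal (exp (- (l2 * x)))"])
  also have "\<dots> = (ennreal (exp (- l3 * x)) * ennreal (exp (- l2 * x)) * ennreal (exp (- l1 * x))) * (\<integral>\<^sup>+w. K w \<partial>clocks l1 l2 l3)"
    unfolding 1 by (simp add: nn_integral_clocks l ac_simps)
  also have "ennreal (exp (- l3 * x)) * ennreal (exp (- l2 * x)) * ennreal (exp (- l1 * x)) = ennreal (exp (- (l1 + l2 + l3) * x))"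
    by (simp add: ennreal_mult'[symmetric] exp_add[symmetric] algebra_simps)
  finally show ?thesis .
qed

lemma race_none_idle:
  assumes l: "0 < l1" "0 < l2" "0 < l3" and K[measurable]: "K \<in> borel_measurable (clocks l1 l2 l3)" and x: "0 \<le> x"
  shows "(\<integral>\<^sup>+(X, Y, Z). of_bool (x < X 0 \<and> x < Y 0) * K (elapse x X, elapse x Y, Z) \<partial>clocks l1 l2 l3) =
    ennreal (exp (- (l1 + l2) * x)) * (\<integral>\<^sup>+w. K w \<partial>clocks l1 l2 l3)"
proof -
  interpret A: prob_space "iid (expo l1)" using assms by (intro prob_space_iid_expo)
  interpret B: prob_space "iid (expo l2)" using assms by (intro prob_space_iid_expo)
  interpret C: prob_space "iid (expo l3)" using assms by (intro prob_space_iid_expo)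
  have 2: "(\<integral>\<^sup>+Y. indicator {x<..} (Y 0) * (\<integral>\<^sup>+Z. K (X, elapse x Y, Z) \<partial>iid (expo l3)) \<partial>iid (expo l2)) =
      ennreal (exp (- l2 * x)) * (\<integral>\<^sup>+Y. \<integral>\<^sup>+Z. K (X, Y, Z) \<partial>iid (expo l3) \<partial>iid (expo l2))" for X
    by (rule nn_integral_iid_memoryless[where F="\<lambda>Y. \<integral>\<^sup>+Z. K (X, Y, Z) \<partial>iid (expo l3)"]) (use x l in auto)
  have 1: "(\<integral>\<^sup>+X. indicator {x<..} (X 0) * (\<integral>\<^sup>+Y. \<integral>\<^sup>+Z. K (elapse x X, Y, Z) \<partial>iid (expo l3) \<partial>iid (expo l2)) \<partial>iid (expo l1)) =
      ennreal (exp (- l1 * x)) * (\<integral>\<^sup>+X. \<integral>\<^sup>+Y. \<integral>\<^sup>+Z. K (X, Y, Z) \<partial>iid (expo l3) \<partial>iid (expo l2) \<partial>iid (expo l1))"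
    by (rule nn_integral_iid_memoryless[where F="\<lambda>X. \<integral>\<^sup>+Y. \<integral>\<^sup>+Z. K (X, Y, Z) \<partial>iid (expo l3) \<partial>iid (expo l2)"]) (use x l in auto)
  have "(\<integral>\<^sup>+(X, Y, Z). of_bool (x < X 0 \<and> x < Y 0) * K (elapse x X, elapse x Y, Z) \<partial>clocks l1 l2 l3) =
    (\<integral>\<^sup>+X. \<integral>\<^sup>+Y. \<integral>\<^sup>+Z. indicator {x<..} (X 0) * (indicator {x<..} (Y 0) * 
       K (elapse x X, elapse x Y, Z)) \<partial>iid (expo l3) \<partial>iid (expo l2) \<partial>iid (expo l1))"
    by (subst nn_integral_clocks) (auto simp: l case_prod_beta' indicator_def intro!: nn_integral_cong)
  also have "\<dots> = (\<integral>\<^sup>+X. indicator {x<..} (X 0) * (\<integral>\<^sup>+Y. indicator {x<..} (Y 0) * 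
      (\<integral>\<^sup>+Z. K (elapse x X, elapse x Y, Z) \<partial>iid (expo l3)) \<partial>iid (expo l2)) \<partial>iid (expo l1))"
    by (simp add: nn_integral_cmult)
  also have "\<dots> = ennreal (exp (- l2 * x)) * (\<integral>\<^sup>+X. indicator {x<..} (X 0) * (\<integral>\<^sup>+Y. 
      (\<integral>\<^sup>+Z. K (elapse x X, Y, Z) \<partial>iid (expo l3)) \<partial>iid (expo l2)) \<partial>iid (expo l1))"
    unfolding 2 by (simp add: nn_integral_cmult mult.left_commute[of _ "ennreal (exp (- (l2 * x)))"])
  also have "\<dots> = (ennreal (exp (- l2 * x)) * ennreal (exp (- l1 * x))) * (\<integral>\<^sup>+w. K w \<partial>clocks l1 l2 l3)"
    unfolding 1 by (simp add: nn_integral_clocks l ac_simps)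
  also have "ennreal (exp (- l2 * x)) * ennreal (exp (- l1 * x)) = ennreal (exp (- (l1 + l2) * x))"
    by (simp add: ennreal_mult'[symmetric] exp_add[symmetric] algebra_simps)
  finally show ?thesis .
qed

text \<open>Excludes ties between clocks and ties with a fixed epoch, so that the race has exactly
  one winner.\<close>

lemma AE_clocks_component:
  assumes l: "0 < l1" "0 < l2" "0 < l3"
  shows "AE w in clocks l1 l2 l3. fst w 0 \<noteq> c" "AE w in clocks l1 l2 l3. fst (snd w) 0 \<noteq> c"
    "AE w in clocks l1 l2 l3. snd (snd w) 0 \<noteq> c" "AE w in clocks l1 l2 l3. fst w 0 \<noteq> fst (snd w) 0"
    "AE w in clocks l1 l2 l3. fst w 0 \<noteq> snd (snd w) 0" "AE w in clocks l1 l2 l3. fst (snd w) 0 \<noteq> snd (snd w) 0"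
proof -
  interpret A: prob_space "iid (expo l1)" using assms by (intro prob_space_iid_expo)
  interpret B: prob_space "iid (expo l2)" using assms by (intro prob_space_iid_expo)
  interpret C: prob_space "iid (expo l3)" using assms by (intro prob_space_iid_expo)
  interpret BC: prob_space "iid (expo l2) \<Otimes>\<^sub>M iid (expo l3)" using assms by (intro prob_space_iid_expo prob_space_pair)
  interpret BC': pair_prob_space "iid (expo l2)" "iid (expo l3)" ..
  interpret ABC: pair_prob_space "iid (expo l1)" "iid (expo l2) \<Otimes>\<^sub>M iid (expo l3)" ..
  have [measurable]: "(\<lambda>w. fst w 0) \<in> borel_measurable (iid (expo l2) \<Otimes>\<^sub>M iid (expo l3))"
    "(\<lambda>w. snd w 0) \<in> borel_measurable (iid (expo l2) \<Otimes>\<^sub>M iid (expo l3))"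
    "(\<lambda>w. fst w 0) \<in> borel_measurable (clocks l1 l2 l3)"
    "(\<lambda>w. fst (snd w) 0) \<in> borel_measurable (clocks l1 l2 l3)"
    "(\<lambda>w. snd (snd w) 0) \<in> borel_measurable (clocks l1 l2 l3)"
    by (rule measurable_iid_component, measurable)+
  have r: "AE \<omega> in iid (expo l). \<omega> 0 \<noteq> c" if "0 < l" for l c
  proof (rule AE_PiM_component)
    show "AE x in expo l. x \<noteq> c"
      using AE_lborel_singleton[of c] by (subst AE_density) auto
  qed (auto intro: prob_space_expo that)
  have r': "AE \<omega> in iid (expo l). c \<noteq> \<omega> 0" if "0 < l" for l c
    using r[OF that, of c] by eventually_elim auto
  have p: "AE w in iid (expo l2) \<Otimes>\<^sub>M iid (expo l3). c \<noteq> fst w 0" for c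
    by (subst BC'.AE_pair_iff[symmetric]) (use r' assms in auto)
  have p': "AE w in iid (expo l2) \<Otimes>\<^sub>M iid (expo l3). c \<noteq> snd w 0" for c
    by (subst BC'.AE_pair_iff[symmetric]) (use r' assms in auto)
  have p'': "AE w in iid (expo l2) \<Otimes>\<^sub>M iid (expo l3). fst w 0 \<noteq> snd w 0"
    by (subst BC'.AE_pair_iff[symmetric]) (use r' assms in auto)
  show "AE w in clocks l1 l2 l3. fst w 0 \<noteq> c"
    by (subst ABC.AE_pair_iff[symmetric]) (use r assms in auto)
  have "AE w in clocks l1 l2 l3. c \<noteq> fst (snd w) 0"
    by (subst ABC.AE_pair_iff[symmetric]) (use p in auto)
  then show "AE w in clocks l1 l2 l3. fst (snd w) 0 \<noteq> c" by eventually_elim auto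
  have "AE w in clocks l1 l2 l3. c \<noteq> snd (snd w) 0"
    by (subst ABC.AE_pair_iff[symmetric]) (use p' in auto)
  then show "AE w in clocks l1 l2 l3. snd (snd w) 0 \<noteq> c" by eventually_elim auto
  show "AE w in clocks l1 l2 l3. fst w 0 \<noteq> fst (snd w) 0"
    by (subst ABC.AE_pair_iff[symmetric]) (use p in auto)
  show "AE w in clocks l1 l2 l3. fst w 0 \<noteq> snd (snd w) 0"
    by (subst ABC.AE_pair_iff[symmetric]) (use p' in auto)
  show "AE w in clocks l1 l2 l3. fst (snd w) 0 \<noteq> snd (snd w) 0"
    by (subst ABC.AE_pair_iff[symmetric]) (use p'' in auto)
qed

section \<open>First-event equations for fixed arrivals\<close>

definition cust_seq :: "(nat \<Rightarrow> real) \<Rightarrow> (nat \<Rightarrow> nat) \<Rightarrow> real \<Rightarrow> real \<Rightarrow> nat \<Rightarrow>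
    (nat \<Rightarrow> real) \<Rightarrow> (nat \<Rightarrow> real) \<Rightarrow> (nat \<Rightarrow> real) \<Rightarrow> nat" where
  "cust_seq A B t s n S N D = cust (range A) (\<lambda>e. B (LEAST k. A k = e)) t s n S N D"

lemma measurable_cust_seq:
  assumes [measurable]: "x \<in> borel_measurable M" "S \<in> measurable M (iid (expo l1))"
    "N \<in> measurable M (iid (expo l2))" "D \<in> measurable M (iid (expo l3))"
  shows "(\<lambda>w. cust_seq A B t (x w) n (S w) (N w) (D w)) \<in> measurable M (count_space UNIV)"
  unfolding cust_seq_def
  by (rule measurable_cust[where A="\<lambda>_. A" and B="\<lambda>_. B"])
    (auto intro!: measurable_iid_component[OF assms(2)] measurable_iid_component[OF assms(3)]
      measurable_iid_component[OF assms(4)])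

text \<open>Up to the transition probabilities only the three rates matter; arrival epochs and batch
  sizes are deterministic parameters there.\<close>

locale rates =
  fixes \<mu> \<eta> \<delta> :: real
  assumes mu: "0 < \<mu>" and eta: "0 < \<eta>" and delta: "0 < \<delta>"
begin

abbreviation "clk \<equiv> clocks \<mu> \<eta> \<delta>"

definition I :: "(nat \<Rightarrow> real) \<Rightarrow> (nat \<Rightarrow> nat) \<Rightarrow> real \<Rightarrow> nat \<Rightarrow> real \<Rightarrow> nat \<Rightarrow>
    (nat \<Rightarrow> real) \<Rightarrow> (nat \<Rightarrow> real) \<Rightarrow> (nat \<Rightarrow> real) \<Rightarrow> ennreal" where
  "I A B t j s n S N D = of_bool (cust_seq A B t s n S N D = j)"

lemma measurable_I[measurable (raw)]:
  assumes [measurable]: "x \<in> borel_measurable M" "S \<in> measurable M (iid (expo l1))"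
    "N \<in> measurable M (iid (expo l2))" "D \<in> measurable M (iid (expo l3))"
  shows "(\<lambda>w. I A B t j (x w) n (S w) (N w) (D w)) \<in> borel_measurable M"
proof -
  note measurable_cust_seq[OF assms, measurable]
  show ?thesis unfolding I_def by measurable
qed

text \<open>The probability of \<open>j\<close> customers at time \<open>t\<close>, starting from
  \<open>n\<close> at time \<open>s\<close>, for given arrivals. All clocks start afresh at
  \<open>s\<close>; lack of memory is what lets the same function describe the continuation of a
  path after any event.\<close>

definition W :: "(nat \<Rightarrow> real) \<Rightarrow> (nat \<Rightarrow> nat) \<Rightarrow> real \<Rightarrow> nat \<Rightarrow> real \<Rightarrow> nat \<Rightarrow> ennreal" where
  "W A B t j s n = (\<integral>\<^sup>+w. I A B t j s n (fst w) (fst (snd w)) (snd (snd w)) \<partial>clk)"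

lemma measurable_W[measurable]: "(\<lambda>s. W A B t j s n) \<in> borel_measurable borel"
proof -
  interpret prob_space clk using mu eta delta by (intro prob_space_clocks)
  show ?thesis unfolding W_def by measurable
qed

lemma W_le_1: "W A B t j s n \<le> 1"
proof -
  interpret prob_space clk using mu eta delta by (intro prob_space_clocks)
  have "W A B t j s n \<le> (\<integral>\<^sup>+w. 1 \<partial>clk)"
    unfolding W_def by (intro nn_integral_mono) (simp add: I_def)
  then show ?thesis by (simp add: emeasure_space_1)
qed

lemma nn_integral_iid_tail:
  assumes "0 < l" and [measurable]: "F \<in> borel_measurable (iid (expo l))"
  shows "(\<integral>\<^sup>+\<omega>. F (\<lambda>k. \<omega> (Suc k)) \<partial>iid (expo l)) = (\<integral>\<^sup>+\<omega>. F \<omega> \<partial>iid (expo l))"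
proof -
  interpret prob_space "expo l" using assms by (intro prob_space_expo)
  show ?thesis
    by (subst nn_integral_iid_step) (auto intro: prob_space_axioms simp: emeasure_space_1[simplified])
qed

text \<open>After a removal by a negative customer or a disaster the next service replaces the
  abandoned one. Both have the same law, so discarding entry 0 of the service sequence makes no
  difference.\<close>

lemma W_tail: "(\<integral>\<^sup>+w. I A B t j s n (\<lambda>k. fst w (Suc k)) (fst (snd w)) (snd (snd w)) \<partial>clk) = W A B t j s n"
proof -
  interpret B: prob_space "iid (expo \<eta>)" using eta by (intro prob_space_iid_expo)
  interpret C: prob_space "iid (expo \<delta>)" using delta by (intro prob_space_iid_expo)
  have "(\<integral>\<^sup>+w. I A B t j s n (\<lambda>k. fst w (Suc k)) (fst (snd w)) (snd (snd w)) \<partial>clk) =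
     (\<integral>\<^sup>+X. \<integral>\<^sup>+Y. \<integral>\<^sup>+Z. I A B t j s n (\<lambda>k. X (Suc k)) Y Z \<partial>iid (expo \<delta>) \<partial>iid (expo \<eta>) \<partial>iid (expo \<mu>))"
    by (subst nn_integral_clocks) (simp_all add: mu eta delta)
  also have "\<dots> = (\<integral>\<^sup>+X. \<integral>\<^sup>+Y. \<integral>\<^sup>+Z. I A B t j s n X Y Z \<partial>iid (expo \<delta>) \<partial>iid (expo \<eta>) \<partial>iid (expo \<mu>))"
    by (rule nn_integral_iid_tail[where F="\<lambda>X. \<integral>\<^sup>+Y. \<integral>\<^sup>+Z. I A B t j s n X Y Z \<partial>iid (expo \<delta>) \<partial>iid (expo \<eta>)"])
      (use mu in auto)
  also have "\<dots> = W A B t j s n"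
    unfolding W_def by (subst nn_integral_clocks) (simp_all add: mu eta delta)
  finally show ?thesis .
qed

lemma service_first:
  "(\<integral>\<^sup>+w. of_bool (fst w 0 < fst (snd w) 0 \<and> fst w 0 < snd (snd w) 0 \<and> fst w 0 < L) *
      I A B t j (s + fst w 0) n (\<lambda>k. fst w (Suc k)) (elapse (fst w 0) (fst (snd w))) (elapse (fst w 0) (snd (snd w))) \<partial>clk) =
   (\<integral>\<^sup>+x. indicator {0<..<L} x * ennreal (\<mu> * exp (- (\<mu> + \<eta> + \<delta>) * x)) * W A B t j (s + x) n \<partial>lborel)"
  using race_first[of \<mu> \<eta> \<delta> "\<lambda>w. I A B t j (s + fst w) n (fst (snd w)) (fst (snd (snd w))) (snd (snd (snd w)))" L] mu eta delta
  by (simp add: case_prod_beta' W_def)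

lemma negative_first:
  "(\<integral>\<^sup>+w. of_bool (fst (snd w) 0 < fst w 0 \<and> fst (snd w) 0 < snd (snd w) 0 \<and> fst (snd w) 0 < L) *
      I A B t j (s + fst (snd w) 0) n (\<lambda>k. fst w (Suc k)) (\<lambda>k. fst (snd w) (Suc k)) (elapse (fst (snd w) 0) (snd (snd w))) \<partial>clk) =
   (\<integral>\<^sup>+x. indicator {0<..<L} x * ennreal (\<eta> * exp (- (\<mu> + \<eta> + \<delta>) * x)) * W A B t j (s + x) n \<partial>lborel)" (is "?l = ?r")
proof -
  have "?l = (\<integral>\<^sup>+w. of_bool (fst w 0 < fst (snd w) 0 \<and> fst w 0 < snd (snd w) 0 \<and> fst w 0 < L) *
      I A B t j (s + fst w 0) n (\<lambda>k. fst (snd w) (Suc k)) (\<lambda>k. fst w (Suc k)) (elapse (fst w 0) (snd (snd w))) \<partial>clocks \<eta> \<mu> \<delta>)"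
    by (subst nn_integral_clocks_swap12) (simp_all add: mu eta delta)
  \<comment> \<open>Aging touches entry 0 only, so the tail of the aged sequence is the tail of the
    original one. Written this way the integrand has the shape treated by
    \<open>race_first\<close>.\<close>
  also have "\<dots> = (\<integral>\<^sup>+w. of_bool (fst w 0 < fst (snd w) 0 \<and> fst w 0 < snd (snd w) 0 \<and> fst w 0 < L) *
      I A B t j (s + fst w 0) n (\<lambda>k. elapse (fst w 0) (fst (snd w)) (Suc k)) (\<lambda>k. fst w (Suc k)) (elapse (fst w 0) (snd (snd w))) \<partial>clocks \<eta> \<mu> \<delta>)"
    by (simp add: elapse_def)
  also have "\<dots> = (\<integral>\<^sup>+x. indicator {0<..<L} x * ennreal (\<eta> * exp (- (\<eta> + \<mu> + \<delta>) * x)) *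
       (\<integral>\<^sup>+w. I A B t j (s + x) n (\<lambda>k. fst (snd w) (Suc k)) (fst w) (snd (snd w)) \<partial>clocks \<eta> \<mu> \<delta>) \<partial>lborel)"
    using race_first[of \<eta> \<mu> \<delta> "\<lambda>w. I A B t j (s + fst w) n (\<lambda>k. fst (snd (snd w)) (Suc k)) (fst (snd w)) (snd (snd (snd w)))" L] mu eta delta
    by (simp add: case_prod_beta')
  also have "(\<lambda>x. \<integral>\<^sup>+w. I A B t j (s + x) n (\<lambda>k. fst (snd w) (Suc k)) (fst w) (snd (snd w)) \<partial>clocks \<eta> \<mu> \<delta>) = (\<lambda>x. W A B t j (s + x) n)" (is "?f = _")
  proof (rule ext)
    fix x
    show "?f x = W A B t j (s + x) n"
      using nn_integral_clocks_swap12[of \<mu> \<eta> \<delta> "\<lambda>w. I A B t j (s + x) n (\<lambda>k. fst w (Suc k)) (fst (snd w)) (snd (snd w))"] mu eta delta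
      by (simp add: W_tail[symmetric])
  qed
  finally show ?thesis by (simp add: add_ac)
qed

lemma disaster_first:
  "(\<integral>\<^sup>+w. of_bool (snd (snd w) 0 < fst w 0 \<and> snd (snd w) 0 < fst (snd w) 0 \<and> snd (snd w) 0 < L) *
      I A B t j (s + snd (snd w) 0) n (\<lambda>k. fst w (Suc k)) (elapse (snd (snd w) 0) (fst (snd w))) (\<lambda>k. snd (snd w) (Suc k)) \<partial>clk) =
   (\<integral>\<^sup>+x. indicator {0<..<L} x * ennreal (\<delta> * exp (- (\<mu> + \<eta> + \<delta>) * x)) * W A B t j (s + x) n \<partial>lborel)" (is "?l = ?r")
proof -
  have "?l = (\<integral>\<^sup>+w. of_bool (fst w 0 < fst (snd w) 0 \<and> fst w 0 < snd (snd w) 0 \<and> fst w 0 < L) *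
      I A B t j (s + fst w 0) n (\<lambda>k. fst (snd w) (Suc k)) (elapse (fst w 0) (snd (snd w))) (\<lambda>k. fst w (Suc k)) \<partial>clocks \<delta> \<mu> \<eta>)"
    by (subst nn_integral_clocks_perm312) (simp_all add: mu eta delta)
  also have "\<dots> = (\<integral>\<^sup>+w. of_bool (fst w 0 < fst (snd w) 0 \<and> fst w 0 < snd (snd w) 0 \<and> fst w 0 < L) *
      I A B t j (s + fst w 0) n (\<lambda>k. elapse (fst w 0) (fst (snd w)) (Suc k)) (elapse (fst w 0) (snd (snd w))) (\<lambda>k. fst w (Suc k)) \<partial>clocks \<delta> \<mu> \<eta>)"
    by (simp add: elapse_def)
  also have "\<dots> = (\<integral>\<^sup>+x. indicator {0<..<L} x * ennreal (\<delta> * exp (- (\<delta> + \<mu> + \<eta>) * x)) *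
       (\<integral>\<^sup>+w. I A B t j (s + x) n (\<lambda>k. fst (snd w) (Suc k)) (snd (snd w)) (fst w) \<partial>clocks \<delta> \<mu> \<eta>) \<partial>lborel)"
    using race_first[of \<delta> \<mu> \<eta> "\<lambda>w. I A B t j (s + fst w) n (\<lambda>k. fst (snd (snd w)) (Suc k)) (snd (snd (snd w))) (fst (snd w))" L] mu eta delta
    by (simp add: case_prod_beta')
  also have "(\<lambda>x. \<integral>\<^sup>+w. I A B t j (s + x) n (\<lambda>k. fst (snd w) (Suc k)) (snd (snd w)) (fst w) \<partial>clocks \<delta> \<mu> \<eta>) = (\<lambda>x. W A B t j (s + x) n)" (is "?f = _")
  proof (rule ext)
    fix x
    show "?f x = W A B t j (s + x) n"
      using nn_integral_clocks_perm312[of \<mu> \<eta> \<delta> "\<lambda>w. I A B t j (s + x) n (\<lambda>k. fst w (Suc k)) (fst (snd w)) (snd (snd w))"] mu eta delta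
      by (simp add: W_tail[symmetric])
  qed
  finally show ?thesis by (simp add: add_ac)
qed

lemma negative_first_idle:
  "(\<integral>\<^sup>+w. of_bool (fst (snd w) 0 < snd (snd w) 0 \<and> fst (snd w) 0 < L) *
      I A B t j (s + fst (snd w) 0) n (fst w) (\<lambda>k. fst (snd w) (Suc k)) (elapse (fst (snd w) 0) (snd (snd w))) \<partial>clk) =
   (\<integral>\<^sup>+x. indicator {0<..<L} x * ennreal (\<eta> * exp (- (\<eta> + \<delta>) * x)) * W A B t j (s + x) n \<partial>lborel)" (is "?l = ?r")
proof -
  have "?l = (\<integral>\<^sup>+w. of_bool (fst w 0 < fst (snd w) 0 \<and> fst w 0 < L) *
      I A B t j (s + fst w 0) n (snd (snd w)) (\<lambda>k. fst w (Suc k)) (elapse (fst w 0) (fst (snd w))) \<partial>clocks \<eta> \<delta> \<mu>)"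
    by (subst nn_integral_clocks_perm231) (simp_all add: mu eta delta)
  also have "\<dots> = (\<integral>\<^sup>+x. indicator {0<..<L} x * ennreal (\<eta> * exp (- (\<eta> + \<delta>) * x)) *
       (\<integral>\<^sup>+w. I A B t j (s + x) n (snd (snd w)) (fst w) (fst (snd w)) \<partial>clocks \<eta> \<delta> \<mu>) \<partial>lborel)"
    using race_first_idle[of \<eta> \<delta> \<mu> "\<lambda>w. I A B t j (s + fst w) n (snd (snd (snd w))) (fst (snd w)) (fst (snd (snd w)))" L] mu eta delta
    by (simp add: case_prod_beta')
  also have "(\<lambda>x. \<integral>\<^sup>+w. I A B t j (s + x) n (snd (snd w)) (fst w) (fst (snd w)) \<partial>clocks \<eta> \<delta> \<mu>) = (\<lambda>x. W A B t j (s + x) n)" (is "?f = _")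
  proof (rule ext)
    fix x
    show "?f x = W A B t j (s + x) n"
      using nn_integral_clocks_perm231[of \<mu> \<eta> \<delta> "\<lambda>w. I A B t j (s + x) n (fst w) (fst (snd w)) (snd (snd w))"] mu eta delta
      by (simp add: W_def)
  qed
  finally show ?thesis .
qed

lemma disaster_first_idle:
  "(\<integral>\<^sup>+w. of_bool (snd (snd w) 0 < fst (snd w) 0 \<and> snd (snd w) 0 < L) *
      I A B t j (s + snd (snd w) 0) n (fst w) (elapse (snd (snd w) 0) (fst (snd w))) (\<lambda>k. snd (snd w) (Suc k)) \<partial>clk) =
   (\<integral>\<^sup>+x. indicator {0<..<L} x * ennreal (\<delta> * exp (- (\<eta> + \<delta>) * x)) * W A B t j (s + x) n \<partial>lborel)" (is "?l = ?r")
proof -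
  have "?l = (\<integral>\<^sup>+w. of_bool (fst w 0 < fst (snd w) 0 \<and> fst w 0 < L) *
      I A B t j (s + fst w 0) n (snd (snd w)) (elapse (fst w 0) (fst (snd w))) (\<lambda>k. fst w (Suc k)) \<partial>clocks \<delta> \<eta> \<mu>)"
    by (subst nn_integral_clocks_perm321) (simp_all add: mu eta delta)
  also have "\<dots> = (\<integral>\<^sup>+x. indicator {0<..<L} x * ennreal (\<delta> * exp (- (\<delta> + \<eta>) * x)) *
       (\<integral>\<^sup>+w. I A B t j (s + x) n (snd (snd w)) (fst (snd w)) (fst w) \<partial>clocks \<delta> \<eta> \<mu>) \<partial>lborel)"
    using race_first_idle[of \<delta> \<eta> \<mu> "\<lambda>w. I A B t j (s + fst w) n (snd (snd (snd w))) (fst (snd (snd w))) (fst (snd w))" L] mu eta delta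
    by (simp add: case_prod_beta')
  also have "(\<lambda>x. \<integral>\<^sup>+w. I A B t j (s + x) n (snd (snd w)) (fst (snd w)) (fst w) \<partial>clocks \<delta> \<eta> \<mu>) = (\<lambda>x. W A B t j (s + x) n)" (is "?f = _")
  proof (rule ext)
    fix x
    show "?f x = W A B t j (s + x) n"
      using nn_integral_clocks_perm321[of \<mu> \<eta> \<delta> "\<lambda>w. I A B t j (s + x) n (fst w) (fst (snd w)) (snd (snd w))"] mu eta delta
      by (simp add: W_def)
  qed
  finally show ?thesis by (simp add: add_ac)
qed

lemma none_first:
  assumes "0 \<le> L"
  shows "(\<integral>\<^sup>+w. of_bool (L < fst w 0 \<and> L < fst (snd w) 0 \<and> L < snd (snd w) 0) *
      I A B t j s n (elapse L (fst w)) (elapse L (fst (snd w))) (elapse L (snd (snd w))) \<partial>clk) =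
   ennreal (exp (- (\<mu> + \<eta> + \<delta>) * L)) * W A B t j s n"
  using race_none[of \<mu> \<eta> \<delta> "\<lambda>w. I A B t j s n (fst w) (fst (snd w)) (snd (snd w))" L] mu eta delta assms
  by (simp add: case_prod_beta' W_def)

lemma none_first_idle:
  assumes "0 \<le> L"
  shows "(\<integral>\<^sup>+w. of_bool (L < fst (snd w) 0 \<and> L < snd (snd w) 0) *
      I A B t j s n (fst w) (elapse L (fst (snd w))) (elapse L (snd (snd w))) \<partial>clk) =
   ennreal (exp (- (\<eta> + \<delta>) * L)) * W A B t j s n" (is "?l = ?r")
proof -
  have "?l = (\<integral>\<^sup>+w. of_bool (L < fst w 0 \<and> L < fst (snd w) 0) *
      I A B t j s n (snd (snd w)) (elapse L (fst w)) (elapse L (fst (snd w))) \<partial>clocks \<eta> \<delta> \<mu>)"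
    by (subst nn_integral_clocks_perm231) (simp_all add: mu eta delta)
  also have "\<dots> = ennreal (exp (- (\<eta> + \<delta>) * L)) *
       (\<integral>\<^sup>+w. I A B t j s n (snd (snd w)) (fst w) (fst (snd w)) \<partial>clocks \<eta> \<delta> \<mu>)"
    using race_none_idle[of \<eta> \<delta> \<mu> "\<lambda>w. I A B t j s n (snd (snd w)) (fst w) (fst (snd w))" L] mu eta delta assms
    by (simp add: case_prod_beta')
  also have "(\<integral>\<^sup>+w. I A B t j s n (snd (snd w)) (fst w) (fst (snd w)) \<partial>clocks \<eta> \<delta> \<mu>) = W A B t j s n"
    using nn_integral_clocks_perm231[of \<mu> \<eta> \<delta> "\<lambda>w. I A B t j s n (fst w) (fst (snd w)) (snd (snd w))"] mu eta delta
    by (simp add: W_def)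
  finally show ?thesis .
qed


text \<open>Here \<open>e\<close> is the next arrival or, if no arrival comes first, the end
  \<open>t\<close> of the observation. The four summands correspond to the possible winners:
  service, negative customer, disaster, and \<open>e\<close> itself. Without ties exactly one of the
  four conditions holds.\<close>

lemma I_split_busy:
  assumes e: "s < e" "e \<le> t" "finite (range A \<inter> {s<..t})" "range A \<inter> {s<..<e} = {}"
    and last: "e \<notin> range A \<Longrightarrow> e = t"
    and r: "regular S" "regular N" "regular D"
    and ne: "S 0 \<noteq> e - s" "N 0 \<noteq> e - s" "D 0 \<noteq> e - s" "S 0 \<noteq> N 0" "S 0 \<noteq> D 0" "N 0 \<noteq> D 0"
  shows "I A B t j s (Suc n) S N D =
    of_bool (S 0 < N 0 \<and> S 0 < D 0 \<and> S 0 < e - s) *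
       I A B t j (s + S 0) n (\<lambda>k. S (Suc k)) (elapse (S 0) N) (elapse (S 0) D) +
    of_bool (N 0 < S 0 \<and> N 0 < D 0 \<and> N 0 < e - s) *
       I A B t j (s + N 0) n (\<lambda>k. S (Suc k)) (\<lambda>k. N (Suc k)) (elapse (N 0) D) +
    of_bool (D 0 < S 0 \<and> D 0 < N 0 \<and> D 0 < e - s) *
       I A B t j (s + D 0) 0 (\<lambda>k. S (Suc k)) (elapse (D 0) N) (\<lambda>k. D (Suc k)) +
    of_bool (e - s < S 0 \<and> e - s < N 0 \<and> e - s < D 0) *
       (if e \<in> range A then I A B t j e (Suc n + B (LEAST k. A k = e)) (elapse (e - s) S) (elapse (e - s) N) (elapse (e - s) D)
        else of_bool (Suc n = j))"
proof -
  have pos: "0 < S k" "0 < N k" "0 < D k" for k using r by (auto simp: regular_def)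
  consider "S 0 < N 0" "S 0 < D 0" "S 0 < e - s" | "N 0 < S 0" "N 0 < D 0" "N 0 < e - s"
    | "D 0 < S 0" "D 0 < N 0" "D 0 < e - s" | "e - s < S 0" "e - s < N 0" "e - s < D 0"
    using ne by linarith
  then show ?thesis
  proof cases
    case 1
    have "range A \<inter> {s<..s + S 0} = {}" using e(4) 1 by fastforce
    then show ?thesis using 1 e r pos
      by (simp add: I_def cust_seq_def cust_service)
  next
    case 2
    have "range A \<inter> {s<..s + N 0} = {}" using e(4) 2 by fastforce
    then show ?thesis using 2 e r pos
      by (simp add: I_def cust_seq_def cust_negative)
  next
    case 3
    have "range A \<inter> {s<..s + D 0} = {}" using e(4) 3 by fastforce
    then show ?thesis using 3 e r pos
      by (simp add: I_def cust_seq_def cust_disaster)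
  next
    case 4
    show ?thesis
    proof (cases "e \<in> range A")
      case True
      have "cust_seq A B t s (Suc n) S N D = cust_seq A B t (s + (e - s)) (Suc n + B (LEAST k. A k = s + (e - s)))
         (elapse (e - s) S) (elapse (e - s) N) (elapse (e - s) D)"
        unfolding cust_seq_def using 4 e r True by (subst cust_arrival[where x="e - s"]) auto
      then show ?thesis using 4 True by (simp add: I_def)
    next
      case False
      then have "e = t" by (rule last)
      have "range A \<inter> {s<..t} = {}" proof -
        have "x \<notin> range A" if "s < x" "x \<le> t" for x
          using e(4) False \<open>e = t\<close> that by (cases "x = t") auto
        then show ?thesis by (metis (no_types, opaque_lifting) IntE ex_in_conv greaterThanAtMost_iff)
      qed
      then have "cust_seq A B t s (Suc n) S N D = Suc n"
        unfolding cust_seq_def using 4 e r \<open>e = t\<close> by (intro cust_no_event) auto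
      then show ?thesis using 4 False by (simp add: I_def)
    qed
  qed
qed

lemma I_split_idle:
  assumes e: "s < e" "e \<le> t" "finite (range A \<inter> {s<..t})" "range A \<inter> {s<..<e} = {}"
    and last: "e \<notin> range A \<Longrightarrow> e = t"
    and r: "regular S" "regular N" "regular D"
    and ne: "N 0 \<noteq> e - s" "D 0 \<noteq> e - s" "N 0 \<noteq> D 0"
  shows "I A B t j s 0 S N D =
    of_bool (N 0 < D 0 \<and> N 0 < e - s) *
       I A B t j (s + N 0) 0 S (\<lambda>k. N (Suc k)) (elapse (N 0) D) +
    of_bool (D 0 < N 0 \<and> D 0 < e - s) *
       I A B t j (s + D 0) 0 S (elapse (D 0) N) (\<lambda>k. D (Suc k)) +
    of_bool (e - s < N 0 \<and> e - s < D 0) *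
       (if e \<in> range A then I A B t j e (B (LEAST k. A k = e)) S (elapse (e - s) N) (elapse (e - s) D)
        else of_bool (0 = j))"
proof -
  have pos: "0 < S k" "0 < N k" "0 < D k" for k using r by (auto simp: regular_def)
  consider "N 0 < D 0" "N 0 < e - s"
    | "D 0 < N 0" "D 0 < e - s" | "e - s < N 0" "e - s < D 0"
    using ne by linarith
  then show ?thesis
  proof cases
    case 1
    have "range A \<inter> {s<..s + N 0} = {}" using e(4) 1 by fastforce
    then show ?thesis using 1 e r pos
      by (simp add: I_def cust_seq_def cust_negative)
  next
    case 2
    have "range A \<inter> {s<..s + D 0} = {}" using e(4) 2 by fastforce
    then show ?thesis using 2 e r pos
      by (simp add: I_def cust_seq_def cust_disaster)
  next
    case 3
    show ?thesis
    proof (cases "e \<in> range A")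
      case True
      have "cust_seq A B t s 0 S N D = cust_seq A B t (s + (e - s)) (0 + B (LEAST k. A k = s + (e - s)))
         S (elapse (e - s) N) (elapse (e - s) D)"
        unfolding cust_seq_def using 3 e r True by (subst cust_arrival[where x="e - s"]) auto
      then show ?thesis using 3 True by (simp add: I_def)
    next
      case False
      then have "e = t" by (rule last)
      have "range A \<inter> {s<..t} = {}" proof -
        have "x \<notin> range A" if "s < x" "x \<le> t" for x
          using e(4) False \<open>e = t\<close> that by (cases "x = t") auto
        then show ?thesis by (metis (no_types, opaque_lifting) IntE ex_in_conv greaterThanAtMost_iff)
      qed
      then have "cust_seq A B t s 0 S N D = 0"
        unfolding cust_seq_def using 3 e r \<open>e = t\<close> by (intro cust_no_event) auto
      then show ?thesis using 3 False by (simp add: I_def)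
    qed
  qed
qed

lemma prob_none_first:
  assumes "0 \<le> L"
  shows "(\<integral>\<^sup>+w. of_bool (L < fst w 0 \<and> L < fst (snd w) 0 \<and> L < snd (snd w) 0) * c \<partial>clk) =
   ennreal (exp (- (\<mu> + \<eta> + \<delta>) * L)) * c"
proof -
  interpret prob_space clk using mu eta delta by (intro prob_space_clocks)
  show ?thesis using race_none[of \<mu> \<eta> \<delta> "\<lambda>w. c" L] mu eta delta assms
    by (simp add: case_prod_beta' emeasure_space_1)
qed

lemma prob_none_first_idle:
  assumes "0 \<le> L"
  shows "(\<integral>\<^sup>+w. of_bool (L < fst (snd w) 0 \<and> L < snd (snd w) 0) * c \<partial>clk) =
   ennreal (exp (- (\<eta> + \<delta>) * L)) * c"
proof -
  interpret P: prob_space "clocks \<eta> \<delta> \<mu>" using mu eta delta by (intro prob_space_clocks)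
  have "(\<integral>\<^sup>+w. of_bool (L < fst (snd w) 0 \<and> L < snd (snd w) 0) * c \<partial>clk) =
     (\<integral>\<^sup>+w. of_bool (L < fst w 0 \<and> L < fst (snd w) 0) * c \<partial>clocks \<eta> \<delta> \<mu>)"
    by (subst nn_integral_clocks_perm231) (simp_all add: mu eta delta)
  also have "\<dots> = ennreal (exp (- (\<eta> + \<delta>) * L)) * c"
    using race_none_idle[of \<eta> \<delta> \<mu> "\<lambda>w. c" L] mu eta delta assms
    by (simp add: case_prod_beta' P.emeasure_space_1)
  finally show ?thesis .
qed

text \<open>The value on reaching \<open>e\<close> with \<open>n\<close> customers: an arrival adds
  its batch and the path continues, otherwise \<open>e\<close> is the end of the observation and the
  number is read off.\<close>

definition boundary :: "(nat \<Rightarrow> real) \<Rightarrow> (nat \<Rightarrow> nat) \<Rightarrow> real \<Rightarrow> nat \<Rightarrow> real \<Rightarrow> nat \<Rightarrow> ennreal" where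
  "boundary A B t j e n = (if e \<in> range A then W A B t j e (n + B (LEAST k. A k = e)) else of_bool (n = j))"

lemma measurable_clk_component[measurable]:
    "(\<lambda>w. fst w k) \<in> borel_measurable clk"
    "(\<lambda>w. fst (snd w) k) \<in> borel_measurable clk"
    "(\<lambda>w. snd (snd w) k) \<in> borel_measurable clk"
    by (rule measurable_iid_component, measurable)+

text \<open>Services and negative customers affect a busy system alike, so their rates add.\<close>

lemma combine_busy:
  "i * ennreal (\<mu> * exp y) * (w::ennreal) + i * ennreal (\<eta> * exp y) * w + i * ennreal (\<delta> * exp y) * v =
   i * ennreal (exp y) * (ennreal (\<mu> + \<eta>) * w + ennreal \<delta> * v)"
proof -
  have "ennreal (\<mu> * exp y) = ennreal \<mu> * ennreal (exp y)" "ennreal (\<eta> * exp y) = ennreal \<eta> * ennreal (exp y)"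
    "ennreal (\<delta> * exp y) = ennreal \<delta> * ennreal (exp y)" "ennreal (\<mu> + \<eta>) = ennreal \<mu> + ennreal \<eta>"
    using mu eta delta by (simp_all add: ennreal_mult)
  then show ?thesis by (simp only: distrib_left distrib_right mult_ac add_ac)
qed

text \<open>Negative customers and disasters both leave an empty system unchanged, so their rates
  add.\<close>

lemma combine_idle:
  "i * ennreal (\<eta> * exp y) * (w::ennreal) + i * ennreal (\<delta> * exp y) * w =
   i * ennreal (exp y) * (ennreal (\<eta> + \<delta>) * w)"
proof -
  have "ennreal (\<eta> * exp y) = ennreal \<eta> * ennreal (exp y)"
    "ennreal (\<delta> * exp y) = ennreal \<delta> * ennreal (exp y)" "ennreal (\<eta> + \<delta>) = ennreal \<eta> + ennreal \<delta>"
    using mu eta delta by (simp_all add: ennreal_mult)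
  then show ?thesis by (simp only: distrib_left distrib_right mult_ac add_ac)
qed

text \<open>Kolmogorov's backward equation in integral form: the exponential factor belongs to paths
  without any event up to \<open>e\<close>, the integral to the first removal, after which
  \<open>n\<close> or 0 customers remain.\<close>

lemma W_busy:
  assumes e: "s < e" "e \<le> t" "finite (range A \<inter> {s<..t})" "range A \<inter> {s<..<e} = {}"
    and last: "e \<notin> range A \<Longrightarrow> e = t"
  shows "W A B t j s (Suc n) = ennreal (exp (- (\<mu> + \<eta> + \<delta>) * (e - s))) * boundary A B t j e (Suc n) +
     (\<integral>\<^sup>+x. indicator {0<..<e - s} x * ennreal (exp (- (\<mu> + \<eta> + \<delta>) * x)) *
        (ennreal (\<mu> + \<eta>) * W A B t j (s + x) n + ennreal \<delta> * W A B t j (s + x) 0) \<partial>lborel)"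
proof -
  let ?L = "e - s"
  define f1 where "f1 w = of_bool (fst w 0 < fst (snd w) 0 \<and> fst w 0 < snd (snd w) 0 \<and> fst w 0 < ?L) *
      I A B t j (s + fst w 0) n (\<lambda>k. fst w (Suc k)) (elapse (fst w 0) (fst (snd w))) (elapse (fst w 0) (snd (snd w)))" for w
  define f2 where "f2 w = of_bool (fst (snd w) 0 < fst w 0 \<and> fst (snd w) 0 < snd (snd w) 0 \<and> fst (snd w) 0 < ?L) *
      I A B t j (s + fst (snd w) 0) n (\<lambda>k. fst w (Suc k)) (\<lambda>k. fst (snd w) (Suc k)) (elapse (fst (snd w) 0) (snd (snd w)))" for w
  define f3 where "f3 w = of_bool (snd (snd w) 0 < fst w 0 \<and> snd (snd w) 0 < fst (snd w) 0 \<and> snd (snd w) 0 < ?L) *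
      I A B t j (s + snd (snd w) 0) 0 (\<lambda>k. fst w (Suc k)) (elapse (snd (snd w) 0) (fst (snd w))) (\<lambda>k. snd (snd w) (Suc k))" for w
  define f4 where "f4 w = of_bool (?L < fst w 0 \<and> ?L < fst (snd w) 0 \<and> ?L < snd (snd w) 0) *
     (if e \<in> range A then I A B t j e (Suc n + B (LEAST k. A k = e)) (elapse ?L (fst w)) (elapse ?L (fst (snd w))) (elapse ?L (snd (snd w)))
      else of_bool (Suc n = j))" for w
  have [measurable]: "f1 \<in> borel_measurable clk" "f2 \<in> borel_measurable clk" "f3 \<in> borel_measurable clk"
    unfolding f1_def f2_def f3_def by measurable
  have [measurable]: "f4 \<in> borel_measurable clk"
    unfolding f4_def by (cases "e \<in> range A") simp_all
  have "AE w in clk. I A B t j s (Suc n) (fst w) (fst (snd w)) (snd (snd w)) = f1 w + f2 w + f3 w + f4 w"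
    using AE_clocks_component(1-3)[OF mu eta delta, of ?L] AE_clocks_component(4-6)[OF mu eta delta] AE_clocks_regular[OF mu eta delta]
  proof eventually_elim
    case (elim w)
    then show ?case unfolding f1_def f2_def f3_def f4_def by (intro I_split_busy[OF e last]) auto
  qed
  then have "W A B t j s (Suc n) = (\<integral>\<^sup>+w. f1 w + f2 w + f3 w + f4 w \<partial>clk)"
    unfolding W_def by (rule nn_integral_cong_AE)
  also have "\<dots> = (\<integral>\<^sup>+w. f4 w \<partial>clk) + ((\<integral>\<^sup>+w. f1 w \<partial>clk) + (\<integral>\<^sup>+w. f2 w \<partial>clk) + (\<integral>\<^sup>+w. f3 w \<partial>clk))"
    by (simp add: nn_integral_add add_ac)
  also have "(\<integral>\<^sup>+w. f4 w \<partial>clk) = ennreal (exp (- (\<mu> + \<eta> + \<delta>) * ?L)) * boundary A B t j e (Suc n)"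
    using none_first[where L="?L" and A=A and B=B and t=t and j=j and s=e and n="Suc n + B (LEAST k. A k = e)"] prob_none_first[where L="?L" and c="of_bool (Suc n = j)"] e(1)
    unfolding f4_def boundary_def by auto
  also have "(\<integral>\<^sup>+w. f1 w \<partial>clk) + (\<integral>\<^sup>+w. f2 w \<partial>clk) + (\<integral>\<^sup>+w. f3 w \<partial>clk) =
      (\<integral>\<^sup>+x. indicator {0<..<e - s} x * ennreal (exp (- (\<mu> + \<eta> + \<delta>) * x)) *
        (ennreal (\<mu> + \<eta>) * W A B t j (s + x) n + ennreal \<delta> * W A B t j (s + x) 0) \<partial>lborel)"
    unfolding f1_def f2_def f3_def service_first negative_first disaster_first
    by (simp add: nn_integral_add[symmetric] combine_busy)
  finally show ?thesis .
qed

text \<open>Events in the empty system lead back to the empty system, so the unknown occurs on both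
  sides. This equation determines it only together with a uniqueness argument.\<close>

lemma W_idle:
  assumes e: "s < e" "e \<le> t" "finite (range A \<inter> {s<..t})" "range A \<inter> {s<..<e} = {}"
    and last: "e \<notin> range A \<Longrightarrow> e = t"
  shows "W A B t j s 0 = ennreal (exp (- (\<eta> + \<delta>) * (e - s))) * boundary A B t j e 0 +
     (\<integral>\<^sup>+x. indicator {0<..<e - s} x * ennreal (exp (- (\<eta> + \<delta>) * x)) *
        (ennreal (\<eta> + \<delta>) * W A B t j (s + x) 0) \<partial>lborel)"
proof -
  let ?L = "e - s"
  define f2 where "f2 w = of_bool (fst (snd w) 0 < snd (snd w) 0 \<and> fst (snd w) 0 < ?L) *
      I A B t j (s + fst (snd w) 0) 0 (fst w) (\<lambda>k. fst (snd w) (Suc k)) (elapse (fst (snd w) 0) (snd (snd w)))" for w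
  define f3 where "f3 w = of_bool (snd (snd w) 0 < fst (snd w) 0 \<and> snd (snd w) 0 < ?L) *
      I A B t j (s + snd (snd w) 0) 0 (fst w) (elapse (snd (snd w) 0) (fst (snd w))) (\<lambda>k. snd (snd w) (Suc k))" for w
  define f4 where "f4 w = of_bool (?L < fst (snd w) 0 \<and> ?L < snd (snd w) 0) *
     (if e \<in> range A then I A B t j e (B (LEAST k. A k = e)) (fst w) (elapse ?L (fst (snd w))) (elapse ?L (snd (snd w)))
      else of_bool (0 = j))" for w
  have [measurable]: "f2 \<in> borel_measurable clk" "f3 \<in> borel_measurable clk"
    unfolding f2_def f3_def by measurable
  have [measurable]: "f4 \<in> borel_measurable clk"
    unfolding f4_def by (cases "e \<in> range A") simp_all
  have "AE w in clk. I A B t j s 0 (fst w) (fst (snd w)) (snd (snd w)) = f2 w + f3 w + f4 w"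
    using AE_clocks_component(1-3)[OF mu eta delta, of ?L] AE_clocks_component(4-6)[OF mu eta delta] AE_clocks_regular[OF mu eta delta]
  proof eventually_elim
    case (elim w)
    then show ?case unfolding f2_def f3_def f4_def by (intro I_split_idle[OF e last]) auto
  qed
  then have "W A B t j s 0 = (\<integral>\<^sup>+w. f2 w + f3 w + f4 w \<partial>clk)"
    unfolding W_def by (rule nn_integral_cong_AE)
  also have "\<dots> = (\<integral>\<^sup>+w. f4 w \<partial>clk) + ((\<integral>\<^sup>+w. f2 w \<partial>clk) + (\<integral>\<^sup>+w. f3 w \<partial>clk))"
    by (simp add: nn_integral_add add_ac)
  also have "(\<integral>\<^sup>+w. f4 w \<partial>clk) = ennreal (exp (- (\<eta> + \<delta>) * ?L)) * boundary A B t j e 0"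
    using none_first_idle[where L="?L" and A=A and B=B and t=t and j=j and s=e and n="B (LEAST k. A k = e)"] prob_none_first_idle[where L="?L" and c="of_bool (0 = j)"] e(1)
    unfolding f4_def boundary_def by auto
  also have "(\<integral>\<^sup>+w. f2 w \<partial>clk) + (\<integral>\<^sup>+w. f3 w \<partial>clk) =
      (\<integral>\<^sup>+x. indicator {0<..<e - s} x * ennreal (exp (- (\<eta> + \<delta>) * x)) *
        (ennreal (\<eta> + \<delta>) * W A B t j (s + x) 0) \<partial>lborel)"
    unfolding f2_def f3_def negative_first_idle disaster_first_idle
    by (simp add: nn_integral_add[symmetric] combine_idle)
  finally show ?thesis .
qed

end

section \<open>Transition probabilities between arrivals\<close>

context rates begin

definition wt :: "nat \<Rightarrow> real \<Rightarrow> real" where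
  "wt l d = exp (- (\<mu> + \<eta> + \<delta>) * d) * ((\<mu> + \<eta>) * d) ^ l / fact l"

text \<open>Without arrivals, \<open>n\<close> customers become \<open>n - l\<close> with probability \<open>wt l d\<close> as long as \<open>l < n\<close>:
  no disaster and exactly \<open>l\<close> other removals.\<close>

definition trans_fun :: "real \<Rightarrow> (nat \<Rightarrow> real) \<Rightarrow> nat \<Rightarrow> real" where
  "trans_fun d \<phi> n = \<phi> 0 + (\<Sum>l<n. wt l d * (\<phi> (n - l) - \<phi> 0))"

definition trans :: "real \<Rightarrow> nat \<Rightarrow> nat \<Rightarrow> real" where
  "trans d n j = trans_fun d (\<lambda>i. of_bool (i = j)) n"

lemma wt_nonneg: "0 \<le> d \<Longrightarrow> 0 \<le> wt l d"
  using mu eta by (simp add: wt_def)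

lemma sum_wt_le: assumes "0 \<le> d" shows "(\<Sum>l<n. wt l d) \<le> exp (- \<delta> * d)"
proof -
  have "(\<Sum>l<n. ((\<mu> + \<eta>) * d) ^ l / fact l) \<le> exp ((\<mu> + \<eta>) * d)"
  proof -
    have "(\<lambda>l. ((\<mu> + \<eta>) * d) ^ l / fact l) sums exp ((\<mu> + \<eta>) * d)"
      using exp_converges[of "(\<mu> + \<eta>) * d"] by (simp add: scaleR_conv_of_real field_simps)
    then show ?thesis using assms mu eta
      by (metis (no_types, lifting) add_nonneg_nonneg divide_nonneg_nonneg fact_ge_zero less_imp_le mult_nonneg_nonneg sum_le_suminf
        sums_iff finite_lessThan zero_le_power)
  qed
  then have "exp (- (\<mu> + \<eta> + \<delta>) * d) * (\<Sum>l<n. ((\<mu> + \<eta>) * d) ^ l / fact l) \<le> exp (- (\<mu> + \<eta> + \<delta>) * d) * exp ((\<mu> + \<eta>) * d)"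
    by (rule mult_left_mono) simp
  also have "\<dots> = exp (- \<delta> * d)" by (simp add: exp_add[symmetric] algebra_simps)
  finally show ?thesis by (simp add: wt_def sum_distrib_left)
qed

lemma sum_wt_le_1: "0 \<le> d \<Longrightarrow> (\<Sum>l<n. wt l d) \<le> 1"
  using sum_wt_le[of d n] delta by (smt (verit) exp_le_one_iff mult_minus_left mult_nonneg_nonneg)

lemma wt_le_1: "0 \<le> d \<Longrightarrow> wt l d \<le> 1"
  using sum_wt_le_1[of d "Suc l"] sum_nonneg[of "{..<l}" "\<lambda>l. wt l d"] wt_nonneg[of d] by simp

text \<open>Mass not carried by the weights is in state 0, having got there through a disaster or
  through enough single removals.\<close>

lemma trans_fun_alt: "trans_fun d \<phi> n = (1 - (\<Sum>l<n. wt l d)) * \<phi> 0 + (\<Sum>l<n. wt l d * \<phi> (n - l))"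
  by (simp add: trans_fun_def algebra_simps sum_subtractf sum_distrib_left)

lemma trans_fun_0 [simp]: "trans_fun d \<phi> 0 = \<phi> 0"
  by (simp add: trans_fun_def)

lemma wt_zero: "wt l 0 = of_bool (l = 0)"
  by (simp add: wt_def)

lemma trans_fun_zero: "trans_fun 0 \<phi> n = \<phi> n"
  by (cases n) (auto simp: trans_fun_def wt_zero sum.lessThan_Suc_shift)

lemma trans_fun_nonneg: "0 \<le> d \<Longrightarrow> (\<And>i. 0 \<le> \<phi> i) \<Longrightarrow> 0 \<le> trans_fun d \<phi> n"
  unfolding trans_fun_alt
  by (intro add_nonneg_nonneg mult_nonneg_nonneg sum_nonneg) (auto simp: sum_wt_le_1 wt_nonneg)

lemma trans_nonneg: "0 \<le> d \<Longrightarrow> 0 \<le> trans d n j"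
  unfolding trans_def by (intro trans_fun_nonneg) auto

lemma trans_fun_eq_sum: "trans_fun d \<phi> n = (\<Sum>j\<le>n. trans d n j * \<phi> j)"
proof -
  have *: "(\<Sum>j\<le>n. of_bool (i = j) * \<phi> j) = \<phi> i" if "i \<le> n" for i
    using that by (subst sum.remove[of _ i]) (auto intro!: sum.neutral)
  have "(\<Sum>j\<le>n. trans d n j * \<phi> j) =
    (\<Sum>j\<le>n. (1 - (\<Sum>l<n. wt l d)) * (of_bool (0 = j) * \<phi> j)) + (\<Sum>j\<le>n. \<Sum>l<n. wt l d * (of_bool (n - l = j) * \<phi> j))"
    by (simp add: trans_def trans_fun_alt sum.distrib[symmetric] distrib_right sum_distrib_right mult.assoc
      del: sum_mult_of_bool_eq sum_of_bool_mult_eq)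
  also have "\<dots> = (1 - (\<Sum>l<n. wt l d)) * \<phi> 0 + (\<Sum>l<n. \<Sum>j\<le>n. wt l d * (of_bool (n - l = j) * \<phi> j))"
    by (subst sum.swap) (simp only: sum_distrib_left[symmetric] *)
  also have "\<dots> = trans_fun d \<phi> n"
    unfolding trans_fun_alt sum_distrib_left[symmetric] by (subst *) simp_all
  finally show ?thesis ..
qed

lemma sum_trans: "(\<Sum>j\<le>n. trans d n j) = 1"
  using trans_fun_eq_sum[of d "\<lambda>_. 1" n] by (simp add: trans_fun_def)

lemma trans_eq_0: "n < j \<Longrightarrow> trans d n j = 0"
  by (auto simp: trans_def trans_fun_def intro!: sum.neutral)

lemma trans_pos: assumes "1 \<le> j" shows "trans d n j = (if j \<le> n then wt (n - j) d else 0)"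
proof (cases "j \<le> n")
  case True
  have "{..<n} \<inter> {l. n - l = j} = {n - j}" using assms True by auto
  moreover have "trans d n j = (\<Sum>l\<in>{..<n} \<inter> {l. n - l = j}. wt l d)"
    unfolding trans_def trans_fun_def using assms by auto
  ultimately show ?thesis using True by simp
qed (simp add: trans_eq_0)

lemma trans_le_1: assumes "0 \<le> d" shows "trans d n j \<le> 1"
proof (cases "j \<le> n")
  case True
  then have "trans d n j \<le> (\<Sum>j\<le>n. trans d n j)"
    using trans_nonneg[OF assms] by (intro member_le_sum) auto
  then show ?thesis by (simp add: sum_trans)
qed (simp add: trans_eq_0)

lemma DERIV_wt_0: "(wt 0 has_real_derivative - (\<mu> + \<eta> + \<delta>) * wt 0 d) (at d)"
  unfolding wt_def by (auto intro!: derivative_eq_intros)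

lemma DERIV_wt_Suc:
  "(wt (Suc l) has_real_derivative - (\<mu> + \<eta> + \<delta>) * wt (Suc l) d + (\<mu> + \<eta>) * wt l d) (at d)"
proof -
  have "((\<lambda>d. exp (- c * d) * (v * d) ^ Suc l / fact (Suc l)) has_real_derivative
     - c * (exp (- c * d) * (v * d) ^ Suc l / fact (Suc l)) + v * (exp (- c * d) * (v * d) ^ l / fact l)) (at d)" for c v :: real
  proof -
    have *: "real (Suc l) * y / fact (Suc l) = y / fact l" for y :: real
      by (subst fact_Suc) (simp del: of_nat_Suc)
    have "((\<lambda>d. exp (- c * d) * (v * d) ^ Suc l / fact (Suc l)) has_real_derivative
       (exp (- c * d) * (- c) * (v * d) ^ Suc l + exp (- c * d) * (real (Suc l) * ((v * d) ^ l * v))) / fact (Suc l)) (at d)"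
    proof (intro DERIV_cdivide)
      have "((\<lambda>d. (v * d) ^ Suc l) has_real_derivative real (Suc l) * ((v * d) ^ l * v)) (at d)"
      proof -
        have "((\<lambda>d. v * d) has_real_derivative v) (at d)" by (auto intro!: derivative_eq_intros)
        from DERIV_power[OF this, of "Suc l"] show ?thesis by (simp add: mult_ac del: power_Suc of_nat_Suc)
      qed
      note P = this
      have E: "((\<lambda>d. exp (- c * d)) has_real_derivative exp (- c * d) * (- c)) (at d)"
        by (auto intro!: derivative_eq_intros)
      show "((\<lambda>d. exp (- c * d) * (v * d) ^ Suc l) has_real_derivative
        exp (- c * d) * (- c) * (v * d) ^ Suc l + exp (- c * d) * (real (Suc l) * ((v * d) ^ l * v))) (at d)"
        by (rule DERIV_cong[OF DERIV_mult[OF E P]]) (simp add: mult_ac add_ac del: of_nat_Suc power_Suc)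
    qed
    also have "(exp (- c * d) * (- c) * (v * d) ^ Suc l + exp (- c * d) * (real (Suc l) * ((v * d) ^ l * v))) / fact (Suc l) =
      - c * (exp (- c * d) * (v * d) ^ Suc l / fact (Suc l)) + real (Suc l) * (v * (exp (- c * d) * (v * d) ^ l)) / fact (Suc l)"
      by (simp add: add_divide_distrib diff_divide_distrib mult_ac del: fact_Suc of_nat_Suc power_Suc)
    finally show ?thesis unfolding * by simp
  qed
  from this[of "\<mu> + \<eta> + \<delta>" "\<mu> + \<eta>"] show ?thesis unfolding wt_def by simp
qed

lemma DERIV_wt: "(wt l has_real_derivative - (\<mu> + \<eta> + \<delta>) * wt l d + (\<mu> + \<eta>) * (if l = 0 then 0 else wt (l - 1) d)) (at d)"
  using DERIV_wt_0 DERIV_wt_Suc by (cases l) auto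

text \<open>Backward equation of a death process with killing: from \<open>Suc n\<close> one moves
  to \<open>n\<close> at rate mu + eta and to 0 at rate delta, and 0 is absorbing.\<close>

lemma DERIV_trans_fun:
  "((\<lambda>d. trans_fun d \<phi> (Suc n)) has_real_derivative
     - (\<mu> + \<eta> + \<delta>) * trans_fun d \<phi> (Suc n) + (\<mu> + \<eta>) * trans_fun d \<phi> n + \<delta> * \<phi> 0) (at d)"
proof -
  have "((\<lambda>d. trans_fun d \<phi> (Suc n)) has_real_derivative
     (\<Sum>l<Suc n. (- (\<mu> + \<eta> + \<delta>) * wt l d + (\<mu> + \<eta>) * (if l = 0 then 0 else wt (l - 1) d)) * (\<phi> (Suc n - l) - \<phi> 0))) (at d)"
    unfolding trans_fun_def by (auto intro!: derivative_eq_intros DERIV_wt sum.cong)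
  also have "(\<Sum>l<Suc n. (- (\<mu> + \<eta> + \<delta>) * wt l d + (\<mu> + \<eta>) * (if l = 0 then 0 else wt (l - 1) d)) * (\<phi> (Suc n - l) - \<phi> 0)) =
    - (\<mu> + \<eta> + \<delta>) * (\<Sum>l<Suc n. wt l d * (\<phi> (Suc n - l) - \<phi> 0)) +
     (\<mu> + \<eta>) * (\<Sum>l<Suc n. (if l = 0 then 0 else wt (l - 1) d) * (\<phi> (Suc n - l) - \<phi> 0))"
    by (simp only: distrib_right sum.distrib sum_distrib_left mult.assoc)
  also have "(\<Sum>l<Suc n. (if l = 0 then 0 else wt (l - 1) d) * (\<phi> (Suc n - l) - \<phi> 0)) = (\<Sum>l<n. wt l d * (\<phi> (n - l) - \<phi> 0))"
    by (subst sum.lessThan_Suc_shift) simp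
  also have "- (\<mu> + \<eta> + \<delta>) * (\<Sum>l<Suc n. wt l d * (\<phi> (Suc n - l) - \<phi> 0)) + (\<mu> + \<eta>) * (\<Sum>l<n. wt l d * (\<phi> (n - l) - \<phi> 0)) =
     - (\<mu> + \<eta> + \<delta>) * trans_fun d \<phi> (Suc n) + (\<mu> + \<eta>) * trans_fun d \<phi> n + \<delta> * \<phi> 0"
  proof -
    have "- (\<mu> + \<eta> + \<delta>) * S + (\<mu> + \<eta>) * T = - (\<mu> + \<eta> + \<delta>) * (\<phi> 0 + S) + (\<mu> + \<eta>) * (\<phi> 0 + T) + \<delta> * \<phi> 0"
      for S T :: real by (simp add: algebra_simps)
    then show ?thesis unfolding trans_fun_def .
  qed
  finally show ?thesis .
qed

lemma measurable_trans_fun[measurable]: "(\<lambda>d. trans_fun d \<phi> n) \<in> borel_measurable borel"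
  unfolding trans_fun_def wt_def by measurable

lemma measurable_trans[measurable]: "(\<lambda>d. trans d n j) \<in> borel_measurable borel"
  unfolding trans_def by measurable

text \<open>The explicit formula solves the equation in \<open>W_busy\<close>: by the backward
  equation, exp(- (mu + eta + delta) x) \<open>trans_fun (L - x) \<phi> (Suc n)\<close> has minus
  the integrand as its derivative, and integration runs from 0 to \<open>L\<close>.\<close>

lemma trans_fun_integral:
  assumes L: "0 \<le> L" and \<phi>: "\<And>i. 0 \<le> \<phi> i"
  shows "ennreal (trans_fun L \<phi> (Suc n)) = ennreal (exp (- (\<mu> + \<eta> + \<delta>) * L) * \<phi> (Suc n)) +
    (\<integral>\<^sup>+x. indicator {0<..<L} x * ennreal (exp (- (\<mu> + \<eta> + \<delta>) * x)) *
        (ennreal (\<mu> + \<eta>) * ennreal (trans_fun (L - x) \<phi> n) + ennreal \<delta> * ennreal (\<phi> 0)) \<partial>lborel)"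
proof -
  define f where "f x = exp (- (\<mu> + \<eta> + \<delta>) * x) * ((\<mu> + \<eta>) * trans_fun (L - x) \<phi> n + \<delta> * \<phi> 0)" for x
  define F where "F x = - (exp (- (\<mu> + \<eta> + \<delta>) * x) * trans_fun (L - x) \<phi> (Suc n))" for x
  have f0: "0 \<le> f x" if "x \<in> {0..L}" for x
    unfolding f_def using mu eta delta \<phi> that
    by (intro mult_nonneg_nonneg add_nonneg_nonneg trans_fun_nonneg) auto
  have DF: "(F has_real_derivative f x) (at x)" for x
  proof -
    have "((\<lambda>x. trans_fun (L - x) \<phi> (Suc n)) has_real_derivative
       (- (\<mu> + \<eta> + \<delta>) * trans_fun (L - x) \<phi> (Suc n) + (\<mu> + \<eta>) * trans_fun (L - x) \<phi> n + \<delta> * \<phi> 0) * (- 1)) (at x)"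
      by (rule DERIV_chain2[OF DERIV_trans_fun]) (auto intro!: derivative_eq_intros)
    then show ?thesis unfolding F_def f_def
      by (auto intro!: derivative_eq_intros simp: algebra_simps)
  qed
  have "(\<integral>\<^sup>+x. indicator {0<..<L} x * ennreal (exp (- (\<mu> + \<eta> + \<delta>) * x)) *
        (ennreal (\<mu> + \<eta>) * ennreal (trans_fun (L - x) \<phi> n) + ennreal \<delta> * ennreal (\<phi> 0)) \<partial>lborel) =
     (\<integral>\<^sup>+x. ennreal (f x) * indicator {0..L} x \<partial>lborel)"
  proof (rule nn_integral_cong_AE)
    show "AE x in lborel. indicator {0<..<L} x * ennreal (exp (- (\<mu> + \<eta> + \<delta>) * x)) *
        (ennreal (\<mu> + \<eta>) * ennreal (trans_fun (L - x) \<phi> n) + ennreal \<delta> * ennreal (\<phi> 0)) = ennreal (f x) * indicator {0..L} x"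
      using AE_lborel_singleton[of 0] AE_lborel_singleton[of L]
    proof eventually_elim
      case (elim x)
      show ?case
      proof (cases "0 < x \<and> x < L")
        case True
        then show ?thesis unfolding f_def using mu eta delta \<phi>
          by (simp add: trans_fun_nonneg flip: ennreal_mult ennreal_plus)
      qed (use elim in auto)
    qed
  qed
  also have "\<dots> = ennreal (F L - F 0)"
    by (rule nn_integral_FTC_Icc) (use L f0 DF in \<open>auto simp: f_def\<close>)
  also have "F L - F 0 = trans_fun L \<phi> (Suc n) - exp (- (\<mu> + \<eta> + \<delta>) * L) * \<phi> (Suc n)"
    by (simp add: F_def trans_fun_zero)
  finally have *: "(\<integral>\<^sup>+x. indicator {0<..<L} x * ennreal (exp (- (\<mu> + \<eta> + \<delta>) * x)) *
        (ennreal (\<mu> + \<eta>) * ennreal (trans_fun (L - x) \<phi> n) + ennreal \<delta> * ennreal (\<phi> 0)) \<partial>lborel) =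
    ennreal (trans_fun L \<phi> (Suc n) - exp (- (\<mu> + \<eta> + \<delta>) * L) * \<phi> (Suc n))" .
  \<comment> \<open>The integral has been found as a difference inside \<open>ennreal\<close>. The
    subtracted term is a single summand of \<open>trans_fun\<close>, so the difference is not
    truncated and can be undone.\<close>
  have "exp (- (\<mu> + \<eta> + \<delta>) * L) * \<phi> (Suc n) = wt 0 L * \<phi> (Suc n - 0)" by (simp add: wt_def)
  also have "\<dots> \<le> (\<Sum>l<Suc n. wt l L * \<phi> (Suc n - l))"
    by (rule member_le_sum) (auto simp: wt_nonneg L \<phi>)
  also have "\<dots> \<le> trans_fun L \<phi> (Suc n)"
    unfolding trans_fun_alt using sum_wt_le_1[OF L, of "Suc n"] \<phi> by (auto intro!: mult_nonneg_nonneg)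
  finally show ?thesis unfolding * using \<phi> by (subst ennreal_plus[symmetric]) auto
qed

text \<open>The state changes at no more than the total rate, whatever \<open>n\<close> and
  \<open>j\<close> are. Uniformity in both makes the effect of a time window of length h an error of
  order h.\<close>

lemma trans_Lipschitz:
  assumes "0 \<le> x" "0 \<le> y"
  shows "\<bar>trans x n j - trans y n j\<bar> \<le> (\<mu> + \<eta> + \<delta>) * \<bar>x - y\<bar>"
proof (cases n)
  case 0
  then show ?thesis using mu eta delta by (auto simp: trans_def)
next
  case (Suc m)
  let ?\<phi> = "\<lambda>i. of_bool (i = j)"
  let ?D = "\<lambda>d. - (\<mu> + \<eta> + \<delta>) * trans d (Suc m) j + (\<mu> + \<eta>) * trans d m j + \<delta> * of_bool (0 = j)"
  have "norm (trans x (Suc m) j - trans y (Suc m) j) \<le> (\<mu> + \<eta> + \<delta>) * norm (x - y)"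
  proof (rule field_differentiable_bound[where S="{0..}"])
    show "((\<lambda>d. trans d (Suc m) j) has_field_derivative ?D d) (at d within {0..})" for d
      using DERIV_trans_fun[of ?\<phi> m d] unfolding trans_def by (rule has_field_derivative_at_within)
    show "norm (?D d) \<le> \<mu> + \<eta> + \<delta>" if "d \<in> {0..}" for d
    proof -
      have "0 \<le> trans d (Suc m) j" "trans d (Suc m) j \<le> 1" "0 \<le> trans d m j" "trans d m j \<le> 1"
        using that by (auto simp: trans_nonneg trans_le_1)
      then have "0 \<le> (\<mu> + \<eta> + \<delta>) * trans d (Suc m) j" "(\<mu> + \<eta> + \<delta>) * trans d (Suc m) j \<le> (\<mu> + \<eta> + \<delta>)"
        "0 \<le> (\<mu> + \<eta>) * trans d m j" "(\<mu> + \<eta>) * trans d m j \<le> \<mu> + \<eta>" "0 \<le> \<delta> * of_bool (0 = j)" "\<delta> * of_bool (0 = j) \<le> \<delta>"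
        using mu eta delta by (auto intro: mult_left_le)
      then show ?thesis unfolding real_norm_def by linarith
    qed
  qed (use assms in auto)
  then show ?thesis using Suc by simp
qed


section \<open>Identification of the transition probabilities\<close>

lemma W_finite [simp]: "W A B t j s n < top" "W A B t j s n \<noteq> top"
  using W_le_1[of A B t j s n] by (auto simp: less_top order_le_less_trans[OF _ ennreal_one_less_top] top_unique)

lemma W_real: "W A B t j s n = ennreal (enn2real (W A B t j s n))"
  by simp

lemma boundary_le_1: "boundary A B t j e n \<le> 1"
  by (auto simp: boundary_def W_le_1)

lemma boundary_real: "boundary A B t j e n = ennreal (enn2real (boundary A B t j e n))"
  using boundary_le_1[of A B t j e n]
  by (metis ennreal_enn2real ennreal_one_less_top order_le_less_trans)

lemma nn_integral_exp_interval:
  assumes "0 < c" "0 \<le> L"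
  shows "(\<integral>\<^sup>+x. indicator {0<..<L} x * ennreal (exp (- c * x)) * (ennreal c * ennreal m) \<partial>lborel) =
     ennreal ((1 - exp (- c * L)) * m)"
proof -
  have "(\<integral>\<^sup>+x. indicator {0<..<L} x * ennreal (exp (- c * x)) * (ennreal c * ennreal m) \<partial>lborel) =
     (\<integral>\<^sup>+x. (ennreal (c * exp (- c * x)) * indicator {0..L} x) * ennreal m \<partial>lborel)"
  proof (rule nn_integral_cong_AE)
    show "AE x in lborel. indicator {0<..<L} x * ennreal (exp (- c * x)) * (ennreal c * ennreal m) =
      (ennreal (c * exp (- c * x)) * indicator {0..L} x) * ennreal m"
      using AE_lborel_singleton[of 0] AE_lborel_singleton[of L]
      by eventually_elim (use assms in \<open>auto simp: ennreal_mult indicator_def mult_ac\<close>)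
  qed
  also have "\<dots> = (\<integral>\<^sup>+x. ennreal (c * exp (- c * x)) * indicator {0..L} x \<partial>lborel) * ennreal m"
    by (rule nn_integral_multc) simp
  also have "(\<integral>\<^sup>+x. ennreal (c * exp (- c * x)) * indicator {0..L} x \<partial>lborel) = ennreal (- exp (- c * L) - - exp (- c * 0))"
    by (rule nn_integral_FTC_Icc) (use assms in \<open>auto intro!: derivative_eq_intros\<close>)
  finally show ?thesis using assms by (simp add: ennreal_mult')
qed

text \<open>Successive approximation: the constant \<open>\<phi>\<close> solves the equation, and
  each use of the equation shrinks the distance to it by the factor q = 1 - exp(- c (e - s0)) < 1,
  the probability of an event in the longest interval considered. The initial distance is at most 1
  because both quantities lie in [0, 1].\<close>

lemma idle_unique:
  fixes v :: "real \<Rightarrow> real"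
  assumes c: "0 < c" and v: "\<And>s. 0 \<le> v s" "\<And>s. v s \<le> 1" and \<phi>: "0 \<le> \<phi>" "\<phi> \<le> 1"
    and [measurable]: "v \<in> borel_measurable borel"
    and eq: "\<And>s. s0 \<le> s \<Longrightarrow> s < e \<Longrightarrow> ennreal (v s) = ennreal (exp (- c * (e - s)) * \<phi>) +
      (\<integral>\<^sup>+x. indicator {0<..<e - s} x * ennreal (exp (- c * x)) * (ennreal c * ennreal (v (s + x))) \<partial>lborel)"
    and s: "s0 \<le> s" "s < e"
  shows "v s = \<phi>"
proof -
  define q where "q = 1 - exp (- c * (e - s0))"
  have q: "0 \<le> q" "q < 1" using c s by (auto simp: q_def)
  have "\<forall>s. s0 \<le> s \<longrightarrow> s < e \<longrightarrow> \<bar>v s - \<phi>\<bar> \<le> q ^ k" for k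
  proof (induction k)
    case 0
    show ?case using v \<phi> by (auto simp: abs_le_iff) (smt (verit))+
  next
    case (Suc k)
    show ?case
    proof (intro allI impI)
      fix s assume s: "s0 \<le> s" "s < e"
      let ?L = "e - s" and ?E = "exp (- c * (e - s))"
      have qL: "1 - ?E \<le> q" unfolding q_def using s c by simp
      have up: "v s \<le> ?E * \<phi> + (1 - ?E) * (\<phi> + q ^ k)"
      proof -
        have "ennreal (v s) \<le> ennreal (?E * \<phi>) +
          (\<integral>\<^sup>+x. indicator {0<..<?L} x * ennreal (exp (- c * x)) * (ennreal c * ennreal (\<phi> + q ^ k)) \<partial>lborel)"
          unfolding eq[OF s]
        proof (intro add_mono nn_integral_mono order_refl)
          fix x
          show "indicator {0<..<?L} x * ennreal (exp (- c * x)) * (ennreal c * ennreal (v (s + x))) \<le>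
            indicator {0<..<?L} x * ennreal (exp (- c * x)) * (ennreal c * ennreal (\<phi> + q ^ k))"
          proof (cases "x \<in> {0<..<?L}")
            case True
            then have "\<bar>v (s + x) - \<phi>\<bar> \<le> q ^ k" using Suc.IH s by auto
            then have "v (s + x) \<le> \<phi> + q ^ k" by auto
            then show ?thesis by (intro mult_left_mono ennreal_leI) auto
          qed simp
        qed
        also have "\<dots> = ennreal (?E * \<phi> + (1 - ?E) * (\<phi> + q ^ k))"
          using c s \<phi> q by (subst nn_integral_exp_interval) (auto simp: ennreal_plus[symmetric] simp del: ennreal_plus)
        finally show ?thesis using c s \<phi> q by (subst (asm) ennreal_le_iff) auto
      qed
      \<comment> \<open>The cut at 0 keeps the comparison value nonnegative, so that nothing is lost
        when it is embedded in \<open>ennreal\<close>.\<close>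
      have low: "?E * \<phi> + (1 - ?E) * max 0 (\<phi> - q ^ k) \<le> v s"
      proof -
        have "ennreal (?E * \<phi> + (1 - ?E) * max 0 (\<phi> - q ^ k)) = ennreal (?E * \<phi>) +
          (\<integral>\<^sup>+x. indicator {0<..<?L} x * ennreal (exp (- c * x)) * (ennreal c * ennreal (max 0 (\<phi> - q ^ k))) \<partial>lborel)"
          using c s \<phi> q by (subst nn_integral_exp_interval) (auto simp: ennreal_plus[symmetric] simp del: ennreal_plus)
        also have "\<dots> \<le> ennreal (v s)"
          unfolding eq[OF s]
        proof (intro add_mono nn_integral_mono order_refl)
          fix x
          show "indicator {0<..<?L} x * ennreal (exp (- c * x)) * (ennreal c * ennreal (max 0 (\<phi> - q ^ k))) \<le>
            indicator {0<..<?L} x * ennreal (exp (- c * x)) * (ennreal c * ennreal (v (s + x)))"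
          proof (cases "x \<in> {0<..<?L}")
            case True
            then have "\<bar>v (s + x) - \<phi>\<bar> \<le> q ^ k" using Suc.IH s by auto
            then have "max 0 (\<phi> - q ^ k) \<le> v (s + x)" using v(1)[of "s + x"] by auto
            then show ?thesis by (intro mult_left_mono ennreal_leI) auto
          qed simp
        qed
        finally show ?thesis using v by (subst (asm) ennreal_le_iff) auto
      qed
      have *: "(1 - ?E) * q ^ k \<le> q * q ^ k" using qL q by (intro mult_right_mono) auto
      have "(1 - ?E) * (\<phi> - q ^ k) \<le> (1 - ?E) * max 0 (\<phi> - q ^ k)"
        using c s by (intro mult_left_mono) auto
      then have "?E * \<phi> + (1 - ?E) * (\<phi> - q ^ k) \<le> v s" using low by linarith
      then show "\<bar>v s - \<phi>\<bar> \<le> q ^ Suc k" using up * by (simp add: abs_le_iff algebra_simps)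
    qed
  qed
  then have le: "\<bar>v s - \<phi>\<bar> \<le> q ^ k" for k using s by auto
  have "(\<lambda>k. q ^ k) \<longlonglongrightarrow> 0" using q by (intro LIMSEQ_power_zero) auto
  then have "\<bar>v s - \<phi>\<bar> \<le> 0" by (rule LIMSEQ_le_const) (use le in blast)
  then show ?thesis by simp
qed

text \<open>State 0 is settled by \<open>idle_unique\<close>; then the equation for
  \<open>Suc n\<close> refers only to \<open>n\<close> and 0 and allows induction on
  \<open>n\<close>. The induction covers all starting times before \<open>e\<close> at once, because
  the integral runs over later starting times.\<close>

lemma W_until_next:
  assumes e: "s < e" "e \<le> t" "finite (range A \<inter> {s<..t})" "range A \<inter> {s<..<e} = {}"
    and last: "e \<notin> range A \<Longrightarrow> e = t"
  shows "W A B t j s n = ennreal (trans_fun (e - s) (\<lambda>i. enn2real (boundary A B t j e i)) n)"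
proof -
  let ?\<phi> = "\<lambda>i. enn2real (boundary A B t j e i)"
  have H: "finite (range A \<inter> {s'<..t}) \<and> range A \<inter> {s'<..<e} = {}" if "s \<le> s'" for s'
    using that e by (auto intro: finite_subset[OF _ e(3)])
  have idle: "W A B t j s' 0 = ennreal (?\<phi> 0)" if "s \<le> s'" "s' < e" for s'
  proof -
    have "enn2real (W A B t j s' 0) = ?\<phi> 0"
    proof (rule idle_unique[of "\<eta> + \<delta>" "\<lambda>s. enn2real (W A B t j s 0)" "?\<phi> 0" s e s'])
      fix s' assume s': "s \<le> s'" "s' < e"
      show "ennreal (enn2real (W A B t j s' 0)) = ennreal (exp (- (\<eta> + \<delta>) * (e - s')) * ?\<phi> 0) +
        (\<integral>\<^sup>+x. indicator {0<..<e - s'} x * ennreal (exp (- (\<eta> + \<delta>) * x)) *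
           (ennreal (\<eta> + \<delta>) * ennreal (enn2real (W A B t j (s' + x) 0))) \<partial>lborel)"
      proof -
        have "W A B t j s' 0 = ennreal (exp (- (\<eta> + \<delta>) * (e - s'))) * boundary A B t j e 0 +
         (\<integral>\<^sup>+x. indicator {0<..<e - s'} x * ennreal (exp (- (\<eta> + \<delta>) * x)) *
           (ennreal (\<eta> + \<delta>) * W A B t j (s' + x) 0) \<partial>lborel)"
          using W_idle[OF s'(2) e(2) _ _ last, where B=B and j=j] H[OF s'(1)] by blast
        moreover have "ennreal (exp (- (\<eta> + \<delta>) * (e - s')) * ?\<phi> 0) = ennreal (exp (- (\<eta> + \<delta>) * (e - s'))) * boundary A B t j e 0"
          by (subst ennreal_mult) (simp_all add: boundary_real[symmetric])
        ultimately show ?thesis unfolding W_real[symmetric] by (simp only:)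
      qed
    qed (use eta delta that W_le_1 boundary_le_1 in \<open>auto simp: enn2real_leI\<close>)
    then show ?thesis by (metis W_real)
  qed
  have "\<forall>s'. s \<le> s' \<longrightarrow> s' < e \<longrightarrow> W A B t j s' n = ennreal (trans_fun (e - s') ?\<phi> n)"
  proof (induction n)
    case 0
    then show ?case using idle by simp
  next
    case (Suc n)
    show ?case
    proof (intro allI impI)
      fix s' assume s': "s \<le> s'" "s' < e"
      have "W A B t j s' (Suc n) = ennreal (exp (- (\<mu> + \<eta> + \<delta>) * (e - s'))) * boundary A B t j e (Suc n) +
         (\<integral>\<^sup>+x. indicator {0<..<e - s'} x * ennreal (exp (- (\<mu> + \<eta> + \<delta>) * x)) *
          (ennreal (\<mu> + \<eta>) * W A B t j (s' + x) n + ennreal \<delta> * W A B t j (s' + x) 0) \<partial>lborel)"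
        using W_busy[OF s'(2) e(2) _ _ last, where B=B and j=j and n=n] H[OF s'(1)] by blast
      also have "\<dots> = ennreal (exp (- (\<mu> + \<eta> + \<delta>) * (e - s')) * ?\<phi> (Suc n)) +
         (\<integral>\<^sup>+x. indicator {0<..<e - s'} x * ennreal (exp (- (\<mu> + \<eta> + \<delta>) * x)) *
          (ennreal (\<mu> + \<eta>) * ennreal (trans_fun (e - s' - x) ?\<phi> n) + ennreal \<delta> * ennreal (?\<phi> 0)) \<partial>lborel)"
        using Suc.IH idle s' boundary_real[of A B t j e "Suc n"]
        by (intro arg_cong2[of _ _ _ _ "(+)"] nn_integral_cong)
          (auto simp: ennreal_mult' indicator_def diff_diff_eq)
      also have "\<dots> = ennreal (trans_fun (e - s') ?\<phi> (Suc n))"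
        using s' by (intro trans_fun_integral[symmetric]) auto
      finally show "W A B t j s' (Suc n) = ennreal (trans_fun (e - s') ?\<phi> (Suc n))" .
    qed
  qed
  then show ?thesis using e by simp
qed

lemma W_self: "W A B t j t n = of_bool (n = j)"
proof -
  interpret prob_space clk using mu eta delta by (intro prob_space_clocks)
  have "AE w in clk. I A B t j t n (fst w) (fst (snd w)) (snd (snd w)) = of_bool (n = j)"
    using AE_clocks_regular[OF mu eta delta]
  proof eventually_elim
    case (elim w)
    then have "cust_seq A B t t n (fst w) (fst (snd w)) (snd (snd w)) = n"
      unfolding cust_seq_def by (intro cust_no_event) (auto simp: regular_def)
    then show ?case by (simp add: I_def)
  qed
  then have "W A B t j t n = (\<integral>\<^sup>+w. of_bool (n = j) \<partial>clk)"
    unfolding W_def by (rule nn_integral_cong_AE)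
  then show ?thesis by (simp add: emeasure_space_1)
qed

lemma trans_fun_suminf:
  assumes "0 \<le> d" "\<And>i. 0 \<le> \<phi> i"
  shows "ennreal (trans_fun d \<phi> n) = (\<Sum>i. ennreal (trans d n i) * ennreal (\<phi> i))"
proof -
  have "ennreal (trans_fun d \<phi> n) = (\<Sum>i\<le>n. ennreal (trans d n i) * ennreal (\<phi> i))"
    unfolding trans_fun_eq_sum using assms by (simp add: sum_ennreal[symmetric] trans_nonneg ennreal_mult)
  also have "\<dots> = (\<Sum>i. ennreal (trans d n i) * ennreal (\<phi> i))"
    by (rule suminf_finite[symmetric]) (auto simp: trans_eq_0)
  finally show ?thesis .
qed

section \<open>The distribution found by successive arrivals, for fixed epochs and batches\<close>

definition arrivals :: "(nat \<Rightarrow> real) \<Rightarrow> bool" where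
  "arrivals A \<longleftrightarrow> 0 < A 0 \<and> strict_mono A \<and> (\<forall>t. \<exists>k. t < A k)"

lemma arrivals_finite: assumes "arrivals A" shows "finite (range A \<inter> {s<..t})"
proof -
  obtain k where k: "t < A k" using assms by (auto simp: arrivals_def)
  have "range A \<inter> {s<..t} \<subseteq> A ` {..k}"
  proof
    fix x assume "x \<in> range A \<inter> {s<..t}"
    then obtain i where i: "x = A i" "A i \<le> t" by auto
    then have "A i < A k" using k by simp
    then have "i < k" using assms by (auto simp: arrivals_def strict_mono_less)
    then show "x \<in> A ` {..k}" using i by auto
  qed
  then show ?thesis by (rule finite_subset) simp
qed

lemma LEAST_arrival: fixes A :: "nat \<Rightarrow> real" shows "strict_mono A \<Longrightarrow> (LEAST k. A k = A m) = m"
  by (rule Least_equality) (simp_all add: strict_mono_eq[of A])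

text \<open>The assumptions on \<open>s\<close> say that arrival \<open>k\<close> is the next one
  after \<open>s\<close>. An arrival exactly at \<open>s\<close> is allowed and is already part of
  \<open>n\<close>.\<close>

lemma W_to_arrival:
  assumes A: "arrivals A" and s: "s < A k" "A k \<le> t" "\<And>i. i < k \<Longrightarrow> A i \<le> s"
  shows "W A B t j s n = (\<Sum>i. ennreal (trans (A k - s) n i) * W A B t j (A k) (i + B k))"
proof -
  have sm: "strict_mono A" using A by (simp add: arrivals_def)
  have "range A \<inter> {s<..<A k} = {}"
    using s(3) by (force simp: strict_mono_less[OF sm])
  then have "W A B t j s n = ennreal (trans_fun (A k - s) (\<lambda>i. enn2real (boundary A B t j (A k) i)) n)"
    by (intro W_until_next arrivals_finite A s) auto
  also have "\<dots> = (\<Sum>i. ennreal (trans (A k - s) n i) * W A B t j (A k) (i + B k))"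
    using s(1) by (subst trans_fun_suminf) (auto simp: boundary_def LEAST_arrival[OF sm])
  finally show ?thesis .
qed

lemma W_to_end:
  assumes A: "arrivals A" and s: "s \<le> t" "t < A k" "\<And>i. i < k \<Longrightarrow> A i \<le> s"
  shows "W A B t j s n = ennreal (trans (t - s) n j)"
proof (cases "s = t")
  case True
  then show ?thesis by (simp add: W_self trans_def trans_fun_zero)
next
  case False
  have sm: "strict_mono A" using A by (simp add: arrivals_def)
  have *: "A i \<le> s \<or> t < A i" for i
  proof (cases "i < k")
    case False
    then have "A k \<le> A i" using strict_mono_less_eq[OF sm, of k i] by simp
    then show ?thesis using s(2) by simp
  qed (use s(3) in auto)
  have "x \<notin> range A" if "s < x" "x \<le> t" for x
    using * that by (metis imageE linorder_not_less)
  then have "range A \<inter> {s<..<t} = {}" "t \<notin> range A" using s(1) False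
    by (metis IntE ex_in_conv greaterThanLessThan_iff less_imp_le, metis order_refl order_le_neq_trans)
  then have "W A B t j s n = ennreal (trans_fun (t - s) (\<lambda>i. enn2real (boundary A B t j t i)) n)"
    using s False by (intro W_until_next arrivals_finite A) auto
  moreover have "(\<lambda>i. enn2real (of_bool (i = j))) = (\<lambda>i. of_bool (i = j))"
    by (auto simp: fun_eq_iff of_bool_def)
  ultimately show ?thesis using \<open>t \<notin> range A\<close>
    by (simp add: boundary_def trans_def)
qed

text \<open>\<open>prearr A B n0 k\<close> is the distribution of the number of customers just before arrival \<open>k\<close> when
  the arrival epochs and batch sizes are fixed.\<close>

fun prearr :: "(nat \<Rightarrow> real) \<Rightarrow> (nat \<Rightarrow> nat) \<Rightarrow> nat \<Rightarrow> nat \<Rightarrow> nat \<Rightarrow> ennreal" where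
  "prearr A B n0 0 j = ennreal (trans (A 0) n0 j)"
| "prearr A B n0 (Suc k) j = (\<Sum>m. prearr A B n0 k m * ennreal (trans (A (Suc k) - A k) (m + B k) j))"

lemma suminf_swap_ennreal: "(\<Sum>i. \<Sum>j. f i j) = (\<Sum>j. \<Sum>i. (f i j :: ennreal))"
proof -
  have "(\<Sum>i. \<Sum>j. f i j) = (\<Sum>i. \<integral>\<^sup>+j. f i j \<partial>count_space UNIV)" by (simp add: nn_integral_count_space_nat)
  also have "\<dots> = (\<integral>\<^sup>+j. (\<Sum>i. f i j) \<partial>count_space UNIV)" by (rule nn_integral_suminf[symmetric]) simp
  finally show ?thesis by (simp add: nn_integral_count_space_nat)
qed

lemma suminf_cmult_ennreal: "(\<Sum>i. c * f i) = c * (\<Sum>i. (f i :: ennreal))"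
  by (rule ennreal_suminf_cmult)

text \<open>The Chapman-Kolmogorov equation at the epoch of arrival \<open>k\<close>, proved by
  passing from arrival to arrival. It is what identifies \<open>prearr\<close> as the distribution
  found by arrival \<open>k\<close>.\<close>

lemma W_prearr:
  assumes A: "arrivals A" and k: "A k \<le> t"
  shows "W A B t j 0 n0 = (\<Sum>m. prearr A B n0 k m * W A B t j (A k) (m + B k))"
  using k
proof (induction k)
  case 0
  then show ?case using W_to_arrival[OF A, of 0 0 t B j n0] A by (simp add: arrivals_def)
next
  case (Suc k)
  have sm: "strict_mono A" using A by (simp add: arrivals_def)
  have lt: "A k < A (Suc k)" using sm by (simp add: strict_mono_less)
  have "W A B t j 0 n0 = (\<Sum>m. prearr A B n0 k m * W A B t j (A k) (m + B k))"
    using Suc lt by simp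
  also have "\<dots> = (\<Sum>m. prearr A B n0 k m * (\<Sum>i. ennreal (trans (A (Suc k) - A k) (m + B k) i) * W A B t j (A (Suc k)) (i + B (Suc k))))"
    using Suc.prems lt sm by (subst W_to_arrival[OF A, of "A k" "Suc k"]) (auto simp: strict_mono_less_eq)
  also have "\<dots> = (\<Sum>i. \<Sum>m. prearr A B n0 k m * ennreal (trans (A (Suc k) - A k) (m + B k) i) * W A B t j (A (Suc k)) (i + B (Suc k)))"
    unfolding suminf_cmult_ennreal[symmetric] by (subst suminf_swap_ennreal) (simp add: mult.assoc)
  also have "\<dots> = (\<Sum>m. prearr A B n0 (Suc k) m * W A B t j (A (Suc k)) (m + B (Suc k)))"
    by (simp add: ennreal_suminf_multc)
  finally show ?case .
qed

lemma W_before_first: "arrivals A \<Longrightarrow> 0 \<le> t \<Longrightarrow> t < A 0 \<Longrightarrow> W A B t j 0 n0 = ennreal (trans t n0 j)"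
  using W_to_end[of A 0 t 0 B j n0] by simp

lemma W_between:
  assumes A: "arrivals A" and k: "A k \<le> t" "t < A (Suc k)"
  shows "W A B t j 0 n0 = (\<Sum>m. prearr A B n0 k m * ennreal (trans (t - A k) (m + B k) j))"
proof -
  have sm: "strict_mono A" using A by (simp add: arrivals_def)
  show ?thesis
    unfolding W_prearr[OF A k(1)] using k
    by (subst W_to_end[OF A, of "A k" t "Suc k"]) (auto simp: strict_mono_less_eq[OF sm])
qed

end

section \<open>Law of the inputs\<close>

sublocale negative_disaster_queue \<subseteq> rates \<mu> \<eta> \<delta>
  by unfold_locales (rule \<mu>_pos \<eta>_pos \<delta>_pos)+

abbreviation input_space :: "(nat \<times> real) measure" where
  "input_space \<equiv> count_space UNIV \<Otimes>\<^sub>M borel"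

definition epoch_of :: "(input_index \<Rightarrow> nat \<times> real) \<Rightarrow> nat \<Rightarrow> real" where
  "epoch_of x k = snd (x Initial) + (\<Sum>i<k. snd (x (Gap i)))"

definition batch_of :: "(input_index \<Rightarrow> nat \<times> real) \<Rightarrow> nat \<Rightarrow> nat" where
  "batch_of x k = fst (x (Batch k))"

definition num_of :: "(input_index \<Rightarrow> nat \<times> real) \<Rightarrow> nat" where
  "num_of x = fst (x Initial)"

definition arrival_idx :: "input_index set" where
  "arrival_idx = insert Initial (range Gap \<union> range Batch)"

text \<open>The inputs that determine the epoch of arrival \<open>k\<close> and, through
  \<open>prearr\<close>, what that arrival finds. Gap \<open>k\<close> and batch \<open>k\<close>
  are left out: they describe what comes next and are independent of this block.\<close>

definition past_idx :: "nat \<Rightarrow> input_index set" where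
  "past_idx k = insert Initial (Gap ` {..<k} \<union> Batch ` {..<k})"

abbreviation coords :: "input_index set \<Rightarrow> (input_index \<Rightarrow> nat \<times> real) measure" where
  "coords J \<equiv> PiM J (\<lambda>_. input_space)"

lemma measurable_coord_snd: "i \<in> J \<Longrightarrow> (\<lambda>x. snd (x i)) \<in> borel_measurable (coords J)"
proof -
  assume "i \<in> J"
  then have "(\<lambda>x. x i) \<in> measurable (coords J) input_space" by (rule measurable_component_singleton)
  from measurable_compose[OF this measurable_snd] show ?thesis .
qed

lemma measurable_coord_fst: "i \<in> J \<Longrightarrow> (\<lambda>x. fst (x i)) \<in> measurable (coords J) (count_space UNIV)"
proof -
  assume "i \<in> J"
  then have "(\<lambda>x. x i) \<in> measurable (coords J) input_space" by (rule measurable_component_singleton)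
  from measurable_compose[OF this measurable_fst] show ?thesis .
qed

lemma measurable_epoch_of: "past_idx k \<subseteq> J \<Longrightarrow> (\<lambda>x. epoch_of x k) \<in> borel_measurable (coords J)"
  unfolding epoch_of_def
  by (intro borel_measurable_add borel_measurable_sum measurable_coord_snd) (auto simp: past_idx_def)

lemma measurable_batch_of: "Batch k \<in> J \<Longrightarrow> (\<lambda>x. batch_of x k) \<in> measurable (coords J) (count_space UNIV)"
  unfolding batch_of_def by (rule measurable_coord_fst)

lemma measurable_num_of: "Initial \<in> J \<Longrightarrow> num_of \<in> measurable (coords J) (count_space UNIV)"
  unfolding num_of_def[abs_def] by (rule measurable_coord_fst)

lemma past_subset_arrival: "past_idx k \<subseteq> arrival_idx"
  by (auto simp: past_idx_def arrival_idx_def)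

lemma (in rates) prearr_cong:
  assumes "\<And>i. i \<le> k \<Longrightarrow> A i = A' i" "\<And>i. i < k \<Longrightarrow> B i = B' i"
  shows "prearr A B n k j = prearr A' B' n k j"
  using assms
proof (induction k arbitrary: j)
  case (Suc k)
  have "prearr A B n k m = prearr A' B' n k m" for m using Suc by auto
  then show ?case using Suc.prems by simp
qed simp

lemma (in rates) measurable_trans_nat:
  assumes [measurable]: "d \<in> borel_measurable M" "n \<in> measurable M (count_space UNIV)"
  shows "(\<lambda>x. trans (d x) (n x) j) \<in> borel_measurable M"
  by (rule measurable_compose_countable[where g=n]) (auto intro: measurable_compose[OF _ measurable_trans])

lemma (in rates) measurable_prearr:
  assumes A: "\<And>i. i \<le> k \<Longrightarrow> (\<lambda>x. A x i) \<in> borel_measurable M"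
    and B: "\<And>i. i < k \<Longrightarrow> (\<lambda>x. B x i) \<in> measurable M (count_space UNIV)"
    and n: "n \<in> measurable M (count_space UNIV)"
  shows "(\<lambda>x. prearr (A x) (B x) (n x) k j) \<in> borel_measurable M"
  using A B
proof (induction k arbitrary: j)
  case 0
  then show ?case using n by (auto intro!: measurable_compose[OF _ measurable_ennreal] measurable_trans_nat)
next
  case (Suc k)
  have [measurable]: "(\<lambda>x. prearr (A x) (B x) (n x) k m) \<in> borel_measurable M" for m
    using Suc by auto
  have [measurable]: "(\<lambda>x. trans (A x (Suc k) - A x k) (m + B x k) j) \<in> borel_measurable M" for m
    using Suc.prems by (intro measurable_trans_nat borel_measurable_diff) (auto intro: measurable_compose[OF Suc.prems(2)])
  show ?case by simp
qed

lemma (in rates) prearr_sum: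
  assumes "arrivals A" shows "(\<Sum>j. prearr A B n k j) = 1"
proof (induction k)
  have 1: "(\<Sum>j. ennreal (trans d n j)) = 1" if "0 \<le> d" for d n
    using trans_fun_suminf[of d "\<lambda>_. 1" n] that by (simp add: trans_fun_def)
  {
    case 0
    show ?case using assms by (simp add: 1 arrivals_def)
  next
    case (Suc k)
    have "A k \<le> A (Suc k)" using assms by (simp add: arrivals_def strict_mono_less_eq)
    have "(\<Sum>j. prearr A B n (Suc k) j) = (\<Sum>m. \<Sum>j. prearr A B n k m * ennreal (trans (A (Suc k) - A k) (m + B k) j))"
      by (simp, subst suminf_swap_ennreal) simp
    also have "\<dots> = (\<Sum>m. prearr A B n k m)"
      using \<open>A k \<le> A (Suc k)\<close> by (simp add: 1)
    finally show ?case using Suc by simp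
  }
qed

context negative_disaster_queue
begin

definition inp :: "'a \<Rightarrow> input_index \<Rightarrow> nat \<times> real" where "inp \<omega> i = input_var Q i \<omega>"

lemma measurable_inp: "(\<lambda>\<omega>. inp \<omega> i) \<in> measurable M input_space"
  using indep by (auto simp: indep_vars_def inp_def)

lemma measurable_inp_restrict: "(\<lambda>\<omega>. restrict (inp \<omega>) J) \<in> measurable M (coords J)"
  by (rule measurable_restrict) (rule measurable_inp)

lemma epoch_inp: "arrival_epoch Q k \<omega> = epoch_of (inp \<omega>) k"
  by (simp add: arrival_epoch_def epoch_of_def inp_def)

lemma batch_inp: "batch Q k \<omega> = batch_of (inp \<omega>) k"
  by (simp add: batch_of_def inp_def)

lemma num_inp: "num0 Q \<omega> = num_of (inp \<omega>)"
  by (simp add: num_of_def inp_def)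

lemma epoch_restrict: "past_idx k \<subseteq> J \<Longrightarrow> epoch_of (restrict x J) k = epoch_of x k"
  by (auto simp: epoch_of_def past_idx_def intro!: sum.cong)

lemma batch_restrict: "Batch k \<in> J \<Longrightarrow> batch_of (restrict x J) k = batch_of x k"
  by (simp add: batch_of_def)

lemma num_restrict: "Initial \<in> J \<Longrightarrow> num_of (restrict x J) = num_of x"
  by (simp add: num_of_def)

lemma measurable_inputs[measurable]:
  "(\<lambda>\<omega>. arrival_epoch Q k \<omega>) \<in> borel_measurable M"
  "(\<lambda>\<omega>. batch Q k \<omega>) \<in> measurable M (count_space UNIV)"
  "(\<lambda>\<omega>. num0 Q \<omega>) \<in> measurable M (count_space UNIV)"
  "(\<lambda>\<omega>. res0 Q \<omega>) \<in> borel_measurable M"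
  "(\<lambda>\<omega>. gap Q k \<omega>) \<in> borel_measurable M"
  "(\<lambda>\<omega>. svc Q k \<omega>) \<in> borel_measurable M"
  "(\<lambda>\<omega>. neg Q k \<omega>) \<in> borel_measurable M"
  "(\<lambda>\<omega>. dis Q k \<omega>) \<in> borel_measurable M"
proof -
  have f: "(\<lambda>\<omega>. fst (inp \<omega> i)) \<in> measurable M (count_space UNIV)" for i
    by (rule measurable_compose[OF measurable_inp measurable_fst])
  have s: "(\<lambda>\<omega>. snd (inp \<omega> i)) \<in> borel_measurable M" for i
    by (rule measurable_compose[OF measurable_inp measurable_snd])
  show 1: "(\<lambda>\<omega>. gap Q k \<omega>) \<in> borel_measurable M" for k using s[of "Gap k"] by (simp add: inp_def)
  show 2: "(\<lambda>\<omega>. res0 Q \<omega>) \<in> borel_measurable M" using s[of Initial] by (simp add: inp_def)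
  show "(\<lambda>\<omega>. arrival_epoch Q k \<omega>) \<in> borel_measurable M" unfolding arrival_epoch_def
    by (intro borel_measurable_add borel_measurable_sum 1 2)
  show "(\<lambda>\<omega>. batch Q k \<omega>) \<in> measurable M (count_space UNIV)" using f[of "Batch k"] by (simp add: inp_def)
  show "(\<lambda>\<omega>. num0 Q \<omega>) \<in> measurable M (count_space UNIV)" using f[of Initial] by (simp add: inp_def)
  show "(\<lambda>\<omega>. svc Q k \<omega>) \<in> borel_measurable M" using s[of "Svc k"] by (simp add: inp_def)
  show "(\<lambda>\<omega>. neg Q k \<omega>) \<in> borel_measurable M" using s[of "Neg k"] by (simp add: inp_def)
  show "(\<lambda>\<omega>. dis Q k \<omega>) \<in> borel_measurable M" using s[of "Dis k"] by (simp add: inp_def)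
qed

lemma measurable_num_customers[measurable (raw)]:
  assumes [measurable]: "t \<in> borel_measurable N" "f \<in> measurable N M"
  shows "(\<lambda>x. num_customers Q (t x) (f x)) \<in> measurable N (count_space UNIV)"
  unfolding num_customers_eq_cust
  by (rule measurable_cust[where B="\<lambda>x k. batch Q k (f x)"]) (auto intro!: measurable_compose[OF assms(2)])

lemma measurable_remaining_time[measurable]: "remaining_time Q t \<in> borel_measurable M"
proof -
  have "(\<lambda>\<omega>. arrival_epoch Q (LEAST k. t < arrival_epoch Q k \<omega>) \<omega>) \<in> borel_measurable M"
    by (rule measurable_compose_countable[where f="\<lambda>k \<omega>. arrival_epoch Q k \<omega>"]) measurable
  then show ?thesis unfolding remaining_time_def[abs_def] by measurable
qed

lemma indep_blocks:
  assumes "J \<inter> K = {}"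
  shows "indep_var (coords J) (\<lambda>\<omega>. restrict (inp \<omega>) J) (coords K) (\<lambda>\<omega>. restrict (inp \<omega>) K)"
  unfolding inp_def using indep_var_restrict[OF indep assms] by simp

lemma iid_law:
  assumes inj: "inj c" and D: "\<And>k. distributed M lborel (\<lambda>\<omega>. snd (inp \<omega> (c k))) f"
    and N: "N = density lborel f"
  shows "distr M (iid N) (\<lambda>\<omega> k. snd (inp \<omega> (c k))) = iid N"
proof -
  have setsN: "sets N = sets borel" unfolding N by simp
  have mk: "(\<lambda>\<omega>. snd (inp \<omega> (c k))) \<in> borel_measurable M" for k
    by (rule measurable_compose[OF measurable_inp measurable_snd])
  have "indep_vars (\<lambda>k. coords {c k}) (\<lambda>k \<omega>. restrict (\<lambda>i. input_var Q i \<omega>) {c k}) UNIV"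
    using inj by (intro indep_vars_restrict[OF indep]) (auto simp: disjoint_family_on_def inj_def)
  then have "indep_vars (\<lambda>_. borel) (\<lambda>k \<omega>. snd ((restrict (\<lambda>i. input_var Q i \<omega>) {c k}) (c k))) UNIV"
    by (rule indep_vars_compose2) (auto intro!: measurable_coord_snd)
  then have "indep_vars (\<lambda>_. borel) (\<lambda>k \<omega>. snd (inp \<omega> (c k))) UNIV"
    by (simp add: inp_def)
  then have "distr M (iid borel) (\<lambda>\<omega>. \<lambda>k\<in>UNIV. snd (inp \<omega> (c k))) = PiM UNIV (\<lambda>k. distr M borel (\<lambda>\<omega>. snd (inp \<omega> (c k))))"
    using mk by (subst (asm) indep_vars_iff_distr_eq_PiM) auto
  moreover have "distr M borel (\<lambda>\<omega>. snd (inp \<omega> (c k))) = N" for k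
  proof -
    have "distr M borel (\<lambda>\<omega>. snd (inp \<omega> (c k))) = distr M lborel (\<lambda>\<omega>. snd (inp \<omega> (c k)))"
      by (rule distr_cong) auto
    then show ?thesis using distributed_distr_eq_density[OF D] N by simp
  qed
  moreover have "distr M (iid N) (\<lambda>\<omega> k. snd (inp \<omega> (c k))) = distr M (iid borel) (\<lambda>\<omega>. \<lambda>k\<in>UNIV. snd (inp \<omega> (c k)))"
    by (rule distr_cong) (auto intro!: sets_PiM_cong simp: setsN)
  ultimately show ?thesis by simp
qed

abbreviation gap_law :: "real measure" where "gap_law \<equiv> density lborel (\<lambda>t. ennreal (a t))"

lemma laws:
  "distr M (iid (expo \<mu>)) (\<lambda>\<omega> k. svc Q k \<omega>) = iid (expo \<mu>)"
  "distr M (iid (expo \<eta>)) (\<lambda>\<omega> k. neg Q k \<omega>) = iid (expo \<eta>)"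
  "distr M (iid (expo \<delta>)) (\<lambda>\<omega> k. dis Q k \<omega>) = iid (expo \<delta>)"
  "distr M (iid gap_law) (\<lambda>\<omega> k. gap Q k \<omega>) = iid gap_law"
  using iid_law[of Svc "\<lambda>t. ennreal (exponential_density \<mu> t)"] svc_exp
    iid_law[of Neg "\<lambda>t. ennreal (exponential_density \<eta> t)"] neg_exp
    iid_law[of Dis "\<lambda>t. ennreal (exponential_density \<delta> t)"] dis_exp
    iid_law[of Gap "\<lambda>t. ennreal (a t)"] gap_density
  by (simp_all add: inp_def inj_def)

text \<open>Functions of disjoint blocks of inputs are independent. Both functions are required to
  ignore coordinates outside their block, so that they can be applied to the full input without
  restrictions in the result.\<close>

lemma block_law:
  assumes JK: "J \<inter> K = {}" and f[measurable]: "f \<in> measurable (coords J) S" and h[measurable]: "h \<in> measurable (coords K) T"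
    and fJ: "\<And>x. f (restrict x J) = f x" and hK: "\<And>x. h (restrict x K) = h x"
  shows "distr M (S \<Otimes>\<^sub>M T) (\<lambda>\<omega>. (f (inp \<omega>), h (inp \<omega>))) =
     distr M S (\<lambda>\<omega>. f (inp \<omega>)) \<Otimes>\<^sub>M distr M T (\<lambda>\<omega>. h (inp \<omega>))"
proof -
  note [measurable] = measurable_inp_restrict
  let ?MJ = "distr M (coords J) (\<lambda>\<omega>. restrict (inp \<omega>) J)" and ?MK = "distr M (coords K) (\<lambda>\<omega>. restrict (inp \<omega>) K)"
  interpret K: prob_space ?MK by (rule prob_space_distr) measurable
  interpret H: prob_space "distr ?MK T h" by (rule K.prob_space_distr) measurable
  have eq: "?MJ \<Otimes>\<^sub>M ?MK = distr M (coords J \<Otimes>\<^sub>M coords K) (\<lambda>\<omega>. (restrict (inp \<omega>) J, restrict (inp \<omega>) K))"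
    using indep_blocks[OF JK] by (simp add: indep_var_distribution_eq)
  have "distr ?MJ S f \<Otimes>\<^sub>M distr ?MK T h = distr (?MJ \<Otimes>\<^sub>M ?MK) (S \<Otimes>\<^sub>M T) (\<lambda>(x, y). (f x, h y))"
    by (rule pair_measure_distr) (use H.sigma_finite_measure_axioms in auto)
  also have "\<dots> = distr M (S \<Otimes>\<^sub>M T) (\<lambda>\<omega>. (f (restrict (inp \<omega>) J), h (restrict (inp \<omega>) K)))"
    unfolding eq by (subst distr_distr) (auto simp: comp_def)
  finally show ?thesis by (simp add: distr_distr comp_def fJ hK)
qed

lemma measurable_seq_coords:
  "range c \<subseteq> J \<Longrightarrow> (\<lambda>x k. snd (x (c k))) \<in> measurable (coords J) (iid (expo l))"
  by (intro measurable_iid_intro measurable_coord_snd) auto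

lemma clocks_law:
  "distr M clk (\<lambda>\<omega>. (\<lambda>k. svc Q k \<omega>, \<lambda>k. neg Q k \<omega>, \<lambda>k. dis Q k \<omega>)) = clk"
proof -
  note m = measurable_seq_coords
  have 1: "distr M (iid (expo \<eta>) \<Otimes>\<^sub>M iid (expo \<delta>)) (\<lambda>\<omega>. ((\<lambda>k. snd (inp \<omega> (Neg k))), (\<lambda>k. snd (inp \<omega> (Dis k))))) =
     distr M (iid (expo \<eta>)) (\<lambda>\<omega> k. snd (inp \<omega> (Neg k))) \<Otimes>\<^sub>M distr M (iid (expo \<delta>)) (\<lambda>\<omega> k. snd (inp \<omega> (Dis k)))"
    by (rule block_law[of "range Neg" "range Dis" "\<lambda>x k. snd (x (Neg k))" _ "\<lambda>x k. snd (x (Dis k))"]) (auto intro!: m)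
  have 2: "distr M clk (\<lambda>\<omega>. ((\<lambda>k. snd (inp \<omega> (Svc k))), ((\<lambda>k. snd (inp \<omega> (Neg k))), (\<lambda>k. snd (inp \<omega> (Dis k)))))) =
     distr M (iid (expo \<mu>)) (\<lambda>\<omega> k. snd (inp \<omega> (Svc k))) \<Otimes>\<^sub>M
     distr M (iid (expo \<eta>) \<Otimes>\<^sub>M iid (expo \<delta>)) (\<lambda>\<omega>. ((\<lambda>k. snd (inp \<omega> (Neg k))), (\<lambda>k. snd (inp \<omega> (Dis k)))))"
    by (rule block_law[of "range Svc" "range Neg \<union> range Dis" "\<lambda>x k. snd (x (Svc k))" _
        "\<lambda>x. ((\<lambda>k. snd (x (Neg k))), (\<lambda>k. snd (x (Dis k))))"]) (auto intro!: m measurable_Pair)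
  show ?thesis
    using 2 unfolding 1 using laws(1-3) by (simp add: inp_def)
qed

lemma clocks_indep:
  "distr M (coords arrival_idx \<Otimes>\<^sub>M clk) (\<lambda>\<omega>. (restrict (inp \<omega>) arrival_idx, (\<lambda>k. svc Q k \<omega>, \<lambda>k. neg Q k \<omega>, \<lambda>k. dis Q k \<omega>))) =
   distr M (coords arrival_idx) (\<lambda>\<omega>. restrict (inp \<omega>) arrival_idx) \<Otimes>\<^sub>M clk"
proof -
  note m = measurable_seq_coords
  have "distr M (coords arrival_idx \<Otimes>\<^sub>M clk) (\<lambda>\<omega>. (restrict (inp \<omega>) arrival_idx,
       ((\<lambda>k. snd (inp \<omega> (Svc k))), (\<lambda>k. snd (inp \<omega> (Neg k))), (\<lambda>k. snd (inp \<omega> (Dis k)))))) =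
     distr M (coords arrival_idx) (\<lambda>\<omega>. restrict (inp \<omega>) arrival_idx) \<Otimes>\<^sub>M
     distr M clk (\<lambda>\<omega>. ((\<lambda>k. snd (inp \<omega> (Svc k))), (\<lambda>k. snd (inp \<omega> (Neg k))), (\<lambda>k. snd (inp \<omega> (Dis k)))))"
  proof (rule block_law[of arrival_idx "range Svc \<union> range Neg \<union> range Dis" "\<lambda>x. restrict x arrival_idx" _
        "\<lambda>x. ((\<lambda>k. snd (x (Svc k))), (\<lambda>k. snd (x (Neg k))), (\<lambda>k. snd (x (Dis k))))"])
    show "(\<lambda>x. restrict x arrival_idx) \<in> measurable (coords arrival_idx) (coords arrival_idx)"
      by (rule measurable_restrict) (rule measurable_component_singleton)
  qed (auto intro!: m measurable_Pair simp: arrival_idx_def)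
  then show ?thesis using clocks_law by (simp add: inp_def)
qed

section \<open>Conditioning on the arrivals\<close>

lemma nn_integral_condition_clocks:
  assumes G[measurable]: "G \<in> borel_measurable (coords arrival_idx \<Otimes>\<^sub>M clk)"
  shows "(\<integral>\<^sup>+\<omega>. G (restrict (inp \<omega>) arrival_idx, (\<lambda>k. svc Q k \<omega>, \<lambda>k. neg Q k \<omega>, \<lambda>k. dis Q k \<omega>)) \<partial>M) =
    (\<integral>\<^sup>+\<omega>. \<integral>\<^sup>+w. G (restrict (inp \<omega>) arrival_idx, w) \<partial>clk \<partial>M)"
proof -
  interpret C: prob_space clk using mu eta delta by (intro prob_space_clocks)
  note [measurable] = measurable_inp_restrict
  have rv: "random_variable clk (\<lambda>\<omega>. (\<lambda>k. svc Q k \<omega>, \<lambda>k. neg Q k \<omega>, \<lambda>k. dis Q k \<omega>))"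
    by (intro measurable_Pair measurable_iid_intro) auto
  note eq = clocks_indep[symmetric]
  have "(\<integral>\<^sup>+\<omega>. G (restrict (inp \<omega>) arrival_idx, (\<lambda>k. svc Q k \<omega>, \<lambda>k. neg Q k \<omega>, \<lambda>k. dis Q k \<omega>)) \<partial>M) =
    (\<integral>\<^sup>+z. G z \<partial>(distr M (coords arrival_idx) (\<lambda>\<omega>. restrict (inp \<omega>) arrival_idx) \<Otimes>\<^sub>M clk))"
    unfolding eq using rv by (subst nn_integral_distr) auto
  also have "\<dots> = (\<integral>\<^sup>+x. \<integral>\<^sup>+w. G (x, w) \<partial>clk \<partial>distr M (coords arrival_idx) (\<lambda>\<omega>. restrict (inp \<omega>) arrival_idx))"
    by (subst C.nn_integral_fst[symmetric]) auto
  also have "\<dots> = (\<integral>\<^sup>+\<omega>. \<integral>\<^sup>+w. G (restrict (inp \<omega>) arrival_idx, w) \<partial>clk \<partial>M)"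
    by (subst nn_integral_distr) auto
  finally show ?thesis .
qed

text \<open>A version of the conditional probability of \<open>j\<close> customers at time
  \<open>t\<close>, given the arrival epochs, the batch sizes and the initial number.\<close>

definition cond_prob :: "real \<Rightarrow> nat \<Rightarrow> 'a \<Rightarrow> ennreal" where
  "cond_prob t j \<omega> = W (\<lambda>k. arrival_epoch Q k \<omega>) (\<lambda>k. batch Q k \<omega>) t j 0 (num0 Q \<omega>)"

text \<open>Clocks and arrivals are independent, so the clocks can be integrated out first. The
  weight \<open>Z\<close> may be any measurable nonnegative function of the arrival epochs; events
  about the remaining time are of this kind, which gives access to the joint law of N(t) and
  U(t).\<close>

lemma num_customers_condition:
  assumes Z: "(\<lambda>x. Z (epoch_of x)) \<in> borel_measurable (coords arrival_idx)"
  shows "(\<integral>\<^sup>+\<omega>. of_bool (num_customers Q t \<omega> = j) * Z (\<lambda>k. arrival_epoch Q k \<omega>) \<partial>M) =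
    (\<integral>\<^sup>+\<omega>. cond_prob t j \<omega> * Z (\<lambda>k. arrival_epoch Q k \<omega>) \<partial>M)"
proof -
  interpret C: prob_space clk using mu eta delta by (intro prob_space_clocks)
  define G where "G = (\<lambda>(x, w). of_bool (cust_seq (epoch_of x) (batch_of x) t 0 (num_of x) (fst w) (fst (snd w)) (snd (snd w)) = j) *
     Z (epoch_of x))"
  have Z'[measurable]: "(\<lambda>p. Z (epoch_of (fst p))) \<in> borel_measurable (coords arrival_idx \<Otimes>\<^sub>M clk)"
    by (rule measurable_compose[OF measurable_fst Z])
  have [measurable]: "(\<lambda>p. cust_seq (epoch_of (fst p)) (batch_of (fst p)) t 0 (num_of (fst p))
      (fst (snd p)) (fst (snd (snd p))) (snd (snd (snd p)))) \<in> measurable (coords arrival_idx \<Otimes>\<^sub>M clk) (count_space UNIV)"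
    unfolding cust_seq_def
  proof (rule measurable_cust)
    show "(\<lambda>\<omega>. epoch_of (fst \<omega>) k) \<in> borel_measurable (coords arrival_idx \<Otimes>\<^sub>M clk)" for k
      by (rule measurable_compose[OF measurable_fst measurable_epoch_of[OF past_subset_arrival]])
    show "(\<lambda>\<omega>. batch_of (fst \<omega>) k) \<in> measurable (coords arrival_idx \<Otimes>\<^sub>M clk) (count_space UNIV)" for k
      by (rule measurable_compose[OF measurable_fst measurable_batch_of]) (simp add: arrival_idx_def)
    show "(\<lambda>x. num_of (fst x)) \<in> measurable (coords arrival_idx \<Otimes>\<^sub>M clk) (count_space UNIV)"
      by (rule measurable_compose[OF measurable_fst measurable_num_of]) (simp add: arrival_idx_def)
  qed (rule measurable_iid_component, measurable)+
  have [measurable]: "G \<in> borel_measurable (coords arrival_idx \<Otimes>\<^sub>M clk)"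
    unfolding G_def case_prod_beta' by measurable
  have e: "epoch_of (restrict (inp \<omega>) arrival_idx) = (\<lambda>k. arrival_epoch Q k \<omega>)"
    "batch_of (restrict (inp \<omega>) arrival_idx) = (\<lambda>k. batch Q k \<omega>)"
    "num_of (restrict (inp \<omega>) arrival_idx) = num0 Q \<omega>" for \<omega>
  proof -
    show "epoch_of (restrict (inp \<omega>) arrival_idx) = (\<lambda>k. arrival_epoch Q k \<omega>)"
      by (intro ext) (simp add: epoch_inp epoch_restrict[OF past_subset_arrival])
    show "batch_of (restrict (inp \<omega>) arrival_idx) = (\<lambda>k. batch Q k \<omega>)"
      by (intro ext) (simp add: batch_inp batch_restrict arrival_idx_def)
    show "num_of (restrict (inp \<omega>) arrival_idx) = num0 Q \<omega>"
      by (simp add: num_inp num_restrict arrival_idx_def)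
  qed
  have "(\<integral>\<^sup>+\<omega>. of_bool (num_customers Q t \<omega> = j) * Z (\<lambda>k. arrival_epoch Q k \<omega>) \<partial>M) =
    (\<integral>\<^sup>+\<omega>. G (restrict (inp \<omega>) arrival_idx, (\<lambda>k. svc Q k \<omega>, \<lambda>k. neg Q k \<omega>, \<lambda>k. dis Q k \<omega>)) \<partial>M)"
    by (simp add: G_def e num_customers_eq_cust cust_seq_def)
  also have "\<dots> = (\<integral>\<^sup>+\<omega>. \<integral>\<^sup>+w. G (restrict (inp \<omega>) arrival_idx, w) \<partial>clk \<partial>M)"
    by (rule nn_integral_condition_clocks) measurable
  also have "\<dots> = (\<integral>\<^sup>+\<omega>. cond_prob t j \<omega> * Z (\<lambda>k. arrival_epoch Q k \<omega>) \<partial>M)"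
    unfolding cond_prob_def W_def G_def
    by (intro nn_integral_cong, simp add: e I_def[symmetric]) (subst nn_integral_multc, auto)
  finally show ?thesis .
qed

abbreviation epoch :: "'a \<Rightarrow> nat \<Rightarrow> real" where "epoch \<omega> \<equiv> (\<lambda>k. arrival_epoch Q k \<omega>)"

text \<open>The conditional probability, given the arrivals, that arrival \<open>k\<close> finds
  \<open>j\<close> customers. Expectations of \<open>rho\<close> times functions of the epoch of
  arrival \<open>k\<close> replace expectations over the actual path.\<close>

definition rho :: "nat \<Rightarrow> nat \<Rightarrow> 'a \<Rightarrow> ennreal" where
  "rho k j \<omega> = prearr (epoch \<omega>) (\<lambda>k. batch Q k \<omega>) (num0 Q \<omega>) k j"

lemma measurable_rho[measurable]: "rho k j \<in> borel_measurable M"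
  unfolding rho_def[abs_def] by (rule measurable_prearr) auto

lemma a_measurable[measurable]: "a \<in> borel_measurable borel"
proof -
  have "(\<lambda>t. ennreal (a t)) \<in> borel_measurable lborel"
    using gap_density[of 0] by (simp add: distributed_def)
  then have "(\<lambda>t. enn2real (ennreal (a t))) \<in> borel_measurable lborel" by (rule measurable_compose) simp
  then show ?thesis using a_nonneg by simp
qed

lemma gap_distr: "distr M borel (gap Q k) = gap_law"
proof -
  have "distr M borel (gap Q k) = distr M lborel (gap Q k)" by (rule distr_cong) auto
  then show ?thesis using distributed_distr_eq_density[OF gap_density[of k]] by simp
qed

lemma prob_gap_law: "prob_space gap_law"
  using prob_space_distr[of "gap Q 0" borel] unfolding gap_distr by simp

lemma AE_gap_law_pos: "AE x in gap_law. 0 < x"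
proof -
  have "AE x in lborel. x \<noteq> (0::real)" by (rule AE_lborel_singleton)
  then have "AE x in lborel. 0 < ennreal (a x) \<longrightarrow> 0 < x"
  proof eventually_elim
    case (elim x)
    show ?case using elim a_support[of x] by (cases "x < 0") auto
  qed
  then show ?thesis by (subst AE_density) auto
qed

lemma AE_gaps_regular: "AE \<omega> in M. regular (\<lambda>k. gap Q k \<omega>)"
proof -
  have "AE x in distr M (iid gap_law) (\<lambda>\<omega> k. gap Q k \<omega>). regular x"
    unfolding laws(4) by (intro AE_iid_regular prob_gap_law AE_gap_law_pos) simp
  then show ?thesis
    by (rule AE_distrD[rotated]) (auto intro!: measurable_iid_intro)
qed

lemma epoch_Suc: "arrival_epoch Q (Suc k) \<omega> = arrival_epoch Q k \<omega> + gap Q k \<omega>"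
  by (simp add: arrival_epoch_def)

lemma AE_arrivals: "AE \<omega> in M. arrivals (epoch \<omega>)"
  using AE_gaps_regular res0_pos
proof eventually_elim
  case (elim \<omega>)
  have "strict_mono (epoch \<omega>)"
    using elim by (intro strict_monoI_Suc) (simp add: epoch_Suc regular_def)
  moreover have "\<exists>k. t < epoch \<omega> k" for t
  proof -
    obtain k where "t < (\<Sum>i\<le>k. gap Q i \<omega>)" using elim by (auto simp: regular_def)
    then have "t < arrival_epoch Q (Suc k) \<omega>"
      using elim by (simp add: arrival_epoch_def lessThan_Suc_atMost)
    then show ?thesis by blast
  qed
  moreover have "0 < epoch \<omega> 0" using elim by (simp add: arrival_epoch_def)
  ultimately show ?case by (simp add: arrivals_def)
qed

lemma g_nonneg: "1 \<le> i \<Longrightarrow> i \<le> b \<Longrightarrow> 0 \<le> g i"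
  using batch_size[of i 0] by (metis measure_nonneg)

lemma AE_batch: "AE \<omega> in M. batch Q k \<omega> \<in> {1..b}"
proof -
  have "prob (\<Union>i\<in>{1..b}. {\<omega> \<in> space M. batch Q k \<omega> = i}) = (\<Sum>i\<in>{1..b}. prob {\<omega> \<in> space M. batch Q k \<omega> = i})"
    by (rule finite_measure_finite_Union) (auto simp: disjoint_family_on_def)
  also have "\<dots> = 1" using g_sum batch_size by simp
  also have "(\<Union>i\<in>{1..b}. {\<omega> \<in> space M. batch Q k \<omega> = i}) = {\<omega> \<in> space M. batch Q k \<omega> \<in> {1..b}}" by auto
  finally show ?thesis by (subst prob_Collect_eq_1[symmetric]) auto
qed

lemma nn_integral_batch:
  "(\<integral>\<^sup>+\<omega>. f (batch Q k \<omega>) \<partial>M) = (\<Sum>i=1..b. ennreal (g i) * f i)"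
proof -
  have "(\<integral>\<^sup>+\<omega>. f (batch Q k \<omega>) \<partial>M) = (\<integral>\<^sup>+\<omega>. (\<Sum>i=1..b. f i * indicator {\<omega> \<in> space M. batch Q k \<omega> = i} \<omega>) \<partial>M)"
  proof (rule nn_integral_cong_AE)
    show "AE \<omega> in M. f (batch Q k \<omega>) = (\<Sum>i=1..b. f i * indicator {\<omega> \<in> space M. batch Q k \<omega> = i} \<omega>)"
      using AE_batch[of k] AE_space
    proof eventually_elim
      case (elim \<omega>)
      have "(\<Sum>i=1..b. f i * indicator {\<omega> \<in> space M. batch Q k \<omega> = i} \<omega>) = (\<Sum>i\<in>{batch Q k \<omega>}. f i)"
        using elim by (intro sum.mono_neutral_cong_right) (auto simp: indicator_def)
      then show ?case by simp
    qed
  qed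
  also have "\<dots> = (\<Sum>i=1..b. f i * emeasure M {\<omega> \<in> space M. batch Q k \<omega> = i})"
    by (subst nn_integral_sum) (auto simp: nn_integral_cmult_indicator)
  also have "\<dots> = (\<Sum>i=1..b. ennreal (g i) * f i)"
    by (intro sum.cong) (auto simp: emeasure_eq_measure batch_size mult.commute)
  finally show ?thesis .
qed

lemma rho_inp: "rho k m \<omega> = prearr (epoch_of (inp \<omega>)) (batch_of (inp \<omega>)) (num_of (inp \<omega>)) k m"
  by (simp add: rho_def epoch_inp batch_inp num_inp)

lemma past_law:
  "distr M ((borel \<Otimes>\<^sub>M borel) \<Otimes>\<^sub>M (borel \<Otimes>\<^sub>M count_space UNIV))
     (\<lambda>\<omega>. ((arrival_epoch Q k \<omega>, rho k m \<omega>), (gap Q k \<omega>, batch Q k \<omega>))) =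
   distr M (borel \<Otimes>\<^sub>M borel) (\<lambda>\<omega>. (arrival_epoch Q k \<omega>, rho k m \<omega>)) \<Otimes>\<^sub>M
     (gap_law \<Otimes>\<^sub>M distr M (count_space UNIV) (batch Q k))"
proof -
  have 1: "distr M (borel \<Otimes>\<^sub>M count_space UNIV) (\<lambda>\<omega>. (snd (inp \<omega> (Gap k)), fst (inp \<omega> (Batch k)))) =
    distr M borel (\<lambda>\<omega>. snd (inp \<omega> (Gap k))) \<Otimes>\<^sub>M distr M (count_space UNIV) (\<lambda>\<omega>. fst (inp \<omega> (Batch k)))"
    by (rule block_law[of "{Gap k}" "{Batch k}" "\<lambda>x. snd (x (Gap k))" _ "\<lambda>x. fst (x (Batch k))"])
      (auto intro!: measurable_coord_snd measurable_coord_fst)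
  have ep: "epoch_of (restrict x (past_idx k)) i = epoch_of x i" if "i \<le> k" for x i
    using that by (intro epoch_restrict) (auto simp: past_idx_def)
  have ba: "batch_of (restrict x (past_idx k)) i = batch_of x i" if "i < k" for x i
    using that by (intro batch_restrict) (auto simp: past_idx_def)
  have pr: "prearr (epoch_of (restrict x (past_idx k))) (batch_of (restrict x (past_idx k))) (num_of (restrict x (past_idx k))) k m =
    prearr (epoch_of x) (batch_of x) (num_of x) k m" for x
    by (subst num_restrict, simp add: past_idx_def, rule prearr_cong) (auto intro: ep ba)
  have me: "(\<lambda>x. epoch_of x i) \<in> borel_measurable (coords (past_idx k))" if "i \<le> k" for i
    using that by (intro measurable_epoch_of) (auto simp: past_idx_def)
  have mb: "(\<lambda>x. batch_of x i) \<in> measurable (coords (past_idx k)) (count_space UNIV)" if "i < k" for i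
    using that by (intro measurable_batch_of) (auto simp: past_idx_def)
  have mn: "num_of \<in> measurable (coords (past_idx k)) (count_space UNIV)"
    by (intro measurable_num_of) (auto simp: past_idx_def)
  have 2: "distr M ((borel \<Otimes>\<^sub>M borel) \<Otimes>\<^sub>M (borel \<Otimes>\<^sub>M count_space UNIV))
     (\<lambda>\<omega>. ((epoch_of (inp \<omega>) k, prearr (epoch_of (inp \<omega>)) (batch_of (inp \<omega>)) (num_of (inp \<omega>)) k m),
        (snd (inp \<omega> (Gap k)), fst (inp \<omega> (Batch k))))) =
     distr M (borel \<Otimes>\<^sub>M borel) (\<lambda>\<omega>. (epoch_of (inp \<omega>) k, prearr (epoch_of (inp \<omega>)) (batch_of (inp \<omega>)) (num_of (inp \<omega>)) k m)) \<Otimes>\<^sub>M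
     distr M (borel \<Otimes>\<^sub>M count_space UNIV) (\<lambda>\<omega>. (snd (inp \<omega> (Gap k)), fst (inp \<omega> (Batch k))))"
    by (rule block_law[of "past_idx k" "{Gap k, Batch k}"
        "\<lambda>x. (epoch_of x k, prearr (epoch_of x) (batch_of x) (num_of x) k m)" _ "\<lambda>x. (snd (x (Gap k)), fst (x (Batch k)))"])
      (auto intro!: measurable_Pair measurable_coord_snd measurable_coord_fst measurable_prearr me mb mn
        simp: ep pr, auto simp: past_idx_def)
  have "gap Q k = (\<lambda>\<omega>. snd (inp \<omega> (Gap k)))" "batch Q k = (\<lambda>\<omega>. fst (inp \<omega> (Batch k)))"
    by (auto simp: inp_def fun_eq_iff)
  then show ?thesis using 2 unfolding 1 epoch_inp rho_inp by (simp add: gap_distr[of k, symmetric])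
qed

text \<open>The Markov step at arrival \<open>k\<close>: its epoch and \<open>rho k m\<close> are
  functions of the past, while the following gap and the batch are independent of the past and of
  each other. The one-step estimates and recursions over \<open>k\<close> that follow use it,
  directly or through \<open>nn_integral_next_total\<close>.\<close>

lemma nn_integral_next:
  assumes f[measurable]: "f \<in> borel_measurable (borel \<Otimes>\<^sub>M borel \<Otimes>\<^sub>M count_space UNIV)"
  shows "(\<integral>\<^sup>+\<omega>. rho k m \<omega> * f (arrival_epoch Q k \<omega>, gap Q k \<omega>, batch Q k \<omega>) \<partial>M) =
    (\<integral>\<^sup>+\<omega>. rho k m \<omega> * (\<Sum>i=1..b. ennreal (g i) * (\<integral>\<^sup>+x. f (arrival_epoch Q k \<omega>, x, i) \<partial>gap_law)) \<partial>M)"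
proof -
  interpret G: prob_space gap_law by (rule prob_gap_law)
  interpret B: prob_space "distr M (count_space UNIV) (batch Q k)" by (rule prob_space_distr) simp
  interpret GB: prob_space "gap_law \<Otimes>\<^sub>M distr M (count_space UNIV) (batch Q k)"
    by (intro prob_space_pair) unfold_locales
  interpret GB': pair_sigma_finite gap_law "distr M (count_space UNIV) (batch Q k)" ..
  let ?P = "distr M (borel \<Otimes>\<^sub>M borel) (\<lambda>\<omega>. (arrival_epoch Q k \<omega>, rho k m \<omega>))"
  have "(\<integral>\<^sup>+\<omega>. rho k m \<omega> * f (arrival_epoch Q k \<omega>, gap Q k \<omega>, batch Q k \<omega>) \<partial>M) =
    (\<integral>\<^sup>+z. snd (fst z) * f (fst (fst z), snd z) \<partial>distr M ((borel \<Otimes>\<^sub>M borel) \<Otimes>\<^sub>M (borel \<Otimes>\<^sub>M count_space UNIV))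
     (\<lambda>\<omega>. ((arrival_epoch Q k \<omega>, rho k m \<omega>), (gap Q k \<omega>, batch Q k \<omega>))))"
    by (subst nn_integral_distr) auto
  also have "\<dots> = (\<integral>\<^sup>+x. \<integral>\<^sup>+y. snd x * f (fst x, y) \<partial>(gap_law \<Otimes>\<^sub>M distr M (count_space UNIV) (batch Q k)) \<partial>?P)"
    unfolding past_law by (subst GB.nn_integral_fst[symmetric]) auto
  also have "\<dots> = (\<integral>\<^sup>+x. snd x * (\<integral>\<^sup>+y. f (fst x, y) \<partial>(gap_law \<Otimes>\<^sub>M distr M (count_space UNIV) (batch Q k))) \<partial>?P)"
    by (intro nn_integral_cong nn_integral_cmult) simp
  also have "\<dots> = (\<integral>\<^sup>+x. snd x * (\<Sum>i=1..b. ennreal (g i) * (\<integral>\<^sup>+y. f (fst x, y, i) \<partial>gap_law)) \<partial>?P)"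
  proof (intro nn_integral_cong arg_cong2[of _ _ _ _ "(*)"] refl)
    fix x :: "real \<times> ennreal"
    have "(\<integral>\<^sup>+y. f (fst x, y) \<partial>(gap_law \<Otimes>\<^sub>M distr M (count_space UNIV) (batch Q k))) =
      (\<integral>\<^sup>+i. \<integral>\<^sup>+y. f (fst x, y, i) \<partial>gap_law \<partial>distr M (count_space UNIV) (batch Q k))"
      by (subst GB'.nn_integral_snd[symmetric]) auto
    also have "\<dots> = (\<integral>\<^sup>+\<omega>. \<integral>\<^sup>+y. f (fst x, y, batch Q k \<omega>) \<partial>gap_law \<partial>M)"
      by (subst nn_integral_distr) auto
    also have "\<dots> = (\<Sum>i=1..b. ennreal (g i) * (\<integral>\<^sup>+y. f (fst x, y, i) \<partial>gap_law))"
      by (rule nn_integral_batch)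
    finally show "(\<integral>\<^sup>+y. f (fst x, y) \<partial>(gap_law \<Otimes>\<^sub>M distr M (count_space UNIV) (batch Q k))) =
      (\<Sum>i=1..b. ennreal (g i) * (\<integral>\<^sup>+y. f (fst x, y, i) \<partial>gap_law))" .
  qed
  also have "\<dots> = (\<integral>\<^sup>+\<omega>. rho k m \<omega> * (\<Sum>i=1..b. ennreal (g i) * (\<integral>\<^sup>+x. f (arrival_epoch Q k \<omega>, x, i) \<partial>gap_law)) \<partial>M)"
    by (subst nn_integral_distr) auto
  finally show ?thesis .
qed

end

text \<open>A supremum argument that uses no continuity. Let u be the supremum of the times in
  [t0, t] at which f is at least f t0. The left condition, that values shortly before a time hardly
  exceed the value at that time, shows that u belongs to this set; the right condition would push
  the set beyond u if u < t.\<close>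

lemma growth:
  fixes f :: "real \<Rightarrow> real"
  assumes left: "\<And>t e. t0 < t \<Longrightarrow> 0 < e \<Longrightarrow> \<exists>d>0. \<forall>s. t - d < s \<longrightarrow> s < t \<longrightarrow> f s \<le> f t + e"
    and right: "\<And>t. t0 \<le> t \<Longrightarrow> eventually (\<lambda>h. f t \<le> f (t + h)) (at_right 0)"
    and "t0 \<le> t"
  shows "f t0 \<le> f t"
proof -
  define S where "S = {s. t0 \<le> s \<and> s \<le> t \<and> f t0 \<le> f s}"
  have ne: "t0 \<in> S" using assms by (simp add: S_def)
  have bdd: "bdd_above S" by (rule bdd_aboveI[of _ t]) (simp add: S_def)
  define u where "u = Sup S"
  have u: "t0 \<le> u" "u \<le> t"
  proof -
    show "t0 \<le> u" unfolding u_def by (rule cSup_upper[OF ne bdd])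
    show "u \<le> t" unfolding u_def using ne by (intro cSup_least) (auto simp: S_def)
  qed
  have fu: "f t0 \<le> f u"
  proof (cases "u \<in> S")
    case False
    then have "t0 \<noteq> u" using ne by blast
    then have "t0 < u" using u by simp
    show ?thesis
    proof (rule field_le_epsilon)
      fix e :: real assume "0 < e"
      then obtain d where d: "d > 0" "\<And>s. u - d < s \<Longrightarrow> s < u \<Longrightarrow> f s \<le> f u + e"
        using left[OF \<open>t0 < u\<close>] by blast
      have "u - d < Sup S" using d by (simp add: u_def)
      then obtain s where s: "s \<in> S" "u - d < s" using less_cSupE[of "u - d" S] ne by blast
      have "s \<le> u" using cSup_upper[OF s(1) bdd] by (simp add: u_def)
      moreover have "s \<noteq> u" using s(1) False by blast
      ultimately have "f s \<le> f u + e" using d(2)[OF s(2)] by simp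
      moreover have "f t0 \<le> f s" using s(1) by (simp add: S_def)
      ultimately show "f t0 \<le> f u + e" by simp
    qed
  qed (simp add: S_def)
  have "u = t"
  proof (rule ccontr)
    assume "u \<noteq> t"
    then have "u < t" using u by simp
    have "eventually (\<lambda>h. h \<in> {0<..<t - u}) (at_right 0)"
      using \<open>u < t\<close> by (intro eventually_at_right_real) simp
    then have "eventually (\<lambda>h. h \<in> {0<..<t - u} \<and> f u \<le> f (u + h)) (at_right 0)"
      using right[OF u(1)] by (rule eventually_conj)
    then have "\<exists>h. h \<in> {0<..<t - u} \<and> f u \<le> f (u + h)"
      by (rule eventually_happens'[rotated]) simp
    then obtain h where "0 < h" "h < t - u" "f u \<le> f (u + h)" by auto
    then have "u + h \<in> S" using fu u by (simp add: S_def)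
    then have "u + h \<le> u" unfolding u_def by (rule cSup_upper[OF _ bdd])
    then show False using \<open>0 < h\<close> by simp
  qed
  then show ?thesis using fu by simp
qed

section \<open>Expected numbers of arrivals\<close>

context negative_disaster_queue
begin

definition lap :: "real \<Rightarrow> ennreal" where "lap s = (\<integral>\<^sup>+x. ennreal (exp (- s * x)) \<partial>gap_law)"

lemma gap_law_UNIV [simp]: "emeasure gap_law UNIV = 1"
  using prob_space.emeasure_space_1[OF prob_gap_law] by simp

lemma sum_g [simp]: "(\<Sum>i=Suc 0..b. ennreal (g i)) = 1"
  using g_sum g_nonneg by (subst sum_ennreal) auto

lemma AE_exp_le_1: "0 \<le> s \<Longrightarrow> AE x in gap_law. ennreal (exp (- s * x)) \<le> 1"
proof -
  assume s: "0 \<le> s"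
  show ?thesis using AE_gap_law_pos
  proof eventually_elim
    case (elim x)
    then have "0 \<le> s * x" using s by simp
    then show ?case by simp
  qed
qed

lemma lap_le_1: "0 \<le> s \<Longrightarrow> lap s \<le> 1"
proof -
  assume "0 \<le> s"
  then have "lap s \<le> (\<integral>\<^sup>+x. 1 \<partial>gap_law)"
    unfolding lap_def by (intro nn_integral_mono_AE AE_exp_le_1)
  then show ?thesis by simp
qed

lemma lap_less_1: assumes s: "0 < s" shows "lap s < 1"
proof -
  have "lap s < (\<integral>\<^sup>+x. 1 \<partial>gap_law)"
    unfolding lap_def
  proof (rule nn_integral_less)
    show "(\<integral>\<^sup>+x. ennreal (exp (- s * x)) \<partial>gap_law) \<noteq> \<infinity>"
    proof -
      have "lap s < top" using lap_le_1[of s] s by (intro order_le_less_trans[OF _ ennreal_one_less_top]) auto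
      then show ?thesis unfolding lap_def by (simp only: infinity_ennreal_def less_top)
    qed
    show "AE x in gap_law. ennreal (exp (- s * x)) \<le> 1"
      using s by (intro AE_exp_le_1) simp
    show "\<not> (AE x in gap_law. 1 \<le> ennreal (exp (- s * x)))"
    proof
      assume "AE x in gap_law. 1 \<le> ennreal (exp (- s * x))"
      then have "AE x in gap_law. x \<le> 0"
      proof eventually_elim
        case (elim x)
        then have "s * x \<le> 0" by simp
        then show ?case using s by (simp add: mult_le_0_iff)
      qed
      then have "AE x in gap_law. False"
        using AE_gap_law_pos by eventually_elim linarith
      then show False using prob_space.AE_False[OF prob_gap_law] by blast
    qed
  qed auto
  then show ?thesis by simp
qed

lemma AE_rho_sum: "AE \<omega> in M. (\<Sum>m. rho k m \<omega>) = 1"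
  using AE_arrivals by eventually_elim (simp add: rho_def prearr_sum)

text \<open>\<open>rho k\<close> is almost surely a probability vector and may be inserted under any
  integral. Statements about all arrivals thus follow by summing those about arrivals that find
  \<open>m\<close> customers.\<close>

lemma nn_integral_rho_sum:
  assumes [measurable]: "F \<in> borel_measurable M"
  shows "(\<integral>\<^sup>+\<omega>. F \<omega> \<partial>M) = (\<Sum>m. \<integral>\<^sup>+\<omega>. rho k m \<omega> * F \<omega> \<partial>M)"
proof -
  have "(\<integral>\<^sup>+\<omega>. F \<omega> \<partial>M) = (\<integral>\<^sup>+\<omega>. (\<Sum>m. rho k m \<omega> * F \<omega>) \<partial>M)"
    by (rule nn_integral_cong_AE) (use AE_rho_sum[of k] in eventually_elim, simp add: ennreal_suminf_multc)
  then show ?thesis by (subst (asm) nn_integral_suminf) auto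
qed

lemma nn_integral_next_total:
  assumes f[measurable]: "f \<in> borel_measurable (borel \<Otimes>\<^sub>M borel)"
  shows "(\<integral>\<^sup>+\<omega>. f (arrival_epoch Q k \<omega>, gap Q k \<omega>) \<partial>M) =
    (\<integral>\<^sup>+\<omega>. (\<integral>\<^sup>+x. f (arrival_epoch Q k \<omega>, x) \<partial>gap_law) \<partial>M)"
proof -
  interpret G: prob_space gap_law by (rule prob_gap_law)
  have "(\<integral>\<^sup>+\<omega>. rho k m \<omega> * f (arrival_epoch Q k \<omega>, gap Q k \<omega>) \<partial>M) =
      (\<integral>\<^sup>+\<omega>. rho k m \<omega> * (\<integral>\<^sup>+x. f (arrival_epoch Q k \<omega>, x) \<partial>gap_law) \<partial>M)" for m
    using nn_integral_next[of "\<lambda>z. f (fst z, fst (snd z))" k m]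
    by (simp add: sum_distrib_right[symmetric])
  then show ?thesis
    using nn_integral_rho_sum[of "\<lambda>\<omega>. f (arrival_epoch Q k \<omega>, gap Q k \<omega>)" k]
      nn_integral_rho_sum[of "\<lambda>\<omega>. \<integral>\<^sup>+x. f (arrival_epoch Q k \<omega>, x) \<partial>gap_law" k] by simp
qed

lemma nn_integral_exp_epoch:
  "(\<integral>\<^sup>+\<omega>. ennreal (exp (- s * arrival_epoch Q k \<omega>)) \<partial>M) = (\<integral>\<^sup>+\<omega>. ennreal (exp (- s * res0 Q \<omega>)) \<partial>M) * lap s ^ k"
proof (induction k)
  case 0
  then show ?case by (simp add: arrival_epoch_def)
next
  case (Suc k)
  have "(\<integral>\<^sup>+\<omega>. ennreal (exp (- s * arrival_epoch Q (Suc k) \<omega>)) \<partial>M) =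
     (\<integral>\<^sup>+\<omega>. ennreal (exp (- s * arrival_epoch Q k \<omega>)) * ennreal (exp (- s * gap Q k \<omega>)) \<partial>M)"
    by (intro nn_integral_cong) (simp add: epoch_Suc ennreal_mult'[symmetric] exp_add[symmetric] algebra_simps)
  also have "\<dots> = (\<integral>\<^sup>+\<omega>. (\<integral>\<^sup>+x. ennreal (exp (- s * arrival_epoch Q k \<omega>)) * ennreal (exp (- s * x)) \<partial>gap_law) \<partial>M)"
    using nn_integral_next_total[of "\<lambda>z. ennreal (exp (- s * fst z)) * ennreal (exp (- s * snd z))" k] by simp
  also have "\<dots> = (\<integral>\<^sup>+\<omega>. ennreal (exp (- s * arrival_epoch Q k \<omega>)) \<partial>M) * lap s"
    unfolding lap_def by (subst nn_integral_cmult) (simp_all add: nn_integral_multc)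
  finally show ?case using Suc.IH by (simp add: mult_ac)
qed

text \<open>The expected number of arrivals up to time \<open>t\<close> that find \<open>n\<close>
  customers. The sum over n, \<open>LamT\<close>, is the renewal function of the batch
  arrivals.\<close>

definition Lam :: "nat \<Rightarrow> real \<Rightarrow> ennreal" where
  "Lam n t = (\<Sum>k. \<integral>\<^sup>+\<omega>. rho k n \<omega> * of_bool (arrival_epoch Q k \<omega> \<le> t) \<partial>M)"

definition LamT :: "real \<Rightarrow> ennreal" where
  "LamT t = (\<Sum>k. \<integral>\<^sup>+\<omega>. of_bool (arrival_epoch Q k \<omega> \<le> t) \<partial>M)"

lemma sum_Lam: "(\<Sum>n. Lam n t) = LamT t"
  unfolding Lam_def LamT_def
  by (subst suminf_swap_ennreal) (simp add: nn_integral_rho_sum[symmetric])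

text \<open>By the exponential Markov bound the probability that arrival k has occurred by t is at
  most exp(t) \<open>lap 1\<close>^k, a convergent geometric series.\<close>

lemma LamT_finite: "LamT t < top"
proof -
  have "(\<integral>\<^sup>+\<omega>. of_bool (arrival_epoch Q k \<omega> \<le> t) \<partial>M) \<le> ennreal (exp t) * lap 1 ^ k" for k
  proof -
    have "(\<integral>\<^sup>+\<omega>. of_bool (arrival_epoch Q k \<omega> \<le> t) \<partial>M) \<le> (\<integral>\<^sup>+\<omega>. ennreal (exp t) * ennreal (exp (- 1 * arrival_epoch Q k \<omega>)) \<partial>M)"
    proof (rule nn_integral_mono)
      fix \<omega>
      show "of_bool (arrival_epoch Q k \<omega> \<le> t) \<le> ennreal (exp t) * ennreal (exp (- 1 * arrival_epoch Q k \<omega>))"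
      proof (cases "arrival_epoch Q k \<omega> \<le> t")
        case True
        have "ennreal (exp t) * ennreal (exp (- 1 * arrival_epoch Q k \<omega>)) = ennreal (exp (t - arrival_epoch Q k \<omega>))"
          by (simp add: ennreal_mult'[symmetric] exp_add[symmetric])
        then show ?thesis using True by simp
      qed simp
    qed
    also have "\<dots> = ennreal (exp t) * ((\<integral>\<^sup>+\<omega>. ennreal (exp (- 1 * res0 Q \<omega>)) \<partial>M) * lap 1 ^ k)"
      unfolding nn_integral_exp_epoch[symmetric] by (rule nn_integral_cmult) measurable
    also have "\<dots> \<le> ennreal (exp t) * (1 * lap 1 ^ k)"
    proof (intro mult_left_mono mult_right_mono)
      have "(\<integral>\<^sup>+\<omega>. ennreal (exp (- 1 * res0 Q \<omega>)) \<partial>M) \<le> (\<integral>\<^sup>+\<omega>. 1 \<partial>M)"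
        using res0_pos by (intro nn_integral_mono_AE) (auto elim!: eventually_mono)
      then show "(\<integral>\<^sup>+\<omega>. ennreal (exp (- 1 * res0 Q \<omega>)) \<partial>M) \<le> 1" by (simp add: emeasure_space_1)
    qed auto
    finally show ?thesis by simp
  qed
  then have "LamT t \<le> (\<Sum>k. ennreal (exp t) * lap 1 ^ k)"
    unfolding LamT_def by (intro suminf_le) auto
  also have "\<dots> = ennreal (exp t) * (\<Sum>k. lap 1 ^ k)" by simp
  also have "\<dots> < top"
  proof -
    obtain c where c: "lap 1 = ennreal c" "0 \<le> c" using lap_less_1[of 1] by (cases "lap 1") auto
    then have "c < 1" using lap_less_1[of 1] by (simp add: ennreal_less_one_iff)
    have "(\<Sum>k. lap 1 ^ k) = (\<Sum>k. ennreal (c ^ k))" using c by (simp add: ennreal_power)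
    also have "\<dots> = ennreal (\<Sum>k. c ^ k)" using c \<open>c < 1\<close> by (intro suminf_ennreal2 summable_geometric) auto
    finally show ?thesis by (simp add: ennreal_mult_less_top)
  qed
  finally show ?thesis .
qed

lemma Lam_le_LamT: "Lam n t \<le> LamT t"
  unfolding sum_Lam[symmetric] using sum_le_suminf[of "\<lambda>n. Lam n t" "{n}"] by simp

lemma Lam_finite: "Lam n t < top"
  using Lam_le_LamT LamT_finite by (rule order_le_less_trans)

text \<open>The window is open on the left and closed on the right, matching the event u < U <= u +
  h in the definition of the density.\<close>

definition inc :: "nat \<Rightarrow> real \<Rightarrow> real \<Rightarrow> ennreal" where
  "inc n t h = (\<Sum>k. \<integral>\<^sup>+\<omega>. rho k n \<omega> * of_bool (t < arrival_epoch Q k \<omega> \<and> arrival_epoch Q k \<omega> \<le> t + h) \<partial>M)"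

definition incT :: "real \<Rightarrow> real \<Rightarrow> ennreal" where
  "incT t h = (\<Sum>k. \<integral>\<^sup>+\<omega>. of_bool (t < arrival_epoch Q k \<omega> \<and> arrival_epoch Q k \<omega> \<le> t + h) \<partial>M)"

lemma suminf_add_ennreal:
  fixes u v :: "nat \<Rightarrow> ennreal"
  shows "(\<Sum>k. u k) + (\<Sum>k. v k) = (\<Sum>k. u k + v k)"
  by (rule suminf_add) auto

lemma Lam_add: assumes "0 \<le> h" shows "Lam n (t + h) = Lam n t + inc n t h"
  unfolding Lam_def inc_def suminf_add_ennreal
  by (intro suminf_cong, subst nn_integral_add[symmetric])
    (use assms in \<open>auto intro!: nn_integral_cong simp: of_bool_def\<close>)

lemma sum_inc: "(\<Sum>n. inc n t h) = incT t h"
  unfolding inc_def incT_def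
  by (subst suminf_swap_ennreal) (simp add: nn_integral_rho_sum[symmetric])

lemma LamT_add: assumes "0 \<le> h" shows "LamT (t + h) = LamT t + incT t h"
  unfolding LamT_def incT_def suminf_add_ennreal
  by (intro suminf_cong, subst nn_integral_add[symmetric])
    (use assms in \<open>auto intro!: nn_integral_cong simp: of_bool_def\<close>)

end

section \<open>Arrivals that find a given number of customers\<close>

context negative_disaster_queue
begin

abbreviation "next_idx t \<omega> \<equiv> (LEAST k. t < arrival_epoch Q k \<omega>)"

lemma next_idx:
  assumes "arrivals (epoch \<omega>)"
  shows "t < epoch \<omega> (next_idx t \<omega>)" "i < next_idx t \<omega> \<Longrightarrow> epoch \<omega> i \<le> t"
proof -
  obtain k where "t < epoch \<omega> k" using assms by (auto simp: arrivals_def)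
  then show "t < epoch \<omega> (next_idx t \<omega>)" by (rule LeastI)
  show "i < next_idx t \<omega> \<Longrightarrow> epoch \<omega> i \<le> t" using not_less_Least by fastforce
qed

lemma remaining_pos: "arrivals (epoch \<omega>) \<Longrightarrow> 0 < remaining_time Q t \<omega>"
  using next_idx(1)[of \<omega> t] by (simp add: remaining_time_def)

lemma measurable_at_next_idx:
  assumes [measurable]: "\<And>k. w k \<in> borel_measurable M"
  shows "(\<lambda>\<omega>. w (next_idx t \<omega>) \<omega>) \<in> borel_measurable M"
  by (rule measurable_compose_countable[where f=w and g="next_idx t"]) measurable

lemma measurable_rho_next[measurable]: "(\<lambda>\<omega>. rho (next_idx t \<omega>) n \<omega>) \<in> borel_measurable M"
  by (rule measurable_at_next_idx) measurable

lemma trans_ennreal_Lipschitz: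
  assumes "0 \<le> x" "0 \<le> y" "\<bar>x - y\<bar> \<le> d"
  shows "ennreal (trans x n j) \<le> ennreal (trans y n j) + ennreal ((\<mu> + \<eta> + \<delta>) * d)"
proof -
  have "trans x n j \<le> trans y n j + (\<mu> + \<eta> + \<delta>) * \<bar>x - y\<bar>"
    using trans_Lipschitz[OF assms(1,2), of n j] by (simp add: abs_le_iff)
  also have "\<dots> \<le> trans y n j + (\<mu> + \<eta> + \<delta>) * d"
    using assms mu eta delta by (intro add_left_mono mult_left_mono) auto
  finally have "ennreal (trans x n j) \<le> ennreal (trans y n j + (\<mu> + \<eta> + \<delta>) * d)" by (rule ennreal_leI)
  also have "\<dots> = ennreal (trans y n j) + ennreal ((\<mu> + \<eta> + \<delta>) * d)"
    using assms mu eta delta by (intro ennreal_plus trans_nonneg mult_nonneg_nonneg) auto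
  finally show ?thesis .
qed

lemma suminf_le_add_const:
  fixes r u v :: "nat \<Rightarrow> ennreal"
  assumes "(\<Sum>m. r m) = 1" "\<And>m. u m \<le> v m + e"
  shows "(\<Sum>m. r m * u m) \<le> (\<Sum>m. r m * v m) + e"
proof -
  have "(\<Sum>m. r m * u m) \<le> (\<Sum>m. r m * v m + r m * e)"
    by (intro suminf_le) (auto simp: distrib_left[symmetric] assms(2) intro!: mult_left_mono)
  also have "\<dots> = (\<Sum>m. r m * v m) + (\<Sum>m. r m) * e"
    by (simp add: suminf_add_ennreal[symmetric] ennreal_suminf_multc)
  finally show ?thesis using assms by simp
qed

text \<open>Both sides are values of one transition probability, taken at \<open>t\<close> and at
  the next arrival, at most \<open>h\<close> later. The Lipschitz bound is uniform in the state, so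
  mixing over the state left by the previous arrival preserves it.\<close>

lemma cond_prob_vs_rho:
  assumes A: "arrivals (epoch \<omega>)" and t: "0 \<le> t" and h: "remaining_time Q t \<omega> \<le> h"
  shows "cond_prob t n \<omega> \<le> rho (next_idx t \<omega>) n \<omega> + ennreal ((\<mu> + \<eta> + \<delta>) * h)"
    "rho (next_idx t \<omega>) n \<omega> \<le> cond_prob t n \<omega> + ennreal ((\<mu> + \<eta> + \<delta>) * h)"
proof -
  have n1: "t < epoch \<omega> (next_idx t \<omega>)" using next_idx[OF A] by blast
  have hh: "epoch \<omega> (next_idx t \<omega>) - t \<le> h" using h by (simp add: remaining_time_def)
  have "cond_prob t n \<omega> \<le> rho (next_idx t \<omega>) n \<omega> + ennreal ((\<mu> + \<eta> + \<delta>) * h) \<and>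
    rho (next_idx t \<omega>) n \<omega> \<le> cond_prob t n \<omega> + ennreal ((\<mu> + \<eta> + \<delta>) * h)"
  proof (cases "next_idx t \<omega>")
    case 0
    then have "cond_prob t n \<omega> = ennreal (trans t (num0 Q \<omega>) n)"
      unfolding cond_prob_def using n1 t A by (intro W_before_first) auto
    moreover have "rho (next_idx t \<omega>) n \<omega> = ennreal (trans (epoch \<omega> 0) (num0 Q \<omega>) n)"
      using 0 by (simp add: rho_def)
    ultimately show ?thesis using n1 hh 0 t
      by (auto intro!: trans_ennreal_Lipschitz)
  next
    case (Suc k)
    have k: "epoch \<omega> k \<le> t" "t < epoch \<omega> (Suc k)" using next_idx[OF A, where t=t] Suc by (auto simp del: One_nat_def)
    have c: "cond_prob t n \<omega> = (\<Sum>m. rho k m \<omega> * ennreal (trans (t - epoch \<omega> k) (m + batch Q k \<omega>) n))"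
      unfolding cond_prob_def rho_def using k by (intro W_between[OF A]) auto
    have r: "rho (next_idx t \<omega>) n \<omega> = (\<Sum>m. rho k m \<omega> * ennreal (trans (epoch \<omega> (Suc k) - epoch \<omega> k) (m + batch Q k \<omega>) n))"
      using Suc by (simp add: rho_def)
    have s: "(\<Sum>m. rho k m \<omega>) = 1" using prearr_sum[OF A] by (simp add: rho_def)
    show ?thesis unfolding c r
      using k hh Suc by (intro conjI suminf_le_add_const[OF s] trans_ennreal_Lipschitz) auto
  qed
  then show "cond_prob t n \<omega> \<le> rho (next_idx t \<omega>) n \<omega> + ennreal ((\<mu> + \<eta> + \<delta>) * h)"
    "rho (next_idx t \<omega>) n \<omega> \<le> cond_prob t n \<omega> + ennreal ((\<mu> + \<eta> + \<delta>) * h)" by auto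
qed

section \<open>The density at 0 as a rate of arrivals\<close>

definition soon :: "nat \<Rightarrow> real \<Rightarrow> real \<Rightarrow> ennreal" where
  "soon n t h = (\<integral>\<^sup>+\<omega>. of_bool (num_customers Q t \<omega> = n) * of_bool (remaining_time Q t \<omega> \<le> h) \<partial>M)"

definition soonT :: "real \<Rightarrow> real \<Rightarrow> ennreal" where
  "soonT t h = (\<integral>\<^sup>+\<omega>. of_bool (remaining_time Q t \<omega> \<le> h) \<partial>M)"

text \<open>Compared with \<open>soon\<close>, the number of customers at time \<open>t\<close> is
  replaced by the number found by the first arrival after \<open>t\<close>. This version is directly
  comparable with the expected counts.\<close>

definition first_inc :: "nat \<Rightarrow> real \<Rightarrow> real \<Rightarrow> ennreal" where
  "first_inc n t h = (\<integral>\<^sup>+\<omega>. rho (next_idx t \<omega>) n \<omega> * of_bool (remaining_time Q t \<omega> \<le> h) \<partial>M)"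

lemma measurable_cond_prob[measurable]: "cond_prob t j \<in> borel_measurable M"
proof -
  interpret C: prob_space clk using mu eta delta by (intro prob_space_clocks)
  have [measurable]: "(\<lambda>p. cust_seq (epoch (fst p)) (\<lambda>k. batch Q k (fst p)) t 0 (num0 Q (fst p))
      (fst (snd p)) (fst (snd (snd p))) (snd (snd (snd p)))) \<in> measurable (M \<Otimes>\<^sub>M clk) (count_space UNIV)"
    unfolding cust_seq_def
  proof (rule measurable_cust)
    show "(\<lambda>\<omega>. fst (snd \<omega>) k) \<in> borel_measurable (M \<Otimes>\<^sub>M clk)" for k
      by (rule measurable_iid_component) measurable
    show "(\<lambda>\<omega>. fst (snd (snd \<omega>)) k) \<in> borel_measurable (M \<Otimes>\<^sub>M clk)" for k
      by (rule measurable_iid_component) measurable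
    show "(\<lambda>\<omega>. snd (snd (snd \<omega>)) k) \<in> borel_measurable (M \<Otimes>\<^sub>M clk)" for k
      by (rule measurable_iid_component) measurable
  qed measurable
  show ?thesis unfolding cond_prob_def[abs_def] W_def I_def by measurable
qed

lemma soon_condition: "soon n t h = (\<integral>\<^sup>+\<omega>. cond_prob t n \<omega> * of_bool (remaining_time Q t \<omega> \<le> h) \<partial>M)"
proof -
  have [measurable]: "(\<lambda>x. epoch_of x k) \<in> borel_measurable (coords arrival_idx)" for k
    by (rule measurable_epoch_of[OF past_subset_arrival])
  have [measurable]: "(\<lambda>x. epoch_of x (LEAST k. t < epoch_of x k)) \<in> borel_measurable (coords arrival_idx)"
    by (rule measurable_compose_countable[where f="\<lambda>k x. epoch_of x k"]) measurable
  have "(\<lambda>x. of_bool (epoch_of x (LEAST k. t < epoch_of x k) - t \<le> h) :: ennreal) \<in> borel_measurable (coords arrival_idx)"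
    by measurable
  from num_customers_condition[where Z="\<lambda>A. of_bool (A (LEAST k. t < A k) - t \<le> h)" and t=t and j=n, OF this]
  show ?thesis unfolding soon_def remaining_time_def .
qed

lemma soon_vs_first:
  assumes t: "0 \<le> t" and h: "0 \<le> h"
  shows "soon n t h \<le> first_inc n t h + ennreal ((\<mu> + \<eta> + \<delta>) * h) * soonT t h"
    "first_inc n t h \<le> soon n t h + ennreal ((\<mu> + \<eta> + \<delta>) * h) * soonT t h"
proof -
  have *: "(\<integral>\<^sup>+\<omega>. f \<omega> * of_bool (remaining_time Q t \<omega> \<le> h) \<partial>M) \<le>
     (\<integral>\<^sup>+\<omega>. g \<omega> * of_bool (remaining_time Q t \<omega> \<le> h) \<partial>M) + ennreal ((\<mu> + \<eta> + \<delta>) * h) * soonT t h"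
    if [measurable]: "g \<in> borel_measurable M" and
      le: "AE \<omega> in M. remaining_time Q t \<omega> \<le> h \<longrightarrow> f \<omega> \<le> g \<omega> + ennreal ((\<mu> + \<eta> + \<delta>) * h)" for f g
  proof -
    have "(\<integral>\<^sup>+\<omega>. f \<omega> * of_bool (remaining_time Q t \<omega> \<le> h) \<partial>M) \<le>
      (\<integral>\<^sup>+\<omega>. g \<omega> * of_bool (remaining_time Q t \<omega> \<le> h) + ennreal ((\<mu> + \<eta> + \<delta>) * h) * of_bool (remaining_time Q t \<omega> \<le> h) \<partial>M)"
      by (rule nn_integral_mono_AE) (use le in eventually_elim, simp add: of_bool_def)
    also have "\<dots> = (\<integral>\<^sup>+\<omega>. g \<omega> * of_bool (remaining_time Q t \<omega> \<le> h) \<partial>M) + ennreal ((\<mu> + \<eta> + \<delta>) * h) * soonT t h"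
      unfolding soonT_def by (subst nn_integral_add) (auto simp: nn_integral_cmult)
    finally show ?thesis .
  qed
  have [measurable]: "(\<lambda>\<omega>. rho (next_idx t \<omega>) n \<omega>) \<in> borel_measurable M" by measurable
  show "soon n t h \<le> first_inc n t h + ennreal ((\<mu> + \<eta> + \<delta>) * h) * soonT t h"
    unfolding soon_condition first_inc_def
  proof (rule *)
    show "AE \<omega> in M. remaining_time Q t \<omega> \<le> h \<longrightarrow> cond_prob t n \<omega> \<le> rho (next_idx t \<omega>) n \<omega> + ennreal ((\<mu> + \<eta> + \<delta>) * h)"
      using AE_arrivals by eventually_elim (use cond_prob_vs_rho t in blast)
  qed measurable
  show "first_inc n t h \<le> soon n t h + ennreal ((\<mu> + \<eta> + \<delta>) * h) * soonT t h"
    unfolding soon_condition first_inc_def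
  proof (rule *)
    show "AE \<omega> in M. remaining_time Q t \<omega> \<le> h \<longrightarrow> rho (next_idx t \<omega>) n \<omega> \<le> cond_prob t n \<omega> + ennreal ((\<mu> + \<eta> + \<delta>) * h)"
      using AE_arrivals by eventually_elim (use cond_prob_vs_rho t in blast)
  qed measurable
qed

lemma suminf_split_first:
  fixes u :: "nat \<Rightarrow> ennreal"
  shows "(\<Sum>k. u k) = u 0 + (\<Sum>k. u (Suc k))"
proof -
  have "(\<lambda>k. u (Suc k)) sums (\<Sum>k. u (Suc k))" by (rule summable_sums) simp
  then have "(\<lambda>n. u 0 + (\<Sum>k<n. u (Suc k))) \<longlonglongrightarrow> u 0 + (\<Sum>k. u (Suc k))"
    unfolding sums_def by (intro tendsto_add tendsto_const)
  then have "(\<lambda>n. \<Sum>k<Suc n. u k) \<longlonglongrightarrow> u 0 + (\<Sum>k. u (Suc k))"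
    by (simp add: sum.lessThan_Suc_shift del: sum.lessThan_Suc)
  then have "u sums (u 0 + (\<Sum>k. u (Suc k)))" unfolding sums_def by (rule LIMSEQ_imp_Suc)
  then show ?thesis by (rule sums_unique[symmetric])
qed

text \<open>Among the arrivals in the window, the first has index \<open>next_idx t\<close> and is
  present exactly if the remaining time is at most \<open>h\<close>. Each later one is recognised by
  its predecessor also lying after \<open>t\<close>; arrival 0 has no predecessor and is never a
  later one.\<close>

lemma window_split:
  assumes [measurable]: "\<And>k. w k \<in> borel_measurable M"
  shows "(\<Sum>k. \<integral>\<^sup>+\<omega>. w k \<omega> * of_bool (t < arrival_epoch Q k \<omega> \<and> arrival_epoch Q k \<omega> \<le> t + h) \<partial>M) =
    (\<integral>\<^sup>+\<omega>. w (next_idx t \<omega>) \<omega> * of_bool (remaining_time Q t \<omega> \<le> h) \<partial>M) +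
    (\<Sum>k. \<integral>\<^sup>+\<omega>. w (Suc k) \<omega> * of_bool (t < arrival_epoch Q k \<omega> \<and> arrival_epoch Q (Suc k) \<omega> \<le> t + h) \<partial>M)"
    (is "?L = ?X + ?E")
proof -
  define v where "v k \<omega> = (case k of 0 \<Rightarrow> 0 | Suc k' \<Rightarrow> w k \<omega> * of_bool (t < arrival_epoch Q k' \<omega> \<and> arrival_epoch Q k \<omega> \<le> t + h))" for k \<omega>
  have [measurable]: "v k \<in> borel_measurable M" for k unfolding v_def by (cases k) auto
  have [measurable]: "(\<lambda>\<omega>. w (next_idx t \<omega>) \<omega>) \<in> borel_measurable M"
    by (rule measurable_at_next_idx) measurable
  have "?L = (\<integral>\<^sup>+\<omega>. (\<Sum>k. w k \<omega> * of_bool (t < arrival_epoch Q k \<omega> \<and> arrival_epoch Q k \<omega> \<le> t + h)) \<partial>M)"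
    by (rule nn_integral_suminf[symmetric]) measurable
  also have "\<dots> = (\<integral>\<^sup>+\<omega>. w (next_idx t \<omega>) \<omega> * of_bool (remaining_time Q t \<omega> \<le> h) + (\<Sum>k. v k \<omega>) \<partial>M)"
  proof (rule nn_integral_cong_AE)
    show "AE \<omega> in M. (\<Sum>k. w k \<omega> * of_bool (t < arrival_epoch Q k \<omega> \<and> arrival_epoch Q k \<omega> \<le> t + h)) =
       w (next_idx t \<omega>) \<omega> * of_bool (remaining_time Q t \<omega> \<le> h) + (\<Sum>k. v k \<omega>)"
      using AE_arrivals
    proof eventually_elim
      case (elim \<omega>)
      have sm: "strict_mono (epoch \<omega>)" using elim by (simp add: arrivals_def)
      let ?x = "w (next_idx t \<omega>) \<omega> * of_bool (remaining_time Q t \<omega> \<le> h)"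
      have "w k \<omega> * of_bool (t < epoch \<omega> k \<and> epoch \<omega> k \<le> t + h) = (if k = next_idx t \<omega> then ?x else 0) + v k \<omega>" for k
      proof -
        consider "k < next_idx t \<omega>" | "k = next_idx t \<omega>" | k' where "k = Suc k'" "next_idx t \<omega> \<le> k'"
          by (cases k) (auto simp: not_less less_Suc_eq_le, fastforce simp: le_Suc_eq not_less_eq_eq)
        then show ?thesis
        proof cases
          case 1
          then have "epoch \<omega> k \<le> t" using next_idx(2)[OF elim] by blast
          moreover have "epoch \<omega> k' \<le> t" if "k = Suc k'" for k'
            using next_idx(2)[OF elim, of k' t] 1 that by simp
          ultimately show ?thesis using 1 by (auto simp: v_def split: nat.split)
        next
          case 2
          have "epoch \<omega> k' \<le> t" if "k = Suc k'" for k'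
            using next_idx(2)[OF elim, of k' t] 2 that by simp
          then have "v k \<omega> = 0" by (auto simp: v_def split: nat.split dest: leD)
          moreover have "t < epoch \<omega> k" using next_idx(1)[OF elim] 2 by blast
          moreover have "(remaining_time Q t \<omega> \<le> h) = (epoch \<omega> k \<le> t + h)" using 2 by (auto simp: remaining_time_def)
          ultimately show ?thesis using 2 by simp
        next
          case (3 k')
          have "epoch \<omega> (next_idx t \<omega>) \<le> epoch \<omega> k'" using monoD[OF strict_mono_mono[OF sm]] 3 by simp
          then have "t < epoch \<omega> k'" using next_idx(1)[OF elim, of t] by linarith
          moreover have "epoch \<omega> k' < epoch \<omega> k" using strict_monoD[OF sm] 3 by simp
          ultimately show ?thesis using 3 by (auto simp: v_def)
        qed
      qed
      then have "(\<Sum>k. w k \<omega> * of_bool (t < epoch \<omega> k \<and> epoch \<omega> k \<le> t + h)) = (\<Sum>k. (if k = next_idx t \<omega> then ?x else 0) + v k \<omega>)"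
        by (simp only:)
      also have "\<dots> = (\<Sum>k. (if k = next_idx t \<omega> then ?x else 0)) + (\<Sum>k. v k \<omega>)"
        by (rule suminf_add_ennreal[symmetric])
      also have "(\<Sum>k. (if k = next_idx t \<omega> then ?x else 0)) = ?x"
        by (subst suminf_finite[of "{next_idx t \<omega>}"]) auto
      finally show ?case .
    qed
  qed
  also have "\<dots> = ?X + (\<integral>\<^sup>+\<omega>. (\<Sum>k. v k \<omega>) \<partial>M)"
    by (rule nn_integral_add) measurable
  also have "(\<integral>\<^sup>+\<omega>. (\<Sum>k. v k \<omega>) \<partial>M) = (\<Sum>k. \<integral>\<^sup>+\<omega>. v k \<omega> \<partial>M)"
    by (rule nn_integral_suminf) measurable
  also have "\<dots> = ?E"
    by (subst suminf_split_first) (simp add: v_def[abs_def])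
  finally show ?thesis .
qed

lemma inc_split: "inc n t h = first_inc n t h +
   (\<Sum>k. \<integral>\<^sup>+\<omega>. rho (Suc k) n \<omega> * of_bool (t < arrival_epoch Q k \<omega> \<and> arrival_epoch Q (Suc k) \<omega> \<le> t + h) \<partial>M)"
  unfolding inc_def first_inc_def by (rule window_split) measurable

lemma incT_split: "incT t h = soonT t h +
   (\<Sum>k. \<integral>\<^sup>+\<omega>. of_bool (t < arrival_epoch Q k \<omega> \<and> arrival_epoch Q (Suc k) \<omega> \<le> t + h) \<partial>M)"
  unfolding incT_def soonT_def using window_split[of "\<lambda>_ _. 1" t h] by simp

definition gcdf :: "real \<Rightarrow> ennreal" where "gcdf h = emeasure gap_law {..h}"

lemma gcdf_eq: "gcdf h = (\<integral>\<^sup>+x. of_bool (x \<le> h) \<partial>gap_law)"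
proof -
  have "gcdf h = (\<integral>\<^sup>+x. indicator {..h} x \<partial>gap_law)" by (simp add: gcdf_def)
  then show ?thesis by (simp add: indicator_def)
qed

text \<open>A later arrival in the window needs its predecessor in the window and then a gap of
  length at most \<open>h\<close>, independent of it. The resulting factor \<open>gcdf h\<close>
  becomes small with \<open>h\<close>.\<close>

lemma incT_bound:
  "incT t h \<le> soonT t h + gcdf h * incT t h"
proof -
  have "(\<integral>\<^sup>+\<omega>. of_bool (t < arrival_epoch Q k \<omega> \<and> arrival_epoch Q (Suc k) \<omega> \<le> t + h) \<partial>M) \<le>
    gcdf h * (\<integral>\<^sup>+\<omega>. of_bool (t < arrival_epoch Q k \<omega> \<and> arrival_epoch Q k \<omega> \<le> t + h) \<partial>M)" for k
  proof -
    let ?f = "\<lambda>z. of_bool (t < fst z \<and> fst z \<le> t + h) * of_bool (snd z \<le> h) :: ennreal"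
    have "(\<integral>\<^sup>+\<omega>. of_bool (t < arrival_epoch Q k \<omega> \<and> arrival_epoch Q (Suc k) \<omega> \<le> t + h) \<partial>M) \<le>
      (\<integral>\<^sup>+\<omega>. ?f (arrival_epoch Q k \<omega>, gap Q k \<omega>) \<partial>M)"
    proof (rule nn_integral_mono_AE)
      show "AE \<omega> in M. of_bool (t < arrival_epoch Q k \<omega> \<and> arrival_epoch Q (Suc k) \<omega> \<le> t + h) \<le>
         ?f (arrival_epoch Q k \<omega>, gap Q k \<omega>)"
        using AE_gaps_regular
      proof eventually_elim
        case (elim \<omega>)
        then have "0 < gap Q k \<omega>" by (simp add: regular_def)
        then show ?case by (auto simp: epoch_Suc)
      qed
    qed
    also have "\<dots> = (\<integral>\<^sup>+\<omega>. (\<integral>\<^sup>+x. ?f (arrival_epoch Q k \<omega>, x) \<partial>gap_law) \<partial>M)"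
      by (rule nn_integral_next_total) measurable
    also have "\<dots> = gcdf h * (\<integral>\<^sup>+\<omega>. of_bool (t < arrival_epoch Q k \<omega> \<and> arrival_epoch Q k \<omega> \<le> t + h) \<partial>M)"
      by (simp add: nn_integral_cmult gcdf_eq[symmetric] nn_integral_multc mult.commute)
    finally show ?thesis .
  qed
  then have "(\<Sum>k. \<integral>\<^sup>+\<omega>. of_bool (t < arrival_epoch Q k \<omega> \<and> arrival_epoch Q (Suc k) \<omega> \<le> t + h) \<partial>M) \<le> gcdf h * incT t h"
    unfolding incT_def ennreal_suminf_cmult[symmetric] by (intro suminf_le) auto
  then show ?thesis by (subst incT_split) (rule add_left_mono)
qed

text \<open>Two reasons make later arrivals negligible. If the predecessor found m < n customers, a
  gap of at most \<open>h\<close> is needed, at the cost of a factor \<open>gcdf h\<close>. If it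
  found m >= n, its batch of at least one raises the number above \<open>n\<close>, so a removal
  must occur within time \<open>h\<close>, at a cost of order h. The first kind involves only
  finitely many m, the second carries a factor \<open>h\<close> in front of the total count.\<close>

lemma later_bound:
  assumes h: "0 \<le> h"
  shows "(\<Sum>k. \<integral>\<^sup>+\<omega>. rho (Suc k) n \<omega> * of_bool (t < arrival_epoch Q k \<omega> \<and> arrival_epoch Q (Suc k) \<omega> \<le> t + h) \<partial>M) \<le>
     gcdf h * (\<Sum>m<n. inc m t h) + ennreal ((\<mu> + \<eta> + \<delta>) * h) * incT t h"
proof -
  define c where "c m = (if m < n then gcdf h else ennreal ((\<mu> + \<eta> + \<delta>) * h))" for m
  let ?w = "\<lambda>k \<omega>. of_bool (t < arrival_epoch Q k \<omega> \<and> arrival_epoch Q k \<omega> \<le> t + h) :: ennreal"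
  define f where "f m z = of_bool (t < fst z \<and> fst z \<le> t + h) * (of_bool (fst (snd z) \<le> h) *
     ennreal (trans (fst (snd z)) (m + snd (snd z)) n))" for m :: nat and z :: "real \<times> real \<times> nat"
  have [measurable]: "(\<lambda>z::real \<times> real \<times> nat. trans (fst (snd z)) (m + snd (snd z)) n) \<in> borel_measurable (borel \<Otimes>\<^sub>M borel \<Otimes>\<^sub>M count_space UNIV)" for m
    by (rule measurable_trans_nat) measurable
  have f[measurable]: "f m \<in> borel_measurable (borel \<Otimes>\<^sub>M borel \<Otimes>\<^sub>M count_space UNIV)" for m
    unfolding f_def[abs_def] by measurable
  have inner: "(\<Sum>i=1..b. ennreal (g i) * (\<integral>\<^sup>+x. f m (s, x, i) \<partial>gap_law)) \<le> of_bool (t < s \<and> s \<le> t + h) * c m" for m s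
  proof -
    have "(\<integral>\<^sup>+x. f m (s, x, i) \<partial>gap_law) \<le> of_bool (t < s \<and> s \<le> t + h) * c m" if "i \<in> {1..b}" for i
    proof (cases "m < n")
      case True
      have "(\<integral>\<^sup>+x. f m (s, x, i) \<partial>gap_law) \<le> (\<integral>\<^sup>+x. of_bool (t < s \<and> s \<le> t + h) * of_bool (x \<le> h) \<partial>gap_law)"
      proof (rule nn_integral_mono_AE)
        show "AE x in gap_law. f m (s, x, i) \<le> of_bool (t < s \<and> s \<le> t + h) * of_bool (x \<le> h)"
          using AE_gap_law_pos
        proof eventually_elim
          case (elim x)
          then have "ennreal (trans x (m + i) n) \<le> 1" by (simp add: trans_le_1)
          then show ?case by (auto simp: f_def)
        qed
      qed
      also have "\<dots> = of_bool (t < s \<and> s \<le> t + h) * c m"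
        using True by (simp add: nn_integral_cmult gcdf_eq c_def)
      finally show ?thesis .
    next
      case False
      have "(\<integral>\<^sup>+x. f m (s, x, i) \<partial>gap_law) \<le> (\<integral>\<^sup>+x. of_bool (t < s \<and> s \<le> t + h) * c m \<partial>gap_law)"
      proof (rule nn_integral_mono_AE)
        show "AE x in gap_law. f m (s, x, i) \<le> of_bool (t < s \<and> s \<le> t + h) * c m"
          using AE_gap_law_pos
        proof eventually_elim
          case (elim x)
          have "ennreal (trans x (m + i) n) \<le> ennreal ((\<mu> + \<eta> + \<delta>) * h)" if "x \<le> h"
            using trans_ennreal_Lipschitz[of x 0 h "m + i" n] elim that False \<open>i \<in> {1..b}\<close>
            by (auto simp: trans_def trans_fun_zero)
          then show ?case using False by (auto simp: f_def c_def)
        qed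
      qed
      then show ?thesis by simp
    qed
    then have "(\<Sum>i=1..b. ennreal (g i) * (\<integral>\<^sup>+x. f m (s, x, i) \<partial>gap_law)) \<le>
      (\<Sum>i=1..b. ennreal (g i) * (of_bool (t < s \<and> s \<le> t + h) * c m))"
      by (intro sum_mono mult_left_mono) auto
    then show ?thesis by (simp add: sum_distrib_right[symmetric])
  qed
  have "(\<integral>\<^sup>+\<omega>. rho (Suc k) n \<omega> * of_bool (t < arrival_epoch Q k \<omega> \<and> arrival_epoch Q (Suc k) \<omega> \<le> t + h) \<partial>M) \<le>
     (\<Sum>m. (\<integral>\<^sup>+\<omega>. rho k m \<omega> * ?w k \<omega> \<partial>M) * c m)" for k
  proof -
    have "(\<integral>\<^sup>+\<omega>. rho (Suc k) n \<omega> * of_bool (t < arrival_epoch Q k \<omega> \<and> arrival_epoch Q (Suc k) \<omega> \<le> t + h) \<partial>M) \<le>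
      (\<integral>\<^sup>+\<omega>. (\<Sum>m. rho k m \<omega> * f m (arrival_epoch Q k \<omega>, gap Q k \<omega>, batch Q k \<omega>)) \<partial>M)"
    proof (rule nn_integral_mono_AE)
      show "AE \<omega> in M. rho (Suc k) n \<omega> * of_bool (t < arrival_epoch Q k \<omega> \<and> arrival_epoch Q (Suc k) \<omega> \<le> t + h) \<le>
        (\<Sum>m. rho k m \<omega> * f m (arrival_epoch Q k \<omega>, gap Q k \<omega>, batch Q k \<omega>))"
        using AE_gaps_regular
      proof eventually_elim
        case (elim \<omega>)
        then have "0 < gap Q k \<omega>" by (simp add: regular_def)
        then show ?case by (auto simp: rho_def epoch_Suc f_def)
      qed
    qed
    also have "\<dots> = (\<Sum>m. \<integral>\<^sup>+\<omega>. rho k m \<omega> * f m (arrival_epoch Q k \<omega>, gap Q k \<omega>, batch Q k \<omega>) \<partial>M)"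
      by (rule nn_integral_suminf) (auto intro!: borel_measurable_times measurable_compose[OF _ f])
    also have "\<dots> = (\<Sum>m. \<integral>\<^sup>+\<omega>. rho k m \<omega> * (\<Sum>i=1..b. ennreal (g i) * (\<integral>\<^sup>+x. f m (arrival_epoch Q k \<omega>, x, i) \<partial>gap_law)) \<partial>M)"
      by (intro suminf_cong nn_integral_next f)
    also have "\<dots> \<le> (\<Sum>m. \<integral>\<^sup>+\<omega>. rho k m \<omega> * (?w k \<omega> * c m) \<partial>M)"
      by (intro suminf_le nn_integral_mono mult_left_mono inner) auto
    also have "\<dots> = (\<Sum>m. (\<integral>\<^sup>+\<omega>. rho k m \<omega> * ?w k \<omega> \<partial>M) * c m)"
      by (simp add: nn_integral_multc mult.assoc[symmetric])
    finally show ?thesis .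
  qed
  then have "(\<Sum>k. \<integral>\<^sup>+\<omega>. rho (Suc k) n \<omega> * of_bool (t < arrival_epoch Q k \<omega> \<and> arrival_epoch Q (Suc k) \<omega> \<le> t + h) \<partial>M) \<le>
    (\<Sum>k. \<Sum>m. (\<integral>\<^sup>+\<omega>. rho k m \<omega> * ?w k \<omega> \<partial>M) * c m)"
    by (intro suminf_le) auto
  also have "\<dots> = (\<Sum>m. inc m t h * c m)"
    by (subst suminf_swap_ennreal) (simp add: inc_def ennreal_suminf_multc)
  also have "\<dots> \<le> (\<Sum>m. (if m < n then inc m t h * gcdf h else 0) + inc m t h * ennreal ((\<mu> + \<eta> + \<delta>) * h))"
    by (intro suminf_le) (auto simp: c_def)
  also have "\<dots> = (\<Sum>m. (if m < n then inc m t h * gcdf h else 0)) + incT t h * ennreal ((\<mu> + \<eta> + \<delta>) * h)"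
    by (simp add: suminf_add_ennreal[symmetric] ennreal_suminf_multc sum_inc)
  also have "(\<Sum>m. (if m < n then inc m t h * gcdf h else 0)) = (\<Sum>m<n. inc m t h * gcdf h)"
    by (subst suminf_finite[of "{..<n}"]) auto
  finally show ?thesis unfolding sum_distrib_right[symmetric] by (simp only: mult.commute)
qed

lemma inc_upper:
  assumes "0 \<le> t" "0 \<le> h"
  shows "inc n t h \<le> soon n t h + ennreal ((\<mu> + \<eta> + \<delta>) * h) * soonT t h + gcdf h * (\<Sum>m<n. inc m t h) +
     ennreal ((\<mu> + \<eta> + \<delta>) * h) * incT t h"
proof -
  have "inc n t h \<le> (soon n t h + ennreal ((\<mu> + \<eta> + \<delta>) * h) * soonT t h) + (gcdf h * (\<Sum>m<n. inc m t h) +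
     ennreal ((\<mu> + \<eta> + \<delta>) * h) * incT t h)"
    by (subst inc_split, intro add_mono soon_vs_first later_bound assms)
  then show ?thesis by (simp add: add.assoc)
qed

lemma inc_lower:
  assumes "0 \<le> t" "0 \<le> h"
  shows "soon n t h \<le> inc n t h + ennreal ((\<mu> + \<eta> + \<delta>) * h) * soonT t h"
proof -
  have "first_inc n t h \<le> inc n t h" unfolding inc_split by simp
  then show ?thesis using soon_vs_first(1)[OF assms, of n] by (meson add_right_mono order_trans)
qed

lemma inc_finite: "0 \<le> h \<Longrightarrow> inc n t h < top"
  using Lam_add[of h n t] Lam_finite[of n "t + h"] by (simp add: less_top[symmetric])

lemma incT_finite: "0 \<le> h \<Longrightarrow> incT t h < top"
  using LamT_add[of h t] LamT_finite[of "t + h"] by (simp add: less_top[symmetric])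

lemma soonT_le_1: "soonT t h \<le> 1"
proof -
  have "soonT t h \<le> (\<integral>\<^sup>+\<omega>. 1 \<partial>M)" unfolding soonT_def by (intro nn_integral_mono) simp
  then show ?thesis by (simp add: emeasure_space_1)
qed

lemma soon_le_1: "soon n t h \<le> 1"
proof -
  have "soon n t h \<le> (\<integral>\<^sup>+\<omega>. 1 \<partial>M)" unfolding soon_def by (intro nn_integral_mono) simp
  then show ?thesis by (simp add: emeasure_space_1)
qed

lemma gcdf_le_1: "gcdf h \<le> 1"
  unfolding gcdf_def using prob_space.measure_le_1[OF prob_gap_law] prob_space.emeasure_le_1[OF prob_gap_law] by blast

definition "rinc n t h = enn2real (inc n t h)"
definition "rincT t h = enn2real (incT t h)"
definition "rsoon n t h = enn2real (soon n t h)"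
definition "rsoonT t h = enn2real (soonT t h)"
definition "rgcdf h = enn2real (gcdf h)"

lemma real_forms:
  "0 \<le> h \<Longrightarrow> inc n t h = ennreal (rinc n t h)" "0 \<le> h \<Longrightarrow> incT t h = ennreal (rincT t h)"
  "soon n t h = ennreal (rsoon n t h)" "soonT t h = ennreal (rsoonT t h)" "gcdf h = ennreal (rgcdf h)"
  using inc_finite incT_finite order_le_less_trans[OF soon_le_1 ennreal_one_less_top]
    order_le_less_trans[OF soonT_le_1 ennreal_one_less_top] order_le_less_trans[OF gcdf_le_1 ennreal_one_less_top]
  by (auto simp: rinc_def rincT_def rsoon_def rsoonT_def rgcdf_def)

lemma real_nonneg [simp]: "0 \<le> rinc n t h" "0 \<le> rincT t h" "0 \<le> rsoon n t h" "0 \<le> rsoonT t h" "0 \<le> rgcdf h"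
  by (simp_all add: rinc_def rincT_def rsoon_def rsoonT_def rgcdf_def)

lemma rinc_upper:
  assumes "0 \<le> t" "0 \<le> h"
  shows "rinc n t h \<le> rsoon n t h + (\<mu> + \<eta> + \<delta>) * h * rsoonT t h + rgcdf h * (\<Sum>m<n. rinc m t h) +
     (\<mu> + \<eta> + \<delta>) * h * rincT t h"
proof -
  have c: "0 \<le> (\<mu> + \<eta> + \<delta>) * h" using assms mu eta delta by simp
  have "ennreal (rinc n t h) \<le> ennreal (rsoon n t h) + ennreal ((\<mu> + \<eta> + \<delta>) * h) * ennreal (rsoonT t h) +
     ennreal (rgcdf h) * (\<Sum>m<n. ennreal (rinc m t h)) + ennreal ((\<mu> + \<eta> + \<delta>) * h) * ennreal (rincT t h)"
    using inc_upper[OF assms, of n] assms by (simp add: real_forms)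
  also have "\<dots> = ennreal (rsoon n t h + (\<mu> + \<eta> + \<delta>) * h * rsoonT t h + rgcdf h * (\<Sum>m<n. rinc m t h) +
     (\<mu> + \<eta> + \<delta>) * h * rincT t h)"
    using c by (simp add: sum_ennreal ennreal_mult[symmetric] ennreal_plus[symmetric] sum_nonneg del: ennreal_plus)
  finally show ?thesis
    using c by (subst (asm) ennreal_le_iff) (auto intro!: add_nonneg_nonneg mult_nonneg_nonneg sum_nonneg)
qed

lemma rinc_lower:
  assumes "0 \<le> t" "0 \<le> h"
  shows "rsoon n t h \<le> rinc n t h + (\<mu> + \<eta> + \<delta>) * h * rsoonT t h"
proof -
  have c: "0 \<le> (\<mu> + \<eta> + \<delta>) * h" using assms mu eta delta by simp
  have "ennreal (rsoon n t h) \<le> ennreal (rinc n t h) + ennreal ((\<mu> + \<eta> + \<delta>) * h) * ennreal (rsoonT t h)"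
    using inc_lower[OF assms, of n] assms by (simp add: real_forms)
  also have "\<dots> = ennreal (rinc n t h + (\<mu> + \<eta> + \<delta>) * h * rsoonT t h)"
    using c by (simp add: ennreal_mult[symmetric] ennreal_plus[symmetric] del: ennreal_plus)
  finally show ?thesis using c by (subst (asm) ennreal_le_iff) auto
qed

lemma rincT_upper:
  assumes "0 \<le> h" shows "rincT t h \<le> rsoonT t h + rgcdf h * rincT t h"
proof -
  have "ennreal (rincT t h) \<le> ennreal (rsoonT t h + rgcdf h * rincT t h)"
    using incT_bound[of t h] assms by (simp add: real_forms ennreal_mult[symmetric] ennreal_plus[symmetric] del: ennreal_plus)
  then show ?thesis by (subst (asm) ennreal_le_iff) auto
qed

lemma rgcdf_tendsto: "((\<lambda>h. rgcdf h) \<longlongrightarrow> 0) (at_right 0)"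
proof -
  interpret G: prob_space gap_law by (rule prob_gap_law)
  interpret G: finite_borel_measure gap_law by unfold_locales simp
  have "measure gap_law {..0} = 0"
  proof -
    have "AE x in gap_law. x \<notin> {..0}" using AE_gap_law_pos by eventually_elim auto
    then have "emeasure gap_law {..0} = 0" by (subst (asm) AE_iff_measurable[OF _ refl]) (auto simp: atMost_def)
    then show ?thesis by (simp add: measure_def)
  qed
  moreover have "continuous (at_right 0) (cdf gap_law)" by (rule G.cdf_is_right_cont)
  moreover have "rgcdf = cdf gap_law" by (auto simp: rgcdf_def gcdf_def cdf_def measure_def fun_eq_iff)
  ultimately show ?thesis by (simp add: continuous_within cdf_def)
qed

lemma rsoonT_eq: "rsoonT t h = measure M {\<omega> \<in> space M. remaining_time Q t \<omega> \<le> h}"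
proof -
  have "soonT t h = (\<integral>\<^sup>+\<omega>. indicator {\<omega> \<in> space M. remaining_time Q t \<omega> \<le> h} \<omega> \<partial>M)"
    unfolding soonT_def by (intro nn_integral_cong) (auto simp: indicator_def)
  then show ?thesis by (simp add: rsoonT_def measure_def)
qed

lemma rsoonT_tendsto: "((\<lambda>h. rsoonT t h) \<longlongrightarrow> 0) (at_right 0)"
proof -
  let ?D = "distr M borel (remaining_time Q t)"
  interpret D: prob_space ?D by (rule prob_space_distr) measurable
  interpret D: finite_borel_measure ?D by unfold_locales simp
  have e: "cdf ?D h = rsoonT t h" for h
    unfolding cdf_def rsoonT_eq by (subst measure_distr) (auto intro!: arg_cong[where f=prob])
  have "AE \<omega> in M. \<not> remaining_time Q t \<omega> \<le> 0"
    using AE_arrivals by eventually_elim (simp add: remaining_pos not_le)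
  then have "prob {\<omega> \<in> space M. remaining_time Q t \<omega> \<le> 0} = 0"
    by (subst prob_Collect_eq_0) auto
  then have "rsoonT t 0 = 0" by (simp add: rsoonT_eq)
  moreover have "continuous (at_right 0) (cdf ?D)" by (rule D.cdf_is_right_cont)
  moreover have "cdf ?D = rsoonT t" by (rule ext) (rule e)
  ultimately show ?thesis by (simp add: continuous_within)
qed

text \<open>Once \<open>gcdf h\<close> is below 1/2, the later arrivals are absorbed into the left
  side of \<open>rincT_upper\<close>, leaving twice the probability of an arrival within
  \<open>h\<close>.\<close>

lemma rincT_tendsto: "((\<lambda>h. rincT t h) \<longlongrightarrow> 0) (at_right 0)"
proof (rule tendsto_sandwich[where f="\<lambda>_. 0" and h="\<lambda>h. 2 * rsoonT t h"])
  show "((\<lambda>h. 2 * rsoonT t h) \<longlongrightarrow> 0) (at_right 0)"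
    using tendsto_mult[OF tendsto_const[of 2] rsoonT_tendsto[of t]] by simp
  have "eventually (\<lambda>h. rgcdf h < 1/2) (at_right 0)"
    using rgcdf_tendsto by (rule order_tendstoD) simp
  then show "eventually (\<lambda>h. rincT t h \<le> 2 * rsoonT t h) (at_right 0)"
    using eventually_at_right_less[of "0::real"]
  proof eventually_elim
    case (elim h)
    have "rgcdf h * rincT t h \<le> 1/2 * rincT t h" using elim by (intro mult_right_mono) auto
    then show ?case using rincT_upper[of h t] elim by simp
  qed
qed auto

lemma rsoon_eq: "rsoon n t h = measure M {\<omega> \<in> space M. num_customers Q t \<omega> = n \<and> 0 < remaining_time Q t \<omega> \<and> remaining_time Q t \<omega> \<le> 0 + h}"
proof -
  have "soon n t h = (\<integral>\<^sup>+\<omega>. indicator {\<omega> \<in> space M. num_customers Q t \<omega> = n \<and> 0 < remaining_time Q t \<omega> \<and> remaining_time Q t \<omega> \<le> 0 + h} \<omega> \<partial>M)"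
    unfolding soon_def
  proof (rule nn_integral_cong_AE)
    show "AE \<omega> in M. of_bool (num_customers Q t \<omega> = n) * of_bool (remaining_time Q t \<omega> \<le> h) =
      (indicator {\<omega> \<in> space M. num_customers Q t \<omega> = n \<and> 0 < remaining_time Q t \<omega> \<and> remaining_time Q t \<omega> \<le> 0 + h} \<omega> :: ennreal)"
      using AE_arrivals AE_space
    proof eventually_elim
      case (elim \<omega>)
      then show ?case using remaining_pos[of \<omega> t] by (auto simp: indicator_def)
    qed
  qed
  then show ?thesis by (simp add: rsoon_def measure_def)
qed

text \<open>Strong induction on \<open>n\<close>. After division by h, the terms for m < n converge
  by induction and are multiplied by \<open>rgcdf h\<close>, which tends to 0. The total count
  divided by h is not known to stay bounded, but the total enters only with a factor h of its own,
  so that its convergence to 0 suffices.\<close>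

lemma rinc_derivative:
  assumes res: "residual_density M Q q" and t: "0 < t"
  shows "((\<lambda>h. rinc n t h / h) \<longlongrightarrow> q n 0 t) (at_right 0)"
proof (induction n rule: less_induct)
  case (less n)
  let ?C = "\<mu> + \<eta> + \<delta>"
  have s: "((\<lambda>h. rsoon n t h / h) \<longlongrightarrow> q n 0 t) (at_right 0)"
    using res[unfolded residual_density_def, THEN spec, of n, THEN spec, of 0] t unfolding rsoon_eq by simp
  show ?case
  proof (rule tendsto_sandwich)
    show "((\<lambda>h. rsoon n t h / h - ?C * rsoonT t h) \<longlongrightarrow> q n 0 t) (at_right 0)"
      using tendsto_diff[OF s tendsto_mult[OF tendsto_const[of ?C] rsoonT_tendsto[of t]]] by simp
    have "((\<lambda>h. rsoon n t h / h + ?C * rsoonT t h + rgcdf h * (\<Sum>m<n. rinc m t h / h) + ?C * rincT t h)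
       \<longlongrightarrow> q n 0 t + ?C * 0 + 0 * (\<Sum>m<n. q m 0 t) + ?C * 0) (at_right 0)"
      by (intro tendsto_add tendsto_mult tendsto_const tendsto_sum s rsoonT_tendsto rgcdf_tendsto rincT_tendsto less) auto
    then show "((\<lambda>h. rsoon n t h / h + ?C * rsoonT t h + rgcdf h * (\<Sum>m<n. rinc m t h / h) + ?C * rincT t h)
       \<longlongrightarrow> q n 0 t) (at_right 0)" by simp
    show "eventually (\<lambda>h. rsoon n t h / h - ?C * rsoonT t h \<le> rinc n t h / h) (at_right 0)"
      using eventually_at_right_less[of "0::real"]
    proof eventually_elim
      case (elim h)
      have "rsoon n t h / h \<le> (rinc n t h + ?C * h * rsoonT t h) / h"
        using rinc_lower[of t h n] t elim by (intro divide_right_mono) auto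
      also have "\<dots> = rinc n t h / h + ?C * rsoonT t h" using elim by (simp add: add_divide_distrib)
      finally show ?case by simp
    qed
    show "eventually (\<lambda>h. rinc n t h / h \<le> rsoon n t h / h + ?C * rsoonT t h + rgcdf h * (\<Sum>m<n. rinc m t h / h) + ?C * rincT t h) (at_right 0)"
      using eventually_at_right_less[of "0::real"]
    proof eventually_elim
      case (elim h)
      have "rinc n t h / h \<le> (rsoon n t h + ?C * h * rsoonT t h + rgcdf h * (\<Sum>m<n. rinc m t h) + ?C * h * rincT t h) / h"
        using rinc_upper[of t h n] t elim by (intro divide_right_mono) auto
      also have "\<dots> = rsoon n t h / h + ?C * rsoonT t h + rgcdf h * (\<Sum>m<n. rinc m t h / h) + ?C * rincT t h"
        using elim by (simp add: add_divide_distrib sum_divide_distrib[symmetric])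
      finally show ?case .
    qed
  qed
qed

section \<open>From right derivatives to the long-run rate\<close>

definition "lam n t = enn2real (Lam n t)"

lemma Lam_real: "Lam n t = ennreal (lam n t)"
  using Lam_finite[of n t] by (simp add: lam_def)

lemma lam_nonneg [simp]: "0 \<le> lam n t" by (simp add: lam_def)

lemma lam_add: assumes "0 \<le> h" shows "lam n (t + h) = lam n t + rinc n t h"
proof -
  have "ennreal (lam n (t + h)) = ennreal (lam n t + rinc n t h)"
    using Lam_add[OF assms, of n t] assms by (simp add: Lam_real real_forms)
  then show ?thesis by (subst (asm) ennreal_inj) auto
qed

text \<open>The same count without arrival 0. Later epochs contain a gap and so have no atoms,
  whereas \<open>res0\<close> may have some; the price is a discrepancy of at most 1.\<close>

definition "Lam' n t = (\<Sum>k. \<integral>\<^sup>+\<omega>. rho (Suc k) n \<omega> * of_bool (arrival_epoch Q (Suc k) \<omega> \<le> t) \<partial>M)"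
definition "lam' n t = enn2real (Lam' n t)"

lemma rho_le_1: "AE \<omega> in M. rho k n \<omega> \<le> 1"
  using AE_rho_sum[of k]
proof eventually_elim
  case (elim \<omega>)
  have "rho k n \<omega> \<le> (\<Sum>m. rho k m \<omega>)" using sum_le_suminf[of "\<lambda>m. rho k m \<omega>" "{n}"] by simp
  then show ?case using elim by simp
qed

lemma Lam_Lam':
  obtains z where "0 \<le> z" "z \<le> 1" "Lam n t = ennreal z + Lam' n t"
proof -
  let ?z = "\<integral>\<^sup>+\<omega>. rho 0 n \<omega> * of_bool (arrival_epoch Q 0 \<omega> \<le> t) \<partial>M"
  have "?z \<le> (\<integral>\<^sup>+\<omega>. 1 \<partial>M)"
    using rho_le_1[of 0 n] by (intro nn_integral_mono_AE) (auto elim!: eventually_mono)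
  then have "?z \<le> 1" by (simp add: emeasure_space_1)
  define z where "z = enn2real ?z"
  have z: "?z = ennreal z" "0 \<le> z" "z \<le> 1"
    using \<open>?z \<le> 1\<close> order_le_less_trans[OF \<open>?z \<le> 1\<close> ennreal_one_less_top]
    by (simp_all add: z_def enn2real_leI)
  have "Lam n t = ?z + Lam' n t" unfolding Lam_def Lam'_def by (rule suminf_split_first)
  then have "Lam n t = ennreal z + Lam' n t" by (simp only: z(1))
  then show ?thesis by (rule that[OF z(2,3)])
qed

lemma Lam'_real: "Lam' n t = ennreal (lam' n t)" "0 \<le> lam' n t" "lam' n t \<le> lam n t" "lam n t \<le> 1 + lam' n t"
proof -
  obtain z where z: "0 \<le> z" "z \<le> 1" "Lam n t = ennreal z + Lam' n t" by (rule Lam_Lam')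
  then have "Lam' n t < top" using Lam_finite[of n t] by (simp add: less_top[symmetric])
  then show 1: "Lam' n t = ennreal (lam' n t)" by (simp add: lam'_def)
  show 2: "0 \<le> lam' n t" by (simp add: lam'_def)
  have "ennreal (lam n t) = ennreal (z + lam' n t)" using z 1 2 by (simp add: Lam_real)
  then have "lam n t = z + lam' n t" using z 2 by (subst (asm) ennreal_inj) auto
  then show "lam' n t \<le> lam n t" "lam n t \<le> 1 + lam' n t" using z by auto
qed

lemma lam'_increment: assumes "0 \<le> h" shows "lam' n (t + h) - lam' n t \<le> rinc n t h" "lam' n t \<le> lam' n (t + h)"
proof -
  let ?i = "\<Sum>k. \<integral>\<^sup>+\<omega>. rho (Suc k) n \<omega> * of_bool (t < arrival_epoch Q (Suc k) \<omega> \<and> arrival_epoch Q (Suc k) \<omega> \<le> t + h) \<partial>M"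
  have 1: "Lam' n (t + h) = Lam' n t + ?i"
    unfolding Lam'_def suminf_add_ennreal
    by (intro suminf_cong, subst nn_integral_add[symmetric])
      (use assms in \<open>auto intro!: nn_integral_cong simp: of_bool_def\<close>)
  have 2: "?i \<le> inc n t h" unfolding inc_def by (subst (2) suminf_split_first) simp
  have "ennreal (lam' n (t + h)) \<le> ennreal (lam' n t + rinc n t h)"
    using 1 2 assms by (simp add: Lam'_real real_forms ennreal_plus Lam'_real(2))
  then show "lam' n (t + h) - lam' n t \<le> rinc n t h" by (subst (asm) ennreal_le_iff) (auto simp: Lam'_real(2))
  have "ennreal (lam' n t) \<le> ennreal (lam' n (t + h))" using 1 by (simp add: Lam'_real(1)[symmetric])
  then show "lam' n t \<le> lam' n (t + h)" by (subst (asm) ennreal_le_iff) (auto simp: Lam'_real(2))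
qed

lemma AE_no_atom: "AE \<omega> in M. arrival_epoch Q (Suc k) \<omega> \<noteq> t"
proof -
  have "(\<integral>\<^sup>+\<omega>. of_bool (arrival_epoch Q (Suc k) \<omega> = t) \<partial>M) = (\<integral>\<^sup>+\<omega>. (\<integral>\<^sup>+x. of_bool (arrival_epoch Q k \<omega> + x = t) \<partial>gap_law) \<partial>M)"
    unfolding epoch_Suc using nn_integral_next_total[of "\<lambda>z. of_bool (fst z + snd z = t)" k] by simp
  also have "\<dots> = (\<integral>\<^sup>+\<omega>. 0 \<partial>M)"
  proof (intro nn_integral_cong)
    fix \<omega>
    have "AE x in lborel. x \<noteq> t - arrival_epoch Q k \<omega>" by (rule AE_lborel_singleton)
    then have "AE x in lborel. 0 < ennreal (a x) \<longrightarrow> of_bool (arrival_epoch Q k \<omega> + x = t) = (0::ennreal)" by eventually_elim auto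
    then have "AE x in gap_law. of_bool (arrival_epoch Q k \<omega> + x = t) = (0::ennreal)" by (subst AE_density) auto
    then show "(\<integral>\<^sup>+x. of_bool (arrival_epoch Q k \<omega> + x = t) \<partial>gap_law) = 0"
      by (subst nn_integral_cong_AE[where v="\<lambda>_. 0"]) auto
  qed
  finally have "(\<integral>\<^sup>+\<omega>. of_bool (arrival_epoch Q (Suc k) \<omega> = t) \<partial>M) = 0" by simp
  then have "AE \<omega> in M. of_bool (arrival_epoch Q (Suc k) \<omega> = t) = (0::ennreal)"
    by (subst (asm) nn_integral_0_iff_AE) auto
  then show ?thesis by eventually_elim (auto simp: of_bool_def split: if_splits)
qed

text \<open>Left continuity, by monotone convergence along t - 1 / (i + 1). Since no epoch counted
  here equals \<open>t\<close> with positive probability, the limit of the counts is the count at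
  \<open>t\<close>.\<close>

lemma lam'_left:
  assumes "0 < e" shows "\<exists>d>0. \<forall>s. t - d < s \<longrightarrow> s < t \<longrightarrow> lam' n t \<le> lam' n s + e"
proof -
  define s where "s i = t - inverse (real (Suc i))" for i
  have smono: "s i \<le> s j" if "i \<le> j" for i j using that by (auto simp: s_def intro!: le_imp_inverse_le)
  have smono': "of_bool (y \<le> s i) \<le> (of_bool (y \<le> s j) :: ennreal)" if "i \<le> j" for i j y
    using smono[OF that] by (auto simp: of_bool_def)
  have slt: "s i < t" for i by (simp add: s_def)
  have slim: "s \<longlonglongrightarrow> t"
    using tendsto_diff[OF tendsto_const[of t] LIMSEQ_inverse_real_of_nat] by (simp add: s_def[abs_def])
  have up: "(SUP i. \<integral>\<^sup>+\<omega>. rho (Suc k) n \<omega> * of_bool (arrival_epoch Q (Suc k) \<omega> \<le> s i) \<partial>M) =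
     (\<integral>\<^sup>+\<omega>. rho (Suc k) n \<omega> * of_bool (arrival_epoch Q (Suc k) \<omega> \<le> t) \<partial>M)" for k
  proof -
    have "(SUP i. \<integral>\<^sup>+\<omega>. rho (Suc k) n \<omega> * of_bool (arrival_epoch Q (Suc k) \<omega> \<le> s i) \<partial>M) =
      (\<integral>\<^sup>+\<omega>. (SUP i. rho (Suc k) n \<omega> * of_bool (arrival_epoch Q (Suc k) \<omega> \<le> s i)) \<partial>M)"
      by (rule nn_integral_monotone_convergence_SUP[symmetric])
        (unfold incseq_def le_fun_def, intro allI impI mult_left_mono smono', auto)
    also have "\<dots> = (\<integral>\<^sup>+\<omega>. rho (Suc k) n \<omega> * of_bool (arrival_epoch Q (Suc k) \<omega> \<le> t) \<partial>M)"
    proof (rule nn_integral_cong_AE)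
      show "AE \<omega> in M. (SUP i. rho (Suc k) n \<omega> * of_bool (arrival_epoch Q (Suc k) \<omega> \<le> s i)) =
         rho (Suc k) n \<omega> * of_bool (arrival_epoch Q (Suc k) \<omega> \<le> t)"
        using AE_no_atom[of k t]
      proof eventually_elim
        case (elim \<omega>)
        show ?case
        proof (cases "arrival_epoch Q (Suc k) \<omega> < t")
          case True
          have "eventually (\<lambda>i. arrival_epoch Q (Suc k) \<omega> < s i) sequentially"
            using slim True by (rule order_tendstoD)
          then obtain i where i: "arrival_epoch Q (Suc k) \<omega> < s i" by (auto simp: eventually_sequentially)
          have "(SUP i. rho (Suc k) n \<omega> * of_bool (arrival_epoch Q (Suc k) \<omega> \<le> s i)) = rho (Suc k) n \<omega>"
          proof (rule antisym)
            show "(SUP i. rho (Suc k) n \<omega> * of_bool (arrival_epoch Q (Suc k) \<omega> \<le> s i)) \<le> rho (Suc k) n \<omega>"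
              by (rule SUP_least) (simp add: of_bool_def)
            show "rho (Suc k) n \<omega> \<le> (SUP i. rho (Suc k) n \<omega> * of_bool (arrival_epoch Q (Suc k) \<omega> \<le> s i))"
              by (rule SUP_upper2[of i]) (use i in auto)
          qed
          then show ?thesis using True by simp
        next
          case False
          then have "\<not> arrival_epoch Q (Suc k) \<omega> \<le> s i" for i using slt[of i] by linarith
          then show ?thesis using False elim by simp
        qed
      qed
    qed
    finally show ?thesis .
  qed
  have "Lam' n t = (SUP i. Lam' n (s i))"
    unfolding Lam'_def up[symmetric]
    by (rule ennreal_suminf_SUP_eq)
      (unfold incseq_def, intro allI impI nn_integral_mono mult_left_mono smono', auto)
  \<comment> \<open>A value strictly below the supremum is exceeded along the sequence. This needs a
    positive count; if the count is 0, any index will do.\<close>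
  moreover have "ennreal (lam' n t - e) < Lam' n t" if "0 < lam' n t"
    unfolding Lam'_real using that assms by (intro ennreal_lessI) auto
  ultimately have "\<exists>i. lam' n t \<le> lam' n (s i) + e"
  proof (cases "0 < lam' n t")
    case True
    assume "0 < lam' n t \<Longrightarrow> ennreal (lam' n t - e) < Lam' n t" and L: "Lam' n t = (SUP i. Lam' n (s i))"
    then have "ennreal (lam' n t - e) < (SUP i. Lam' n (s i))" using True by simp
    then obtain i where "ennreal (lam' n t - e) < Lam' n (s i)" by (auto simp: less_SUP_iff)
    then have "lam' n t - e < lam' n (s i)" unfolding Lam'_real
      by (metis Lam'_real(2) ennreal_leI leD leI)
    then show ?thesis by (intro exI[of _ i]) simp
  next
    case False
    then show ?thesis using assms Lam'_real(2)[of n "s 0"] by (intro exI[of _ 0]) simp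
  qed
  then obtain i where i: "lam' n t \<le> lam' n (s i) + e" by blast
  show ?thesis
  proof (intro exI[of _ "t - s i"] conjI allI impI)
    show "0 < t - s i" using slt by simp
    fix u assume "t - (t - s i) < u" "u < t"
    then have "lam' n (s i) \<le> lam' n u" using lam'_increment(2)[of "u - s i" n "s i"] by simp
    then show "lam' n t \<le> lam' n u + e" using i by simp
  qed
qed

lemma lin_aux:
  fixes x e t K l :: real
  assumes "(x - e/2) * t - K \<le> l" "l \<le> (x + e/2) * t + K" "K < e / 4 * t" "0 < e" "0 < t"
  shows "(x - e) * t < l" "l < (x + e) * t"
proof -
  define P R where "P = x * t" and "R = e * t"
  have R: "0 < R" using assms by (simp add: R_def)
  have "(x - e/2) * t = P - R / 2" "(x + e/2) * t = P + R / 2" "e / 4 * t = R / 4"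
    "(x - e) * t = P - R" "(x + e) * t = P + R"
    unfolding P_def R_def by (simp_all add: algebra_simps)
  then show "(x - e) * t < l" "l < (x + e) * t" using assms(1-3) R by auto
qed

text \<open>From some time u on, the right derivatives lie within a margin of x, and
  \<open>growth\<close> is applied to the count minus a line of slope x - e/2 and to a line of slope
  x + e/2 minus the count. Upward jumps are harmless for the first function, where monotonicity is
  enough. For the second they are not, and the count without arrival 0 is used.\<close>

lemma lam_rate:
  assumes res: "residual_density M Q q" and lim: "((\<lambda>t. q n 0 t) \<longlongrightarrow> x) at_top"
  shows "((\<lambda>t. lam n t / t) \<longlongrightarrow> x) at_top"
proof (rule tendstoI)
  fix e :: real assume e: "0 < e"
  have "eventually (\<lambda>t. \<bar>q n 0 t - x\<bar> < e / 4) at_top"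
    using tendstoD[OF lim, of "e / 4"] e by (simp add: dist_real_def)
  then obtain t0 where t0: "\<And>t. t0 \<le> t \<Longrightarrow> \<bar>q n 0 t - x\<bar> < e / 4" by (auto simp: eventually_at_top_linorder)
  define u where "u = max 1 t0"
  have u: "0 < u" "\<And>t. u \<le> t \<Longrightarrow> \<bar>q n 0 t - x\<bar> < e / 4" using t0 by (auto simp: u_def)
  have ev: "eventually (\<lambda>h. (x - e/2) * h \<le> rinc n t h \<and> rinc n t h \<le> (x + e/2) * h) (at_right 0)" if "u \<le> t" for t
  proof -
    have d: "((\<lambda>h. rinc n t h / h) \<longlongrightarrow> q n 0 t) (at_right 0)"
      using u that by (intro rinc_derivative[OF res]) auto
    have "eventually (\<lambda>h. dist (rinc n t h / h) (q n 0 t) < e / 4) (at_right 0)"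
      using tendstoD[OF d, of "e/4"] e by simp
    then show ?thesis using eventually_at_right_less[of "0::real"]
    proof eventually_elim
      case (elim h)
      have "\<bar>rinc n t h / h - q n 0 t\<bar> < e / 4" using elim by (simp only: dist_real_def)
      then have "\<bar>rinc n t h / h - x\<bar> < e / 2" using u(2)[OF that] by linarith
      then have "x - e/2 \<le> rinc n t h / h" "rinc n t h / h \<le> x + e/2" by linarith+
      then show ?case using elim by (simp add: field_simps)
    qed
  qed
  have low: "lam n u - (x - e/2) * u \<le> lam n t - (x - e/2) * t" if "u \<le> t" for t
  proof (rule growth[where f="\<lambda>t. lam n t - (x - e/2) * t", OF _ _ that])
    fix t d :: real assume "u < t" "0 < d"
    show "\<exists>d'>0. \<forall>s. t - d' < s \<longrightarrow> s < t \<longrightarrow> lam n s - (x - e/2) * s \<le> lam n t - (x - e/2) * t + d"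
    proof (intro exI[of _ "d / (\<bar>x - e/2\<bar> + 1)"] conjI allI impI)
      show "0 < d / (\<bar>x - e/2\<bar> + 1)" using \<open>0 < d\<close> by simp
      fix s assume s: "t - d / (\<bar>x - e/2\<bar> + 1) < s" "s < t"
      have "lam n s \<le> lam n t" using lam_add[of "t - s" n s] s by simp
      moreover have "(x - e/2) * (t - s) \<le> (\<bar>x - e/2\<bar> + 1) * (t - s)" using s by (intro mult_right_mono) auto
      moreover have "(\<bar>x - e/2\<bar> + 1) * (t - s) \<le> d"
      proof -
        have "t - s < d / (\<bar>x - e/2\<bar> + 1)" using s by linarith
        then show ?thesis by (simp add: pos_less_divide_eq mult.commute less_imp_le add_pos_nonneg)
      qed
      moreover have "(x - e/2) * (t - s) = (x - e/2) * t - (x - e/2) * s" by (rule right_diff_distrib)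
      ultimately show "lam n s - (x - e/2) * s \<le> lam n t - (x - e/2) * t + d" by linarith
    qed
  next
    fix t assume "u \<le> t"
    from ev[OF this] eventually_at_right_less[of "0::real"]
    show "eventually (\<lambda>h. lam n t - (x - e/2) * t \<le> lam n (t + h) - (x - e/2) * (t + h)) (at_right 0)"
    proof eventually_elim
      case (elim h)
      then have "lam n (t + h) = lam n t + rinc n t h" by (intro lam_add) simp
      then show ?case using elim by (simp only: distrib_left) linarith
    qed
  qed
  have high: "(x + e/2) * u - lam' n u \<le> (x + e/2) * t - lam' n t" if "u \<le> t" for t
  proof (rule growth[where f="\<lambda>t. (x + e/2) * t - lam' n t", OF _ _ that])
    fix t d :: real assume "u < t" "0 < d"
    obtain d1 where d1: "d1 > 0" "\<And>s. t - d1 < s \<Longrightarrow> s < t \<Longrightarrow> lam' n t \<le> lam' n s + d / 2"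
      using lam'_left[of "d / 2" t n] \<open>0 < d\<close> by auto
    show "\<exists>d'>0. \<forall>s. t - d' < s \<longrightarrow> s < t \<longrightarrow> (x + e/2) * s - lam' n s \<le> (x + e/2) * t - lam' n t + d"
    proof (intro exI[of _ "min d1 (d / 2 / (\<bar>x + e/2\<bar> + 1))"] conjI allI impI)
      have "0 < \<bar>x + e/2\<bar> + 1" by (simp add: add_nonneg_pos)
      then show "0 < min d1 (d / 2 / (\<bar>x + e/2\<bar> + 1))" using \<open>0 < d\<close> d1(1) by (simp only: min_less_iff_conj divide_pos_pos zero_less_numeral)
      fix s assume s: "t - min d1 (d / 2 / (\<bar>x + e/2\<bar> + 1)) < s" "s < t"
      have "lam' n t \<le> lam' n s + d / 2" using d1 s by auto
      moreover have "- ((x + e/2) * (t - s)) \<le> (\<bar>x + e/2\<bar> + 1) * (t - s)"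
        using s by (subst mult_minus_left[symmetric], intro mult_right_mono) auto
      moreover have "t - s < d / 2 / (\<bar>x + e/2\<bar> + 1)" using s by linarith
      then have "(\<bar>x + e/2\<bar> + 1) * (t - s) \<le> d / 2"
      proof -
        assume *: "t - s < d / 2 / (\<bar>x + e/2\<bar> + 1)"
        have K: "0 < \<bar>x + e/2\<bar> + 1" by (simp add: add_nonneg_pos)
        then have "(t - s) * (\<bar>x + e/2\<bar> + 1) < d / 2" using * by (simp only: pos_less_divide_eq)
        then show ?thesis by (subst mult.commute) (rule less_imp_le)
      qed
      moreover have "(x + e/2) * (t - s) = (x + e/2) * t - (x + e/2) * s" by (rule right_diff_distrib)
      ultimately show "(x + e/2) * s - lam' n s \<le> (x + e/2) * t - lam' n t + d" using \<open>0 < d\<close> by linarith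
    qed
  next
    fix t assume "u \<le> t"
    from ev[OF this] eventually_at_right_less[of "0::real"]
    show "eventually (\<lambda>h. (x + e/2) * t - lam' n t \<le> (x + e/2) * (t + h) - lam' n (t + h)) (at_right 0)"
    proof eventually_elim
      case (elim h)
      then have "lam' n (t + h) - lam' n t \<le> rinc n t h" by (intro lam'_increment(1)) simp
      then show ?case using elim by (simp only: distrib_left) linarith
    qed
  qed
  \<comment> \<open>\<open>K\<close> dominates everything evaluated at the fixed time
    \<open>u\<close> and the discrepancy between the two counts. It does not depend on
    \<open>t\<close>, so it is eventually below e t / 4.\<close>
  define K where "K = \<bar>x - e/2\<bar> * u + \<bar>x + e/2\<bar> * u + 2 + lam n u"
  have "eventually (\<lambda>t. max u (4 * K / e) < t) at_top" by (rule eventually_gt_at_top)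
  then show "eventually (\<lambda>t. dist (lam n t / t) x < e) at_top"
  proof eventually_elim
    case (elim t)
    then have t: "u \<le> t" "0 < t" "4 * K / e < t" using u by auto
    have "(x - e/2) * u \<le> \<bar>x - e/2\<bar> * u" "- ((x + e/2) * u) \<le> \<bar>x + e/2\<bar> * u"
      using u by (intro mult_right_mono, simp, simp, subst mult_minus_left[symmetric], intro mult_right_mono) auto
    moreover have "0 \<le> \<bar>x - e/2\<bar> * u" "0 \<le> \<bar>x + e/2\<bar> * u" "0 \<le> lam n u" using u by auto
    ultimately have "(x - e/2) * t - K \<le> lam n t" "lam n t \<le> (x + e/2) * t + K"
      using low[OF t(1)] high[OF t(1)] Lam'_real(3,4)[of n t] Lam'_real(2-4)[of n u] unfolding K_def by linarith+
    moreover have "K < e / 4 * t" using t e by (simp add: field_simps)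
    ultimately have "(x - e) * t < lam n t" "lam n t < (x + e) * t"
      using lin_aux[of x e t K "lam n t"] e t by auto
    then show ?case using t by (simp add: dist_real_def abs_less_iff field_simps)
  qed
qed

end

section \<open>Laplace transforms and their limits\<close>

lemma nn_integral_expo_shift:
  assumes [measurable]: "g \<in> borel_measurable borel" and "0 \<le> x"
  shows "(\<integral>\<^sup>+y. of_bool (x \<le> y) * g (y - x) \<partial>expo l) = ennreal (exp (- l * x)) * (\<integral>\<^sup>+y. g y \<partial>expo l)"
proof -
  have "(\<integral>\<^sup>+y. of_bool (x \<le> y) * g (y - x) \<partial>expo l) = (\<integral>\<^sup>+y. indicator {x<..} y * g (y - x) \<partial>expo l)"
  proof (rule nn_integral_cong_AE)
    have "AE y in expo l. y \<noteq> x"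
      using AE_lborel_singleton[of x] by (subst AE_density) auto
    then show "AE y in expo l. of_bool (x \<le> y) * g (y - x) = indicator {x<..} y * g (y - x)"
      by eventually_elim (auto simp: indicator_def)
  qed
  then show ?thesis using nn_integral_expo_memoryless[OF assms, of l] by simp
qed

context negative_disaster_queue
begin

text \<open>The Laplace-Stieltjes transform of \<open>Lam n\<close>. Of the two kernels below,
  \<open>kap s m n\<close> describes the passage from an arrival that finds \<open>m\<close> to the
  next one finding \<open>n\<close>, discounted over the gap, and \<open>occ s m n\<close> is the
  discounted time spent with \<open>n\<close> customers in between.\<close>

definition Lt :: "nat \<Rightarrow> real \<Rightarrow> ennreal" where
  "Lt n s = (\<Sum>k. \<integral>\<^sup>+\<omega>. rho k n \<omega> * ennreal (exp (- s * arrival_epoch Q k \<omega>)) \<partial>M)"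

definition kap :: "real \<Rightarrow> nat \<Rightarrow> nat \<Rightarrow> ennreal" where
  "kap s m n = (\<Sum>i=1..b. ennreal (g i) * (\<integral>\<^sup>+x. ennreal (exp (- s * x)) * ennreal (trans x (m + i) n) \<partial>gap_law))"

definition occ :: "real \<Rightarrow> nat \<Rightarrow> nat \<Rightarrow> ennreal" where
  "occ s m n = (\<Sum>i=1..b. ennreal (g i) *
     (\<integral>\<^sup>+x. (\<integral>\<^sup>+y. indicator {0<..<x} y * ennreal (exp (- s * y)) * ennreal (trans y (m + i) n) \<partial>lborel) \<partial>gap_law))"

lemma Lt_rec: "Lt n s = (\<integral>\<^sup>+\<omega>. rho 0 n \<omega> * ennreal (exp (- s * arrival_epoch Q 0 \<omega>)) \<partial>M) + (\<Sum>m. Lt m s * kap s m n)"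
proof -
  have "(\<integral>\<^sup>+\<omega>. rho (Suc k) n \<omega> * ennreal (exp (- s * arrival_epoch Q (Suc k) \<omega>)) \<partial>M) =
     (\<Sum>m. (\<integral>\<^sup>+\<omega>. rho k m \<omega> * ennreal (exp (- s * arrival_epoch Q k \<omega>)) \<partial>M) * kap s m n)" for k
  proof -
    define f where "f m z = ennreal (exp (- s * fst z)) * (ennreal (exp (- s * fst (snd z))) *
      ennreal (trans (fst (snd z)) (m + snd (snd z)) n))" for m :: nat and z :: "real \<times> real \<times> nat"
    have [measurable]: "(\<lambda>z::real \<times> real \<times> nat. trans (fst (snd z)) (m + snd (snd z)) n) \<in> borel_measurable (borel \<Otimes>\<^sub>M borel \<Otimes>\<^sub>M count_space UNIV)" for m
      by (rule measurable_trans_nat) measurable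
    have f[measurable]: "f m \<in> borel_measurable (borel \<Otimes>\<^sub>M borel \<Otimes>\<^sub>M count_space UNIV)" for m
      unfolding f_def[abs_def] by measurable
    have "rho (Suc k) n \<omega> * ennreal (exp (- s * arrival_epoch Q (Suc k) \<omega>)) =
       (\<Sum>m. rho k m \<omega> * f m (arrival_epoch Q k \<omega>, gap Q k \<omega>, batch Q k \<omega>))" for \<omega>
    proof -
      have e: "ennreal (exp (- s * arrival_epoch Q (Suc k) \<omega>)) = ennreal (exp (- s * arrival_epoch Q k \<omega>)) * ennreal (exp (- s * gap Q k \<omega>))"
        by (simp add: epoch_Suc ennreal_mult'[symmetric] exp_add[symmetric] algebra_simps)
      show ?thesis unfolding e
        by (simp add: rho_def f_def epoch_Suc ennreal_suminf_multc[symmetric] mult_ac)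
    qed
    then have "(\<integral>\<^sup>+\<omega>. rho (Suc k) n \<omega> * ennreal (exp (- s * arrival_epoch Q (Suc k) \<omega>)) \<partial>M) =
       (\<integral>\<^sup>+\<omega>. (\<Sum>m. rho k m \<omega> * f m (arrival_epoch Q k \<omega>, gap Q k \<omega>, batch Q k \<omega>)) \<partial>M)" by (simp only:)
    also have "\<dots> = (\<Sum>m. \<integral>\<^sup>+\<omega>. rho k m \<omega> * f m (arrival_epoch Q k \<omega>, gap Q k \<omega>, batch Q k \<omega>) \<partial>M)"
      by (rule nn_integral_suminf) (auto intro!: borel_measurable_times measurable_compose[OF _ f])
    also have "\<dots> = (\<Sum>m. \<integral>\<^sup>+\<omega>. rho k m \<omega> * (\<Sum>i=1..b. ennreal (g i) * (\<integral>\<^sup>+x. f m (arrival_epoch Q k \<omega>, x, i) \<partial>gap_law)) \<partial>M)"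
      by (intro suminf_cong nn_integral_next f)
    also have "\<dots> = (\<Sum>m. \<integral>\<^sup>+\<omega>. (rho k m \<omega> * ennreal (exp (- s * arrival_epoch Q k \<omega>))) * kap s m n \<partial>M)"
    proof (intro suminf_cong nn_integral_cong)
      fix m \<omega>
      have "(\<integral>\<^sup>+x. f m (arrival_epoch Q k \<omega>, x, i) \<partial>gap_law) = ennreal (exp (- s * arrival_epoch Q k \<omega>)) *
         (\<integral>\<^sup>+x. ennreal (exp (- s * x)) * ennreal (trans x (m + i) n) \<partial>gap_law)" for i
        unfolding f_def fst_conv snd_conv by (rule nn_integral_cmult) measurable
      then show "rho k m \<omega> * (\<Sum>i=1..b. ennreal (g i) * (\<integral>\<^sup>+x. f m (arrival_epoch Q k \<omega>, x, i) \<partial>gap_law)) =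
         (rho k m \<omega> * ennreal (exp (- s * arrival_epoch Q k \<omega>))) * kap s m n"
        by (simp add: kap_def sum_distrib_left mult_ac)
    qed
    also have "\<dots> = (\<Sum>m. (\<integral>\<^sup>+\<omega>. rho k m \<omega> * ennreal (exp (- s * arrival_epoch Q k \<omega>)) \<partial>M) * kap s m n)"
      by (intro suminf_cong nn_integral_multc) measurable
    finally show ?thesis .
  qed
  then have "(\<Sum>k. \<integral>\<^sup>+\<omega>. rho (Suc k) n \<omega> * ennreal (exp (- s * arrival_epoch Q (Suc k) \<omega>)) \<partial>M) =
     (\<Sum>k. \<Sum>m. (\<integral>\<^sup>+\<omega>. rho k m \<omega> * ennreal (exp (- s * arrival_epoch Q k \<omega>)) \<partial>M) * kap s m n)" by (simp only:)
  also have "\<dots> = (\<Sum>m. Lt m s * kap s m n)"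
    by (subst suminf_swap_ennreal) (simp add: Lt_def ennreal_suminf_multc)
  finally show ?thesis unfolding Lt_def[of n] by (subst suminf_split_first) simp
qed

text \<open>Summed over the states the queue disappears and only the renewal process is left, whose
  transform is a geometric series.\<close>

lemma Lt_sum: "(\<Sum>n. Lt n s) = (\<integral>\<^sup>+\<omega>. ennreal (exp (- s * res0 Q \<omega>)) \<partial>M) * (\<Sum>k. lap s ^ k)"
proof -
  have "(\<Sum>n. Lt n s) = (\<Sum>k. \<Sum>n. \<integral>\<^sup>+\<omega>. rho k n \<omega> * ennreal (exp (- s * arrival_epoch Q k \<omega>)) \<partial>M)"
    unfolding Lt_def by (rule suminf_swap_ennreal)
  also have "\<dots> = (\<Sum>k. \<integral>\<^sup>+\<omega>. ennreal (exp (- s * arrival_epoch Q k \<omega>)) \<partial>M)"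
    by (intro suminf_cong nn_integral_rho_sum[symmetric]) measurable
  also have "\<dots> = (\<integral>\<^sup>+\<omega>. ennreal (exp (- s * res0 Q \<omega>)) \<partial>M) * (\<Sum>k. lap s ^ k)"
    unfolding nn_integral_exp_epoch by (rule ennreal_suminf_cmult)
  finally show ?thesis .
qed

text \<open>Integration by parts in probabilistic form: exp(- s A) is the probability that an
  independent exponential time of rate s is at least A.\<close>

lemma Lt_eq_expo: assumes s: "0 < s" shows "Lt n s = (\<integral>\<^sup>+t. Lam n t \<partial>expo s)"
proof -
  interpret E: prob_space "expo s" using s by (rule prob_space_expo)
  interpret EM: pair_sigma_finite "expo s" M ..
  have "(\<integral>\<^sup>+t. Lam n t \<partial>expo s) = (\<Sum>k. \<integral>\<^sup>+t. \<integral>\<^sup>+\<omega>. rho k n \<omega> * of_bool (arrival_epoch Q k \<omega> \<le> t) \<partial>M \<partial>expo s)"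
    unfolding Lam_def by (rule nn_integral_suminf) measurable
  also have "\<dots> = (\<Sum>k. \<integral>\<^sup>+\<omega>. \<integral>\<^sup>+t. rho k n \<omega> * of_bool (arrival_epoch Q k \<omega> \<le> t) \<partial>expo s \<partial>M)"
  proof (intro suminf_cong)
    fix k
    have "(\<lambda>(t, \<omega>). rho k n \<omega> * of_bool (arrival_epoch Q k \<omega> \<le> t)) \<in> borel_measurable (expo s \<Otimes>\<^sub>M M)" by measurable
    from EM.Fubini[OF this]
    show "(\<integral>\<^sup>+t. \<integral>\<^sup>+\<omega>. rho k n \<omega> * of_bool (arrival_epoch Q k \<omega> \<le> t) \<partial>M \<partial>expo s) =
      (\<integral>\<^sup>+\<omega>. \<integral>\<^sup>+t. rho k n \<omega> * of_bool (arrival_epoch Q k \<omega> \<le> t) \<partial>expo s \<partial>M)" by simp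
  qed
  also have "\<dots> = Lt n s"
    unfolding Lt_def
  proof (intro suminf_cong nn_integral_cong_AE)
    fix k
    show "AE \<omega> in M. (\<integral>\<^sup>+t. rho k n \<omega> * of_bool (arrival_epoch Q k \<omega> \<le> t) \<partial>expo s) =
        rho k n \<omega> * ennreal (exp (- s * arrival_epoch Q k \<omega>))"
      using AE_arrivals
    proof eventually_elim
      case (elim \<omega>)
      have "0 < epoch \<omega> 0" "epoch \<omega> 0 \<le> epoch \<omega> k"
        using elim by (auto simp: arrivals_def intro: monoD[OF strict_mono_mono])
      then have "(\<integral>\<^sup>+t. of_bool (arrival_epoch Q k \<omega> \<le> t) \<partial>expo s) = ennreal (exp (- s * arrival_epoch Q k \<omega>))"
        using nn_integral_expo_shift[of "\<lambda>_. 1" "epoch \<omega> k" s] E.emeasure_space_1 by simp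
      then show ?case by (subst nn_integral_cmult) auto
    qed
  qed
  finally show ?thesis ..
qed

definition pn :: "nat \<Rightarrow> real \<Rightarrow> ennreal" where
  "pn n t = (\<integral>\<^sup>+\<omega>. of_bool (num_customers Q t \<omega> = n) \<partial>M)"

lemma measurable_pn[measurable]: "pn n \<in> borel_measurable borel"
  unfolding pn_def[abs_def] by measurable

text \<open>Only the summand of the interval between arrivals that contains \<open>t\<close> can be
  nonzero. Before the first arrival the left side is 0, hence an inequality.\<close>

lemma cond_prob_decomp:
  assumes A: "arrivals (epoch \<omega>)" and t: "0 \<le> t"
  shows "(\<Sum>k. \<Sum>m. rho k m \<omega> *
     (of_bool (epoch \<omega> k \<le> t \<and> t < epoch \<omega> k + gap Q k \<omega>) * ennreal (trans (t - epoch \<omega> k) (m + batch Q k \<omega>) n))) \<le> cond_prob t n \<omega>"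
    (is "(\<Sum>k. ?S k) \<le> _")
proof -
  have sm: "strict_mono (epoch \<omega>)" using A by (simp add: arrivals_def)
  have zero: "?S j = 0" if "Suc j \<noteq> next_idx t \<omega>" for j
  proof -
    have "\<not> (epoch \<omega> j \<le> t \<and> t < epoch \<omega> (Suc j))"
    proof (cases "j < next_idx t \<omega>")
      case True
      then have "Suc j < next_idx t \<omega>" using that by simp
      then show ?thesis using next_idx(2)[OF A, where t=t and i="Suc j"] by simp
    next
      case False
      then have "epoch \<omega> (next_idx t \<omega>) \<le> epoch \<omega> j" using monoD[OF strict_mono_mono[OF sm]] by simp
      then show ?thesis using next_idx(1)[OF A, of t] by linarith
    qed
    then show ?thesis by (auto simp: epoch_Suc)
  qed
  show ?thesis
  proof (cases "next_idx t \<omega>")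
    case 0
    then have "?S j = 0" for j using zero[of j] by simp
    then show ?thesis by (simp only: suminf_zero) simp
  next
    case (Suc k)
    have k: "epoch \<omega> k \<le> t" "t < epoch \<omega> (Suc k)" using next_idx[OF A, where t=t] Suc by auto
    have "(\<Sum>k. ?S k) = (\<Sum>j\<in>{k}. ?S j)"
      using zero Suc by (intro suminf_finite) auto
    also have "\<dots> = (\<Sum>m. rho k m \<omega> * ennreal (trans (t - epoch \<omega> k) (m + batch Q k \<omega>) n))"
      using k by (simp add: epoch_Suc)
    also have "\<dots> = cond_prob t n \<omega>"
      unfolding cond_prob_def rho_def using k by (intro W_between[OF A, symmetric]) auto
    finally show ?thesis by simp
  qed
qed

text \<open>The right side is the probability of \<open>n\<close> customers at an independent
  exponential time T of rate s. Split according to the last arrival before T: reaching the epoch of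
  arrival k contributes exp(- s A_k), and by lack of memory the time elapsed since then has density
  s exp(- s y), which produces \<open>ennreal s * occ s m n\<close>.\<close>

lemma pn_expo_ge:
  assumes s: "0 < s"
  shows "(\<Sum>m. ennreal s * Lt m s * occ s m n) \<le> (\<integral>\<^sup>+t. pn n t \<partial>expo s)"
proof -
  interpret E: prob_space "expo s" using s by (rule prob_space_expo)
  interpret EM: pair_sigma_finite "expo s" M ..
  interpret G: prob_space gap_law by (rule prob_gap_law)
  interpret EG: pair_sigma_finite "expo s" gap_law ..
  define f where "f m t z = of_bool (fst z \<le> t \<and> t < fst z + fst (snd z)) *
      ennreal (trans (t - fst z) (m + snd (snd z)) n)" for m :: nat and t and z :: "real \<times> real \<times> nat"
  have [measurable]: "(\<lambda>z::real \<times> real \<times> nat. trans (t - fst z) (m + snd (snd z)) n) \<in> borel_measurable (borel \<Otimes>\<^sub>M borel \<Otimes>\<^sub>M count_space UNIV)" for m t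
    by (rule measurable_trans_nat) measurable
  have f[measurable]: "f m t \<in> borel_measurable (borel \<Otimes>\<^sub>M borel \<Otimes>\<^sub>M count_space UNIV)" for m t
    unfolding f_def[abs_def] by measurable
  \<comment> \<open>The probability that an arrival at \<open>u\<close> finding \<open>m\<close> is
    the last one before \<open>t\<close> and leads to \<open>n\<close> customers at
    \<open>t\<close>, averaged over batch size and gap.\<close>
  define \<Psi> where "\<Psi> m t u = (\<Sum>i=1..b. ennreal (g i) * (\<integral>\<^sup>+x. of_bool (u \<le> t \<and> t < u + x) * ennreal (trans (t - u) (m + i) n) \<partial>gap_law))" for m t u
  have \<Psi>[measurable]: "(\<lambda>z. \<Psi> m (fst z) (snd z)) \<in> borel_measurable (borel \<Otimes>\<^sub>M borel)" for m
    unfolding \<Psi>_def by measurable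
  have step: "(\<Sum>k. \<Sum>m. \<integral>\<^sup>+\<omega>. rho k m \<omega> * \<Psi> m t (arrival_epoch Q k \<omega>) \<partial>M) \<le> pn n t" if t: "0 \<le> t" for t
  proof -
    have [measurable]: "(\<lambda>\<omega>. f m t (arrival_epoch Q k \<omega>, gap Q k \<omega>, batch Q k \<omega>)) \<in> borel_measurable M" for m k
      by (rule measurable_compose[OF _ f]) measurable
    have "(\<lambda>k m. \<integral>\<^sup>+\<omega>. rho k m \<omega> * \<Psi> m t (arrival_epoch Q k \<omega>) \<partial>M) = (\<lambda>k m. \<integral>\<^sup>+\<omega>. rho k m \<omega> * f m t (arrival_epoch Q k \<omega>, gap Q k \<omega>, batch Q k \<omega>) \<partial>M)"
      using nn_integral_next[OF f] by (auto simp: fun_eq_iff \<Psi>_def f_def)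
    then have "(\<Sum>k. \<Sum>m. \<integral>\<^sup>+\<omega>. rho k m \<omega> * \<Psi> m t (arrival_epoch Q k \<omega>) \<partial>M) =
       (\<Sum>k. \<Sum>m. \<integral>\<^sup>+\<omega>. rho k m \<omega> * f m t (arrival_epoch Q k \<omega>, gap Q k \<omega>, batch Q k \<omega>) \<partial>M)"
      by (simp only: fun_eq_iff)
    also have "\<dots> = (\<integral>\<^sup>+\<omega>. (\<Sum>k. \<Sum>m. rho k m \<omega> * f m t (arrival_epoch Q k \<omega>, gap Q k \<omega>, batch Q k \<omega>)) \<partial>M)"
      by (simp add: nn_integral_suminf)
    also have "\<dots> \<le> (\<integral>\<^sup>+\<omega>. cond_prob t n \<omega> \<partial>M)"
      by (rule nn_integral_mono_AE) (use AE_arrivals in eventually_elim, use cond_prob_decomp[OF _ t, of _ n] in \<open>simp add: f_def\<close>)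
    also have "\<dots> = pn n t"
      using num_customers_condition[of "\<lambda>_. 1" t n] by (simp add: pn_def)
    finally show ?thesis .
  qed
  have [measurable]: "(\<lambda>z. \<Psi> m (fst z) (arrival_epoch Q k (snd z))) \<in> borel_measurable (expo s \<Otimes>\<^sub>M M)" for m k
    using measurable_compose[OF _ \<Psi>[of m], of "\<lambda>z. (fst z, arrival_epoch Q k (snd z))"] by simp
  have "(\<Sum>k. \<Sum>m. \<integral>\<^sup>+t. \<integral>\<^sup>+\<omega>. rho k m \<omega> * \<Psi> m t (arrival_epoch Q k \<omega>) \<partial>M \<partial>expo s) =
     (\<integral>\<^sup>+t. (\<Sum>k. \<Sum>m. \<integral>\<^sup>+\<omega>. rho k m \<omega> * \<Psi> m t (arrival_epoch Q k \<omega>) \<partial>M) \<partial>expo s)"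
    by (simp add: nn_integral_suminf)
  also have "\<dots> \<le> (\<integral>\<^sup>+t. pn n t \<partial>expo s)"
    by (rule nn_integral_mono_AE) (use AE_expo_pos[of s] in \<open>auto elim!: eventually_mono intro!: step\<close>)
  finally have main: "(\<Sum>k. \<Sum>m. \<integral>\<^sup>+t. \<integral>\<^sup>+\<omega>. rho k m \<omega> * \<Psi> m t (arrival_epoch Q k \<omega>) \<partial>M \<partial>expo s) \<le> (\<integral>\<^sup>+t. pn n t \<partial>expo s)" .
  have "(\<Sum>k. \<Sum>m. \<integral>\<^sup>+t. \<integral>\<^sup>+\<omega>. rho k m \<omega> * \<Psi> m t (arrival_epoch Q k \<omega>) \<partial>M \<partial>expo s) =
     (\<Sum>k. \<Sum>m. (\<integral>\<^sup>+\<omega>. rho k m \<omega> * ennreal (exp (- s * arrival_epoch Q k \<omega>)) \<partial>M) * (ennreal s * occ s m n))"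
  proof (intro suminf_cong)
    fix k m
    have [measurable]: "(\<lambda>z. \<Psi> m (fst z) (arrival_epoch Q k (snd z))) \<in> borel_measurable (expo s \<Otimes>\<^sub>M M)"
      using measurable_compose[OF _ \<Psi>[of m], of "\<lambda>z. (fst z, arrival_epoch Q k (snd z))"] by simp
    have [measurable]: "(\<lambda>t. \<Psi> m t u) \<in> borel_measurable borel" for u
      using measurable_compose[OF _ \<Psi>[of m], of "\<lambda>t. (t, u)"] by simp
    have "(\<integral>\<^sup>+t. \<integral>\<^sup>+\<omega>. rho k m \<omega> * \<Psi> m t (arrival_epoch Q k \<omega>) \<partial>M \<partial>expo s) = (\<integral>\<^sup>+\<omega>. \<integral>\<^sup>+t. rho k m \<omega> * \<Psi> m t (arrival_epoch Q k \<omega>) \<partial>expo s \<partial>M)"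
      using EM.Fubini[of "\<lambda>z. rho k m (snd z) * \<Psi> m (fst z) (arrival_epoch Q k (snd z))"] by simp
    also have "\<dots> = (\<integral>\<^sup>+\<omega>. rho k m \<omega> * ennreal (exp (- s * arrival_epoch Q k \<omega>)) * (ennreal s * occ s m n) \<partial>M)"
    proof (rule nn_integral_cong_AE)
      show "AE \<omega> in M. (\<integral>\<^sup>+t. rho k m \<omega> * \<Psi> m t (arrival_epoch Q k \<omega>) \<partial>expo s) =
        rho k m \<omega> * ennreal (exp (- s * arrival_epoch Q k \<omega>)) * (ennreal s * occ s m n)"
        using AE_arrivals
      proof eventually_elim
        case (elim \<omega>)
        let ?u = "epoch \<omega> k"
        have "0 < epoch \<omega> 0" "epoch \<omega> 0 \<le> epoch \<omega> k"
          using elim by (auto simp: arrivals_def intro: monoD[OF strict_mono_mono])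
        then have u: "0 \<le> ?u" by simp
        have "(\<integral>\<^sup>+t. \<integral>\<^sup>+x. of_bool (?u \<le> t \<and> t < ?u + x) * ennreal (trans (t - ?u) (m + i) n) \<partial>gap_law \<partial>expo s) =
           ennreal (exp (- s * ?u)) * (ennreal s * (\<integral>\<^sup>+x. (\<integral>\<^sup>+y. indicator {0<..<x} y * ennreal (exp (- s * y)) * ennreal (trans y (m + i) n) \<partial>lborel) \<partial>gap_law))" for i
        proof -
          \<comment> \<open>For \<open>m + i\<close> customers just after the arrival: the
            probability that the gap outlasts \<open>y\<close> and that \<open>n\<close> customers
            are present at that age.\<close>
          define h where "h y = (\<integral>\<^sup>+x. of_bool (y < x) * ennreal (trans y (m + i) n) \<partial>gap_law)" for y
          have [measurable]: "h \<in> borel_measurable borel" unfolding h_def by measurable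
          have "(\<integral>\<^sup>+t. \<integral>\<^sup>+x. of_bool (?u \<le> t \<and> t < ?u + x) * ennreal (trans (t - ?u) (m + i) n) \<partial>gap_law \<partial>expo s) =
             (\<integral>\<^sup>+t. of_bool (?u \<le> t) * h (t - ?u) \<partial>expo s)"
            unfolding h_def by (intro nn_integral_cong, subst nn_integral_cmult[symmetric]) (auto intro!: nn_integral_cong simp: of_bool_def)
          also have "\<dots> = ennreal (exp (- s * ?u)) * (\<integral>\<^sup>+y. h y \<partial>expo s)"
            by (rule nn_integral_expo_shift) (use u in auto)
          also have "(\<integral>\<^sup>+y. h y \<partial>expo s) = (\<integral>\<^sup>+x. \<integral>\<^sup>+y. of_bool (y < x) * ennreal (trans y (m + i) n) \<partial>expo s \<partial>gap_law)"
            unfolding h_def using EG.Fubini[of "\<lambda>(y, x). of_bool (y < x) * ennreal (trans y (m + i) n)"] by simp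
          also have "\<dots> = (\<integral>\<^sup>+x. ennreal s * (\<integral>\<^sup>+y. indicator {0<..<x} y * ennreal (exp (- s * y)) * ennreal (trans y (m + i) n) \<partial>lborel) \<partial>gap_law)"
          proof (intro nn_integral_cong)
            fix x
            have "(\<integral>\<^sup>+y. of_bool (y < x) * ennreal (trans y (m + i) n) \<partial>expo s) =
              (\<integral>\<^sup>+y. ennreal (exponential_density s y) * (of_bool (y < x) * ennreal (trans y (m + i) n)) \<partial>lborel)"
              by (subst nn_integral_density) auto
            also have "\<dots> = (\<integral>\<^sup>+y. ennreal s * (indicator {0<..<x} y * ennreal (exp (- s * y)) * ennreal (trans y (m + i) n)) \<partial>lborel)"
            proof (rule nn_integral_cong_AE)
              show "AE y in lborel. ennreal (exponential_density s y) * (of_bool (y < x) * ennreal (trans y (m + i) n)) =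
                 ennreal s * (indicator {0<..<x} y * ennreal (exp (- s * y)) * ennreal (trans y (m + i) n))"
                using AE_lborel_singleton[of 0]
                by eventually_elim (use s in \<open>auto simp: exponential_density_def indicator_def ennreal_mult' mult_ac\<close>)
            qed
            also have "\<dots> = ennreal s * (\<integral>\<^sup>+y. indicator {0<..<x} y * ennreal (exp (- s * y)) * ennreal (trans y (m + i) n) \<partial>lborel)"
              by (rule nn_integral_cmult) measurable
            finally show "(\<integral>\<^sup>+y. of_bool (y < x) * ennreal (trans y (m + i) n) \<partial>expo s) =
               ennreal s * (\<integral>\<^sup>+y. indicator {0<..<x} y * ennreal (exp (- s * y)) * ennreal (trans y (m + i) n) \<partial>lborel)" .
          qed
          also have "\<dots> = ennreal s * (\<integral>\<^sup>+x. (\<integral>\<^sup>+y. indicator {0<..<x} y * ennreal (exp (- s * y)) * ennreal (trans y (m + i) n) \<partial>lborel) \<partial>gap_law)"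
          proof (rule nn_integral_cmult)
            show "(\<lambda>x. \<integral>\<^sup>+y. indicator {0<..<x} y * ennreal (exp (- s * y)) * ennreal (trans y (m + i) n) \<partial>lborel) \<in> borel_measurable gap_law"
              unfolding greaterThanLessThan_iff indicator_def by measurable
          qed
          finally show ?thesis .
        qed
        then have "(\<integral>\<^sup>+t. \<Psi> m t ?u \<partial>expo s) = ennreal (exp (- s * ?u)) * (ennreal s * occ s m n)"
          unfolding \<Psi>_def occ_def
          by (subst nn_integral_sum) (auto simp: nn_integral_cmult sum_distrib_left mult_ac)
        then show ?case by (subst nn_integral_cmult) (auto simp: mult_ac)
      qed
    qed
    also have "\<dots> = (\<integral>\<^sup>+\<omega>. rho k m \<omega> * ennreal (exp (- s * arrival_epoch Q k \<omega>)) \<partial>M) * (ennreal s * occ s m n)"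
      by (rule nn_integral_multc) measurable
    finally show "(\<integral>\<^sup>+t. \<integral>\<^sup>+\<omega>. rho k m \<omega> * \<Psi> m t (arrival_epoch Q k \<omega>) \<partial>M \<partial>expo s) =
       (\<integral>\<^sup>+\<omega>. rho k m \<omega> * ennreal (exp (- s * arrival_epoch Q k \<omega>)) \<partial>M) * (ennreal s * occ s m n)" .
  qed
  also have "\<dots> = (\<Sum>m. ennreal s * Lt m s * occ s m n)"
    by (subst suminf_swap_ennreal) (simp add: Lt_def ennreal_suminf_multc mult_ac)
  finally show ?thesis using main by simp
qed

end

section \<open>Fatou's lemma for series and comparison of total masses\<close>

lemma suminf_fatou:
  fixes u :: "nat \<Rightarrow> nat \<Rightarrow> ennreal"
  shows "(\<Sum>m. liminf (\<lambda>s. u s m)) \<le> liminf (\<lambda>s. \<Sum>m. u s m)"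
  using nn_integral_liminf[of u "count_space UNIV"] by (simp add: nn_integral_count_space_nat)

lemma suminf_fatou_liminf:
  fixes u :: "nat \<Rightarrow> nat \<Rightarrow> ennreal"
  assumes lim: "\<And>m. (\<lambda>s. u s m) \<longlonglongrightarrow> v m" and le: "\<And>s. (\<Sum>m. u s m) \<le> w s"
  shows "(\<Sum>m. v m) \<le> liminf w"
proof -
  have "(\<Sum>m. v m) = (\<Sum>m. liminf (\<lambda>s. u s m))"
    using lim by (intro suminf_cong) (metis lim_imp_Liminf trivial_limit_sequentially)
  also have "\<dots> \<le> liminf (\<lambda>s. \<Sum>m. u s m)" by (rule suminf_fatou)
  also have "\<dots> \<le> liminf w" by (rule Liminf_mono) (simp add: le)
  finally show ?thesis .
qed

lemma suminf_fatou_le: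
  fixes u :: "nat \<Rightarrow> nat \<Rightarrow> ennreal"
  assumes lim: "\<And>m. (\<lambda>s. u s m) \<longlonglongrightarrow> v m" and le: "\<And>s. (\<Sum>m. u s m) \<le> w s" and w: "w \<longlonglongrightarrow> l"
  shows "(\<Sum>m. v m) \<le> l"
  using suminf_fatou_liminf[OF lim le] lim_imp_Liminf[OF trivial_limit_sequentially w] by simp

text \<open>The differences \<open>v n - u n\<close> are nonnegative, and cancelling the finite sum
  of u shows that they sum to 0. The invariance equation and the occupation formula are both
  obtained from inequalities in this way.\<close>

lemma suminf_eq_termwise:
  fixes u v :: "nat \<Rightarrow> ennreal"
  assumes le: "\<And>n. u n \<le> v n" and sum: "(\<Sum>n. v n) \<le> (\<Sum>n. u n)" and fin: "(\<Sum>n. u n) \<noteq> top"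
  shows "u n = v n"
proof -
  have "(\<Sum>n. v n) = (\<Sum>n. u n + (v n - u n))" using le by (simp add: add_diff_inverse_ennreal)
  also have "\<dots> = (\<Sum>n. u n) + (\<Sum>n. v n - u n)" by (rule suminf_add[symmetric]) auto
  finally have "(\<Sum>n. u n) + (\<Sum>n. v n - u n) \<le> (\<Sum>n. u n) + 0" using sum by simp
  then have "(\<Sum>n. v n - u n) \<le> 0" using fin by (simp add: ennreal_add_left_cancel_le)
  moreover have "v n - u n \<le> (\<Sum>n. v n - u n)" using sum_le_suminf[of "\<lambda>n. v n - u n" "{n}"] by simp
  ultimately have "v n - u n = 0" by simp
  then show ?thesis using le[of n] by (metis add.right_neutral add_diff_inverse_ennreal)
qed

lemma nn_integral_expo_scale:
  assumes s: "0 < s" and [measurable]: "f \<in> borel_measurable borel"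
  shows "(\<integral>\<^sup>+t. f t \<partial>expo s) = (\<integral>\<^sup>+t. f (t / s) \<partial>expo 1)"
proof -
  have "(\<integral>\<^sup>+t. f t \<partial>expo s) = (\<integral>\<^sup>+t. ennreal (exponential_density s t) * f t \<partial>lborel)"
    by (subst nn_integral_density) auto
  also have "\<dots> = ennreal (1 / s) * (\<integral>\<^sup>+t. ennreal (exponential_density s (t / s)) * f (t / s) \<partial>lborel)"
    using s by (subst nn_integral_real_affine[where t=0 and c="1 / s"]) auto
  also have "\<dots> = (\<integral>\<^sup>+t. ennreal (exponential_density 1 t) * f (t / s) \<partial>lborel)"
  proof (subst nn_integral_cmult[symmetric])
    have "ennreal (1 / s) * ennreal (exponential_density s (t / s)) = ennreal (exponential_density 1 t)" for t
      using s by (auto simp: exponential_density_def ennreal_mult'[symmetric] divide_less_0_iff)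
    then show "(\<integral>\<^sup>+t. ennreal (1 / s) * (ennreal (exponential_density s (t / s)) * f (t / s)) \<partial>lborel) =
      (\<integral>\<^sup>+t. ennreal (exponential_density 1 t) * f (t / s) \<partial>lborel)" by (simp add: mult.assoc[symmetric])
  qed auto
  also have "\<dots> = (\<integral>\<^sup>+t. f (t / s) \<partial>expo 1)" by (subst nn_integral_density) auto
  finally show ?thesis .
qed

lemma nn_integral_expo_mean: "(\<integral>\<^sup>+t. ennreal t \<partial>expo 1) = 1"
proof -
  have "(\<integral>\<^sup>+t. ennreal t \<partial>expo 1) = (\<integral>\<^sup>+t. ennreal (exponential_density 1 t * t) \<partial>lborel)"
    by (subst nn_integral_density) (auto simp: ennreal_mult' exponential_density_def intro!: nn_integral_cong)
  then show ?thesis using nn_integral_erlang_ith_moment[of 1 0 1] by simp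
qed

text \<open>The transform parameter tends to 0 along a sequence, which is the form in which Fatou's
  lemma and dominated convergence apply.\<close>

definition th :: "nat \<Rightarrow> real" where "th s = inverse (real (Suc s))"

lemma th_pos [simp]: "0 < th s" by (simp add: th_def)
lemma th_neq_0 [simp]: "th s \<noteq> 0" "\<not> th s \<le> 0" using th_pos[of s] by linarith+
lemma th_le_1: "th s \<le> 1" by (simp add: th_def inverse_le_1_iff)
lemma th_lim: "th \<longlonglongrightarrow> 0" unfolding th_def by (rule LIMSEQ_inverse_real_of_nat)

lemma th_inverse_lim: assumes "0 < t" shows "filterlim (\<lambda>s. t / th s) at_top sequentially"
proof -
  have "filterlim (\<lambda>s. t * real (Suc s)) at_top sequentially"
    by (rule filterlim_tendsto_pos_mult_at_top[OF tendsto_const assms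
      filterlim_compose[OF filterlim_real_sequentially filterlim_Suc]])
  then show ?thesis by (simp only: th_def divide_inverse inverse_inverse_eq)
qed

section \<open>Limits of the transforms\<close>

context negative_disaster_queue
begin

text \<open>An Abelian theorem. With time rescaled, s \<open>Lt n s\<close> is the expectation of s
  \<open>lam n (T / s)\<close> for T exponential of rate 1; the integrand converges to x T, and the
  mean of T is 1. At most linear growth of the count supplies the dominating function C (1 +
  T).\<close>

lemma Lt_limit:
  assumes lim: "((\<lambda>t. lam n t / t) \<longlongrightarrow> x) at_top"
  shows "(\<lambda>s. ennreal (th s) * Lt n (th s)) \<longlonglongrightarrow> ennreal x" "0 \<le> x"
proof -
  have "eventually (\<lambda>t. 0 \<le> lam n t / t) at_top"
    using eventually_ge_at_top[of 0] by eventually_elim simp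
  then show x0: "0 \<le> x" by (rule tendsto_lowerbound[OF lim]) simp
  have "eventually (\<lambda>t. lam n t / t < x + 1) at_top" by (rule order_tendstoD[OF lim]) simp
  then obtain T where T: "\<And>t. T \<le> t \<Longrightarrow> lam n t / t < x + 1" by (auto simp: eventually_at_top_linorder)
  \<comment> \<open>The part x + 1 serves beyond \<open>T\<close>, where the ratio is below x + 1;
    the value of the count at \<open>max 1 T\<close> serves before, by monotonicity.\<close>
  define C where "C = x + 1 + lam n (max 1 T)"
  have C: "0 \<le> C" using x0 by (simp add: C_def)
  have mono: "lam n t \<le> lam n t'" if "t \<le> t'" for t t' using lam_add[of "t' - t" n t] that by simp
  have bound: "lam n t \<le> C * (1 + t)" if "0 \<le> t" for t
  proof (cases "max 1 T \<le> t")
    case True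
    then have "lam n t \<le> (x + 1) * t" using T[of t] by (simp add: field_simps)
    also have "\<dots> \<le> C * (1 + t)" using x0 that by (intro mult_mono) (auto simp: C_def)
    finally show ?thesis .
  next
    case False
    then have "t \<le> max 1 T" by linarith
    from mono[OF this] have "lam n t \<le> C * 1" using x0 by (simp add: C_def)
    also have "\<dots> \<le> C * (1 + t)" using C that by (intro mult_left_mono) auto
    finally show ?thesis .
  qed
  have [measurable]: "Lam n \<in> borel_measurable borel" unfolding Lam_def[abs_def] by measurable
  have conv: "(\<lambda>s. \<integral>\<^sup>+t. ennreal (th s) * Lam n (t / th s) \<partial>expo 1) \<longlonglongrightarrow> (\<integral>\<^sup>+t. ennreal (x * t) \<partial>expo 1)"
  proof (rule nn_integral_dominated_convergence[where w="\<lambda>t. ennreal C + ennreal C * ennreal t"])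
    show "AE t in expo 1. ennreal (th s) * Lam n (t / th s) \<le> ennreal C + ennreal C * ennreal t" for s
      using AE_expo_pos[of 1]
    proof eventually_elim
      case (elim t)
      have "th s * lam n (t / th s) \<le> th s * (C * (1 + t / th s))"
        using bound[of "t / th s"] elim less_imp_le[OF th_pos[of s]] by (intro mult_left_mono) simp_all
      also have "\<dots> = C * th s + C * t" by (simp add: field_simps)
      also have "\<dots> \<le> C + C * t" using C th_le_1[of s] by (simp add: mult_left_le)
      finally have "ennreal (th s * lam n (t / th s)) \<le> ennreal (C + C * t)" by (rule ennreal_leI)
      then show ?case using C elim by (simp add: Lam_real ennreal_mult less_imp_le)
    qed
    have "(\<integral>\<^sup>+t. ennreal C + ennreal C * ennreal t \<partial>expo 1) = ennreal C * emeasure (expo 1) UNIV + ennreal C * 1"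
      by (subst nn_integral_add) (auto simp: nn_integral_cmult nn_integral_expo_mean)
    also have "emeasure (expo 1) UNIV = 1" using prob_space.emeasure_space_1[OF prob_space_expo[of 1]] by simp
    finally show "(\<integral>\<^sup>+t. ennreal C + ennreal C * ennreal t \<partial>expo 1) < \<infinity>" by simp
    show "AE t in expo 1. (\<lambda>s. ennreal (th s) * Lam n (t / th s)) \<longlonglongrightarrow> ennreal (x * t)"
      using AE_expo_pos[of 1]
    proof eventually_elim
      case (elim t)
      have "(\<lambda>s. lam n (t / th s) / (t / th s) * t) \<longlonglongrightarrow> x * t"
        by (intro tendsto_mult tendsto_const filterlim_compose[OF lim th_inverse_lim] elim)
      moreover have "lam n (t / th s) / (t / th s) * t = th s * lam n (t / th s)" for s
        using elim by (simp add: field_simps)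
      ultimately have "(\<lambda>s. ennreal (th s * lam n (t / th s))) \<longlonglongrightarrow> ennreal (x * t)" by (intro tendsto_ennrealI) simp
      then show ?case by (simp add: Lam_real ennreal_mult less_imp_le)
    qed
  qed auto
  have "(\<integral>\<^sup>+t. ennreal (x * t) \<partial>expo 1) = ennreal x"
    using x0 by (simp add: ennreal_mult' nn_integral_cmult nn_integral_expo_mean)
  moreover have "ennreal (th s) * Lt n (th s) = (\<integral>\<^sup>+t. ennreal (th s) * Lam n (t / th s) \<partial>expo 1)" for s
    unfolding Lt_eq_expo[OF th_pos] by (subst nn_integral_expo_scale) (auto simp: nn_integral_cmult)
  ultimately show "(\<lambda>s. ennreal (th s) * Lt n (th s)) \<longlonglongrightarrow> ennreal x" using conv by simp
qed

definition mean :: real where "mean = (LINT t|lborel. t * a t)"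

lemma gap_mean: "(\<integral>\<^sup>+x. ennreal x \<partial>gap_law) = ennreal mean" "0 < mean"
proof -
  interpret G: prob_space gap_law by (rule prob_gap_law)
  have nn: "0 \<le> t * a t" for t using a_nonneg[of t] a_support[of t] by (cases "t < 0") auto
  have "(\<integral>\<^sup>+x. ennreal x \<partial>gap_law) = (\<integral>\<^sup>+x. ennreal (x * a x) \<partial>lborel)"
    by (subst nn_integral_density)
      (auto intro!: nn_integral_cong simp: ennreal_mult''[OF a_nonneg] mult.commute)
  also have "\<dots> = ennreal mean" unfolding mean_def using a_mean nn by (intro nn_integral_eq_integral) auto
  finally show m: "(\<integral>\<^sup>+x. ennreal x \<partial>gap_law) = ennreal mean" .
  have "mean \<noteq> 0"
  proof
    assume "mean = 0"
    then have "(\<integral>\<^sup>+x. ennreal x \<partial>gap_law) = 0" using m by simp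
    then have "AE x in gap_law. ennreal x = 0" by (subst (asm) nn_integral_0_iff_AE) auto
    then have "AE x in gap_law. False" using AE_gap_law_pos by eventually_elim (auto simp: ennreal_eq_0_iff)
    then show False by simp
  qed
  moreover have "0 \<le> mean" unfolding mean_def using nn by (intro integral_nonneg_AE) auto
  ultimately show "0 < mean" by simp
qed

definition rlap :: "real \<Rightarrow> real" where "rlap s = enn2real (lap s)"

lemma rlap: "0 < s \<Longrightarrow> lap s = ennreal (rlap s)" "0 < s \<Longrightarrow> rlap s < 1" "0 \<le> rlap s"
proof -
  assume s: "0 < s"
  have "lap s < top" using lap_less_1[OF s] by (rule order_less_trans) simp
  then show e: "lap s = ennreal (rlap s)" by (simp add: rlap_def)
  show "rlap s < 1" using lap_less_1[OF s] unfolding e by (simp add: ennreal_less_one_iff rlap_def)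
qed (simp add: rlap_def)

text \<open>The quotient (1 - exp(- s x)) / s lies between 0 and x and tends to x, so dominated
  convergence with the integrable gap applies.\<close>

lemma rlap_deriv: "(\<lambda>s. (1 - rlap (th s)) / th s) \<longlonglongrightarrow> mean"
proof -
  let ?f = "\<lambda>s x. (1 - exp (- th s * x)) / th s"
  have f: "0 \<le> ?f s x" "?f s x \<le> x" if "0 < x" for s x
  proof -
    have "- th s * x \<le> 0" using that less_imp_le[OF th_pos[of s]] by simp
    then show "0 \<le> ?f s x" using less_imp_le[OF th_pos[of s]] by simp
    have "1 - exp (- th s * x) \<le> th s * x" using exp_ge_add_one_self[of "- th s * x"] by simp
    then show "?f s x \<le> x" by (simp add: divide_le_eq mult.commute)
  qed
  have conv: "(\<lambda>s. \<integral>\<^sup>+x. ennreal (?f s x) \<partial>gap_law) \<longlonglongrightarrow> (\<integral>\<^sup>+x. ennreal x \<partial>gap_law)"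
  proof (rule nn_integral_dominated_convergence[where w="\<lambda>x. ennreal x"])
    show "AE x in gap_law. ennreal (?f s x) \<le> ennreal x" for s
      using AE_gap_law_pos by eventually_elim (use f in \<open>auto intro!: ennreal_leI\<close>)
    show "(\<integral>\<^sup>+x. ennreal x \<partial>gap_law) < \<infinity>" by (simp add: gap_mean)
    show "AE x in gap_law. (\<lambda>s. ennreal (?f s x)) \<longlonglongrightarrow> ennreal x"
      using AE_gap_law_pos
    proof eventually_elim
      case (elim x)
      have "((\<lambda>t. exp (- t * x)) has_real_derivative - x) (at 0)" by (auto intro!: derivative_eq_intros)
      then have "(\<lambda>s. (exp (- th s * x) - exp (- 0 * x)) / (th s - 0)) \<longlonglongrightarrow> - x"
        unfolding has_field_derivative_iff
        by (rule filterlim_compose) (auto simp: filterlim_at th_lim less_imp_neq[OF th_pos, symmetric])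
      from tendsto_minus[OF this] have "(\<lambda>s. ?f s x) \<longlonglongrightarrow> x"
        by (simp add: minus_divide_left)
      then show ?case by (rule tendsto_ennrealI)
    qed
  qed auto
  have "(\<integral>\<^sup>+x. ennreal (?f s x) \<partial>gap_law) = ennreal ((1 - rlap (th s)) / th s)" for s
  proof -
    have "ennreal (th s) * (\<integral>\<^sup>+x. ennreal (?f s x) \<partial>gap_law) + lap (th s) =
       (\<integral>\<^sup>+x. ennreal (th s) * ennreal (?f s x) + ennreal (exp (- th s * x)) \<partial>gap_law)"
      unfolding lap_def by (subst nn_integral_add) (auto simp: nn_integral_cmult)
    also have "\<dots> = (\<integral>\<^sup>+x. 1 \<partial>gap_law)"
    proof (rule nn_integral_cong_AE)
      show "AE x in gap_law. ennreal (th s) * ennreal (?f s x) + ennreal (exp (- th s * x)) = 1"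
        using AE_gap_law_pos
      proof eventually_elim
        case (elim x)
        have "ennreal (th s) * ennreal (?f s x) + ennreal (exp (- th s * x)) = ennreal (th s * ?f s x + exp (- th s * x))"
          unfolding ennreal_mult[OF less_imp_le[OF th_pos[of s]] f(1)[OF elim, of s], symmetric]
          by (rule ennreal_plus[symmetric]) (rule mult_nonneg_nonneg[OF less_imp_le[OF th_pos[of s]] f(1)[OF elim, of s]], simp)
        also have "th s * ?f s x + exp (- th s * x) = 1" using th_pos[of s] by (simp add: less_imp_neq[OF th_pos, symmetric])
        finally show ?case by simp
      qed
    qed
    finally have e: "ennreal (th s) * (\<integral>\<^sup>+x. ennreal (?f s x) \<partial>gap_law) + ennreal (rlap (th s)) = 1"
      by (simp add: rlap(1))
    obtain r where r: "(\<integral>\<^sup>+x. ennreal (?f s x) \<partial>gap_law) = ennreal r" "0 \<le> r"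
    proof (cases "\<integral>\<^sup>+x. ennreal (?f s x) \<partial>gap_law")
      case top
      then have "ennreal (th s) * top + ennreal (rlap (th s)) = 1" using e by simp
      then show ?thesis by (simp add: ennreal_mult_top ennreal_eq_0_iff not_le)
    qed auto
    have "ennreal (th s * r + rlap (th s)) = ennreal 1"
      using e r rlap(3) less_imp_le[OF th_pos[of s]] by (simp add: ennreal_mult ennreal_plus)
    then have "th s * r + rlap (th s) = 1"
      using r(2) rlap(3) less_imp_le[OF th_pos[of s]] by (subst (asm) ennreal_inj) auto
    then have "r = (1 - rlap (th s)) / th s" by (simp add: field_simps)
    then show ?thesis using r by simp
  qed
  then have "(\<lambda>s. ennreal ((1 - rlap (th s)) / th s)) \<longlonglongrightarrow> ennreal mean" using conv by (simp add: gap_mean)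
  then show ?thesis
    using rlap(2)[OF th_pos] gap_mean(2) by (subst (asm) tendsto_ennreal_iff) (auto intro!: divide_nonneg_pos always_eventually less_imp_le)
qed

definition tot :: "nat \<Rightarrow> ennreal" where "tot s = (\<Sum>m. ennreal (th s) * Lt m (th s))"

text \<open>The elementary renewal theorem in transform form: the geometric series gives s / (1 -
  \<open>lap s\<close>), whose limit is the reciprocal of the mean gap, and the factor from the
  first arrival tends to 1.\<close>

lemma tot_limit: "tot \<longlonglongrightarrow> ennreal (1 / mean)"
proof -
  let ?R = "\<lambda>s. \<integral>\<^sup>+\<omega>. ennreal (exp (- th s * res0 Q \<omega>)) \<partial>M"
  have R: "?R \<longlonglongrightarrow> (\<integral>\<^sup>+\<omega>. 1 \<partial>M)"
  proof (rule nn_integral_dominated_convergence[where w="\<lambda>_. 1"])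
    show "AE \<omega> in M. ennreal (exp (- th s * res0 Q \<omega>)) \<le> 1" for s
      using res0_pos
    proof eventually_elim
      case (elim \<omega>)
      then have "0 \<le> th s * res0 Q \<omega>" using th_pos[of s] by (simp add: less_imp_le)
      then show ?case by simp
    qed
    have "(\<lambda>s. ennreal (exp (- th s * res0 Q \<omega>))) \<longlonglongrightarrow> ennreal (exp (- 0 * res0 Q \<omega>))" for \<omega>
      by (intro tendsto_ennrealI tendsto_intros th_lim)
    then show "AE \<omega> in M. (\<lambda>s. ennreal (exp (- th s * res0 Q \<omega>))) \<longlonglongrightarrow> 1"
      by simp
  qed (auto simp: emeasure_space_1)
  have g: "ennreal (th s) * (\<Sum>k. lap (th s) ^ k) = ennreal (1 / ((1 - rlap (th s)) / th s))" for s
  proof -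
    have "(\<Sum>k. lap (th s) ^ k) = (\<Sum>k. ennreal (rlap (th s) ^ k))"
      using rlap(3) by (simp add: rlap(1) ennreal_power)
    also have "\<dots> = ennreal (\<Sum>k. rlap (th s) ^ k)"
      using rlap(2)[OF th_pos] rlap(3) by (intro suminf_ennreal2 summable_geometric) auto
    also have "(\<Sum>k. rlap (th s) ^ k) = 1 / (1 - rlap (th s))"
      using rlap(2)[OF th_pos] rlap(3) by (intro suminf_geometric) auto
    finally show ?thesis using less_imp_le[OF th_pos[of s]] by (simp add: ennreal_mult'[symmetric])
  qed
  have "tot s = ?R s * ennreal (1 / ((1 - rlap (th s)) / th s))" for s
    unfolding tot_def ennreal_suminf_cmult Lt_sum g[symmetric] by (simp add: mult_ac)
  moreover have "(\<lambda>s. ?R s * ennreal (1 / ((1 - rlap (th s)) / th s))) \<longlonglongrightarrow> 1 * ennreal (1 / mean)"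
  proof (rule tendsto_mult_ennreal)
    show "?R \<longlonglongrightarrow> 1" using R by (simp add: emeasure_space_1)
    show "(\<lambda>s. ennreal (1 / ((1 - rlap (th s)) / th s))) \<longlonglongrightarrow> ennreal (1 / mean)"
      by (intro tendsto_ennrealI tendsto_divide tendsto_const rlap_deriv) (use gap_mean(2) in simp)
  qed auto
  ultimately show ?thesis by (subst tendsto_cong[of tot]) (auto simp only: mult_1 intro!: always_eventually)
qed

section \<open>Tightness through disasters\<close>

lemma sum_trans_tail:
  assumes "0 \<le> x" "1 \<le> n"
  shows "(\<Sum>j. of_bool (n \<le> j) * ennreal (trans x i j)) \<le> of_bool (n \<le> i) * ennreal (exp (- \<delta> * x))"
proof (cases "n \<le> i")
  case True
  have "(\<Sum>j. of_bool (n \<le> j) * ennreal (trans x i j)) = (\<Sum>j\<in>{n..i}. of_bool (n \<le> j) * ennreal (trans x i j))"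
    by (intro suminf_finite) (auto simp: trans_eq_0)
  also have "\<dots> = (\<Sum>j\<in>{n..i}. ennreal (wt (i - j) x))"
    using assms by (intro sum.cong) (auto simp: trans_pos)
  also have "\<dots> = ennreal (\<Sum>j\<in>{n..i}. wt (i - j) x)" using wt_nonneg[OF assms(1)] by (intro sum_ennreal) auto
  also have "(\<Sum>j\<in>{n..i}. wt (i - j) x) = (\<Sum>l<Suc (i - n). wt l x)"
    by (rule sum.reindex_bij_witness[where i="\<lambda>l. i - l" and j="\<lambda>j. i - j"]) (use True in auto)
  also have "ennreal \<dots> \<le> ennreal (exp (- \<delta> * x))" by (intro ennreal_leI sum_wt_le assms)
  finally show ?thesis using True by simp
next
  case False
  then have "(\<lambda>j. of_bool (n \<le> j) * ennreal (trans x i j)) = (\<lambda>j. 0)" by (auto simp: trans_eq_0)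
  then show ?thesis by (simp only: suminf_zero zero_le)
qed

definition TL :: "nat \<Rightarrow> real \<Rightarrow> ennreal" where "TL n s = (\<Sum>m. of_bool (n \<le> m) * Lt m s)"

text \<open>A batch has at most \<open>b\<close> members, so an arrival that finds at least (j + 1)
  b customers had a predecessor that found at least j b, and no disaster happened in between; this
  costs the factor \<open>lap \<delta>\<close>. The 1 accounts for the first arrival, which has no
  predecessor.\<close>

lemma TL_step: assumes s: "0 \<le> s" shows "TL (Suc j * b) s \<le> 1 + lap \<delta> * TL (j * b) s"
proof -
  let ?n = "Suc j * b"
  have n1: "1 \<le> ?n" using b_pos by simp
  have kap_tail: "(\<Sum>j'. of_bool (?n \<le> j') * kap s m j') \<le> of_bool (j * b \<le> m) * lap \<delta>" for m
  proof -
    have "(\<Sum>j'. of_bool (?n \<le> j') * kap s m j') = (\<Sum>i=1..b. ennreal (g i) *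
       (\<integral>\<^sup>+x. ennreal (exp (- s * x)) * (\<Sum>j'. of_bool (?n \<le> j') * ennreal (trans x (m + i) j')) \<partial>gap_law))"
    proof -
      have "(\<Sum>j'. of_bool (?n \<le> j') * kap s m j') = (\<Sum>j'. \<Sum>i=1..b. ennreal (g i) *
       (\<integral>\<^sup>+x. ennreal (exp (- s * x)) * (of_bool (?n \<le> j') * ennreal (trans x (m + i) j')) \<partial>gap_law))"
        unfolding kap_def sum_distrib_left
        by (intro suminf_cong sum.cong refl) (simp add: of_bool_def)
      also have "\<dots> = (\<Sum>i=1..b. \<Sum>j'. ennreal (g i) *
       (\<integral>\<^sup>+x. ennreal (exp (- s * x)) * (of_bool (?n \<le> j') * ennreal (trans x (m + i) j')) \<partial>gap_law))"
        by (intro suminf_sum) simp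
      also have "\<dots> = (\<Sum>i=1..b. ennreal (g i) *
       (\<integral>\<^sup>+x. ennreal (exp (- s * x)) * (\<Sum>j'. of_bool (?n \<le> j') * ennreal (trans x (m + i) j')) \<partial>gap_law))"
        by (simp add: nn_integral_suminf ennreal_suminf_cmult[symmetric] del: ennreal_suminf_cmult)
      finally show ?thesis .
    qed
    also have "\<dots> \<le> (\<Sum>i=1..b. ennreal (g i) * (of_bool (j * b \<le> m) * lap \<delta>))"
    proof (intro sum_mono mult_left_mono)
      fix i assume i: "i \<in> {1..b}"
      have "(\<integral>\<^sup>+x. ennreal (exp (- s * x)) * (\<Sum>j'. of_bool (?n \<le> j') * ennreal (trans x (m + i) j')) \<partial>gap_law) \<le>
        (\<integral>\<^sup>+x. of_bool (j * b \<le> m) * ennreal (exp (- \<delta> * x)) \<partial>gap_law)"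
      proof (rule nn_integral_mono_AE)
        show "AE x in gap_law. ennreal (exp (- s * x)) * (\<Sum>j'. of_bool (?n \<le> j') * ennreal (trans x (m + i) j')) \<le>
           of_bool (j * b \<le> m) * ennreal (exp (- \<delta> * x))"
          using AE_gap_law_pos AE_exp_le_1[OF s]
        proof eventually_elim
          case (elim x)
          have "ennreal (exp (- s * x)) * (\<Sum>j'. of_bool (?n \<le> j') * ennreal (trans x (m + i) j')) \<le>
            1 * (of_bool (?n \<le> m + i) * ennreal (exp (- \<delta> * x)))"
            using elim n1 by (intro mult_mono sum_trans_tail) auto
          also have "\<dots> \<le> of_bool (j * b \<le> m) * ennreal (exp (- \<delta> * x))" using i by (auto simp: of_bool_def)
          finally show ?case .
        qed
      qed
      then show "(\<integral>\<^sup>+x. ennreal (exp (- s * x)) * (\<Sum>j'. of_bool (?n \<le> j') * ennreal (trans x (m + i) j')) \<partial>gap_law) \<le>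
        of_bool (j * b \<le> m) * lap \<delta>" by (simp add: nn_integral_cmult lap_def)
    qed auto
    also have "\<dots> = of_bool (j * b \<le> m) * lap \<delta>" by (simp add: sum_distrib_right[symmetric])
    finally show ?thesis .
  qed
  let ?r = "\<lambda>n. \<integral>\<^sup>+\<omega>. rho 0 n \<omega> * ennreal (exp (- s * arrival_epoch Q 0 \<omega>)) \<partial>M"
  have "TL ?n s = (\<Sum>j'. of_bool (?n \<le> j') * ?r j' + of_bool (?n \<le> j') * (\<Sum>m. Lt m s * kap s m j'))"
    unfolding TL_def by (subst Lt_rec) (simp add: distrib_left)
  also have "\<dots> = (\<Sum>j'. of_bool (?n \<le> j') * ?r j') + (\<Sum>j'. of_bool (?n \<le> j') * (\<Sum>m. Lt m s * kap s m j'))"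
    by (rule suminf_add_ennreal[symmetric])
  also have "\<dots> \<le> 1 + (\<Sum>m. Lt m s * (of_bool (j * b \<le> m) * lap \<delta>))"
  proof (intro add_mono)
    have "(\<Sum>j'. of_bool (?n \<le> j') * ?r j') \<le> (\<Sum>j'. ?r j')"
      by (intro suminf_le) (auto simp: of_bool_def)
    also have "\<dots> = (\<integral>\<^sup>+\<omega>. ennreal (exp (- s * arrival_epoch Q 0 \<omega>)) \<partial>M)"
      by (rule nn_integral_rho_sum[symmetric]) measurable
    also have "\<dots> \<le> (\<integral>\<^sup>+\<omega>. 1 \<partial>M)"
    proof (rule nn_integral_mono_AE)
      show "AE \<omega> in M. ennreal (exp (- s * arrival_epoch Q 0 \<omega>)) \<le> 1"
        using res0_pos
      proof eventually_elim
        case (elim \<omega>)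
        then have "0 \<le> s * res0 Q \<omega>" using s by simp
        then show ?case by (simp add: arrival_epoch_def)
      qed
    qed
    finally show "(\<Sum>j'. of_bool (?n \<le> j') * ?r j') \<le> 1" by (simp add: emeasure_space_1)
    have "(\<Sum>j'. of_bool (?n \<le> j') * (\<Sum>m. Lt m s * kap s m j')) = (\<Sum>j'. \<Sum>m. Lt m s * (of_bool (?n \<le> j') * kap s m j'))"
      unfolding ennreal_suminf_cmult[symmetric] by (simp only: mult_ac)
    also have "\<dots> = (\<Sum>m. Lt m s * (\<Sum>j'. of_bool (?n \<le> j') * kap s m j'))"
      by (subst suminf_swap_ennreal) simp
    also have "\<dots> \<le> (\<Sum>m. Lt m s * (of_bool (j * b \<le> m) * lap \<delta>))"
      by (intro suminf_le mult_left_mono kap_tail) auto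
    finally show "(\<Sum>j'. of_bool (?n \<le> j') * (\<Sum>m. Lt m s * kap s m j')) \<le> (\<Sum>m. Lt m s * (of_bool (j * b \<le> m) * lap \<delta>))" .
  qed
  also have "(\<Sum>m. Lt m s * (of_bool (j * b \<le> m) * lap \<delta>)) = lap \<delta> * TL (j * b) s"
    unfolding TL_def ennreal_suminf_cmult[symmetric] by (simp only: mult_ac)
  finally show ?thesis .
qed

text \<open>Iteration over \<open>j\<close>. The additive term grows with \<open>j\<close> but is
  free of s, so it disappears after multiplication by the vanishing parameter.\<close>

lemma TL_bound: assumes s: "0 \<le> s" shows "TL (j * b) s \<le> of_nat j + lap \<delta> ^ j * TL 0 s"
proof (induction j)
  case (Suc j)
  have "TL (Suc j * b) s \<le> 1 + lap \<delta> * TL (j * b) s" by (rule TL_step[OF s])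
  also have "\<dots> \<le> 1 + lap \<delta> * (of_nat j + lap \<delta> ^ j * TL 0 s)"
    by (intro add_left_mono mult_left_mono Suc) simp
  also have "\<dots> = 1 + (lap \<delta> * of_nat j + lap \<delta> ^ Suc j * TL 0 s)" by (simp add: distrib_left mult_ac)
  also have "\<dots> \<le> 1 + (1 * of_nat j + lap \<delta> ^ Suc j * TL 0 s)"
    using lap_le_1[of \<delta>] delta by (intro add_left_mono add_right_mono mult_right_mono) auto
  finally show ?case by (simp add: add.assoc)
qed simp

lemma suminf_trans: assumes "0 \<le> x" shows "(\<Sum>n. ennreal (trans x i n)) = 1"
proof -
  have "(\<Sum>n. ennreal (trans x i n)) = (\<Sum>n\<le>i. ennreal (trans x i n))"
    by (intro suminf_finite) (auto simp: trans_eq_0)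
  also have "\<dots> = ennreal (\<Sum>n\<le>i. trans x i n)" using trans_nonneg[OF assms] by (intro sum_ennreal) auto
  finally show ?thesis by (simp add: sum_trans)
qed

lemma kap_sum: "(\<Sum>n. kap 0 m n) = 1"
proof -
  have "(\<Sum>n. kap 0 m n) = (\<Sum>i=1..b. \<Sum>n. ennreal (g i) * (\<integral>\<^sup>+x. ennreal (trans x (m + i) n) \<partial>gap_law))"
    unfolding kap_def by (subst suminf_sum) auto
  also have "\<dots> = (\<Sum>i=1..b. ennreal (g i) * (\<integral>\<^sup>+x. (\<Sum>n. ennreal (trans x (m + i) n)) \<partial>gap_law))"
    by (simp add: nn_integral_suminf)
  also have "\<dots> = (\<Sum>i=1..b. ennreal (g i) * (\<integral>\<^sup>+x. 1 \<partial>gap_law))"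
    using AE_gap_law_pos by (intro sum.cong arg_cong2[where f=times] nn_integral_cong_AE refl)
      (auto elim!: eventually_mono simp: suminf_trans)
  finally show ?thesis by simp
qed

lemma kap_limit: "(\<lambda>s. kap (th s) m n) \<longlonglongrightarrow> kap 0 m n"
  unfolding kap_def
proof (intro tendsto_sum ennreal_tendsto_cmult nn_integral_dominated_convergence[where w="\<lambda>_. 1"])
  fix i
  show "AE x in gap_law. ennreal (exp (- th s * x)) * ennreal (trans x (m + i) n) \<le> 1" for s
    using AE_gap_law_pos AE_exp_le_1[OF less_imp_le[OF th_pos[of s]]]
  proof eventually_elim
    case (elim x)
    then have "ennreal (exp (- th s * x)) * ennreal (trans x (m + i) n) \<le> 1 * 1"
      by (intro mult_mono) (auto simp: trans_le_1)
    then show ?case by simp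
  qed
  have "(\<lambda>s. ennreal (trans x (m + i) n) * ennreal (exp (- th s * x))) \<longlonglongrightarrow> ennreal (trans x (m + i) n) * ennreal (exp (- 0 * x))" for x
    by (intro ennreal_tendsto_cmult tendsto_ennrealI tendsto_intros th_lim) simp
  then show "AE x in gap_law. (\<lambda>s. ennreal (exp (- th s * x)) * ennreal (trans x (m + i) n)) \<longlonglongrightarrow>
      ennreal (exp (- 0 * x)) * ennreal (trans x (m + i) n)" by (simp only: mult.commute[of "ennreal (exp _)"]) simp
qed auto

text \<open>The integrand of \<open>occ\<close>, named so that its measurability in both time
  variables and its bounds are established once.\<close>

definition occ_ker :: "real \<Rightarrow> nat \<Rightarrow> nat \<Rightarrow> real \<Rightarrow> real \<Rightarrow> ennreal" where
  "occ_ker s i n x y = indicator {0<..<x} y * ennreal (exp (- s * y)) * ennreal (trans y i n)"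

lemma occ_ker: "occ s m n = (\<Sum>i=1..b. ennreal (g i) * (\<integral>\<^sup>+x. (\<integral>\<^sup>+y. occ_ker s (m + i) n x y \<partial>lborel) \<partial>gap_law))"
  by (simp add: occ_def occ_ker_def)

lemma measurable_occ_ker[measurable]:
  "occ_ker s i n x \<in> borel_measurable borel"
  "(\<lambda>x. \<integral>\<^sup>+y. occ_ker s i n x y \<partial>lborel) \<in> borel_measurable borel"
  unfolding occ_ker_def[abs_def] greaterThanLessThan_iff indicator_def by measurable

lemma occ_ker_le: assumes "0 \<le> s" shows "occ_ker s i n x y \<le> indicator {0<..<x} y"
proof (cases "0 < y")
  case True
  then have "ennreal (exp (- s * y)) * ennreal (trans y i n) \<le> 1 * 1"
    using assms by (intro mult_mono) (auto simp: trans_le_1)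
  then show ?thesis by (auto simp: occ_ker_def indicator_def)
qed (simp add: occ_ker_def)

lemma occ_ker_integral_le: "0 \<le> s \<Longrightarrow> (\<integral>\<^sup>+y. occ_ker s i n x y \<partial>lborel) \<le> ennreal x"
proof -
  assume "0 \<le> s"
  then have "(\<integral>\<^sup>+y. occ_ker s i n x y \<partial>lborel) \<le> (\<integral>\<^sup>+y. indicator {0<..<x} y \<partial>lborel)"
    by (intro nn_integral_mono occ_ker_le)
  also have "\<dots> = ennreal x" by (cases "0 \<le> x") (auto simp: ennreal_neg)
  finally show ?thesis .
qed

lemma occ_limit: "(\<lambda>s. occ (th s) m n) \<longlonglongrightarrow> occ 0 m n"
  unfolding occ_ker
proof (intro tendsto_sum ennreal_tendsto_cmult nn_integral_dominated_convergence[where w=ennreal and M=gap_law])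
  fix i
  show "AE x in gap_law. (\<integral>\<^sup>+y. occ_ker (th s) (m + i) n x y \<partial>lborel) \<le> ennreal x" for s
    by (intro AE_I2 occ_ker_integral_le less_imp_le th_pos)
  show "(\<integral>\<^sup>+x. ennreal x \<partial>gap_law) < \<infinity>" by (simp add: gap_mean)
  have "(\<lambda>s. \<integral>\<^sup>+y. occ_ker (th s) (m + i) n x y \<partial>lborel) \<longlonglongrightarrow> (\<integral>\<^sup>+y. occ_ker 0 (m + i) n x y \<partial>lborel)" for x
  proof (rule nn_integral_dominated_convergence[where w="\<lambda>y. indicator {0<..<x} y"])
    show "AE y in lborel. occ_ker (th s) (m + i) n x y \<le> indicator {0<..<x} y" for s
      by (intro AE_I2 occ_ker_le less_imp_le th_pos)
    show "(\<integral>\<^sup>+y. indicator {0<..<x} y \<partial>lborel) < \<infinity>" by (cases "0 \<le> x") auto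
    have "(\<lambda>s. (indicator {0<..<x} y * ennreal (trans y (m + i) n)) * ennreal (exp (- th s * y))) \<longlonglongrightarrow>
      (indicator {0<..<x} y * ennreal (trans y (m + i) n)) * ennreal (exp (- 0 * y))" for y
      by (intro ennreal_tendsto_cmult tendsto_ennrealI tendsto_intros th_lim) (simp add: indicator_def)
    then show "AE y in lborel. (\<lambda>s. occ_ker (th s) (m + i) n x y) \<longlonglongrightarrow> occ_ker 0 (m + i) n x y"
      unfolding occ_ker_def by (intro AE_I2) (simp only: mult_ac)
  qed auto
  then show "AE x in gap_law. (\<lambda>s. \<integral>\<^sup>+y. occ_ker (th s) (m + i) n x y \<partial>lborel) \<longlonglongrightarrow> (\<integral>\<^sup>+y. occ_ker 0 (m + i) n x y \<partial>lborel)"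
    by simp
qed auto

text \<open>Over all states, the occupation times before the next arrival add up to the gap
  itself.\<close>

lemma occ_sum: "(\<Sum>n. occ 0 m n) = ennreal mean"
proof -
  have "(\<Sum>n. occ 0 m n) = (\<Sum>i=1..b. \<Sum>n. ennreal (g i) * (\<integral>\<^sup>+x. (\<integral>\<^sup>+y. occ_ker 0 (m + i) n x y \<partial>lborel) \<partial>gap_law))"
    unfolding occ_ker by (subst suminf_sum) auto
  also have "\<dots> = (\<Sum>i=1..b. ennreal (g i) * (\<integral>\<^sup>+x. (\<integral>\<^sup>+y. (\<Sum>n. occ_ker 0 (m + i) n x y) \<partial>lborel) \<partial>gap_law))"
    by (simp add: nn_integral_suminf)
  also have "\<dots> = (\<Sum>i=1..b. ennreal (g i) * (\<integral>\<^sup>+x. ennreal x \<partial>gap_law))"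
  proof (intro sum.cong arg_cong2[where f=times] nn_integral_cong refl)
    fix i x
    have "(\<Sum>n. occ_ker 0 (m + i) n x y) = indicator {0<..<x} y" for y
      by (cases "y \<in> {0<..<x}") (auto simp: occ_ker_def suminf_trans)
    then have "(\<integral>\<^sup>+y. (\<Sum>n. occ_ker 0 (m + i) n x y) \<partial>lborel) = (\<integral>\<^sup>+y. indicator {0<..<x} y \<partial>lborel)" by simp
    also have "\<dots> = ennreal x" by (cases "0 \<le> x") (auto simp: ennreal_neg)
    finally show "(\<integral>\<^sup>+y. (\<Sum>n. occ_ker 0 (m + i) n x y) \<partial>lborel) = ennreal x" .
  qed
  also have "\<dots> = (\<Sum>i=1..b. ennreal (g i)) * ennreal mean" by (simp only: gap_mean sum_distrib_right)
  finally show ?thesis by simp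
qed

lemma finite_kap: "kap 0 m n \<noteq> top" and finite_occ: "occ 0 m n \<noteq> top"
proof -
  have "kap 0 m n \<le> 1" using sum_le_suminf[of "kap 0 m" "{n}"] by (simp add: kap_sum)
  then show "kap 0 m n \<noteq> top" by (auto simp: top_unique)
  have "occ 0 m n \<le> ennreal mean" using sum_le_suminf[of "occ 0 m" "{n}"] by (simp add: occ_sum)
  then show "occ 0 m n \<noteq> top" by (auto simp: top_unique)
qed

lemma pn_sum: "(\<Sum>n. pn n t) = 1"
proof -
  have "(\<Sum>n. pn n t) = (\<integral>\<^sup>+\<omega>. (\<Sum>n. of_bool (num_customers Q t \<omega> = n)) \<partial>M)"
    unfolding pn_def by (rule nn_integral_suminf[symmetric]) measurable
  moreover have "(\<Sum>n. of_bool (num_customers Q t \<omega> = n)) = (1::ennreal)" for \<omega>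
    by (subst suminf_finite[of "{num_customers Q t \<omega>}"]) auto
  then have "(\<integral>\<^sup>+\<omega>. (\<Sum>n. of_bool (num_customers Q t \<omega> = n)) \<partial>M) = (\<integral>\<^sup>+\<omega>. 1 \<partial>M)" by simp
  ultimately show ?thesis by (simp add: emeasure_space_1)
qed

lemma tot_tail: "tot s \<le> (\<Sum>m<N. ennreal (th s) * Lt m (th s)) + ennreal (th s) * TL N (th s)"
proof -
  let ?z = "\<lambda>m. ennreal (th s) * Lt m (th s)"
  have "tot s = (\<Sum>m. of_bool (m < N) * ?z m + of_bool (N \<le> m) * ?z m)"
    unfolding tot_def by (intro suminf_cong) (auto simp: of_bool_def)
  also have "\<dots> = (\<Sum>m. of_bool (m < N) * ?z m) + (\<Sum>m. of_bool (N \<le> m) * ?z m)"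
    by (rule suminf_add_ennreal[symmetric])
  also have "(\<Sum>m. of_bool (m < N) * ?z m) = (\<Sum>m<N. ?z m)"
    by (subst suminf_finite[of "{..<N}"]) auto
  also have "(\<Sum>m. of_bool (N \<le> m) * ?z m) = ennreal (th s) * TL N (th s)"
    unfolding TL_def ennreal_suminf_cmult[symmetric] by (simp only: mult_ac)
  finally show ?thesis by simp
qed

text \<open>For every h, Fubini's theorem gives P(N(t) = n) as an upper bound for the integral over
  u of P(N(t) = n, u < U(t) <= u + h) / h, because for each value of U(t) the admissible u form an
  interval of length h. Fatou's lemma along h = 1 / (i + 1) passes to the density, whose
  measurability comes from the same limit.\<close>

lemma density_integral_le:
  assumes res: "residual_density M Q q" and t: "0 < t"
  shows "(\<lambda>u. indicator {0..} u * ennreal (q n u t)) \<in> borel_measurable borel"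
    and "(\<integral>\<^sup>+u. indicator {0..} u * ennreal (q n u t) \<partial>lborel) \<le> pn n t"
proof -
  define h where "h i = inverse (real (Suc i))" for i
  have h: "0 < h i" for i by (simp add: h_def)
  define f where "f i u = measure M {\<omega> \<in> space M. num_customers Q t \<omega> = n \<and>
                 u < remaining_time Q t \<omega> \<and> remaining_time Q t \<omega> \<le> u + h i} / h i" for i u
  have h0: "filterlim h (at_right 0) sequentially"
    unfolding filterlim_at using LIMSEQ_inverse_real_of_nat h by (auto simp: h_def[abs_def])
  have lim: "(\<lambda>i. f i u) \<longlonglongrightarrow> q n u t" if "0 \<le> u" for u
    using res[unfolded residual_density_def] t that unfolding f_def by (auto intro: filterlim_compose[OF _ h0])
  have f_eq: "ennreal (f i u) = ennreal (inverse (h i)) * (\<integral>\<^sup>+\<omega>. of_bool (num_customers Q t \<omega> = n) *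
      of_bool (u < remaining_time Q t \<omega> \<and> remaining_time Q t \<omega> \<le> u + h i) \<partial>M)" for i u
  proof -
    let ?A = "{\<omega> \<in> space M. num_customers Q t \<omega> = n \<and> u < remaining_time Q t \<omega> \<and> remaining_time Q t \<omega> \<le> u + h i}"
    have "ennreal (f i u) = ennreal (inverse (h i)) * ennreal (measure M ?A)"
      unfolding f_def divide_inverse using h[of i] by (simp add: ennreal_mult mult.commute)
    also have "ennreal (measure M ?A) = (\<integral>\<^sup>+\<omega>. indicator ?A \<omega> \<partial>M)"
      by (subst nn_integral_indicator) (auto simp: emeasure_eq_measure)
    also have "\<dots> = (\<integral>\<^sup>+\<omega>. of_bool (num_customers Q t \<omega> = n) *
      of_bool (u < remaining_time Q t \<omega> \<and> remaining_time Q t \<omega> \<le> u + h i) \<partial>M)"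
      by (intro nn_integral_cong) (auto simp: indicator_def)
    finally show ?thesis .
  qed
  have meas: "(\<lambda>u. ennreal (f i u)) \<in> borel_measurable borel" for i
    unfolding f_eq by measurable
  have bound: "(\<integral>\<^sup>+u. indicator {0..} u * ennreal (f i u) \<partial>lborel) \<le> pn n t" for i
  proof -
    let ?U = "remaining_time Q t"
    have "(\<integral>\<^sup>+u. indicator {0..} u * ennreal (f i u) \<partial>lborel) \<le> (\<integral>\<^sup>+u. ennreal (f i u) \<partial>lborel)"
      by (intro nn_integral_mono) (auto simp: indicator_def)
    also have "\<dots> = ennreal (inverse (h i)) * (\<integral>\<^sup>+u. \<integral>\<^sup>+\<omega>. of_bool (num_customers Q t \<omega> = n) *
      of_bool (u < ?U \<omega> \<and> ?U \<omega> \<le> u + h i) \<partial>M \<partial>lborel)"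
      unfolding f_eq by (rule nn_integral_cmult) measurable
    also have "(\<integral>\<^sup>+u. \<integral>\<^sup>+\<omega>. of_bool (num_customers Q t \<omega> = n) * of_bool (u < ?U \<omega> \<and> ?U \<omega> \<le> u + h i) \<partial>M \<partial>lborel) =
      (\<integral>\<^sup>+\<omega>. \<integral>\<^sup>+u. of_bool (num_customers Q t \<omega> = n) * of_bool (u < ?U \<omega> \<and> ?U \<omega> \<le> u + h i) \<partial>lborel \<partial>M)"
    proof -
      interpret LM: pair_sigma_finite lborel M ..
      show ?thesis
        using LM.Fubini[of "\<lambda>(u, \<omega>). of_bool (num_customers Q t \<omega> = n) * of_bool (u < ?U \<omega> \<and> ?U \<omega> \<le> u + h i)"]
        by simp
    qed
    also have "\<dots> = (\<integral>\<^sup>+\<omega>. of_bool (num_customers Q t \<omega> = n) * ennreal (h i) \<partial>M)"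
    proof (rule nn_integral_cong)
      fix \<omega>
      have "(\<integral>\<^sup>+u. of_bool (num_customers Q t \<omega> = n) * of_bool (u < ?U \<omega> \<and> ?U \<omega> \<le> u + h i) \<partial>lborel) =
        of_bool (num_customers Q t \<omega> = n) * (\<integral>\<^sup>+u. of_bool (u < ?U \<omega> \<and> ?U \<omega> \<le> u + h i) \<partial>lborel)"
        by (rule nn_integral_cmult) measurable
      also have "(\<integral>\<^sup>+u. of_bool (u < ?U \<omega> \<and> ?U \<omega> \<le> u + h i) \<partial>lborel) = (\<integral>\<^sup>+u. indicator {?U \<omega> - h i..<?U \<omega>} u \<partial>lborel)"
        by (intro nn_integral_cong) (auto simp: indicator_def)
      also have "\<dots> = ennreal (h i)" using h[of i] by simp
      finally show "(\<integral>\<^sup>+u. of_bool (num_customers Q t \<omega> = n) * of_bool (u < ?U \<omega> \<and> ?U \<omega> \<le> u + h i) \<partial>lborel) =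
        of_bool (num_customers Q t \<omega> = n) * ennreal (h i)" .
    qed
    also have "\<dots> = pn n t * ennreal (h i)" unfolding pn_def by (rule nn_integral_multc) measurable
    also have "ennreal (inverse (h i)) * (pn n t * ennreal (h i)) = pn n t * (ennreal (inverse (h i)) * ennreal (h i))"
      by (simp only: mult_ac)
    also have "ennreal (inverse (h i)) * ennreal (h i) = 1"
      using h[of i] by (simp add: ennreal_mult[symmetric])
    finally show ?thesis by simp
  qed
  have q_eq: "(\<lambda>u. indicator {0..} u * ennreal (q n u t)) = (\<lambda>u. liminf (\<lambda>i. indicator {0..} u * ennreal (f i u)))"
  proof
    fix u :: real
    have "(\<lambda>i. indicator {0..} u * ennreal (f i u)) \<longlonglongrightarrow> indicator {0..} u * ennreal (q n u t)"
      by (cases "0 \<le> u") (auto intro!: tendsto_ennrealI lim)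
    then show "indicator {0..} u * ennreal (q n u t) = liminf (\<lambda>i. indicator {0..} u * ennreal (f i u))"
      using lim_imp_Liminf[OF trivial_limit_sequentially] by metis
  qed
  have meas': "(\<lambda>u. indicator {0..} u * ennreal (f i u)) \<in> borel_measurable borel" for i
    by (rule borel_measurable_times_ennreal[OF _ meas]) simp
  show "(\<lambda>u. indicator {0..} u * ennreal (q n u t)) \<in> borel_measurable borel"
    unfolding q_eq by (rule borel_measurable_liminf[OF meas'])
  have "(\<integral>\<^sup>+u. indicator {0..} u * ennreal (q n u t) \<partial>lborel) \<le> liminf (\<lambda>i. \<integral>\<^sup>+u. indicator {0..} u * ennreal (f i u) \<partial>lborel)"
    unfolding q_eq using meas' by (intro nn_integral_liminf) simp
  also have "\<dots> \<le> liminf (\<lambda>i::nat. pn n t)" by (intro Liminf_mono) (simp add: bound)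
  finally show "(\<integral>\<^sup>+u. indicator {0..} u * ennreal (q n u t) \<partial>lborel) \<le> pn n t" by (simp add: Liminf_const)
qed

lemma residual_density_nonneg:
  assumes res: "residual_density M Q q" and t: "0 < t" "0 \<le> u"
  shows "0 \<le> q n u t"
proof (rule tendsto_lowerbound)
  show "((\<lambda>h. measure M {\<omega> \<in> space M. num_customers Q t \<omega> = n \<and>
                 u < remaining_time Q t \<omega> \<and> remaining_time Q t \<omega> \<le> u + h} / h)
           \<longlongrightarrow> q n u t) (at_right 0)"
    using res t unfolding residual_density_def by blast
  show "eventually (\<lambda>h. 0 \<le> measure M {\<omega> \<in> space M. num_customers Q t \<omega> = n \<and>
                 u < remaining_time Q t \<omega> \<and> remaining_time Q t \<omega> \<le> u + h} / h) (at_right 0)"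
    using eventually_at_right_less[of "0::real"] by (rule eventually_mono) simp
qed simp

lemma steady_p_nonneg:
  assumes res: "residual_density M Q q" and lim: "((\<lambda>t. q n u t) \<longlongrightarrow> p n u) at_top" and u: "0 \<le> u"
  shows "0 \<le> p n u"
proof (rule tendsto_lowerbound[OF lim])
  show "eventually (\<lambda>t. 0 \<le> q n u t) at_top"
    using eventually_gt_at_top[of 0] by (rule eventually_mono) (rule residual_density_nonneg[OF res _ u])
qed simp

text \<open>Fatou's lemma is applied twice, over u at rescaled times and then over the exponential
  time. If \<open>p n\<close> is not integrable, \<open>arbitrary_prob\<close> has the default value
  0 of the integral and the bound is trivial.\<close>

lemma arbitrary_prob_le:
  assumes res: "residual_density M Q q" and lim: "\<And>u. 0 \<le> u \<Longrightarrow> ((\<lambda>t. q n u t) \<longlongrightarrow> p n u) at_top"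
  shows "ennreal (arbitrary_prob p n) \<le> liminf (\<lambda>s. \<integral>\<^sup>+t. pn n t \<partial>expo (th s))" "0 \<le> arbitrary_prob p n"
proof -
  have nn: "0 \<le> p n u" if "0 \<le> u" for u
    using steady_p_nonneg[of q n u p, OF res lim[OF that] that] .
  show "0 \<le> arbitrary_prob p n" unfolding arbitrary_prob_def set_lebesgue_integral_def
    by (intro integral_nonneg_AE) (auto simp: indicator_def nn)
  have le: "ennreal (arbitrary_prob p n) \<le> (\<integral>\<^sup>+u. indicator {0..} u * ennreal (p n u) \<partial>lborel)"
  proof (cases "integrable lborel (\<lambda>u. indicator {0..} u * p n u)")
    case True
    then have "(\<integral>\<^sup>+u. ennreal (indicator {0..} u * p n u) \<partial>lborel) = ennreal (LINT u|lborel. indicator {0..} u * p n u)"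
      by (rule nn_integral_eq_integral) (auto simp: indicator_def nn)
    moreover have "(\<integral>\<^sup>+u. ennreal (indicator {0..} u * p n u) \<partial>lborel) = (\<integral>\<^sup>+u. indicator {0..} u * ennreal (p n u) \<partial>lborel)"
      by (intro nn_integral_cong) (auto simp: indicator_def)
    ultimately show ?thesis by (simp add: arbitrary_prob_def set_lebesgue_integral_def)
  next
    case False
    then show ?thesis by (simp add: arbitrary_prob_def set_lebesgue_integral_def not_integrable_integral_eq)
  qed
  have key: "ennreal (arbitrary_prob p n) \<le> liminf (\<lambda>s. pn n (t / th s))" if t: "0 < t" for t
  proof -
    have ts: "0 < t / th s" for s using t by simp
    have "indicator {0..} u * ennreal (p n u) = liminf (\<lambda>s. indicator {0..} u * ennreal (q n u (t / th s)))" for u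
    proof -
      have "(\<lambda>s. indicator {0..} u * ennreal (q n u (t / th s))) \<longlonglongrightarrow> indicator {0..} u * ennreal (p n u)"
        by (cases "0 \<le> u") (auto intro!: tendsto_ennrealI filterlim_compose[OF lim th_inverse_lim] t)
      then show ?thesis using lim_imp_Liminf[OF trivial_limit_sequentially] by metis
    qed
    then have "ennreal (arbitrary_prob p n) \<le> (\<integral>\<^sup>+u. liminf (\<lambda>s. indicator {0..} u * ennreal (q n u (t / th s))) \<partial>lborel)"
      using le by simp
    also have "\<dots> \<le> liminf (\<lambda>s. \<integral>\<^sup>+u. indicator {0..} u * ennreal (q n u (t / th s)) \<partial>lborel)"
      using density_integral_le(1)[OF res ts] by (intro nn_integral_liminf) simp
    also have "\<dots> \<le> liminf (\<lambda>s. pn n (t / th s))"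
      by (intro Liminf_mono always_eventually allI density_integral_le(2)[OF res ts])
    finally show ?thesis .
  qed
  have "ennreal (arbitrary_prob p n) = (\<integral>\<^sup>+t. ennreal (arbitrary_prob p n) \<partial>expo 1)"
    using prob_space.emeasure_space_1[OF prob_space_expo[of 1]] by simp
  also have "\<dots> \<le> (\<integral>\<^sup>+t. liminf (\<lambda>s. pn n (t / th s)) \<partial>expo 1)"
    using AE_expo_pos[of 1] by (intro nn_integral_mono_AE) (auto elim!: eventually_mono intro: key)
  also have "\<dots> \<le> liminf (\<lambda>s. \<integral>\<^sup>+t. pn n (t / th s) \<partial>expo 1)"
    by (intro nn_integral_liminf) simp
  also have "\<dots> = liminf (\<lambda>s. \<integral>\<^sup>+t. pn n t \<partial>expo (th s))"
    by (subst nn_integral_expo_scale[OF th_pos]) simp_all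
  finally show "ennreal (arbitrary_prob p n) \<le> liminf (\<lambda>s. \<integral>\<^sup>+t. pn n t \<partial>expo (th s))" .
qed

section \<open>Exact identities for the steady state\<close>

context
  fixes q p
  assumes res: "residual_density M Q q"
    and lim: "\<And>n u. 0 \<le> u \<Longrightarrow> ((\<lambda>t. q n u t) \<longlongrightarrow> p n u) at_top"
    and total: "(\<lambda>n. arbitrary_prob p n) sums 1"
begin

lemma p0_nonneg: "0 \<le> p m 0" and Lt_conv: "(\<lambda>s. ennreal (th s) * Lt m (th s)) \<longlonglongrightarrow> ennreal (p m 0)"
  using Lt_limit[OF lam_rate[OF res lim[OF order_refl, of m]]] by auto

text \<open>Fatou's lemma alone would permit mass to escape to infinity. In the limit, at most the
  fraction (\<open>lap \<delta>\<close>)^j of the total lies beyond j b, and j is arbitrary.\<close>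

lemma p0_sum: "(\<Sum>m. ennreal (p m 0)) = ennreal (1 / mean)"
proof (rule antisym)
  show "(\<Sum>m. ennreal (p m 0)) \<le> ennreal (1 / mean)"
    by (rule suminf_fatou_le[OF Lt_conv _ tot_limit]) (simp add: tot_def)
  define S where "S = (\<Sum>m. ennreal (p m 0))"
  have step: "ennreal (1 / mean) \<le> (\<Sum>m<j * b. ennreal (p m 0)) + ennreal (rlap \<delta> ^ j / mean)" for j
  proof (rule LIMSEQ_le[OF tot_limit, rule_format])
    let ?B = "\<lambda>s. (\<Sum>m<j * b. ennreal (th s) * Lt m (th s)) + (ennreal (th s) * of_nat j + lap \<delta> ^ j * tot s)"
    have fin: "lap \<delta> ^ j \<noteq> top" by (simp add: rlap(1)[OF delta] ennreal_power[OF rlap(3)])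
    have "?B \<longlonglongrightarrow> (\<Sum>m<j * b. ennreal (p m 0)) + (ennreal 0 * of_nat j + lap \<delta> ^ j * ennreal (1 / mean))"
    proof (intro tendsto_add tendsto_sum Lt_conv ennreal_tendsto_cmult tot_limit)
      show "(\<lambda>s. ennreal (th s) * of_nat j) \<longlonglongrightarrow> ennreal 0 * of_nat j"
        unfolding mult.commute[of _ "of_nat j :: ennreal"]
        by (intro ennreal_tendsto_cmult tendsto_ennrealI th_lim) (simp add: of_nat_less_top)
    qed (use fin in \<open>simp add: less_top\<close>)
    then show "?B \<longlonglongrightarrow> (\<Sum>m<j * b. ennreal (p m 0)) + ennreal (rlap \<delta> ^ j / mean)"
      using rlap(3) gap_mean(2) by (simp add: rlap(1)[OF delta] ennreal_power ennreal_mult[symmetric])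
    have "tot s \<le> ?B s" for s
    proof -
      have "tot s \<le> (\<Sum>m<j * b. ennreal (th s) * Lt m (th s)) + ennreal (th s) * TL (j * b) (th s)" by (rule tot_tail)
      also have "ennreal (th s) * TL (j * b) (th s) \<le> ennreal (th s) * (of_nat j + lap \<delta> ^ j * TL 0 (th s))"
        by (intro mult_left_mono TL_bound less_imp_le th_pos) simp
      also have "\<dots> = ennreal (th s) * of_nat j + lap \<delta> ^ j * tot s"
        by (simp add: tot_def TL_def distrib_left mult_ac)
      finally show ?thesis by (simp add: add_left_mono)
    qed
    then show "\<exists>N. \<forall>s\<ge>N. tot s \<le> ?B s" by blast
  qed
  have "ennreal (1 / mean) \<le> S + ennreal (rlap \<delta> ^ j / mean)" for j
    using step[of j] sum_le_suminf[of "\<lambda>m. ennreal (p m 0)" "{..<j * b}"]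
    by (auto simp: S_def intro: order_trans add_right_mono)
  moreover have "(\<lambda>j. S + ennreal (rlap \<delta> ^ j / mean)) \<longlonglongrightarrow> S + ennreal (0 / mean)"
    using rlap(2)[OF delta] rlap(3)[of \<delta>] gap_mean(2)
    by (intro tendsto_add tendsto_const tendsto_ennrealI tendsto_divide LIMSEQ_realpow_zero) auto
  ultimately have "ennreal (1 / mean) \<le> S + ennreal (0 / mean)"
    by (intro LIMSEQ_le_const) auto
  then show "ennreal (1 / mean) \<le> (\<Sum>m. ennreal (p m 0))" by (simp add: S_def)
qed

text \<open>Dropping the first-arrival term from \<open>Lt_rec\<close> costs nothing in the limit
  and leaves an inequality. The kernel \<open>kap 0\<close> has row sums 1, so both sides have the
  same finite sum over n.\<close>

lemma p0_invariant: "(\<Sum>m. ennreal (p m 0) * kap 0 m n) = ennreal (p n 0)"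
proof (rule suminf_eq_termwise)
  show "(\<Sum>m. ennreal (p m 0) * kap 0 m n) \<le> ennreal (p n 0)" for n
  proof (rule suminf_fatou_le[OF _ _ Lt_conv])
    show "(\<lambda>s. ennreal (th s) * Lt m (th s) * kap (th s) m n) \<longlonglongrightarrow> ennreal (p m 0) * kap 0 m n" for m
      by (rule tendsto_mult_ennreal[OF Lt_conv kap_limit]) (use finite_kap in auto)
    have "(\<Sum>m. Lt m (th s) * kap (th s) m n) \<le> Lt n (th s)" for s
      by (subst (2) Lt_rec) simp
    then show "(\<Sum>m. ennreal (th s) * Lt m (th s) * kap (th s) m n) \<le> ennreal (th s) * Lt n (th s)" for s
      unfolding mult.assoc ennreal_suminf_cmult by (rule mult_left_mono) simp
  qed
  have e: "(\<Sum>n. \<Sum>m. ennreal (p m 0) * kap 0 m n) = (\<Sum>m. ennreal (p m 0))"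
    by (subst suminf_swap_ennreal) (simp add: kap_sum)
  show "(\<Sum>n. ennreal (p n 0)) \<le> (\<Sum>n. \<Sum>m. ennreal (p m 0) * kap 0 m n)" by (simp add: e)
  show "(\<Sum>n. \<Sum>m. ennreal (p m 0) * kap 0 m n) \<noteq> top" by (simp add: e p0_sum)
qed

text \<open>The limit inferior of the occupation probabilities, \<open>L n\<close>, dominates both
  sides. Its sum over n is at most 1 while each side sums to 1: the left by the normalizing
  condition, the right because mass 1 / \<open>mean\<close> of arrivals meets mean occupation time
  \<open>mean\<close>. So both sides equal \<open>L n\<close>.\<close>

lemma arbitrary_prob_eq: "ennreal (arbitrary_prob p n) = (\<Sum>m. ennreal (p m 0) * occ 0 m n)"
proof -
  define L where "L n = liminf (\<lambda>s. \<integral>\<^sup>+t. pn n t \<partial>expo (th s))" for n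
  have O_le: "(\<Sum>m. ennreal (p m 0) * occ 0 m n) \<le> L n" for n
    unfolding L_def
  proof (rule suminf_fatou_liminf)
    show "(\<lambda>s. ennreal (th s) * Lt m (th s) * occ (th s) m n) \<longlonglongrightarrow> ennreal (p m 0) * occ 0 m n" for m
      by (rule tendsto_mult_ennreal[OF Lt_conv occ_limit]) (use finite_occ in auto)
  qed (rule pn_expo_ge[OF th_pos])
  have P_le: "ennreal (arbitrary_prob p n) \<le> L n" for n
    unfolding L_def by (rule arbitrary_prob_le(1)[OF res lim])
  have V_sum: "(\<Sum>n. \<integral>\<^sup>+t. pn n t \<partial>expo (th s)) = 1" for s
    by (subst nn_integral_suminf[symmetric])
      (use prob_space.emeasure_space_1[OF prob_space_expo[OF th_pos[of s]]] in \<open>simp_all add: pn_sum\<close>)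
  have "(\<Sum>n. L n) \<le> liminf (\<lambda>s. \<Sum>n. \<integral>\<^sup>+t. pn n t \<partial>expo (th s))"
    unfolding L_def by (rule suminf_fatou)
  then have L_sum: "(\<Sum>n. L n) \<le> 1" by (simp add: V_sum Liminf_const)
  have "(\<Sum>n. \<Sum>m. ennreal (p m 0) * occ 0 m n) = (\<Sum>m. ennreal (p m 0)) * ennreal mean"
    by (subst suminf_swap_ennreal) (simp add: occ_sum)
  then have O_sum: "(\<Sum>n. \<Sum>m. ennreal (p m 0) * occ 0 m n) = 1"
    using gap_mean(2) by (simp add: p0_sum ennreal_mult[symmetric])
  have nn: "0 \<le> arbitrary_prob p n" for n by (rule arbitrary_prob_le(2)[OF res lim])
  have P_sum: "(\<Sum>n. ennreal (arbitrary_prob p n)) = 1"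
    using suminf_ennreal_eq[OF nn total] by simp
  have "ennreal (arbitrary_prob p n) = L n"
    by (rule suminf_eq_termwise[of _ L]) (auto simp: P_le P_sum L_sum)
  moreover have "(\<Sum>m. ennreal (p m 0) * occ 0 m n) = L n"
    by (rule suminf_eq_termwise[of "\<lambda>n. \<Sum>m. ennreal (p m 0) * occ 0 m n" L]) (auto simp: O_le O_sum L_sum)
  ultimately show ?thesis by simp
qed

end
end

section \<open>Solving the recursion\<close>

lemma summable_mult_bounded:
  fixes f :: "nat \<Rightarrow> 'a::real_normed_algebra_1"
  assumes \<alpha>: "\<And>l. 0 \<le> \<alpha> l" "summable \<alpha>" and f: "\<And>l. norm (f l) \<le> B"
  shows "summable (\<lambda>l. norm (of_real (\<alpha> l) * f l))"
proof (rule summable_comparison_test')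
  show "summable (\<lambda>l. \<alpha> l * B)" using \<alpha>(2) by (rule summable_mult2)
  show "norm (norm (of_real (\<alpha> l) * f l)) \<le> \<alpha> l * B" if "0 \<le> l" for l
  proof -
    have "norm (of_real (\<alpha> l) * f l) \<le> norm (of_real (\<alpha> l) :: 'a) * norm (f l)" by (rule norm_mult_ineq)
    also have "\<dots> \<le> \<alpha> l * B" using \<alpha>(1)[of l] f[of l] by (intro mult_mono) auto
    finally show ?thesis by simp
  qed
qed

text \<open>Summing the recursion gives the same recursion for the tails, which in addition vanish on
  the whole initial range; there it is a contraction for the supremum norm.\<close>

lemma recursion_zero:
  fixes \<alpha> :: "nat \<Rightarrow> real" and g :: "nat \<Rightarrow> real" and d :: "int \<Rightarrow> complex"
  assumes \<alpha>: "\<And>l. 0 \<le> \<alpha> l" "summable \<alpha>" "suminf \<alpha> < 1"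
    and g: "\<And>i. i \<in> {1..b} \<Longrightarrow> 0 \<le> g i" "(\<Sum>i=1..b. g i) = 1"
    and rec: "\<And>n. 1 \<le> n \<Longrightarrow> d n = (\<Sum>i=1..b. of_real (g i) * (\<Sum>l. of_real (\<alpha> l) * d (n + int l - int i)))"
    and zero: "\<And>k. 1 - int b \<le> k \<Longrightarrow> k < 0 \<Longrightarrow> d k = 0"
    and abs: "summable (\<lambda>k. norm (d (int k)))" and total: "(\<lambda>k. d (int k)) sums 0"
  shows "d (int n) = 0"
proof -
  \<comment> \<open>Tail sums, set to 0 at negative arguments. Since \<open>d\<close> vanishes from
    1 - b to -1 and has total 0, this agrees with summation from there, and the difference of
    consecutive tails is \<open>d m\<close> for all m >= 1 - b.\<close>
  define D where "D m = (if m < 0 then 0 else \<Sum>k. d (m + int k))" for m :: int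
  define B where "B = (\<Sum>k. norm (d (int k)))"
  have summ: "summable (\<lambda>k. norm (d (m + int k)))" if "0 \<le> m" for m
  proof -
    from summable_ignore_initial_segment[OF abs, of "nat m"] show ?thesis using that by (simp add: add.commute)
  qed
  have D0: "D m = 0" if "m \<le> 0" for m
    using total that by (cases "m < 0") (auto simp: D_def sums_iff)
  have D_step: "D m - D (m + 1) = d m" if "1 - int b \<le> m" for m
  proof (cases "m < 0")
    case True
    then show ?thesis using D0[of "m + 1"] zero[of m] that by (simp add: D_def)
  next
    case False
    then have "(\<Sum>k. d (m + int k)) = d m + (\<Sum>k. d (m + 1 + int k))"
      using suminf_split_initial_segment[OF summable_norm_cancel[OF summ[of m]], of 1] by (simp add: algebra_simps)
    then show ?thesis using False by (simp add: D_def)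
  qed
  have DB: "norm (D m) \<le> B" for m
  proof (cases "m < 0")
    case False
    then have "norm (D m) \<le> (\<Sum>k. norm (d (m + int k)))"
      unfolding D_def using summ[of m] by (auto intro: summable_norm)
    also have "\<dots> \<le> B"
      unfolding B_def using suminf_split_initial_segment[OF abs, of "nat m"] False
      by (simp add: add.commute sum_nonneg)
    finally show ?thesis .
  qed (simp add: D_def B_def suminf_nonneg[OF abs])
  have \<alpha>D: "summable (\<lambda>l. norm (of_real (\<alpha> l) * D (f l)))" for f
    by (rule summable_mult_bounded[OF \<alpha>(1,2)]) (rule DB)
  \<comment> \<open>The right side of the recursion with \<open>D\<close> in place of
    \<open>d\<close>. The tails satisfy \<open>D m = K m\<close>, which is proved through increments
    rather than by exchanging infinite sums.\<close>
  define K where "K m = (\<Sum>i=1..b. of_real (g i) * (\<Sum>l. of_real (\<alpha> l) * D (m + int l - int i)))" for m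
  have K_le: "norm (K m) \<le> suminf \<alpha> * C" if C: "\<And>j. m - int b \<le> j \<Longrightarrow> norm (D j) \<le> C" for m C
  proof -
    have "norm (K m) \<le> (\<Sum>i=1..b. g i * (suminf \<alpha> * C))"
      unfolding K_def
    proof (rule order_trans[OF norm_sum], rule sum_mono)
      fix i assume i: "i \<in> {1..b}"
      have "norm (\<Sum>l. of_real (\<alpha> l) * D (m + int l - int i)) \<le> (\<Sum>l. norm (of_real (\<alpha> l) * D (m + int l - int i)))"
        by (rule summable_norm[OF \<alpha>D])
      also have "\<dots> \<le> (\<Sum>l. \<alpha> l * C)"
        using \<alpha>(1) i by (intro suminf_le summable_mult2 \<alpha>D \<alpha>(2)) (auto simp: norm_mult intro!: mult_left_mono C)
      also have "\<dots> = suminf \<alpha> * C" using \<alpha>(2) by (rule suminf_mult2[symmetric])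
      finally show "norm (of_real (g i) * (\<Sum>l. of_real (\<alpha> l) * D (m + int l - int i))) \<le> g i * (suminf \<alpha> * C)"
        using g(1)[OF i] by (simp add: norm_mult mult_left_mono)
    qed
    also have "\<dots> = suminf \<alpha> * C" by (simp only: sum_distrib_right[symmetric] g(2) mult_1)
    finally show ?thesis .
  qed
  have K_step: "K m - K (m + 1) = d m" if m: "1 \<le> m" for m
  proof -
    have "K m - K (m + 1) = (\<Sum>i=1..b. of_real (g i) * ((\<Sum>l. of_real (\<alpha> l) * D (m + int l - int i)) - (\<Sum>l. of_real (\<alpha> l) * D (m + 1 + int l - int i))))"
      unfolding K_def by (simp add: sum_subtractf right_diff_distrib)
    also have "\<dots> = (\<Sum>i=1..b. of_real (g i) * (\<Sum>l. of_real (\<alpha> l) * d (m + int l - int i)))"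
    proof (intro sum.cong refl arg_cong2[where f=times])
      fix i assume i: "i \<in> {1..b}"
      have "of_real (\<alpha> l) * D (m + int l - int i) - of_real (\<alpha> l) * D (m + 1 + int l - int i) = of_real (\<alpha> l) * d (m + int l - int i)" for l
        using D_step[of "m + int l - int i"] i m by (simp add: right_diff_distrib[symmetric] algebra_simps)
      then show "(\<Sum>l. of_real (\<alpha> l) * D (m + int l - int i)) - (\<Sum>l. of_real (\<alpha> l) * D (m + 1 + int l - int i)) = (\<Sum>l. of_real (\<alpha> l) * d (m + int l - int i))"
        using suminf_diff[OF summable_norm_cancel[OF \<alpha>D] summable_norm_cancel[OF \<alpha>D], of "\<lambda>l. m + int l - int i" "\<lambda>l. m + 1 + int l - int i"]
        by simp
    qed
    finally show ?thesis using rec[OF m] by simp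
  qed
  \<comment> \<open>\<open>D\<close> and \<open>K\<close> have equal increments for m >= 1, so their
    difference is constant there, and both become small far out. The distance is
    \<open>N + b\<close> instead of \<open>N\<close> because \<open>K\<close> looks back by up to
    \<open>b\<close> places.\<close>
  have DK: "D m = K m" if m: "1 \<le> m" for m
  proof -
    have const: "D m - K m = D (m + int k) - K (m + int k)" for k
    proof (induction k)
      case (Suc k)
      have "D (m + int k) - D (m + int k + 1) = K (m + int k) - K (m + int k + 1)"
        using D_step[of "m + int k"] K_step[of "m + int k"] m by simp
      then have "D (m + int k) - K (m + int k) = D (m + int k + 1) - K (m + int k + 1)"
        by (simp add: algebra_simps)
      then show ?case using Suc by (simp add: add.commute add.left_commute)
    qed simp
    have "norm (D m - K m) \<le> e" if e: "0 < e" for e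
    proof -
      have "(\<lambda>k. \<Sum>i. norm (d (int (i + k)))) \<longlonglongrightarrow> 0"
        using suminf_exist_split2[OF abs] by simp
      then have "eventually (\<lambda>k. norm (\<Sum>i. norm (d (int (i + k)))) < e / 2) sequentially"
        using e by (auto dest: tendstoD[where e="e / 2"] simp: dist_norm)
      then obtain N where N: "\<And>k. N \<le> k \<Longrightarrow> norm (\<Sum>i. norm (d (int (i + k)))) < e / 2"
        by (auto simp: eventually_sequentially)
      have De: "norm (D j) \<le> e / 2" if "int N \<le> j" for j
      proof -
        have "norm (D j) \<le> (\<Sum>k. norm (d (j + int k)))"
          unfolding D_def using summ[of j] that by (auto intro: summable_norm)
        also have "\<dots> \<le> e / 2"
        proof -
          have "N \<le> nat j" using that by linarith
          from N[OF this] show ?thesis using that by (simp add: add.commute abs_less_iff)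
        qed
        finally show ?thesis .
      qed
      have "norm (D m - K m) = norm (D (m + int (N + b)) - K (m + int (N + b)))" by (rule arg_cong[where f=norm, OF const])
      also have "\<dots> \<le> e / 2 + suminf \<alpha> * (e / 2)"
        using m by (intro order_trans[OF norm_triangle_ineq4] add_mono De K_le) auto
      also have "\<dots> \<le> e / 2 + 1 * (e / 2)" using \<alpha>(3) e by (intro add_left_mono mult_right_mono) auto
      finally show ?thesis by simp
    qed
    then have "norm (D m - K m) \<le> 0" by (rule field_le_epsilon[where y=0, simplified])
    then show ?thesis by simp
  qed
  have pow: "norm (D m) \<le> suminf \<alpha> ^ k * B" for m k
  proof (induction k arbitrary: m)
    case (Suc k)
    show ?case
    proof (cases "1 \<le> m")
      case True
      then show ?thesis using DK[of m] K_le[of m "suminf \<alpha> ^ k * B"] Suc by (simp add: mult.assoc)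
    next
      case False
      then show ?thesis using D0[of m] \<alpha>(1,2) DB[of 0] by (simp add: suminf_nonneg D0)
    qed
  qed (simp add: DB)
  have "(\<lambda>k. suminf \<alpha> ^ k * B) \<longlonglongrightarrow> 0 * B"
    using \<alpha> by (intro tendsto_mult tendsto_const LIMSEQ_realpow_zero suminf_nonneg) auto
  then have "norm (D m) \<le> 0" for m using pow by (intro LIMSEQ_le_const[where X="\<lambda>k. suminf \<alpha> ^ k * B"]) auto
  moreover have "1 \<le> b" using g(2) by (cases b) auto
  ultimately show ?thesis using D_step[of "int n"] by simp
qed

section \<open>Removals during a gap and their generating functions\<close>

context rates
begin

lemma wt_0: "wt 0 x = exp (- (\<mu> + \<eta> + \<delta>) * x)" by (simp add: wt_def)

lemma measurable_wt[measurable]: "wt l \<in> borel_measurable borel"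
  unfolding wt_def[abs_def] by measurable

lemma wt_deriv: "(wt (Suc l) has_real_derivative ((\<mu> + \<eta>) * wt l x - (\<mu> + \<eta> + \<delta>) * wt (Suc l) x)) (at x)"
proof -
  let ?c = "\<mu> + \<eta> + \<delta>" and ?n = "\<mu> + \<eta>"
  have "((\<lambda>x. (?n * x) ^ Suc l) has_real_derivative (1 + of_nat l) * (?n * (?n * x) ^ l)) (at x)"
    by (rule DERIV_power_Suc) (auto intro!: derivative_eq_intros)
  moreover have "((\<lambda>x. exp (- ?c * x)) has_real_derivative exp (- ?c * x) * - ?c) (at x)"
    by (auto intro!: derivative_eq_intros)
  ultimately have "((\<lambda>x. exp (- ?c * x) * (?n * x) ^ Suc l / fact (Suc l)) has_real_derivative
     (exp (- ?c * x) * ((1 + of_nat l) * (?n * (?n * x) ^ l)) + exp (- ?c * x) * - ?c * (?n * x) ^ Suc l) / fact (Suc l)) (at x)"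
    by (intro DERIV_cdivide DERIV_mult')
  moreover have "(exp (- ?c * x) * ((1 + of_nat l) * (?n * (?n * x) ^ l)) + exp (- ?c * x) * - ?c * (?n * x) ^ Suc l) / fact (Suc l) =
     ?n * wt l x - ?c * wt (Suc l) x"
  proof -
    have "fact (Suc l) = (1 + real l) * fact l" by simp
    then have "exp (- ?c * x) * ((1 + of_nat l) * (?n * (?n * x) ^ l)) / fact (Suc l) = ?n * wt l x"
      unfolding wt_def by (simp add: divide_simps del: fact_Suc)
    moreover have "e * - k * y / f = - (k * (e * y / f))" for e k y f :: real by simp
    then have "exp (- ?c * x) * - ?c * (?n * x) ^ Suc l / fact (Suc l) = - (?c * wt (Suc l) x)"
      unfolding wt_def .
    ultimately show ?thesis unfolding add_divide_distrib by (simp only: add_uminus_conv_diff)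
  qed
  ultimately show ?thesis unfolding wt_def[abs_def] by simp
qed

text \<open>The antiderivative of \<open>wt l\<close> that vanishes at 0; integrating
  \<open>wt_deriv\<close> gives the recursion. In this form averaging over the gap law yields a
  linear relation between \<open>ga\<close> and \<open>al\<close>.\<close>

primrec Gam :: "nat \<Rightarrow> real \<Rightarrow> real" where
  "Gam 0 x = (1 - wt 0 x) / (\<mu> + \<eta> + \<delta>)"
| "Gam (Suc l) x = ((\<mu> + \<eta>) * Gam l x - wt (Suc l) x) / (\<mu> + \<eta> + \<delta>)"

lemma total_rate_pos: "0 < \<mu> + \<eta> + \<delta>" "0 < \<mu> + \<eta>" using mu eta delta by auto

lemma Gam_deriv: "(Gam l has_real_derivative wt l x) (at x)"
proof (induction l)
  case 0
  have "((\<lambda>x. (1 - exp (- (\<mu> + \<eta> + \<delta>) * x)) / (\<mu> + \<eta> + \<delta>)) has_real_derivative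
    (0 - exp (- (\<mu> + \<eta> + \<delta>) * x) * (- (\<mu> + \<eta> + \<delta>))) / (\<mu> + \<eta> + \<delta>)) (at x)"
    by (intro DERIV_cdivide DERIV_diff DERIV_const) (auto intro!: derivative_eq_intros)
  moreover have "(0 - e * - k) / k = e" if "0 < k" for e k :: real using that by simp
  ultimately show ?case using total_rate_pos by (simp only: wt_0 Gam.simps(1)[abs_def])
next
  case (Suc l)
  have "((\<lambda>x. ((\<mu> + \<eta>) * Gam l x - wt (Suc l) x) / (\<mu> + \<eta> + \<delta>)) has_real_derivative
    ((\<mu> + \<eta>) * wt l x - ((\<mu> + \<eta>) * wt l x - (\<mu> + \<eta> + \<delta>) * wt (Suc l) x)) / (\<mu> + \<eta> + \<delta>)) (at x)"
    by (intro DERIV_cdivide DERIV_diff DERIV_cmult Suc wt_deriv)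
  then show ?case using total_rate_pos by simp
qed

lemma Gam_zero: "Gam l 0 = 0"
  by (induction l) (auto simp: wt_zero)

lemma Gam_nonneg: assumes "0 \<le> x" shows "0 \<le> Gam l x"
  using DERIV_nonneg_imp_nondecreasing[OF assms, of "Gam l"] Gam_deriv wt_nonneg by (metis Gam_zero)

text \<open>Dropping the negative term from the recursion leaves a geometric bound, uniform in
  \<open>x\<close>. Its ratio is below 1 because disasters have positive rate.\<close>

lemma Gam_le: "0 \<le> x \<Longrightarrow> Gam l x \<le> ((\<mu> + \<eta>) / (\<mu> + \<eta> + \<delta>)) ^ l / (\<mu> + \<eta> + \<delta>)"
proof (induction l)
  case 0
  then show ?case using total_rate_pos wt_nonneg[of x 0] by (simp add: divide_right_mono)
next
  case (Suc l)
  have "Gam (Suc l) x \<le> (\<mu> + \<eta>) * Gam l x / (\<mu> + \<eta> + \<delta>)"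
    using total_rate_pos wt_nonneg[OF Suc.prems, of "Suc l"] by (simp add: divide_right_mono)
  also have "\<dots> \<le> (\<mu> + \<eta>) * (((\<mu> + \<eta>) / (\<mu> + \<eta> + \<delta>)) ^ l / (\<mu> + \<eta> + \<delta>)) / (\<mu> + \<eta> + \<delta>)"
    using total_rate_pos Suc by (intro divide_right_mono mult_left_mono) auto
  finally show ?case by (simp add: mult.commute)
qed

lemma measurable_Gam[measurable]: "Gam l \<in> borel_measurable borel"
proof -
  have "continuous_on UNIV (Gam l)" using Gam_deriv by (intro DERIV_continuous_on) auto
  then show ?thesis by (rule borel_measurable_continuous_onI)
qed

lemma Gam_integral:
  assumes "0 \<le> x"
  shows "(\<integral>\<^sup>+y. indicator {0<..<x} y * ennreal (wt l y) \<partial>lborel) = ennreal (Gam l x)"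
proof -
  have "(\<integral>\<^sup>+y. indicator {0<..<x} y * ennreal (wt l y) \<partial>lborel) = (\<integral>\<^sup>+y. ennreal (wt l y) * indicator {0..x} y \<partial>lborel)"
  proof (rule nn_integral_cong_AE)
    show "AE y in lborel. indicator {0<..<x} y * ennreal (wt l y) = ennreal (wt l y) * indicator {0..x} y"
      using AE_lborel_singleton[of 0] AE_lborel_singleton[of x]
      by eventually_elim (auto simp: indicator_def)
  qed
  also have "\<dots> = ennreal (Gam l x - Gam l 0)"
    using assms by (intro nn_integral_FTC_Icc) (auto intro: Gam_deriv wt_nonneg has_field_derivative_at_within)
  finally show ?thesis by (simp add: Gam_zero)
qed

lemma sum_wt_power_le: assumes "0 \<le> x" "0 \<le> r" "(\<mu> + \<eta>) * r \<le> \<mu> + \<eta> + \<delta>" shows "(\<Sum>l<n. wt l x * r ^ l) \<le> 1"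
proof -
  have s: "(\<lambda>l. (((\<mu> + \<eta>) * r) * x) ^ l / fact l) sums exp (((\<mu> + \<eta>) * r) * x)"
    using exp_converges[of "((\<mu> + \<eta>) * r) * x"] by (simp add: scaleR_conv_of_real field_simps)
  have "(\<Sum>l<n. wt l x * r ^ l) = exp (- (\<mu> + \<eta> + \<delta>) * x) * (\<Sum>l<n. (((\<mu> + \<eta>) * r) * x) ^ l / fact l)"
    unfolding sum_distrib_left wt_def by (intro sum.cong) (simp_all add: power_mult_distrib)
  also have "\<dots> \<le> exp (- (\<mu> + \<eta> + \<delta>) * x) * exp (((\<mu> + \<eta>) * r) * x)"
    using assms total_rate_pos by (intro mult_left_mono order_trans[OF sum_le_suminf[OF sums_summable[OF s], of "{..<n}"]])
      (auto simp: sums_unique[OF s, symmetric])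
  also have "\<dots> \<le> 1" using mult_right_mono[OF assms(3,1)] by (simp add: exp_add[symmetric] algebra_simps)
  finally show ?thesis .
qed

lemma wt_power_sums:
  "(\<lambda>l. of_real (wt l x) * z ^ l :: complex) sums exp (- (of_real \<delta> + of_real (\<mu> + \<eta>) * (1 - z)) * of_real x)"
proof -
  have "(\<lambda>l. (of_real ((\<mu> + \<eta>) * x) * z) ^ l /\<^sub>R fact l) sums exp (of_real ((\<mu> + \<eta>) * x) * z)"
    by (rule exp_converges)
  from sums_mult[OF this, of "exp (of_real (- (\<mu> + \<eta> + \<delta>) * x))"]
  have "(\<lambda>l. of_real (wt l x) * z ^ l :: complex) sums (exp (of_real (- (\<mu> + \<eta> + \<delta>) * x)) * exp (of_real ((\<mu> + \<eta>) * x) * z))"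
    by (simp add: wt_def scaleR_conv_of_real power_mult_distrib exp_of_real[symmetric] divide_inverse mult_ac)
  also have "exp (of_real (- (\<mu> + \<eta> + \<delta>) * x)) * exp (of_real ((\<mu> + \<eta>) * x) * z) =
     exp (- (of_real \<delta> + of_real (\<mu> + \<eta>) * (1 - z)) * of_real x)"
    unfolding exp_add[symmetric] by (intro arg_cong[where f=exp]) (simp add: algebra_simps)
  finally show ?thesis .
qed

end

context negative_disaster_queue
begin

text \<open>\<open>al l\<close> is the probability that a gap contains no disaster and exactly
  \<open>l\<close> events of rate mu + eta, and \<open>ga l\<close> is the mean time during a gap at
  which this has been the case since the gap began.\<close>

definition al :: "nat \<Rightarrow> real" where "al l = (LINT x|gap_law. wt l x)"
definition ga :: "nat \<Rightarrow> real" where "ga l = (LINT x|gap_law. Gam l x)"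

lemma integrable_bounded_gap:
  fixes f :: "real \<Rightarrow> 'b::{banach, second_countable_topology}"
  assumes "\<And>x. 0 < x \<Longrightarrow> norm (f x) \<le> B" and [measurable]: "f \<in> borel_measurable borel"
  shows "integrable gap_law f"
proof -
  interpret G: prob_space gap_law by (rule prob_gap_law)
  show ?thesis
    by (rule G.integrable_const_bound[where B=B]) (use AE_gap_law_pos assms(1) in \<open>auto elim: eventually_mono\<close>)
qed

lemma integral_gap_le:
  fixes f :: "real \<Rightarrow> real"
  assumes "\<And>x. 0 < x \<Longrightarrow> 0 \<le> f x" "\<And>x. 0 < x \<Longrightarrow> f x \<le> B" and [measurable]: "f \<in> borel_measurable borel"
  shows "integrable gap_law f" "0 \<le> integral\<^sup>L gap_law f" "integral\<^sup>L gap_law f \<le> B"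
    "(\<integral>\<^sup>+x. ennreal (f x) \<partial>gap_law) = ennreal (integral\<^sup>L gap_law f)"
proof -
  interpret G: prob_space gap_law by (rule prob_gap_law)
  show i: "integrable gap_law f" using assms by (intro integrable_bounded_gap[where B=B]) auto
  have nn: "AE x in gap_law. 0 \<le> f x" using AE_gap_law_pos by eventually_elim (rule assms)
  then show "0 \<le> integral\<^sup>L gap_law f" by (rule integral_nonneg_AE)
  show "(\<integral>\<^sup>+x. ennreal (f x) \<partial>gap_law) = ennreal (integral\<^sup>L gap_law f)"
    by (rule nn_integral_eq_integral[OF i nn])
  have "AE x in gap_law. f x \<le> B" using AE_gap_law_pos by eventually_elim (rule assms)
  from integral_mono_AE[OF i _ this] show "integral\<^sup>L gap_law f \<le> B" by (simp add: G.prob_space[simplified])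
qed

lemma wt_bounds: "0 < x \<Longrightarrow> 0 \<le> wt l x" "0 < x \<Longrightarrow> wt l x \<le> 1"
  using wt_nonneg wt_le_1 by simp_all

lemma al_nonneg: "0 \<le> al l" and integrable_wt: "integrable gap_law (wt l)"
  and nn_integral_wt: "(\<integral>\<^sup>+x. ennreal (wt l x) \<partial>gap_law) = ennreal (al l)"
  unfolding al_def by (rule integral_gap_le[OF wt_bounds measurable_wt]; assumption)+

lemma Gam_bounds: "0 < x \<Longrightarrow> 0 \<le> Gam l x" "0 < x \<Longrightarrow> Gam l x \<le> ((\<mu> + \<eta>) / (\<mu> + \<eta> + \<delta>)) ^ l / (\<mu> + \<eta> + \<delta>)"
  using Gam_nonneg Gam_le by simp_all

lemma ga_nonneg: "0 \<le> ga l" and integrable_Gam: "integrable gap_law (Gam l)"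
  and nn_integral_Gam: "(\<integral>\<^sup>+x. ennreal (Gam l x) \<partial>gap_law) = ennreal (ga l)"
  and ga_le: "ga l \<le> ((\<mu> + \<eta>) / (\<mu> + \<eta> + \<delta>)) ^ l / (\<mu> + \<eta> + \<delta>)"
  unfolding ga_def by (rule integral_gap_le[OF Gam_bounds measurable_Gam]; assumption)+

lemma ga_0: "(\<mu> + \<eta> + \<delta>) * ga 0 = 1 - al 0"
proof -
  interpret G: prob_space gap_law by (rule prob_gap_law)
  have "Gam 0 = (\<lambda>x. (1 - wt 0 x) / (\<mu> + \<eta> + \<delta>))" by (rule ext) simp
  then have "ga 0 = (1 - al 0) / (\<mu> + \<eta> + \<delta>)"
    unfolding ga_def al_def using integrable_wt[of 0] G.prob_space by simp
  then show ?thesis using total_rate_pos by simp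
qed

lemma ga_Suc: "(\<mu> + \<eta> + \<delta>) * ga (Suc l) = (\<mu> + \<eta>) * ga l - al (Suc l)"
proof -
  have "Gam (Suc l) = (\<lambda>x. ((\<mu> + \<eta>) * Gam l x - wt (Suc l) x) / (\<mu> + \<eta> + \<delta>))" by (rule ext) simp
  then have "ga (Suc l) = ((\<mu> + \<eta>) * ga l - al (Suc l)) / (\<mu> + \<eta> + \<delta>)"
    unfolding ga_def al_def using integrable_wt[of "Suc l"] integrable_Gam[of l] by simp
  then show ?thesis using total_rate_pos by simp
qed

lemma summable_ga: "summable ga"
proof (rule summable_comparison_test')
  show "summable (\<lambda>l. ((\<mu> + \<eta>) / (\<mu> + \<eta> + \<delta>)) ^ l / (\<mu> + \<eta> + \<delta>))"
    using total_rate_pos delta by (intro summable_divide summable_geometric) simp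
  show "norm (ga l) \<le> ((\<mu> + \<eta>) / (\<mu> + \<eta> + \<delta>)) ^ l / (\<mu> + \<eta> + \<delta>)" if "0 \<le> l" for l
    using ga_nonneg[of l] ga_le[of l] by simp
qed

lemma lst_eq: "lst a s = (LINT x|gap_law. exp (- s * of_real x))"
proof -
  have "lst a s = (LINT t|lborel. a t *\<^sub>R exp (- s * of_real t))"
    unfolding lst_def set_lebesgue_integral_def
    by (intro Bochner_Integration.integral_cong) (auto simp: indicator_def scaleR_conv_of_real mult.commute a_support not_le)
  also have "\<dots> = (LINT x|gap_law. exp (- s * of_real x))"
    by (intro integral_density[symmetric]) (auto simp: a_nonneg)
  finally show ?thesis .
qed

text \<open>The gap integral and the exponential series are exchanged by absolute convergence. The
  closed disc of validity has radius (mu + eta + delta) / (mu + eta), which exceeds 1.\<close>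

lemma al_sums:
  assumes z: "(\<mu> + \<eta>) * norm z \<le> \<mu> + \<eta> + \<delta>"
  shows "(\<lambda>l. of_real (al l) * z ^ l) sums lst a (of_real \<delta> + of_real (\<mu> + \<eta>) * (1 - z))"
    and "summable (\<lambda>l. al l * norm z ^ l)"
proof -
  let ?f = "\<lambda>l x. of_real (wt l x) * z ^ l :: complex"
  have int: "integrable gap_law (?f l)" for l
    using integrable_wt[of l] by (intro integrable_mult_left integrable_of_real)
  have fi: "(LINT x|gap_law. ?f l x) = of_real (al l) * z ^ l" for l
    unfolding al_def using integrable_wt[of l] by simp
  have norm_eq: "(LINT x|gap_law. norm (?f l x)) = al l * norm z ^ l" for l
  proof -
    have "AE x in gap_law. norm (?f l x) = wt l x * norm z ^ l"
      using AE_gap_law_pos by eventually_elim (simp add: norm_mult norm_power wt_bounds)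
    then have "(LINT x|gap_law. norm (?f l x)) = (LINT x|gap_law. wt l x * norm z ^ l)"
      by (intro integral_cong_AE) auto
    then show ?thesis unfolding al_def using integrable_wt[of l] by simp
  qed
  show summ: "summable (\<lambda>l. al l * norm z ^ l)"
  proof (rule summableI_nonneg_bounded)
    show "0 \<le> al l * norm z ^ l" for l using al_nonneg by simp
    show "(\<Sum>l<n. al l * norm z ^ l) \<le> 1" for n
    proof -
      have "(\<Sum>l<n. al l * norm z ^ l) = (LINT x|gap_law. (\<Sum>l<n. wt l x * norm z ^ l))"
        unfolding al_def using integrable_wt by (subst Bochner_Integration.integral_sum) auto
      also have "\<dots> \<le> 1"
      proof (rule integral_gap_le(3))
        fix x :: real assume x: "0 < x"
        show "0 \<le> (\<Sum>l<n. wt l x * norm z ^ l)" using x by (simp add: sum_nonneg wt_bounds)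
        show "(\<Sum>l<n. wt l x * norm z ^ l) \<le> 1" using x z by (intro sum_wt_power_le) auto
      qed simp
      finally show ?thesis .
    qed
  qed
  have "(\<lambda>l. LINT x|gap_law. ?f l x) sums (LINT x|gap_law. (\<Sum>l. ?f l x))"
  proof (rule sums_integral[OF int])
    show "AE x in gap_law. summable (\<lambda>l. norm (?f l x))"
      using AE_gap_law_pos
    proof eventually_elim
      case (elim x)
      show ?case
        by (rule summableI_nonneg_bounded[where x=1])
          (use elim sum_wt_power_le[of x "norm z"] z in \<open>auto simp: norm_mult norm_power wt_bounds\<close>)
    qed
    show "summable (\<lambda>l. LINT x|gap_law. norm (?f l x))" unfolding norm_eq by (rule summ)
  qed
  then show "(\<lambda>l. of_real (al l) * z ^ l) sums lst a (of_real \<delta> + of_real (\<mu> + \<eta>) * (1 - z))"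
    unfolding fi lst_eq sums_unique[OF wt_power_sums, symmetric] .
qed

lemma summable_al: "summable al"
  using al_sums(2)[of 1] delta by simp

lemma suminf_al_less_1: "suminf al < 1"
proof -
  have "suminf al \<le> rlap \<delta>"
  proof (rule suminf_le_const[OF summable_al])
    fix n
    have "(\<Sum>l<n. al l) = (LINT x|gap_law. (\<Sum>l<n. wt l x))"
      unfolding al_def using integrable_wt by (subst Bochner_Integration.integral_sum) auto
    also have "\<dots> \<le> (LINT x|gap_law. exp (- \<delta> * x))"
    proof (rule integral_mono_AE)
      show "integrable gap_law (\<lambda>x. exp (- \<delta> * x))"
        using delta by (intro integrable_bounded_gap[where B=1]) auto
      show "AE x in gap_law. (\<Sum>l<n. wt l x) \<le> exp (- \<delta> * x)"
        using AE_gap_law_pos by eventually_elim (rule sum_wt_le, simp)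
    qed (use integrable_wt in auto)
    also have "\<dots> = rlap \<delta>" unfolding rlap_def lap_def
      by (rule integral_eq_nn_integral) auto
    finally show "(\<Sum>l<n. al l) \<le> rlap \<delta>" .
  qed
  then show ?thesis using rlap(2)[OF delta] by simp
qed

lemma al_0_pos: "0 < al 0"
proof -
  have "al 0 \<noteq> 0"
  proof
    assume "al 0 = 0"
    then have "AE x in gap_law. wt 0 x = 0"
      unfolding al_def using integrable_wt[of 0] by (subst (asm) integral_nonneg_eq_0_iff_AE) (auto simp: wt_0)
    then have "AE x in gap_law. False" by (rule eventually_mono) (simp add: wt_0)
    then show False using prob_space.AE_False[OF prob_gap_law] by simp
  qed
  then show ?thesis using al_nonneg[of 0] by simp
qed

text \<open>Multiplying the recursion for \<open>ga\<close> by powers of z and summing gives a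
  linear equation for the sum S, namely sigma S = 1 - \<open>lst a\<close> sigma with sigma = delta
  + (mu + eta) (1 - z). Division is allowed since sigma vanishes only at a point outside the closed
  unit disc.\<close>

lemma ga_sums:
  assumes z: "norm z \<le> 1"
  shows "(\<lambda>l. of_real (ga l) * z ^ l) sums
    ((1 - lst a (of_real \<delta> + of_real (\<mu> + \<eta>) * (1 - z))) / (of_real \<delta> + of_real (\<mu> + \<eta>) * (1 - z)))"
proof -
  let ?\<sigma> = "of_real \<delta> + of_real (\<mu> + \<eta>) * (1 - z)" and ?c = "\<mu> + \<eta> + \<delta>"
  have zc: "(\<mu> + \<eta>) * norm z \<le> (\<mu> + \<eta>) * 1" using z total_rate_pos by (intro mult_left_mono) auto
  have "summable (\<lambda>l. norm (of_real (ga l) * z ^ l))"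
    by (rule summable_mult_bounded[OF ga_nonneg summable_ga, of _ 1]) (simp add: norm_power power_le_one z)
  from summable_norm_cancel[OF this] obtain S where S: "(\<lambda>l. of_real (ga l) * z ^ l) sums S"
    by (auto simp: summable_def)
  have A: "(\<lambda>l. of_real (al l) * z ^ l) sums lst a ?\<sigma>" using zc delta by (intro al_sums) simp
  have "(\<lambda>l. of_real (al (Suc l)) * z ^ Suc l) sums (lst a ?\<sigma> - of_real (al 0))"
    using A sums_Suc_iff[of "\<lambda>l. of_real (al l) * z ^ l" "lst a ?\<sigma> - of_real (al 0)"] by simp
  from sums_diff[OF sums_mult[OF S, of "of_real (\<mu> + \<eta>) * z"] this]
  have "(\<lambda>l. of_real (?c * ga (Suc l)) * z ^ Suc l) sums (of_real (\<mu> + \<eta>) * z * S - (lst a ?\<sigma> - of_real (al 0)))"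
    unfolding ga_Suc by (simp add: algebra_simps)
  then have "(\<lambda>l. of_real (?c * ga l) * z ^ l) sums (of_real (\<mu> + \<eta>) * z * S - (lst a ?\<sigma> - of_real (al 0)) + of_real (?c * ga 0) * z ^ 0)"
    by (subst (asm) sums_Suc_iff) simp
  moreover have "(\<lambda>l. of_real (?c * ga l) * z ^ l) sums (of_real ?c * S)"
    using sums_mult[OF S, of "of_real ?c"] by (simp add: mult.assoc)
  ultimately have "of_real ?c * S = of_real (\<mu> + \<eta>) * z * S - (lst a ?\<sigma> - of_real (al 0)) + of_real (?c * ga 0) * z ^ 0"
    by (rule sums_unique2[symmetric])
  then have e: "?\<sigma> * S = 1 - lst a ?\<sigma>" unfolding ga_0 by (simp add: algebra_simps)
  have "?\<sigma> \<noteq> 0"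
  proof
    assume "?\<sigma> = 0"
    then have "of_real (\<mu> + \<eta>) * z = of_real ?c" by (simp add: algebra_simps)
    then have "norm (of_real (\<mu> + \<eta>) * z) = norm (of_real ?c :: complex)" by simp
    then have "(\<mu> + \<eta>) * norm z = ?c" using total_rate_pos by (simp only: norm_mult norm_of_real abs_of_pos)
    then show False using zc delta by simp
  qed
  then have "S = (1 - lst a ?\<sigma>) / ?\<sigma>" using e by (simp add: field_simps)
  then show ?thesis using S by simp
qed

text \<open>A state n >= 1 is reached only without disaster and by exactly m + i - n removals, so
  the kernel becomes a convolution. State 0 also collects the disasters and does not fit this
  form.\<close>

lemma kap_pos:
  assumes n: "1 \<le> n"
  shows "kap 0 m n = (\<Sum>i=1..b. ennreal (g i) * (of_bool (n \<le> m + i) * ennreal (al (m + i - n))))"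
  unfolding kap_def using n by (intro sum.cong refl arg_cong2[where f=times]) (auto simp: trans_pos nn_integral_wt)

lemma occ_pos:
  assumes n: "1 \<le> n"
  shows "occ 0 m n = (\<Sum>i=1..b. ennreal (g i) * (of_bool (n \<le> m + i) * ennreal (ga (m + i - n))))"
  unfolding occ_def
proof (intro sum.cong refl arg_cong2[where f=times])
  fix i
  have "(\<integral>\<^sup>+x. (\<integral>\<^sup>+y. indicator {0<..<x} y * ennreal (exp (- 0 * y)) * ennreal (trans y (m + i) n) \<partial>lborel) \<partial>gap_law) =
    (\<integral>\<^sup>+x. of_bool (n \<le> m + i) * ennreal (Gam (m + i - n) x) \<partial>gap_law)"
  proof (rule nn_integral_cong_AE)
    show "AE x in gap_law. (\<integral>\<^sup>+y. indicator {0<..<x} y * ennreal (exp (- 0 * y)) * ennreal (trans y (m + i) n) \<partial>lborel) =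
      of_bool (n \<le> m + i) * ennreal (Gam (m + i - n) x)"
      using AE_gap_law_pos
    proof eventually_elim
      case (elim x)
      then show ?case unfolding trans_pos[OF n] using Gam_integral[of x "m + i - n"] by simp
    qed
  qed
  then show "(\<integral>\<^sup>+x. (\<integral>\<^sup>+y. indicator {0<..<x} y * ennreal (exp (- 0 * y)) * ennreal (trans y (m + i) n) \<partial>lborel) \<partial>gap_law) =
    of_bool (n \<le> m + i) * ennreal (ga (m + i - n))" by (auto simp: nn_integral_Gam)
qed

end

text \<open>Extension by 0 to negative indices: reindexing by the number l of removals produces the
  predecessor index n + l - i, which may be negative.\<close>

definition ext :: "(nat \<Rightarrow> real) \<Rightarrow> int \<Rightarrow> real" where
  "ext x k = (if k < 0 then 0 else x (nat k))"

context rates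
begin

text \<open>The double sum runs over pairs with m + i = n + l; it is read by predecessors m on the
  left and by removals l on the right. The result is moved from \<open>ennreal\<close> to the reals,
  where differences can be taken.\<close>

lemma suminf_recursion:
  assumes \<psi>: "\<And>l. 0 \<le> \<psi> l" "summable \<psi>" and x: "\<And>m. 0 \<le> x m" "\<And>m. x m \<le> B" and g: "\<forall>i\<in>{1..b}. 0 \<le> g i"
  shows "0 \<le> (\<Sum>i=1..b. g i * (\<Sum>l. \<psi> l * ext x (int n + int l - int i)))"
    and "(\<Sum>m. ennreal (x m) * (\<Sum>i=1..b. ennreal (g i) * (of_bool (n \<le> m + i) * ennreal (\<psi> (m + i - n))))) =
    ennreal (\<Sum>i=1..b. g i * (\<Sum>l. \<psi> l * ext x (int n + int l - int i)))"
proof -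
  have B: "0 \<le> B" using x(1)[of 0] x(2)[of 0] by simp
  have nn: "0 \<le> \<psi> l * ext x k" for l k using \<psi> x by (simp add: ext_def)
  have summ: "summable (\<lambda>l. \<psi> l * ext x (int n + int l - int i))" for i
    using summable_norm_cancel[OF summable_mult_bounded[OF \<psi>, of "\<lambda>l. ext x (int n + int l - int i)" B]] x B
    by (simp add: ext_def)
  show "0 \<le> (\<Sum>i=1..b. g i * (\<Sum>l. \<psi> l * ext x (int n + int l - int i)))"
    by (intro sum_nonneg mult_nonneg_nonneg g[THEN bspec] suminf_nonneg summ nn)
  have conv: "(\<Sum>m. ennreal (x m) * (of_bool (n \<le> m + i) * ennreal (\<psi> (m + i - n)))) =
    ennreal (\<Sum>l. \<psi> l * ext x (int n + int l - int i))" for i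
  proof -
    have "(\<Sum>m. ennreal (x m) * (of_bool (n \<le> m + i) * ennreal (\<psi> (m + i - n)))) =
      (\<Sum>m. \<Sum>l. of_bool (m + i = n + l) * (ennreal (x m) * ennreal (\<psi> l)))"
    proof (rule suminf_cong)
      fix m
      show "ennreal (x m) * (of_bool (n \<le> m + i) * ennreal (\<psi> (m + i - n))) =
        (\<Sum>l. of_bool (m + i = n + l) * (ennreal (x m) * ennreal (\<psi> l)))"
        by (subst suminf_finite[of "if n \<le> m + i then {m + i - n} else {}"]) auto
    qed
    also have "\<dots> = (\<Sum>l. \<Sum>m. of_bool (m + i = n + l) * (ennreal (x m) * ennreal (\<psi> l)))"
      by (rule suminf_swap_ennreal)
    also have "\<dots> = (\<Sum>l. ennreal (\<psi> l * ext x (int n + int l - int i)))"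
    proof (rule suminf_cong)
      fix l
      have e: "nat (int n + int l - int i) = n + l - i" by simp
      show "(\<Sum>m. of_bool (m + i = n + l) * (ennreal (x m) * ennreal (\<psi> l))) = ennreal (\<psi> l * ext x (int n + int l - int i))"
        by (subst suminf_finite[of "if i \<le> n + l then {n + l - i} else {}"])
          (auto simp: ext_def e \<psi> x ennreal_mult mult.commute)
    qed
    also have "\<dots> = ennreal (\<Sum>l. \<psi> l * ext x (int n + int l - int i))"
      by (rule suminf_ennreal2[OF nn summ])
    finally show ?thesis .
  qed
  have "(\<Sum>m. ennreal (x m) * (\<Sum>i=1..b. ennreal (g i) * (of_bool (n \<le> m + i) * ennreal (\<psi> (m + i - n))))) =
    (\<Sum>i=1..b. \<Sum>m. ennreal (g i) * (ennreal (x m) * (of_bool (n \<le> m + i) * ennreal (\<psi> (m + i - n)))))"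
    by (subst suminf_sum[symmetric]) (auto simp: sum_distrib_left mult_ac)
  also have "\<dots> = (\<Sum>i=1..b. ennreal (g i * (\<Sum>l. \<psi> l * ext x (int n + int l - int i))))"
    unfolding ennreal_suminf_cmult conv using g by (intro sum.cong refl) (simp add: ennreal_mult')
  also have "\<dots> = ennreal (\<Sum>i=1..b. g i * (\<Sum>l. \<psi> l * ext x (int n + int l - int i)))"
    by (intro sum_ennreal mult_nonneg_nonneg g[THEN bspec] suminf_nonneg summ nn)
  finally show "(\<Sum>m. ennreal (x m) * (\<Sum>i=1..b. ennreal (g i) * (of_bool (n \<le> m + i) * ennreal (\<psi> (m + i - n))))) =
    ennreal (\<Sum>i=1..b. g i * (\<Sum>l. \<psi> l * ext x (int n + int l - int i)))" .
qed

end

text \<open>A geometric sequence turns the convolution into a product of generating functions.\<close>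

lemma geometric_recursion:
  fixes r c :: "nat \<Rightarrow> complex"
  assumes r0: "\<And>j. j \<in> J \<Longrightarrow> r j \<noteq> 0" and \<Psi>: "\<And>j. j \<in> J \<Longrightarrow> (\<lambda>l. of_real (\<psi> l) * r j ^ l) sums \<Psi> j"
  shows "(\<lambda>l. of_real (\<psi> l) * (\<Sum>j\<in>J. c j * r j powi (n + int l - int i))) sums
     (\<Sum>j\<in>J. c j * r j powi n * inverse (r j) ^ i * \<Psi> j)"
proof -
  have "(\<lambda>l. \<Sum>j\<in>J. c j * r j powi n * inverse (r j) ^ i * (of_real (\<psi> l) * r j ^ l)) sums
     (\<Sum>j\<in>J. c j * r j powi n * inverse (r j) ^ i * \<Psi> j)"
    by (intro sums_sum sums_mult \<Psi>)
  moreover have "(\<Sum>j\<in>J. c j * r j powi n * inverse (r j) ^ i * (of_real (\<psi> l) * r j ^ l)) =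
    of_real (\<psi> l) * (\<Sum>j\<in>J. c j * r j powi (n + int l - int i))" for l
    unfolding sum_distrib_left
  proof (intro sum.cong refl)
    fix j assume "j \<in> J"
    then have "r j powi (n + int l - int i) = r j powi n * r j ^ l * inverse (r j) ^ i"
      using r0 by (simp add: power_int_diff power_int_add divide_inverse power_inverse)
    then show "c j * r j powi n * inverse (r j) ^ i * (of_real (\<psi> l) * r j ^ l) =
      of_real (\<psi> l) * (c j * r j powi (n + int l - int i))" by (simp only: mult_ac)
  qed
  ultimately show ?thesis by simp
qed

section \<open>Closed formulas in terms of the roots\<close>

context negative_disaster_queue
begin

text \<open>At 0 the characteristic function equals \<open>al 0 * g b\<close>, which is nonzero. A
  root can therefore be inverted, and division by z^b turns the characteristic equation into one for
  the generating function at 1 / z.\<close>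

lemma char_fun_root:
  assumes gb: "g b \<noteq> 0" and z: "char_fun a b g \<mu> \<eta> \<delta> z = 0"
  shows "z \<noteq> 0" "lst a (of_real \<delta> + of_real (\<mu> + \<eta>) * (1 - z)) * batch_pgf b g (inverse z) = 1"
proof -
  let ?A = "\<lambda>z. lst a (of_real \<delta> + of_real (\<mu> + \<eta>) * (1 - z))"
  show z0: "z \<noteq> 0"
  proof
    assume "z = 0"
    have "(\<Sum>i=1..b. of_real (g i) * (0::complex) ^ (b - i)) = (\<Sum>i=1..b. if i = b then of_real (g b) else 0)"
      by (intro sum.cong refl) (auto simp: power_0_left)
    also have "\<dots> = of_real (g b)" using b_pos by simp
    finally have "?A 0 = 0" using z \<open>z = 0\<close> gb b_pos by (simp add: char_fun_def power_0_left)
    moreover have "(\<lambda>l. of_real (al l) * (0::complex) ^ l) sums ?A 0"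
      using total_rate_pos by (intro al_sums) simp
    then have "?A 0 = of_real (al 0)" by (simp add: powser_sums_zero_iff)
    ultimately show False using al_0_pos by simp
  qed
  have "batch_pgf b g (inverse z) * z ^ b = (\<Sum>i=1..b. of_real (g i) * z ^ (b - i))"
    unfolding batch_pgf_def sum_distrib_right
  proof (intro sum.cong refl)
    fix i assume "i \<in> {1..b}"
    then have "z ^ (b - i) = z ^ b * inverse z ^ i" using z0 by (simp add: power_diff divide_inverse power_inverse)
    then show "of_real (g i) * inverse z ^ i * z ^ b = of_real (g i) * z ^ (b - i)" by (simp only: mult_ac)
  qed
  then have "?A z * batch_pgf b g (inverse z) * z ^ b = z ^ b"
    using z by (simp add: char_fun_def mult.assoc)
  then show "?A z * batch_pgf b g (inverse z) = 1" using z0 by simp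
qed

context
  fixes q p
  assumes res: "residual_density M Q q"
    and lim: "\<And>n u. 0 \<le> u \<Longrightarrow> ((\<lambda>t. q n u t) \<longlongrightarrow> p n u) at_top"
    and total: "(\<lambda>n. arbitrary_prob p n) sums 1"
begin

lemma p0_nn: "0 \<le> p m 0"
  by (rule p0_nonneg[of q p]) (fact res lim total)+

lemma p0_suminf: "(\<Sum>m. ennreal (p m 0)) = ennreal (1 / mean)"
  by (rule p0_sum[of q p]) (fact res lim total)+

lemma arbitrary_nn: "0 \<le> arbitrary_prob p n"
  by (rule arbitrary_prob_le(2)[where q=q and p=p and n=n]) (fact res lim)+

lemma p0_sums: "(\<lambda>m. p m 0) sums (1 / mean)"
proof -
  have s: "summable (\<lambda>m. p m 0)"
    by (rule summable_suminf_not_top) (simp_all add: p0_nn p0_suminf)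
  have "0 \<le> 1 / mean" using gap_mean(2) by simp
  moreover have "ennreal (\<Sum>m. p m 0) = ennreal (1 / mean)"
    unfolding p0_suminf[symmetric] by (rule suminf_ennreal2[symmetric, OF p0_nn s])
  ultimately have "(\<Sum>m. p m 0) = 1 / mean"
    using ennreal_inj[OF suminf_nonneg[OF s p0_nn]] by blast
  then show ?thesis using s by (simp add: sums_iff)
qed

lemma p0_le: "p m 0 \<le> 1 / mean"
  using sum_le_suminf[OF sums_summable[OF p0_sums], of "{m}"] p0_nn sums_unique[OF p0_sums] by simp

lemma p0_rec:
  assumes n: "1 \<le> n"
  shows "p n 0 = (\<Sum>i=1..b. g i * (\<Sum>l. al l * ext (\<lambda>m. p m 0) (int n + int l - int i)))"
proof -
  have gnn: "\<forall>i\<in>{1..b}. 0 \<le> g i" using g_nonneg by simp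
  note s = suminf_recursion[of al "\<lambda>m. p m 0" "1 / mean" b g n, OF al_nonneg summable_al p0_nn p0_le gnn]
  have "ennreal (p n 0) = (\<Sum>m. ennreal (p m 0) * kap 0 m n)" by (rule p0_invariant[of q p, symmetric]) (fact res lim total)+
  also have "\<dots> = ennreal (\<Sum>i=1..b. g i * (\<Sum>l. al l * ext (\<lambda>m. p m 0) (int n + int l - int i)))"
    unfolding kap_pos[OF n] by (rule s(2))
  finally have "ennreal (p n 0) = ennreal (\<Sum>i=1..b. g i * (\<Sum>l. al l * ext (\<lambda>m. p m 0) (int n + int l - int i)))" .
  then show ?thesis by (rule iffD1[OF ennreal_inj[OF p0_nn s(1)]])
qed

lemma arbitrary_prob_rec:
  assumes n: "1 \<le> n"
  shows "arbitrary_prob p n = (\<Sum>i=1..b. g i * (\<Sum>l. ga l * ext (\<lambda>m. p m 0) (int n + int l - int i)))"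
proof -
  have gnn: "\<forall>i\<in>{1..b}. 0 \<le> g i" using g_nonneg by simp
  note s = suminf_recursion[of ga "\<lambda>m. p m 0" "1 / mean" b g n, OF ga_nonneg summable_ga p0_nn p0_le gnn]
  have "ennreal (arbitrary_prob p n) = (\<Sum>m. ennreal (p m 0) * occ 0 m n)" by (rule arbitrary_prob_eq[of q p]) (fact res lim total)+
  also have "\<dots> = ennreal (\<Sum>i=1..b. g i * (\<Sum>l. ga l * ext (\<lambda>m. p m 0) (int n + int l - int i)))"
    unfolding occ_pos[OF n] by (rule s(2))
  finally have "ennreal (arbitrary_prob p n) = ennreal (\<Sum>i=1..b. g i * (\<Sum>l. ga l * ext (\<lambda>m. p m 0) (int n + int l - int i)))" .
  then show ?thesis by (rule iffD1[OF ennreal_inj[OF arbitrary_nn s(1)]])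
qed

lemma ext_le: "norm (complex_of_real (ext (\<lambda>m. p m 0) k)) \<le> 1 / mean"
  using p0_nn p0_le gap_mean(2) by (simp add: ext_def)

lemma of_real_suminf_ext:
  assumes "\<And>l. 0 \<le> \<psi> l" "summable \<psi>"
  shows "complex_of_real (\<Sum>l. \<psi> l * ext (\<lambda>m. p m 0) (f l)) = (\<Sum>l. of_real (\<psi> l) * of_real (ext (\<lambda>m. p m 0) (f l)))"
proof -
  have "summable (\<lambda>l. \<psi> l * ext (\<lambda>m. p m 0) (f l))"
    using summable_norm_cancel[OF summable_mult_bounded[OF assms, of "\<lambda>l. ext (\<lambda>m. p m 0) (f l)" "1 / mean"]] ext_le
    by simp
  from sums_of_real[OF summable_sums[OF this], where 'a=complex] show ?thesis by (simp add: sums_iff)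
qed

context
  fixes r c :: "nat \<Rightarrow> complex"
  assumes gb: "g b \<noteq> 0" and r: "\<And>j. j \<in> {1..b} \<Longrightarrow> r j \<in> roots_in_disc (char_fun a b g \<mu> \<eta> \<delta>)"
    and c: "solves_system b (arrival_rate a) r c"
begin

lemma root:
  assumes "j \<in> {1..b}"
  shows "norm (r j) < 1" "r j \<noteq> 0"
    "lst a (of_real \<delta> + of_real (\<mu> + \<eta>) * (1 - r j)) * batch_pgf b g (inverse (r j)) = 1"
  using r[OF assms] char_fun_root[OF gb, of "r j"] by (auto simp: roots_in_disc_def)

text \<open>On each geometric sequence, averaging over batch sizes contributes the generating
  function at 1 / r_j and summing over removals contributes \<open>\<Psi> j\<close>. For
  \<open>al\<close> the product is 1 by the characteristic equation.\<close>

lemma convolution_roots: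
  assumes \<Psi>: "\<And>j. j \<in> {1..b} \<Longrightarrow> (\<lambda>l. of_real (\<psi> l) * r j ^ l) sums \<Psi> j"
  shows "(\<Sum>i=1..b. of_real (g i) * (\<Sum>l. of_real (\<psi> l) * (\<Sum>j=1..b. c j * r j powi (n + int l - int i)))) =
    (\<Sum>j=1..b. c j * r j powi n * (batch_pgf b g (inverse (r j)) * \<Psi> j))"
proof -
  have "(\<Sum>l. of_real (\<psi> l) * (\<Sum>j=1..b. c j * r j powi (n + int l - int i))) =
     (\<Sum>j=1..b. c j * r j powi n * inverse (r j) ^ i * \<Psi> j)" for i
    using root(2) \<Psi> by (intro sums_unique[symmetric] geometric_recursion) auto
  then have "(\<Sum>i=1..b. of_real (g i) * (\<Sum>l. of_real (\<psi> l) * (\<Sum>j=1..b. c j * r j powi (n + int l - int i)))) =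
    (\<Sum>i=1..b. \<Sum>j=1..b. of_real (g i) * (c j * r j powi n * inverse (r j) ^ i * \<Psi> j))"
    by (simp add: sum_distrib_left)
  also have "\<dots> = (\<Sum>j=1..b. \<Sum>i=1..b. of_real (g i) * (c j * r j powi n * inverse (r j) ^ i * \<Psi> j))"
    by (rule sum.swap)
  also have "\<dots> = (\<Sum>j=1..b. c j * r j powi n * (batch_pgf b g (inverse (r j)) * \<Psi> j))"
    unfolding batch_pgf_def sum_distrib_left sum_distrib_right by (intro sum.cong refl) (simp add: mult_ac)
  finally show ?thesis .
qed

lemma root_sums:
  assumes "j \<in> {1..b}"
  shows "(\<lambda>l. of_real (al l) * r j ^ l) sums lst a (of_real \<delta> + of_real (\<mu> + \<eta>) * (1 - r j))"
proof (rule al_sums)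
  have "(\<mu> + \<eta>) * norm (r j) \<le> (\<mu> + \<eta>) * 1"
    using root(1)[OF assms] total_rate_pos by (intro mult_left_mono) auto
  then show "(\<mu> + \<eta>) * norm (r j) \<le> \<mu> + \<eta> + \<delta>" using delta by simp
qed

text \<open>The range of \<open>k\<close> extends down to 1 - b because the formula for arbitrary
  epochs evaluates the sequence at n + l - i with n >= 1 and i <= b. At negative k both sides are
  0.\<close>

lemma p0_roots:
  assumes k: "1 - int b \<le> k"
  shows "of_real (ext (\<lambda>m. p m 0) k) = (\<Sum>j=1..b. c j * r j powi k)"
proof -
  define X where "X k = complex_of_real (ext (\<lambda>m. p m 0) k)" for k
  define y where "y k = (\<Sum>j=1..b. c j * r j powi k)" for k
  \<comment> \<open>Equation n of the linear system is the value at k = n - b, so n = 1, ..., b - 1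
    covers exactly the indices from 1 - b to -1.\<close>
  have neg: "y k = 0" if "1 - int b \<le> k" "k < 0" for k
  proof -
    have "nat (k + int b) \<in> {1..b-1}" "int (nat (k + int b)) - int b = k" using that by auto
    with bspec[OF conjunct1[OF c[unfolded solves_system_def]], of "nat (k + int b)"]
    show ?thesis unfolding y_def by (simp only:)
  qed
  have X_nat: "X (int m) = of_real (p m 0)" for m by (simp add: X_def ext_def)
  have y_nat: "y (int m) = (\<Sum>j=1..b. c j * r j ^ m)" for m by (simp add: y_def)
  have y_le: "norm (y (int m)) \<le> (\<Sum>j=1..b. norm (c j) * norm (r j) ^ m)" for m
    unfolding y_nat by (rule order_trans[OF norm_sum]) (simp add: norm_mult norm_power)
  have "X (int m) - y (int m) = 0" for m
  proof (rule recursion_zero[where \<alpha>=al and g=g and b=b and d="\<lambda>k. X k - y k"])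
    fix n :: int assume n: "1 \<le> n"
    have "X n = (\<Sum>i=1..b. of_real (g i) * (\<Sum>l. of_real (al l) * X (n + int l - int i)))"
    proof -
      have "of_real (\<Sum>l. al l * ext (\<lambda>m. p m 0) (int (nat n) + int l - int i)) = (\<Sum>l. of_real (al l) * X (n + int l - int i))" for i
        using n unfolding of_real_suminf_ext[OF al_nonneg summable_al] by (simp add: X_def)
      then show ?thesis using p0_rec[of "nat n"] n X_nat[of "nat n"] by simp
    qed
    moreover have "y n = (\<Sum>i=1..b. of_real (g i) * (\<Sum>l. of_real (al l) * y (n + int l - int i)))"
    proof -
      have "(\<Sum>i=1..b. of_real (g i) * (\<Sum>l. of_real (al l) * y (n + int l - int i))) =
        (\<Sum>j=1..b. c j * r j powi n * (batch_pgf b g (inverse (r j)) * lst a (of_real \<delta> + of_real (\<mu> + \<eta>) * (1 - r j))))"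
        unfolding y_def by (rule convolution_roots[OF root_sums])
      also have "\<dots> = y n"
        unfolding y_def by (intro sum.cong refl) (simp only: mult.commute[of "batch_pgf _ _ _"] root(3) mult_1_right)
      finally show ?thesis by (rule sym)
    qed
    moreover have "summable (\<lambda>l. of_real (al l) * X (n + int l - int i))" for i
      unfolding X_def by (rule summable_norm_cancel[OF summable_mult_bounded[OF al_nonneg summable_al ext_le]])
    moreover have "summable (\<lambda>l. of_real (al l) * y (n + int l - int i))" for i
      unfolding y_def using root(2) root_sums by (intro sums_summable[OF geometric_recursion]) auto
    ultimately show "X n - y n = (\<Sum>i=1..b. of_real (g i) * (\<Sum>l. of_real (al l) * (X (n + int l - int i) - y (n + int l - int i))))"
      by (simp only: right_diff_distrib suminf_diff[symmetric] sum_subtractf)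
  next
    show "X k - y k = 0" if "1 - int b \<le> k" "k < 0" for k using neg[OF that] that by (simp add: X_def ext_def)
    show "summable (\<lambda>k. norm (X (int k) - y (int k)))"
    proof (rule summable_comparison_test')
      show "summable (\<lambda>m. p m 0 + (\<Sum>j=1..b. norm (c j) * norm (r j) ^ m))"
        using root(1) by (intro summable_add sums_summable[OF p0_sums] summable_sum summable_mult summable_geometric) auto
      show "norm (norm (X (int m) - y (int m))) \<le> p m 0 + (\<Sum>j=1..b. norm (c j) * norm (r j) ^ m)" if "0 \<le> m" for m
        using norm_triangle_ineq4[of "X (int m)" "y (int m)"] y_le[of m] p0_nn[of m] by (simp add: X_nat)
    qed
    \<comment> \<open>By the geometric series the last equation of the system fixes the total of the
      right side at the arrival rate, which is also the total of the \<open>p m 0\<close>.\<close>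
    have "(\<lambda>m. y (int m)) sums (\<Sum>j=1..b. c j * (1 / (1 - r j)))"
      unfolding y_nat by (intro sums_sum sums_mult geometric_sums root(1))
    moreover have "(\<Sum>j=1..b. c j * (1 / (1 - r j))) = of_real (1 / mean)"
      using c by (simp add: solves_system_def arrival_rate_def mean_def)
    ultimately show "(\<lambda>m. X (int m) - y (int m)) sums 0"
      using sums_diff[OF sums_of_real[OF p0_sums, where 'a=complex], of "\<lambda>m. y (int m)" "of_real (1 / mean)"] by (simp add: X_nat)
  qed (use al_nonneg summable_al suminf_al_less_1 g_nonneg g_sum in auto)
  from this[of "nat k"] show ?thesis using neg[of k] k by (cases "k < 0") (auto simp: X_def y_def ext_def)
qed

lemma prearrival_formula:
  "of_real (prearrival_prob p n) = 1 / of_real (arrival_rate a) * (\<Sum>i=1..b. c i * r i ^ n)"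
proof -
  have "of_real (p n 0) = (\<Sum>i=1..b. c i * r i ^ n)" using p0_roots[of "int n"] b_pos by (simp add: ext_def)
  then show ?thesis
    by (simp add: prearrival_prob_def sums_unique[OF p0_sums, symmetric] arrival_rate_def mean_def[symmetric] mult.commute)
qed

text \<open>The generating function of \<open>ga\<close> is (1 - A) / sigma with A the transform at
  sigma, and the batch generating function G at 1 / r_j satisfies A G = 1. Hence G (1 - A) / sigma =
  (G - 1) / sigma, which is \<open>root_coeff\<close>.\<close>

lemma arbitrary_formula:
  assumes n: "1 \<le> n"
  shows "of_real (arbitrary_prob p n) = (\<Sum>j=1..b. c j * root_coeff b g \<mu> \<eta> \<delta> (r j) * r j ^ n)"
proof -
  let ?\<sigma> = "\<lambda>j. of_real \<delta> + of_real (\<mu> + \<eta>) * (1 - r j)"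
  have "of_real (\<Sum>l. ga l * ext (\<lambda>m. p m 0) (int n + int l - int i)) =
    (\<Sum>l. of_real (ga l) * (\<Sum>j=1..b. c j * r j powi (int n + int l - int i)))" if i: "i \<in> {1..b}" for i
  proof -
    show ?thesis unfolding of_real_suminf_ext[OF ga_nonneg summable_ga]
      using i n by (intro suminf_cong) (simp add: p0_roots)
  qed
  then have "of_real (arbitrary_prob p n) =
    (\<Sum>i=1..b. of_real (g i) * (\<Sum>l. of_real (ga l) * (\<Sum>j=1..b. c j * r j powi (int n + int l - int i))))"
    unfolding arbitrary_prob_rec[OF n] by simp
  also have "\<dots> = (\<Sum>j=1..b. c j * r j powi int n * (batch_pgf b g (inverse (r j)) * ((1 - lst a (?\<sigma> j)) / ?\<sigma> j)))"
    using root(1) by (intro convolution_roots ga_sums less_imp_le)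
  also have "\<dots> = (\<Sum>j=1..b. c j * root_coeff b g \<mu> \<eta> \<delta> (r j) * r j ^ n)"
  proof (intro sum.cong refl)
    fix j assume "j \<in> {1..b}"
    then have "batch_pgf b g (inverse (r j)) * (1 - lst a (?\<sigma> j)) = batch_pgf b g (inverse (r j)) - 1"
      using root(3)[of j] by (simp add: right_diff_distrib mult.commute)
    then show "c j * r j powi int n * (batch_pgf b g (inverse (r j)) * ((1 - lst a (?\<sigma> j)) / ?\<sigma> j)) =
      c j * root_coeff b g \<mu> \<eta> \<delta> (r j) * r j ^ n" unfolding root_coeff_def by (simp add: mult_ac)
  qed
  finally show ?thesis .
qed

lemma arbitrary_0: "arbitrary_prob p 0 = 1 - (\<Sum>n. arbitrary_prob p (Suc n))"
  using suminf_split_head[OF sums_summable[OF total]] sums_unique[OF total] by simp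

lemma arbitrary_0_formula:
  "of_real (arbitrary_prob p 0) = 1 - (\<Sum>j=1..b. c j * r j / (1 - r j) * root_coeff b g \<mu> \<eta> \<delta> (r j))"
proof -
  have "(\<lambda>n. \<Sum>j=1..b. (c j * root_coeff b g \<mu> \<eta> \<delta> (r j) * r j) * r j ^ n) sums
    (\<Sum>j=1..b. (c j * root_coeff b g \<mu> \<eta> \<delta> (r j) * r j) * (1 / (1 - r j)))"
    by (intro sums_sum sums_mult geometric_sums root(1))
  then have "(\<lambda>n. of_real (arbitrary_prob p (Suc n)) :: complex) sums
    (\<Sum>j=1..b. c j * r j / (1 - r j) * root_coeff b g \<mu> \<eta> \<delta> (r j))"
    by (simp add: arbitrary_formula mult_ac)
  from sums_unique[OF this] have "(\<Sum>j=1..b. c j * r j / (1 - r j) * root_coeff b g \<mu> \<eta> \<delta> (r j)) = (\<Sum>n. complex_of_real (arbitrary_prob p (Suc n)))" .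
  moreover have "(\<lambda>n. of_real (arbitrary_prob p (Suc n)) :: complex) sums of_real (1 - arbitrary_prob p 0)"
    using total sums_Suc_iff[of "arbitrary_prob p" "1 - arbitrary_prob p 0"] by (intro sums_of_real) simp
  from sums_unique[OF this] have "(\<Sum>n. complex_of_real (arbitrary_prob p (Suc n))) = 1 - of_real (arbitrary_prob p 0)" by simp
  ultimately show ?thesis by simp
qed

end
end
end

section \<open>Roots of the characteristic equation\<close>

context negative_disaster_queue
begin

lemma char_fun_holomorphic:
  "(\<lambda>z. lst a (of_real \<delta> + of_real (\<mu> + \<eta>) * (1 - z)) * (\<Sum>i=1..b. of_real (g i) * z ^ (b - i)))
     holomorphic_on ball 0 ((\<mu> + \<eta> + \<delta>) / (\<mu> + \<eta>))"
proof -
  have "(\<lambda>z. lst a (of_real \<delta> + of_real (\<mu> + \<eta>) * (1 - z))) holomorphic_on ball 0 ((\<mu> + \<eta> + \<delta>) / (\<mu> + \<eta>))"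
  proof (rule power_series_holomorphic)
    fix w :: complex assume "w \<in> ball 0 ((\<mu> + \<eta> + \<delta>) / (\<mu> + \<eta>))"
    then have "(\<mu> + \<eta>) * norm w \<le> \<mu> + \<eta> + \<delta>" using total_rate_pos by (simp add: field_simps)
    then show "(\<lambda>l. of_real (al l) * (w - 0) ^ l) sums lst a (of_real \<delta> + of_real (\<mu> + \<eta>) * (1 - w))"
      using al_sums(1)[of w] by simp
  qed
  then show ?thesis by (intro holomorphic_intros)
qed

lemma char_fun_circle:
  assumes z: "norm z = 1"
  shows "norm (lst a (of_real \<delta> + of_real (\<mu> + \<eta>) * (1 - z)) * (\<Sum>i=1..b. of_real (g i) * z ^ (b - i))) < 1"
proof -
  have le: "(\<mu> + \<eta>) * norm z \<le> \<mu> + \<eta> + \<delta>" using z delta by simp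
  have "lst a (of_real \<delta> + of_real (\<mu> + \<eta>) * (1 - z)) = (\<Sum>l. of_real (al l) * z ^ l)"
    by (rule sums_unique[OF al_sums(1)[OF le]])
  moreover have "norm (\<Sum>l. of_real (al l) * z ^ l) \<le> (\<Sum>l. norm (of_real (al l) * z ^ l))"
    by (rule summable_norm) (simp add: norm_mult norm_power z al_nonneg summable_al)
  moreover have "(\<Sum>l. norm (of_real (al l) * z ^ l)) = suminf al" by (simp add: norm_mult norm_power z al_nonneg)
  ultimately have A: "norm (lst a (of_real \<delta> + of_real (\<mu> + \<eta>) * (1 - z))) < 1" using suminf_al_less_1 by simp
  have "norm (\<Sum>i=1..b. of_real (g i) * z ^ (b - i)) \<le> (\<Sum>i=1..b. norm (of_real (g i) * z ^ (b - i)))"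
    by (rule norm_sum)
  also have "\<dots> = (\<Sum>i=1..b. g i)" using g_nonneg by (intro sum.cong) (auto simp: norm_mult norm_power z)
  finally have G: "norm (\<Sum>i=1..b. of_real (g i) * z ^ (b - i)) \<le> 1" unfolding g_sum .
  have "norm (lst a (of_real \<delta> + of_real (\<mu> + \<eta>) * (1 - z))) * norm (\<Sum>i=1..b. of_real (g i) * z ^ (b - i))
    \<le> norm (lst a (of_real \<delta> + of_real (\<mu> + \<eta>) * (1 - z))) * 1"
    by (rule mult_left_mono[OF G norm_ge_zero])
  then show ?thesis using A by (simp only: norm_mult mult_1_right)
qed

text \<open>The dominant function on the circle is - z^b, whose only zero is 0, of order b. The
  contour must lie inside an open set of holomorphy, so the domain is a ball of radius
  \<open>\<rho>\<close> midway between 1 and the radius \<open>R\<close> of the power series; zeros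
  of the ball outside the contour have winding number 0.\<close>

theorem roots_in_disc_count:
  "finite (roots_in_disc (char_fun a b g \<mu> \<eta> \<delta>))"
  "(\<Sum>z\<in>roots_in_disc (char_fun a b g \<mu> \<eta> \<delta>). zorder (char_fun a b g \<mu> \<eta> \<delta>) z) = int b"
proof -
  define F where "F = char_fun a b g \<mu> \<eta> \<delta>"
  define h where "h z = lst a (of_real \<delta> + of_real (\<mu> + \<eta>) * (1 - z)) * (\<Sum>i=1..b. of_real (g i) * z ^ (b - i))" for z
  define R where "R = (\<mu> + \<eta> + \<delta>) / (\<mu> + \<eta>)"
  define \<rho> where "\<rho> = (1 + R) / 2"
  have R: "1 < R" unfolding R_def using total_rate_pos delta by simp
  then have \<rho>: "1 < \<rho>" "\<rho> < R" by (auto simp: \<rho>_def)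
  have h: "h holomorphic_on ball 0 R" unfolding h_def[abs_def] R_def by (rule char_fun_holomorphic)
  have F: "F = (\<lambda>z. - (z ^ b) + h z)" by (rule ext) (simp add: F_def char_fun_def h_def)
  have F_hol: "F holomorphic_on ball 0 R" unfolding F by (intro holomorphic_intros h)
  have h_less: "norm (h z) < 1" if "norm z = 1" for z unfolding h_def by (rule char_fun_circle[OF that])
  have F_circle: "F z \<noteq> 0" if "norm z = 1" for z
  proof
    assume "F z = 0"
    then have "h z = z ^ b" by (simp add: F)
    then show False using h_less[OF that] that by (simp add: norm_power)
  qed
  \<comment> \<open>The argument requires finitely many zeros. A nonconstant holomorphic function
    has finitely many on a compact set inside its connected domain; a constant one has none, since
    \<open>F\<close> is nonzero on the unit circle.\<close>
  have fin: "finite {z \<in> cball 0 \<rho>. F z = 0}"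
  proof (cases "F constant_on ball 0 R")
    case True
    then have "F z = F 1" if "norm z \<le> \<rho>" for z using \<rho> R that by (auto simp: constant_on_def)
    then have "{z \<in> cball 0 \<rho>. F z = 0} = {}" using F_circle[of 1] by auto
    then show ?thesis by (simp only: finite.emptyI)
  next
    case False
    show ?thesis by (rule holomorphic_compact_finite_zeros[OF F_hol _ _ _ _ False]) (use \<rho> in auto)
  qed
  let ?s = "ball 0 \<rho> :: complex set" and ?\<gamma> = "circlepath 0 1 :: real \<Rightarrow> complex"
  have fin_s: "finite {z \<in> ?s. F z = 0}" by (rule finite_subset[OF _ fin]) auto
  have roots: "roots_in_disc F \<subseteq> {z \<in> ?s. F z = 0}" using \<rho> by (auto simp: roots_in_disc_def)
  from finite_subset[OF this fin_s] show "finite (roots_in_disc (char_fun a b g \<mu> \<eta> \<delta>))" by (simp add: F_def)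
  have sub: "?s \<subseteq> ball 0 R" using \<rho> by auto
  have zeros0: "{p \<in> ?s. - (p ^ b) = 0} = {0}" using \<rho> b_pos by auto
  have out: "winding_number ?\<gamma> z = 0" if "1 < norm z" for z
    by (rule winding_number_zero_outside[of _ "cball 0 1"]) (use that in auto)
  have "(\<Sum>p\<in>{p\<in>?s. - (p ^ b) + h p = 0}. winding_number ?\<gamma> p * zorder (\<lambda>p. - (p ^ b) + h p) p)
          = (\<Sum>p\<in>{p\<in>?s. - (p ^ b) = 0}. winding_number ?\<gamma> p * zorder (\<lambda>p. - (p ^ b)) p)"
  proof (rule Rouche_theorem)
    show "finite {p \<in> ?s. - (p ^ b) + h p = 0}" using fin_s by (simp only: F)
    show "finite {p \<in> ?s. - (p ^ b) = 0}" unfolding zeros0 by simp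
    show "h holomorphic_on ?s" by (rule holomorphic_on_subset[OF h sub])
    show "\<forall>z\<in>path_image ?\<gamma>. norm (h z) < norm (- (z ^ b))"
      using h_less by (auto simp: norm_power)
    show "\<forall>z. z \<notin> ?s \<longrightarrow> winding_number ?\<gamma> z = 0" using out \<rho> by auto
  qed (use \<rho> in \<open>auto intro!: holomorphic_intros\<close>)
  then have "(\<Sum>p\<in>{p\<in>?s. F p = 0}. winding_number ?\<gamma> p * zorder F p) = winding_number ?\<gamma> 0 * zorder (\<lambda>p. - (p ^ b) :: complex) 0"
    unfolding zeros0 F by simp
  also have "zorder (\<lambda>p. - (p ^ b) :: complex) 0 = int b"
    by (rule zorder_eqI[of UNIV _ "\<lambda>_. - 1"]) auto
  also have "winding_number ?\<gamma> 0 = 1" by (rule winding_number_circlepath) simp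
  also have "(\<Sum>p\<in>{p\<in>?s. F p = 0}. winding_number ?\<gamma> p * zorder F p) = (\<Sum>p\<in>roots_in_disc F. of_int (zorder F p))"
  proof (rule sum.mono_neutral_cong_right[OF fin_s roots])
    show "\<forall>p\<in>{p \<in> ?s. F p = 0} - roots_in_disc F. winding_number ?\<gamma> p * zorder F p = 0"
    proof
      fix p assume p: "p \<in> {p \<in> ?s. F p = 0} - roots_in_disc F"
      then have "\<not> norm p < 1" by (auto simp: roots_in_disc_def)
      moreover have "norm p \<noteq> 1" using F_circle p by auto
      ultimately show "winding_number ?\<gamma> p * zorder F p = 0" by (simp add: out)
    qed
    show "winding_number ?\<gamma> p * zorder F p = of_int (zorder F p)" if "p \<in> roots_in_disc F" for p
      using that winding_number_circlepath[of p 0 1] by (simp add: roots_in_disc_def)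
  qed
  finally have "of_int (\<Sum>p\<in>roots_in_disc F. zorder F p) = (of_int (int b) :: complex)" by simp
  then show "(\<Sum>z\<in>roots_in_disc (char_fun a b g \<mu> \<eta> \<delta>). zorder (char_fun a b g \<mu> \<eta> \<delta>) z) = int b"
    unfolding F_def by (simp only: of_int_eq_iff)
qed

end

theorem mainTheorem1:
  fixes M :: "'a measure" and Q :: "'a queue_input"
    and a :: "real \<Rightarrow> real" and b :: nat and g :: "nat \<Rightarrow> real" and \<mu> \<eta> \<delta> :: real
    and p :: "nat \<Rightarrow> real \<Rightarrow> real"
  assumes queue: "negative_disaster_queue M Q a b g \<mu> \<eta> \<delta>"
    and steady: "steady_state M Q p"
    and g_b: "g b \<noteq> 0"
  shows "finite (roots_in_disc (char_fun a b g \<mu> \<eta> \<delta>)) \<and>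
    (\<Sum>z\<in>roots_in_disc (char_fun a b g \<mu> \<eta> \<delta>). zorder (char_fun a b g \<mu> \<eta> \<delta>) z) = int b \<and>
    (\<forall>r c. lists_roots_in_disc (char_fun a b g \<mu> \<eta> \<delta>) b r \<longrightarrow>
           solves_system b (arrival_rate a) r c \<longrightarrow>
       (\<forall>n. of_real (prearrival_prob p n) =
              1 / of_real (arrival_rate a) * (\<Sum>i=1..b. c i * r i ^ n)) \<and>
       (\<forall>n\<ge>1. of_real (arbitrary_prob p n) =
              (\<Sum>j=1..b. c j * root_coeff b g \<mu> \<eta> \<delta> (r j) * r j ^ n)) \<and>
       arbitrary_prob p 0 = 1 - (\<Sum>n. arbitrary_prob p (Suc n)) \<and>
       of_real (arbitrary_prob p 0) =
              1 - (\<Sum>j=1..b. c j * r j / (1 - r j) * root_coeff b g \<mu> \<eta> \<delta> (r j)))"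
proof -
  interpret negative_disaster_queue M Q a b g \<mu> \<eta> \<delta> by (rule queue)
  from steady obtain q where res: "residual_density M Q q"
    and q: "\<forall>n. \<forall>u\<ge>0. ((\<lambda>t. q n u t) \<longlongrightarrow> p n u) at_top"
    and total: "(\<lambda>n. arbitrary_prob p n) sums 1"
    unfolding steady_state_def by blast
  have lim: "\<And>n u. 0 \<le> u \<Longrightarrow> ((\<lambda>t. q n u t) \<longlongrightarrow> p n u) at_top" using q by simp
  show ?thesis
  proof (intro conjI allI impI)
    show "finite (roots_in_disc (char_fun a b g \<mu> \<eta> \<delta>))"
      "(\<Sum>z\<in>roots_in_disc (char_fun a b g \<mu> \<eta> \<delta>). zorder (char_fun a b g \<mu> \<eta> \<delta>) z) = int b"
      by (rule roots_in_disc_count)+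
    fix r c assume r: "lists_roots_in_disc (char_fun a b g \<mu> \<eta> \<delta>) b r" and c: "solves_system b (arrival_rate a) r c"
    then have root: "\<And>j. j \<in> {1..b} \<Longrightarrow> r j \<in> roots_in_disc (char_fun a b g \<mu> \<eta> \<delta>)"
      by (simp add: lists_roots_in_disc_def)
    show "of_real (prearrival_prob p n) = 1 / of_real (arrival_rate a) * (\<Sum>i=1..b. c i * r i ^ n)" for n
      by (rule prearrival_formula[where q=q]) (fact res lim total g_b root c)+
    show "of_real (arbitrary_prob p n) = (\<Sum>j=1..b. c j * root_coeff b g \<mu> \<eta> \<delta> (r j) * r j ^ n)" if "1 \<le> n" for n
      by (rule arbitrary_formula[where q=q]) (fact res lim total g_b root c that)+
    show "arbitrary_prob p 0 = 1 - (\<Sum>n. arbitrary_prob p (Suc n))"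
      by (rule arbitrary_0[where q=q]) (fact res lim total g_b root c)+
    show "of_real (arbitrary_prob p 0) = 1 - (\<Sum>j=1..b. c j * r j / (1 - r j) * root_coeff b g \<mu> \<eta> \<delta> (r j))"
      by (rule arbitrary_0_formula[where q=q]) (fact res lim total g_b root c)+
  qed
qed

end
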